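(* Let $p\geq 7$ be a prime number and let $s(12p)$ denote the number of isomorphism classes of skew left braces of size $12p$. Then $$s(12p)=\begin{cases}324 & \text{if } p\equiv 11 \pmod{12},\\ 410 & \text{if } p\equiv 5 \pmod{12},\\ 606 & \text{if } p\equiv 7 \pmod{12},\\ 782 & \text{if } p\equiv 1 \pmod{12}.\end{cases}$$
   Context: A skew left brace is a triple $(B,\cdot,\circ)$ where $(B,\cdot)$ and $(B,\circ)$ are groups on the same set $B$ and $a\circ(b\cdot c)=(a\circ b)\cdot a^{-1}\cdot(a\circ c)$ for all $a,b,c\in B$, with $a^{-1}$ the inverse of $a$ in $(B,\cdot)$. Its size is $|B|$. An isomorphism of skew left braces is a bijection that is a homomorphism for both operations. *)

theory Defs
  imports "HOL-Algebra.Group" "HOL-Computational_Algebra.Primes"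
begin

text \<open>The group structure inherited from \<open>monoid\<close> is the one written with a dot on paper. The neutral
  element of \<open>circ\<close> is a field of its own, because its agreement with \<open>one\<close> is a consequence of the
  axioms and not part of them.\<close>

record 'a skew_brace = "'a monoid" +
  circ :: "'a \<Rightarrow> 'a \<Rightarrow> 'a" (infixl \<open>\<odot>\<index>\<close> 70)
  circ_one :: 'a

definition circ_group :: "('a, 'm) skew_brace_scheme \<Rightarrow> 'a monoid"
  where "circ_group B = \<lparr>carrier = carrier B, monoid.mult = circ B, one = circ_one B\<rparr>"

locale skew_left_brace = group B for B :: "('a, 'm) skew_brace_scheme" (structure) +
  assumes circ_group: "group (circ_group B)"
    and circ_mult: "\<lbrakk>a \<in> carrier B; b \<in> carrier B; c \<in> carrier B\<rbrakk> \<Longrightarrow>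
      a \<odot> (b \<otimes> c) = (a \<odot> b) \<otimes> inv a \<otimes> (a \<odot> c)"

definition skew_brace_iso ::
    "('a, 'm) skew_brace_scheme \<Rightarrow> ('b, 'n) skew_brace_scheme \<Rightarrow> ('a \<Rightarrow> 'b) set"
  where "skew_brace_iso A B =
    {f. f \<in> hom A B \<and> f \<in> hom (circ_group A) (circ_group B) \<and>
        bij_betw f (carrier A) (carrier B)}"

text \<open>Every finite skew left brace has an isomorphic copy with carrier in \<^typ>\<open>nat\<close>
  (\<open>finite_skew_left_brace_copy\<close> below), so these structures suffice for counting isomorphism
  classes. Records that agree on the carrier and differ outside it are isomorphic.\<close>

definition skew_braces_of_size :: "nat \<Rightarrow> nat skew_brace set"
  where "skew_braces_of_size n =
    {B. skew_left_brace B \<and> finite (carrier B) \<and> card (carrier B) = n}"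

definition skew_brace_iso_rel :: "nat \<Rightarrow> (nat skew_brace \<times> nat skew_brace) set"
  where "skew_brace_iso_rel n =
    {(A, B). A \<in> skew_braces_of_size n \<and> B \<in> skew_braces_of_size n \<and> skew_brace_iso A B \<noteq> {}}"

definition num_skew_braces :: "nat \<Rightarrow> nat"
  where "num_skew_braces n = card (skew_braces_of_size n // skew_brace_iso_rel n)"

lemma skew_brace_iso_iff:
  "f \<in> skew_brace_iso A B \<longleftrightarrow> f \<in> iso A B \<and> f \<in> iso (circ_group A) (circ_group B)"
  by (auto simp: skew_brace_iso_def iso_def circ_group_def)

lemma equiv_skew_brace_iso_rel: "equiv (skew_braces_of_size n) (skew_brace_iso_rel n)"
proof (rule equivI)
  show "skew_brace_iso_rel n \<subseteq> skew_braces_of_size n \<times> skew_braces_of_size n"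
    by (auto simp: skew_brace_iso_rel_def)
  show "refl_on (skew_braces_of_size n) (skew_brace_iso_rel n)"
  proof (rule refl_onI)
    fix A assume "A \<in> skew_braces_of_size n"
    moreover have "(\<lambda>x. x) \<in> skew_brace_iso A A"
      by (auto simp: skew_brace_iso_def hom_def bij_betw_def)
    ultimately show "(A, A) \<in> skew_brace_iso_rel n"
      by (auto simp: skew_brace_iso_rel_def)
  qed
  show "sym (skew_brace_iso_rel n)"
  proof (rule symI)
    fix A B assume AB: "(A, B) \<in> skew_brace_iso_rel n"
    then obtain f where f: "f \<in> skew_brace_iso A B"
      by (auto simp: skew_brace_iso_rel_def)
    have A: "group A" "group (circ_group A)"
      using AB by (auto simp: skew_brace_iso_rel_def skew_braces_of_size_def
          skew_left_brace_def skew_left_brace_axioms_def)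
    have "inv_into (carrier A) f \<in> skew_brace_iso B A"
      using f group.iso_set_sym[OF A(1), of f B] group.iso_set_sym[OF A(2), of f "circ_group B"]
      by (simp add: skew_brace_iso_iff) (simp add: circ_group_def)
    with AB show "(B, A) \<in> skew_brace_iso_rel n"
      by (auto simp: skew_brace_iso_rel_def)
  qed
  show "trans (skew_brace_iso_rel n)"
  proof (rule transI)
    fix A B C assume AB: "(A, B) \<in> skew_brace_iso_rel n" and BC: "(B, C) \<in> skew_brace_iso_rel n"
    then obtain f g where fg: "f \<in> skew_brace_iso A B" "g \<in> skew_brace_iso B C"
      by (auto simp: skew_brace_iso_rel_def)
    then have "g \<circ> f \<in> skew_brace_iso A C"
      by (auto simp: skew_brace_iso_iff intro: iso_set_trans)
    with AB BC show "(A, C) \<in> skew_brace_iso_rel n"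
      by (auto simp: skew_brace_iso_rel_def)
  qed
qed

lemma finite_skew_left_brace_copy:
  fixes B :: "('a, 'm) skew_brace_scheme"
  assumes "skew_left_brace B" "finite (carrier B)" "card (carrier B) = n"
  shows "\<exists>A \<in> skew_braces_of_size n. skew_brace_iso B A \<noteq> {}"
proof -
  interpret skew_left_brace B by fact
  interpret C: group "circ_group B" by (rule circ_group)
  obtain f where f: "bij_betw f (carrier B) {0..<n}"
    using ex_bij_betw_finite_nat[OF assms(2)] assms(3) by auto
  define g where "g = inv_into (carrier B) f"
  have gf [simp]: "x \<in> carrier B \<Longrightarrow> g (f x) = x" for x
    using f by (simp add: g_def bij_betw_def)
  have fB: "x \<in> carrier B \<Longrightarrow> f x < n" for x
    using f by (auto simp: bij_betw_def)
  have fE: "\<exists>x \<in> carrier B. y = f x" if "y < n" for y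
    using that f by (auto simp: bij_betw_def)
  have gB: "y < n \<Longrightarrow> g y \<in> carrier B" for y
    using fE[of y] by auto
  have cc: "x \<odot>\<^bsub>B\<^esub> y \<in> carrier B" if "x \<in> carrier B" "y \<in> carrier B" for x y
    using C.m_closed[of x y] that by (simp add: circ_group_def)
  have co: "circ_one B \<in> carrier B"
    using C.one_closed by (simp add: circ_group_def)
  define A :: "nat skew_brace" where "A = \<lparr>carrier = {0..<n}, monoid.mult = (\<lambda>x y. f (g x \<otimes>\<^bsub>B\<^esub> g y)),
    one = f \<one>\<^bsub>B\<^esub>, circ = (\<lambda>x y. f (g x \<odot>\<^bsub>B\<^esub> g y)), circ_one = f (circ_one B)\<rparr>"
  have h: "f \<in> hom B A" "f \<in> hom (circ_group B) (circ_group A)"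
    by (auto simp: hom_def A_def circ_group_def fB)
  have fi: "f \<in> skew_brace_iso B A"
    using h f by (simp add: skew_brace_iso_def) (simp add: A_def)
  have gA: "group A"
  proof (rule groupI)
    fix x y z assume "x \<in> carrier A" "y \<in> carrier A" "z \<in> carrier A"
    then obtain x' y' z' where "x' \<in> carrier B" "y' \<in> carrier B" "z' \<in> carrier B"
      "x = f x'" "y = f y'" "z = f z'"
      using fE by (auto simp: A_def) metis
    then show "x \<otimes>\<^bsub>A\<^esub> y \<otimes>\<^bsub>A\<^esub> z = x \<otimes>\<^bsub>A\<^esub> (y \<otimes>\<^bsub>A\<^esub> z)"
      by (simp add: A_def m_assoc)
  next
    fix x assume "x \<in> carrier A"
    then obtain x' where x': "x' \<in> carrier B" "x = f x'" using fE by (auto simp: A_def)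
    then show "\<one>\<^bsub>A\<^esub> \<otimes>\<^bsub>A\<^esub> x = x"
      by (simp add: A_def)
    show "\<exists>y\<in>carrier A. y \<otimes>\<^bsub>A\<^esub> x = \<one>\<^bsub>A\<^esub>"
      using x' by (intro bexI[of _ "f (inv\<^bsub>B\<^esub> x')"]) (simp_all add: A_def fB)
  qed (simp_all add: A_def fB gB)
  have gC: "group (circ_group A)"
  proof (rule groupI)
    fix x y z
    assume "x \<in> carrier (circ_group A)" "y \<in> carrier (circ_group A)" "z \<in> carrier (circ_group A)"
    then obtain x' y' z' where *: "x' \<in> carrier B" "y' \<in> carrier B" "z' \<in> carrier B"
      "x = f x'" "y = f y'" "z = f z'"
      using fE by (auto simp: A_def circ_group_def) metis
    then show "x \<otimes>\<^bsub>circ_group A\<^esub> y \<otimes>\<^bsub>circ_group A\<^esub> z = x \<otimes>\<^bsub>circ_group A\<^esub> (y \<otimes>\<^bsub>circ_group A\<^esub> z)"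
      using C.m_assoc[of x' y' z'] by (simp add: A_def circ_group_def cc)
  next
    fix x assume "x \<in> carrier (circ_group A)"
    then obtain x' where x': "x' \<in> carrier B" "x = f x'"
      using fE by (auto simp: A_def circ_group_def)
    then show "\<one>\<^bsub>circ_group A\<^esub> \<otimes>\<^bsub>circ_group A\<^esub> x = x"
      using C.l_one[of x'] co by (simp add: A_def circ_group_def)
    have "inv\<^bsub>circ_group B\<^esub> x' \<in> carrier B"
      "(inv\<^bsub>circ_group B\<^esub> x') \<odot>\<^bsub>B\<^esub> x' = circ_one B"
      using x' C.inv_closed[of x'] C.l_inv[of x'] by (simp_all add: circ_group_def)
    with x' show "\<exists>y\<in>carrier (circ_group A). y \<otimes>\<^bsub>circ_group A\<^esub> x = \<one>\<^bsub>circ_group A\<^esub>"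
      by (intro bexI[of _ "f (inv\<^bsub>circ_group B\<^esub> x')"]) (simp_all add: A_def circ_group_def fB)
  qed (simp_all add: A_def circ_group_def fB gB cc co)
  have inv_f: "inv\<^bsub>A\<^esub> (f x) = f (inv\<^bsub>B\<^esub> x)" if "x \<in> carrier B" for x
    using that by (intro group.inv_equality[OF gA]) (simp_all add: A_def fB)
  have "skew_left_brace A"
  proof (intro skew_left_brace.intro gA skew_left_brace_axioms.intro gC)
    fix a b c assume "a \<in> carrier A" "b \<in> carrier A" "c \<in> carrier A"
    then have "a < n" "b < n" "c < n"
      by (simp_all add: A_def)
    then obtain a' b' c' where eq: "a = f a'" "b = f b'" "c = f c'"
      and mem: "a' \<in> carrier B" "b' \<in> carrier B" "c' \<in> carrier B"
      using fE by metis
    show "a \<odot>\<^bsub>A\<^esub> (b \<otimes>\<^bsub>A\<^esub> c) = (a \<odot>\<^bsub>A\<^esub> b) \<otimes>\<^bsub>A\<^esub> inv\<^bsub>A\<^esub> a \<otimes>\<^bsub>A\<^esub> (a \<odot>\<^bsub>A\<^esub> c)"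
      unfolding eq inv_f[OF mem(1)] using mem circ_mult[OF mem] by (simp add: A_def cc)
  qed
  then have "A \<in> skew_braces_of_size n"
    by (simp add: skew_braces_of_size_def) (simp add: A_def)
  with fi show ?thesis by blast
qed

end

theory Submission
  imports Defs "HOL-Algebra.Sylow" "HOL-Number_Theory.Number_Theory" "HOL-Library.Product_Plus"
begin

text \<open>Both groups of a brace of size \<open>12 p\<close> have a normal Sylow \<open>p\<close>-subgroup. A crossed homomorphism
  splits the brace: up to replacing the additive group by its opposite, it is a double semidirect
  product of the trivial brace of order \<open>p\<close> by a brace \<open>E\<close> of size 12, and its isomorphism class is
  given by \<open>E\<close> with the two actions on the group of order \<open>p\<close>, up to automorphisms of \<open>E\<close>. The same
  reduction with 3 in place of \<open>p\<close> leads from \<open>E\<close> to a brace of size 4 unless the alternating group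
  of degree four occurs in \<open>E\<close>; those finitely many exceptions are found by a search. The actions have
  values in the roots of unity of order dividing 12 modulo \<open>p\<close>, so that the number of classes depends
  only on \<open>p mod 12\<close> and is obtained by listing orbit representatives.\<close>

section \<open>Groups of order twelve times a prime\<close>

text \<open>The obstacle is that a complement of the normal subgroup of order p has to be a subgroup
  for both operations. Schur-Zassenhaus gives complements in either group, but nothing makes them
  agree. Crossed homomorphisms therefore stand in for complements: they can be averaged along the
  circle group, and the average is compatible with \<open>lam\<close> once the generator
  \<open>g\<close> acts trivially through \<open>lam\<close>. This proviso shapes the
  classification. The map \<open>lam g\<close> moves each \<open>b\<close> by a power of
  \<open>g\<close>; the exponent is a crossed homomorphism vanishing at \<open>g\<close>, hence of
  the form \<open>v * (1 - tau b)\<close>, and comparing two expressions for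
  \<open>b \<odot> g\<close> leaves only \<open>g \<odot> b = g \<otimes> b\<close> or
  \<open>g \<odot> b = b \<otimes> g\<close>. The second case becomes the first in the opposite
  brace, whence the flags \<open>kp\<close> and \<open>k3\<close>. A flag is set only if the
  additive action is nontrivial, since otherwise \<open>g\<close> is additively central and the
  cases coincide. Among the orders 12p, the congruence for the normaliser leaves one in doubt, 132
  for p = 11, which is excluded by counting elements of order 11.\<close>

lemma funpow_orbit_inj:
  assumes q: "prime q" and per: "(f ^^ q) x = x" and ne: "f x \<noteq> x"
  shows "inj_on (\<lambda>i. (f ^^ i) x) {..<q}"
proof -
  have mult: "(f ^^ (k * m)) x = x" if "(f ^^ m) x = x" for k m
    by (induction k) (simp_all add: that funpow_add)
  have False if ij: "i < j" "j < q" and eq: "(f ^^ i) x = (f ^^ j) x" for i j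
  proof -
    define d where "d = j - i"
    have d: "0 < d" "d < q" using ij by (auto simp: d_def)
    have "(f ^^ (q - i)) ((f ^^ i) x) = x"
      using per ij by (simp flip: funpow_add[THEN fun_cong, unfolded o_def])
    moreover have "(f ^^ (q - i)) ((f ^^ j) x) = (f ^^ d) ((f ^^ q) x)"
      using ij by (simp add: d_def add.commute flip: funpow_add[THEN fun_cong, unfolded o_def])
    ultimately have dx: "(f ^^ d) x = x" using eq per by simp
    have "coprime d q"
      using d q by (metis coprime_commute prime_imp_coprime nat_dvd_not_less)
    \<comment> \<open>Bezout gives \<open>a * d = Suc (b * q)\<close>. Iterating \<open>f\<close>
      that often fixes \<open>x\<close>, because \<open>d\<close> is a period, and also yields
      \<open>f x\<close>, because \<open>q\<close> is one.\<close>
    then obtain a b where ab: "a * d = Suc (b * q)"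
      using coprime_bezout_strong[of d q] q d by (metis Suc_eq_plus1 add.commute mult.commute prime_gt_1_nat less_irrefl)
    have "f x = (f ^^ Suc (b * q)) x"
      using mult[OF per, of b] by simp
    also have "\<dots> = x" using mult[OF dx, of a] ab by metis
    finally show False using ne by simp
  qed
  then show ?thesis by (intro inj_onI) (metis lessThan_iff linorder_neqE_nat)
qed

text \<open>The map generates an action of the cyclic group of order \<open>q\<close>, whose
  nontrivial orbits have exactly \<open>q\<close> elements; the induction removes one such orbit at
  a time.\<close>

lemma card_fixpoints_cong:
  assumes q: "prime q" and "finite X" and "f ` X \<subseteq> X" and "\<And>x. x \<in> X \<Longrightarrow> (f ^^ q) x = x"
  shows "[card {x \<in> X. f x = x} = card X] (mod q)"
  using assms(2-4)
proof (induction "card X" arbitrary: X rule: less_induct)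
  case less
  show ?case
  proof (cases "\<forall>x\<in>X. f x = x")
    case True
    then have "{x \<in> X. f x = x} = X" by auto
    then show ?thesis by simp
  next
    case False
    then obtain x where x: "x \<in> X" "f x \<noteq> x" by auto
    define Ob where "Ob = (\<lambda>i. (f ^^ i) x) ` {..<q}"
    have q0: "q > 0" using q prime_gt_0_nat by auto
    have cO: "card Ob = q"
      unfolding Ob_def using funpow_orbit_inj[OF q less.prems(3)[OF x(1)] x(2)]
      by (simp add: card_image)
    have inX: "(f ^^ i) y \<in> X" if "y \<in> X" for i y
      using less.prems(2) that by (induction i) auto
    have OX: "Ob \<subseteq> X" using inX[OF x(1)] by (auto simp: Ob_def)
    have allO: "(f ^^ i) x \<in> Ob" for i
    proof -
      have "(f ^^ i) x = (f ^^ (i mod q)) x"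
        using funpow_mod_eq[OF less.prems(3)[OF x(1)], of i] by simp
      then show ?thesis using q0 by (auto simp: Ob_def)
    qed
    \<comment> \<open>Closure of the orbit under preimages keeps \<open>f\<close> inside
      \<open>X - Ob\<close>; a preimage is recovered by iterating \<open>f\<close> another
      \<open>q - 1\<close> times.\<close>
    have pre: "y \<in> Ob" if yX: "y \<in> X" and fy: "f y \<in> Ob" for y
    proof -
      obtain i where i: "f y = (f ^^ i) x" using fy by (auto simp: Ob_def)
      have "y = (f ^^ (q - 1)) (f y)"
        using less.prems(3)[OF yX] q0 by (metis Suc_pred' comp_apply funpow_Suc_right)
      also have "\<dots> = (f ^^ (q - 1 + i)) x" using i by (simp add: funpow_add)
      finally show ?thesis using allO by simp
    qed
    have nf: "f y \<noteq> y" if yO: "y \<in> Ob" for y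
    proof
      assume fy: "f y = y"
      obtain i where i: "i < q" "y = (f ^^ i) x" using yO by (auto simp: Ob_def)
      have "(f ^^ k) y = y" for k by (induction k) (simp_all add: fy)
      then have "y = (f ^^ (q - i)) ((f ^^ i) x)" using i by metis
      also have "\<dots> = x" using less.prems(3)[OF x(1)] i(1)
        by (simp flip: funpow_add[THEN fun_cong, unfolded o_def])
      finally show False using fy x by simp
    qed
    have fO: "finite Ob" by (simp add: Ob_def)
    have cX: "card X = q + card (X - Ob)"
      using card_Diff_subset[OF fO OX] cO card_mono[OF less.prems(1) OX] by simp
    have "[card {x \<in> X - Ob. f x = x} = card (X - Ob)] (mod q)"
    proof (rule less.hyps)
      show "card (X - Ob) < card X" using cX q0 by simp
      show "f ` (X - Ob) \<subseteq> X - Ob" using pre less.prems(2) by auto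
    qed (use less.prems in auto)
    moreover have "{x \<in> X - Ob. f x = x} = {x \<in> X. f x = x}" using nf by auto
    ultimately show ?thesis using cX by (simp add: cong_def)
  qed
qed

context group begin

definition cj :: "'a \<Rightarrow> 'a \<Rightarrow> 'a" where "cj g x = g \<otimes> x \<otimes> inv g"

lemma cj_closed [simp]: "g \<in> carrier G \<Longrightarrow> x \<in> carrier G \<Longrightarrow> cj g x \<in> carrier G"
  by (simp add: cj_def)

lemma cj_mult: "\<lbrakk>g \<in> carrier G; x \<in> carrier G; y \<in> carrier G\<rbrakk> \<Longrightarrow> cj g (x \<otimes> y) = cj g x \<otimes> cj g y"
  by (simp add: cj_def m_assoc inv_solve_left)

lemma cj_comp: "\<lbrakk>g \<in> carrier G; h \<in> carrier G; x \<in> carrier G\<rbrakk> \<Longrightarrow> cj (g \<otimes> h) x = cj g (cj h x)"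
  by (simp add: cj_def m_assoc inv_mult_group)

lemma cj_one [simp]: "x \<in> carrier G \<Longrightarrow> cj \<one> x = x" "g \<in> carrier G \<Longrightarrow> cj g \<one> = \<one>"
  by (simp_all add: cj_def)

lemma cj_pow: "\<lbrakk>g \<in> carrier G; x \<in> carrier G\<rbrakk> \<Longrightarrow> cj g (x [^] (n::nat)) = cj g x [^] n"
  by (induction n) (simp_all add: cj_mult)

lemma cj_inj: "\<lbrakk>g \<in> carrier G; x \<in> carrier G; y \<in> carrier G\<rbrakk> \<Longrightarrow> cj g x = cj g y \<longleftrightarrow> x = y"
  by (simp add: cj_def)

lemma cj_inv_cancel: "\<lbrakk>g \<in> carrier G; x \<in> carrier G\<rbrakk> \<Longrightarrow> cj (inv g) (cj g x) = x"
  by (simp flip: cj_comp)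

lemma cj_inv_cancel': "\<lbrakk>g \<in> carrier G; x \<in> carrier G\<rbrakk> \<Longrightarrow> cj g (cj (inv g) x) = x"
  by (simp flip: cj_comp)

lemma funpow_cj: "\<lbrakk>g \<in> carrier G; x \<in> carrier G\<rbrakk> \<Longrightarrow> (cj g ^^ n) x = cj (g [^] n) x"
proof (induction n)
  case (Suc n)
  then show ?case using cj_comp[of g "g [^] n" x] nat_pow_Suc2[of g n] by simp
qed simp

lemma cj_eq_iff_commute: "\<lbrakk>g \<in> carrier G; x \<in> carrier G\<rbrakk> \<Longrightarrow> cj g x = x \<longleftrightarrow> g \<otimes> x = x \<otimes> g"
  unfolding cj_def by (metis inv_solve_right m_closed)

end

section \<open>Normalisers of cyclic subgroups of prime order\<close>

context group begin

text \<open>For prime \<open>q\<close>, the element \<open>g\<close> generates a normal subgroup of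
  order \<open>q\<close>. Normality is put as one exponent per conjugating element, because these
  exponents become the character \<open>chi\<close>.\<close>

definition npsyl :: "nat \<Rightarrow> 'a \<Rightarrow> bool" where
  "npsyl q g \<longleftrightarrow> g \<in> carrier G \<and> ord g = q \<and> (\<forall>b \<in> carrier G. \<exists>k::nat. cj b g = g [^] k)"

text \<open>In a finite group this is the normaliser of \<open>pows g\<close>.\<close>

definition pnorm :: "'a \<Rightarrow> 'a set" where
  "pnorm g = {b \<in> carrier G. \<exists>k::nat. cj b g = g [^] k}"

definition pows :: "'a \<Rightarrow> 'a set" where "pows g = range (\<lambda>k::nat. g [^] k)"

lemma pow_mod_ord:
  assumes "g \<in> carrier G" shows "g [^] (k mod ord g) = g [^] (k::nat)"
proof -
  have "g [^] k = g [^] (ord g * (k div ord g) + k mod ord g)" by simp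
  also have "\<dots> = (g [^] ord g) [^] (k div ord g) \<otimes> g [^] (k mod ord g)"
    using assms by (simp only: nat_pow_mult nat_pow_pow)
  finally show ?thesis using assms by simp
qed

lemma pows_eq: "g \<in> carrier G \<Longrightarrow> ord g = q \<Longrightarrow> q > 0 \<Longrightarrow> pows g = (\<lambda>k. g [^] k) ` {..<q}"
  unfolding pows_def using pow_mod_ord[of g] by (auto simp: image_iff) (metis lessThan_iff mod_less_divisor)

lemma inj_pows: "g \<in> carrier G \<Longrightarrow> ord g = q \<Longrightarrow> inj_on (\<lambda>k::nat. g [^] k) {..<q}"
  using ord_inj[of g] by (auto simp: inj_on_def)

lemma card_pows: "g \<in> carrier G \<Longrightarrow> ord g = q \<Longrightarrow> q > 0 \<Longrightarrow> card (pows g) = q"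
  using pows_eq inj_pows by (simp add: card_image)

lemma pow_eq_cong: "g \<in> carrier G \<Longrightarrow> finite (carrier G) \<Longrightarrow> g [^] (i::nat) = g [^] (j::nat) \<longleftrightarrow> [i = j] (mod ord g)"
  by (smt (verit) cong_def inj_onD inj_pows lessThan_iff mod_less_divisor ord_ge_1 pow_mod_ord less_le_trans zero_less_one)

lemma subgroup_pows: "g \<in> carrier G \<Longrightarrow> finite (carrier G) \<Longrightarrow> subgroup (pows g) G"
proof -
  assume g: "g \<in> carrier G" and f: "finite (carrier G)"
  have "pows g = generate G {g}"
    using generate_pow_on_finite_carrier[OF f g] by (auto simp: pows_def)
  then show ?thesis using generate_is_subgroup[of "{g}"] g by simp
qed

lemma pow_gen_of_prime:
  assumes "g \<in> carrier G" "finite (carrier G)" "prime (ord g)" "g [^] (i::nat) \<noteq> \<one>"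
  shows "\<exists>j::nat. g = (g [^] i) [^] j"
proof -
  have "coprime i (ord g)"
    using assms by (metis coprime_commute pow_eq_id prime_imp_coprime)
  then obtain j where "[i * j = 1] (mod ord g)"
    using cong_solve_coprime_nat by auto
  then have "g [^] (i * j) = g" using assms pow_eq_cong[of g "i*j" 1] by simp
  then show ?thesis using assms by (metis nat_pow_pow)
qed

lemma subgroupI_finite:
  assumes f: "finite (carrier G)" and S: "S \<subseteq> carrier G" "\<one> \<in> S" "\<And>a b. a \<in> S \<Longrightarrow> b \<in> S \<Longrightarrow> a \<otimes> b \<in> S"
  shows "subgroup S G"
proof (rule subgroupI)
  have pow: "a [^] (n::nat) \<in> S" if "a \<in> S" for a n
    by (induction n) (use S that in auto)
  fix a assume a: "a \<in> S"
  then have ac: "a \<in> carrier G" using S by auto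
  have "a \<otimes> a [^] (ord a - 1) = \<one>"
    using pow_ord_eq_1[OF ac] nat_pow_Suc2[OF ac, of "ord a - 1"] ord_ge_1[OF f ac] by simp
  then have "inv a = a [^] (ord a - 1)" using ac by (metis inv_equality inv_inv nat_pow_closed inv_closed)
  then show "inv a \<in> S" using pow a by simp
qed (use S in auto)

lemma subgroup_pnorm:
  assumes g: "g \<in> carrier G" and f: "finite (carrier G)"
  shows "subgroup (pnorm g) G"
proof (rule subgroupI_finite[OF f])
  fix a b assume "a \<in> pnorm g" "b \<in> pnorm g"
  then obtain k l :: nat where "cj a g = g [^] k" "cj b g = g [^] l" "a \<in> carrier G" "b \<in> carrier G"
    by (auto simp: pnorm_def)
  then have "cj (a \<otimes> b) g = g [^] (k * l)" using g by (simp add: cj_comp cj_pow nat_pow_pow)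
  then show "a \<otimes> b \<in> pnorm g" using \<open>a \<in> carrier G\<close> \<open>b \<in> carrier G\<close> by (auto simp: pnorm_def)
next
  show "\<one> \<in> pnorm g" using g by (auto simp: pnorm_def intro!: exI[of _ 1])
qed (auto simp: pnorm_def)

text \<open>Right multiplication by \<open>g\<close> permutes the right cosets of
  \<open>pows g\<close> and fixes the coset of \<open>x\<close> exactly when \<open>x\<close> lies
  in the normaliser. The fixed cosets thus partition \<open>pnorm g\<close>, and
  \<open>card_fixpoints_cong\<close> compares their number with the index \<open>m\<close>.\<close>

lemma card_pnorm:
  assumes f: "finite (carrier G)" and o: "order G = m * q" and q: "prime q"
    and g: "g \<in> carrier G" "ord g = q"
  shows "\<exists>k. card (pnorm g) = k * q \<and> [k = m] (mod q) \<and> k dvd m"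
proof -
  define P where "P = pows g"
  have sP: "subgroup P G" using subgroup_pows g f by (simp add: P_def)
  have q0: "q > 0" using q prime_gt_0_nat by auto
  have cP: "card P = q" using card_pows g q0 by (simp add: P_def)
  have gP: "g [^] (i::nat) \<in> P" for i by (auto simp: P_def pows_def)
  have PG: "P \<subseteq> carrier G" using sP subgroup.subset by auto
  have "card (rcosets P) * q = m * q" using lagrange[OF sP] o cP by simp
  then have cR: "card (rcosets P) = m" using q0 by simp
  have fR: "finite (rcosets P)" using f sP by (simp add: RCOSETS_def)
  define F where "F = {C \<in> rcosets P. C #> g = C}"
  have R: "x \<in> carrier G \<Longrightarrow> (P #> x) #> y = P #> (x \<otimes> y)" if "y \<in> carrier G" for x y
    using that PG by (simp add: coset_mult_assoc)
  have F_iff: "P #> x \<in> F \<longleftrightarrow> x \<in> pnorm g" if x: "x \<in> carrier G" for x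
  proof -
    have "P #> (x \<otimes> g) = P #> x \<longleftrightarrow> x \<otimes> g \<in> P #> x"
      using x g sP repr_independence[of "x \<otimes> g" P x] repr_independenceD[of P "x \<otimes> g" x] by auto
    also have "\<dots> \<longleftrightarrow> cj x g \<in> P"
      using subgroup.rcos_module[OF sP is_group x] x g by (simp add: cj_def)
    also have "\<dots> \<longleftrightarrow> x \<in> pnorm g" using x by (auto simp: pnorm_def P_def pows_def)
    finally show ?thesis using x g R by (auto simp: F_def RCOSETS_def)
  qed
  have RF: "C \<in> F \<Longrightarrow> \<exists>x \<in> carrier G. C = P #> x" for C by (auto simp: F_def RCOSETS_def)
  have "[card F = card (rcosets P)] (mod q)"
    unfolding F_def
  proof (rule card_fixpoints_cong[OF q fR])
    show "(\<lambda>C. C #> g) ` (rcosets P) \<subseteq> rcosets P"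
      using g R by (auto simp: RCOSETS_def)
    fix C assume "C \<in> rcosets P"
    then obtain x where x: "x \<in> carrier G" "C = P #> x" by (auto simp: RCOSETS_def)
    have "((\<lambda>C. C #> g) ^^ n) C = P #> (x \<otimes> g [^] n)" for n
      by (induction n) (use x g R in \<open>simp_all add: m_assoc\<close>)
    then show "((\<lambda>C. C #> g) ^^ q) C = C" using x g pow_ord_eq_1[of g] by simp
  qed
  moreover have "\<Union>F = pnorm g"
  proof
    show "\<Union>F \<subseteq> pnorm g"
    proof
      fix y assume "y \<in> \<Union>F"
      then obtain C where C: "C \<in> F" "y \<in> C" by blast
      then obtain x where "x \<in> carrier G" "C = P #> x" using RF by blast
      with C have x: "x \<in> carrier G" "y \<in> P #> x" "P #> x \<in> F" by auto
      then have "P #> y \<in> F" "y \<in> carrier G" using sP repr_independence[of y P x] r_coset_subset_G[OF PG, of x] by auto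
      then show "y \<in> pnorm g" using F_iff by blast
    qed
    show "pnorm g \<subseteq> \<Union>F" 
    proof
      fix x assume x: "x \<in> pnorm g"
      then have "x \<in> carrier G" by (simp add: pnorm_def)
      with x show "x \<in> \<Union>F" using F_iff rcos_self[OF _ sP] by blast
    qed
  qed
  moreover have "card F * q = card (\<Union>F)"
  proof -
    have "q * card F = card (\<Union>F)"
    proof (rule card_partition)
      show "finite F" using fR by (simp add: F_def)
      have "\<Union>F \<subseteq> carrier G" using rcosets_part_G[OF sP] by (auto simp: F_def)
      then show "finite (\<Union>F)" using f finite_subset by blast
      show "card C = q" if "C \<in> F" for C
        using that card_rcosets_equal[OF _ PG, of C] cP by (simp add: F_def)
      show "C \<inter> D = {}" if "C \<in> F" "D \<in> F" "C \<noteq> D" for C D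
        using that rcos_disjoint[OF sP] by (auto simp: F_def pairwise_def disjnt_def)
    qed
    then show ?thesis by (simp add: mult.commute)
  qed
  moreover have "card (pnorm g) dvd m * q"
    using lagrange[OF subgroup_pnorm[OF g(1) f]] o by (metis dvd_triv_right)
  ultimately have "[card F = m] (mod q)" "card (pnorm g) = card F * q" "card F * q dvd m * q" using cR by simp_all
  then have "card (pnorm g) = card F * q \<and> [card F = m] (mod q) \<and> card F dvd m" using q0 by simp
  then show ?thesis by (rule exI)
qed

lemma npsyl_if_pnorm:
  assumes "g \<in> carrier G" "ord g = q" "pnorm g = carrier G"
  shows "npsyl q g"
  unfolding npsyl_def
proof (intro conjI ballI)
  fix b assume "b \<in> carrier G"
  then have "b \<in> pnorm g" using assms(3) by (simp only:)
  then show "\<exists>k::nat. cj b g = g [^] k" unfolding pnorm_def by (rule CollectE) (rule conjunct2)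
qed (use assms in simp_all)

lemma ex_ord_prime:
  assumes f: "finite (carrier G)" and q: "prime q" and o: "q dvd order G"
  shows "\<exists>g \<in> carrier G. ord g = q"
proof -
  obtain m where "order G = q ^ 1 * m" using o by auto
  then obtain H where H: "subgroup H G" "card H = q" using sylow_thm[OF q is_group _ f, of 1 m] by auto
  then have "H \<noteq> {\<one>}" using q by auto
  moreover have "\<one> \<in> H" using H subgroup.one_closed by auto
  ultimately obtain g where g: "g \<in> H" "g \<noteq> \<one>" by auto
  interpret K: group "G\<lparr>carrier := H\<rparr>" using subgroup_imp_group H by auto
  have gG: "g \<in> carrier G" using H g subgroup.mem_carrier by auto
  have "g [^]\<^bsub>G\<lparr>carrier := H\<rparr>\<^esub> q = \<one>"
    using K.pow_order_eq_1[of g] g H by (simp add: order_def)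
  then have "g [^] q = \<one>" by (simp add: nat_pow_def)
  then have "ord g dvd q" using gG pow_eq_id by auto
  then show ?thesis using q g gG ord_eq_1 by (metis prime_nat_iff)
qed

end

context group begin

text \<open>A Frobenius group in disguise: distinct conjugates of \<open>pows g\<close> meet
  trivially and contribute \<open>(q + 1) * (q - 1)\<close> nontrivial elements, so at most
  \<open>q + 1\<close> elements are left for the prospective kernel. Conjugation by \<open>g\<close>
  fixes none of its nontrivial elements, so an orbit of length \<open>q\<close> exhausts
  them.\<close>

lemma self_normalizing_kernel:
  assumes f: "finite (carrier G)" and o: "order G = (q + 1) * q" and q: "prime q"
    and g: "g \<in> carrier G" "ord g = q" and N: "pnorm g = pows g"
  defines "U \<equiv> {cj y (g [^] i) | y i. y \<in> carrier G \<and> i \<in> {1..<q}}"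
  shows "card (carrier G - U) \<le> q + 1" "\<one> \<notin> U" "\<And>x. x \<in> U \<Longrightarrow> x [^] q = \<one>"
    "\<And>a b. \<lbrakk>a \<in> carrier G - U - {\<one>}; b \<in> carrier G - U - {\<one>}\<rbrakk> \<Longrightarrow> \<exists>i::nat. b = cj (g [^] i) a"
    "\<And>a. a \<in> carrier G - U - {\<one>} \<Longrightarrow> cj g a \<noteq> a"
    "\<And>a b. \<lbrakk>a \<in> carrier G - U; b \<in> carrier G\<rbrakk> \<Longrightarrow> cj b a \<in> carrier G - U"
proof -
  define P where "P = pows g"
  have sP: "subgroup P G" using subgroup_pows g f by (simp add: P_def)
  have q1: "q > 1" using q prime_gt_1_nat by auto
  have cP: "card P = q" using card_pows g q1 by (simp add: P_def)
  have PG: "P \<subseteq> carrier G" using sP subgroup.subset by auto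
  have "card (rcosets P) * q = (q + 1) * q" using lagrange[OF sP] o cP by simp
  then have cR: "card (rcosets P) = q + 1" using q1 by (metis mult_cancel2 not_less_zero)
  have gi_ne: "g [^] i \<noteq> \<one>" if "i \<in> {1..<q}" for i :: nat
    using that g pow_eq_id[of g i] nat_dvd_not_less[of i q] by auto
  define r where "r C = (SOME x. x \<in> carrier G \<and> C = P #> x)" for C
  have r: "r C \<in> carrier G \<and> C = P #> r C" if "C \<in> rcosets P" for C
    unfolding r_def by (rule someI_ex) (use that in \<open>auto simp: RCOSETS_def\<close>)
  \<comment> \<open>Cosets index the conjugates of \<open>pows g\<close>, because this group is its
    own normaliser; injectivity of \<open>h\<close> says that these conjugates meet
    trivially.\<close>
  define h where "h = (\<lambda>(C, i::nat). cj (inv (r C)) (g [^] i))"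
  have inj: "inj_on h ((rcosets P) \<times> {1..<q})"
  proof (rule inj_onI, clarify)
    fix C i D j assume C: "C \<in> rcosets P" and D: "D \<in> rcosets P" and i: "i \<in> {1..<q}" and j: "j \<in> {1..<q}"
      and eq: "h (C, i) = h (D, j)"
    let ?x = "r C" and ?y = "r D"
    have xy: "?x \<in> carrier G" "?y \<in> carrier G" "C = P #> ?x" "D = P #> ?y" using r C D by auto
    have "cj (inv ?x) (g [^] i) = cj (inv ?y) (g [^] j)" using eq by (simp add: h_def)
    then have "cj ?y (cj (inv ?x) (g [^] i)) = g [^] j" using xy g by (simp add: cj_inv_cancel')
    then have e1: "cj (?y \<otimes> inv ?x) (g [^] i) = g [^] j" using xy g by (simp add: cj_comp)
    obtain k where k: "g = (g [^] i) [^] (k::nat)" using pow_gen_of_prime[of g i] g f q gi_ne[OF i] by auto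
    have "cj (?y \<otimes> inv ?x) g = (g [^] j) [^] k" using e1 cj_pow[of "?y \<otimes> inv ?x" "g [^] i" k] k xy g by simp
    then have "?y \<otimes> inv ?x \<in> pnorm g" using xy g by (auto simp: pnorm_def nat_pow_pow)
    then have yx: "?y \<otimes> inv ?x \<in> P" using N by (simp add: P_def)
    then have "?y \<in> P #> ?x" using subgroup.rcos_module[OF sP is_group xy(1,2)] by blast
    then have CD: "C = D" using repr_independence sP xy by metis
    then have "g [^] i = g [^] j" using e1 xy g by simp
    then have "i = j" using inj_pows[OF g] i j by (auto simp: inj_on_def)
    then show "C = D \<and> i = j" using CD by simp
  qed
  have hU: "h ` ((rcosets P) \<times> {1..<q}) \<subseteq> U"
    using r by (fastforce simp: h_def U_def)
  have UG: "U \<subseteq> carrier G" using g by (auto simp: U_def)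
  have fU: "finite U" using UG f finite_subset by auto
  have "(q + 1) * (q - 1) = card (h ` ((rcosets P) \<times> {1..<q}))"
    using inj cR by (simp add: card_image card_cartesian_product)
  then have cU: "(q + 1) * (q - 1) \<le> card U" using card_mono[OF fU hU] by simp
  have "(q + 1) * q = (q + 1) + (q + 1) * (q - 1)" using q1 by (cases q) auto
  then show cK: "card (carrier G - U) \<le> q + 1"
    using cU o card_Diff_subset[OF fU UG] by (simp add: order_def, linarith)
  show oU: "\<one> \<notin> U"
  proof
    assume "\<one> \<in> U"
    then obtain y i where yi: "y \<in> carrier G" "i \<in> {1..<q}" "cj y (g [^] i) = cj y \<one>"
      by (force simp: U_def)
    then show False using gi_ne[OF yi(2)] cj_inj[of y "g [^] i" \<one>] g by simp
  qed
  show "x [^] q = \<one>" if "x \<in> U" for x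
  proof -
    obtain y and i :: nat where yi: "y \<in> carrier G" "x = cj y (g [^] i)" using \<open>x \<in> U\<close> by (auto simp: U_def)
    have "(g [^] i) [^] q = (g [^] q) [^] i" using g by (simp add: nat_pow_pow mult.commute)
    then show ?thesis using yi g pow_ord_eq_1[of g] by (simp flip: cj_pow)
  qed
  show clK: "cj b a \<in> carrier G - U" if "a \<in> carrier G - U" and b: "b \<in> carrier G" for a b
  proof -
    have "cj b a \<notin> U"
    proof
      assume "cj b a \<in> U"
      then obtain y i where "cj b a = cj y (g [^] i)" "y \<in> carrier G" "i \<in> {1..<q}" by (auto simp: U_def)
      then have "a = cj (inv b \<otimes> y) (g [^] i)" "i \<in> {1..<q}" "inv b \<otimes> y \<in> carrier G"
        using that g cj_inv_cancel[of b a] by (auto simp: cj_comp)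
      then show False using that by (auto simp: U_def)
    qed
    then show ?thesis using that by auto
  qed
  \<comment> \<open>An element commuting with \<open>g\<close> normalises \<open>pows g\<close>,
    hence lies in it, hence is trivial or belongs to \<open>U\<close>.\<close>
  show nf: "cj g a \<noteq> a" if a: "a \<in> carrier G - U - {\<one>}" for a
  proof
    assume "cj g a = a"
    then have "a \<otimes> g = g \<otimes> a" using cj_eq_iff_commute[of g a] g a by auto
    then have "cj a g = g" using cj_eq_iff_commute[of a g] g a by auto
    then have "a \<in> P" using N a g by (auto simp: P_def pnorm_def intro!: exI[of _ 1])
    then obtain i where i: "i < q" "a = g [^] i" using pows_eq[OF g] q1 by (auto simp: P_def)
    then have "i \<in> {1..<q}" using a by (cases i) auto
    then have "cj \<one> (g [^] i) \<in> U" unfolding U_def by (metis (mono_tags, lifting) mem_Collect_eq one_closed)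
    then show False using a i g by simp
  qed
  show "\<exists>i::nat. b = cj (g [^] i) a" if a: "a \<in> carrier G - U - {\<one>}" and b: "b \<in> carrier G - U - {\<one>}" for a b
  proof -
    have ac: "a \<in> carrier G" using a by auto
    define Ob where "Ob = (\<lambda>i. (cj g ^^ i) a) ` {..<q}"
    have "(cj g ^^ q) a = a" using g ac pow_ord_eq_1[of g] by (simp add: funpow_cj)
    then have "card Ob = q" unfolding Ob_def using funpow_orbit_inj[where f = "cj g" and x = a, OF q _ nf[OF a]] by (simp add: card_image)
    moreover have "Ob \<subseteq> carrier G - U - {\<one>}"
    proof -
      have "cj (g [^] i) a \<noteq> cj (g [^] i) \<one>" for i :: nat using cj_inj[of "g [^] i" a \<one>] g a by auto
      then show ?thesis using clK a g by (auto simp: Ob_def funpow_cj)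
    qed
    moreover have "card (carrier G - U - {\<one>}) \<le> q" using cK oU f by simp
    ultimately have "Ob = carrier G - U - {\<one>}" using f \<open>card Ob = q\<close> by (intro card_seteq) auto
    then obtain i where "b = (cj g ^^ i) a" using b by (auto simp: Ob_def)
    then show ?thesis using g ac by (auto simp: funpow_cj)
  qed
qed

text \<open>The index \<open>k\<close> of \<open>pows g\<close> in its normaliser divides 12 and is
  congruent to 12 modulo \<open>p\<close>. If \<open>k\<close> is not 12, then \<open>p\<close>
  divides one of 11, 10, 9, 8, 6, which leaves \<open>p = 11\<close> and
  \<open>k = 1\<close>.\<close>

lemma npsyl_12p:
  assumes f: "finite (carrier G)" and o: "order G = 12 * p" and p: "prime p" "p \<ge> 7"
  shows "\<exists>g. npsyl p g"
proof -
  obtain g where g: "g \<in> carrier G" "ord g = p" using ex_ord_prime[OF f p(1)] o by auto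
  obtain k where k: "card (pnorm g) = k * p" "[k = 12] (mod p)" "k dvd 12"
    using card_pnorm[OF f o p(1) g] by auto
  have kle: "k \<le> 12" "k > 0" using k(3) by (auto intro: dvd_imp_le Nat.gr0I)
  show ?thesis
  proof (cases "k = 12")
    case True
    then have "pnorm g = carrier G"
      using k(1) o f by (intro card_subset_eq) (auto simp: order_def pnorm_def)
    then show ?thesis using npsyl_if_pnorm[OF g] by (intro exI)
  next
    case False
    have "p dvd 12 - k" using k(2) kle by (metis cong_altdef_nat cong_sym)
    then have "p \<le> 12 - k" using False kle by (intro dvd_imp_le) auto
    moreover have "k \<in> {1,2,3,4,6}"
    proof -
      have "k \<in> {1,2,3,4,5,6,7,8,9,10,11,12}" using kle unfolding insert_iff empty_iff by presburger
      then show ?thesis using k(3) False by auto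
    qed
    moreover have "p \<in> {7, 8, 9, 10, 11}" using p \<open>p \<le> 12 - k\<close> kle unfolding insert_iff empty_iff by presburger
    ultimately have kp: "k = 1" "p = 11" using \<open>p dvd 12 - k\<close> p by auto
    have "pows g \<subseteq> pnorm g" using g
      by (auto simp: pows_def pnorm_def cj_def intro!: exI[of _ 1])
        (metis nat_pow_Suc nat_pow_Suc2 inv_solve_right nat_pow_closed m_closed)
    then have N: "pnorm g = pows g"
      using card_pows[OF g] kp k(1) by (intro card_subset_eq[symmetric]) (auto intro: finite_subset[OF _ f] simp: pnorm_def)
    define U where "U = {cj y (g [^] i) | y i. y \<in> carrier G \<and> i \<in> {1..<p}}"
    have o': "order G = (p + 1) * p" using o kp by simp
    note K = self_normalizing_kernel[OF f o' p(1) g N, folded U_def]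
    \<comment> \<open>Elements of order 2 and 3 both avoid \<open>U\<close>, where every 11th power
      is trivial; yet all nontrivial elements outside \<open>U\<close> are conjugate.\<close>
    obtain a where a: "a \<in> carrier G" "ord a = 2" using ex_ord_prime[OF f, of 2] o by auto
    obtain b where b: "b \<in> carrier G" "ord b = 3" using ex_ord_prime[OF f, of 3] o by auto
    have ab: "a \<noteq> \<one>" "b \<noteq> \<one>" using a b by auto
    have "a [^] (11::nat) \<noteq> \<one>" "b [^] (11::nat) \<noteq> \<one>" using a b pow_eq_id by auto
    then have "a \<in> carrier G - U - {\<one>}" "b \<in> carrier G - U - {\<one>}" using K(3) a b ab kp by auto
    then obtain i :: nat where i: "b = cj (g [^] i) a" using K(4) by blast
    have "b [^] (2::nat) = cj (g [^] i) (a [^] (2::nat))" using i g a cj_pow by auto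
    also have "\<dots> = \<one>" using a g pow_ord_eq_1[of a] by simp
    finally show ?thesis using b pow_eq_id[of b 2] by auto
  qed
qed

end

section \<open>The alternating group of degree four on explicit datatypes\<close>

text \<open>One type serves as the cyclic group of order four by \<open>+\<close>, as the Klein
  group by \<open>xor4\<close>, and as the field of four elements with \<open>rot T1\<close> as
  multiplication by a primitive element. It also holds the exponents of fourth roots of
  unity.\<close>

datatype q4 = Q0 | Q1 | Q2 | Q3
datatype t3 = T0 | T1 | T2
datatype a4 = AA q4 t3

lemma UNIV_q4: "UNIV = {Q0, Q1, Q2, Q3}" using q4.exhaust by auto
lemma UNIV_t3: "UNIV = {T0, T1, T2}" using t3.exhaust by auto
lemma all_q4: "(\<forall>x. P x) \<longleftrightarrow> P Q0 \<and> P Q1 \<and> P Q2 \<and> P Q3" by (metis q4.exhaust)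
lemma all_t3: "(\<forall>x. P x) \<longleftrightarrow> P T0 \<and> P T1 \<and> P T2" by (metis t3.exhaust)

instantiation q4 :: ab_group_add
begin
fun plus_q4 :: "q4 \<Rightarrow> q4 \<Rightarrow> q4" where
  "Q0 + y = y" | "Q1 + Q0 = Q1" | "Q1 + Q1 = Q2" | "Q1 + Q2 = Q3" | "Q1 + Q3 = Q0"
| "Q2 + Q0 = Q2" | "Q2 + Q1 = Q3" | "Q2 + Q2 = Q0" | "Q2 + Q3 = Q1"
| "Q3 + Q0 = Q3" | "Q3 + Q1 = Q0" | "Q3 + Q2 = Q1" | "Q3 + Q3 = Q2"
fun uminus_q4 :: "q4 \<Rightarrow> q4" where "- Q0 = Q0" | "- Q1 = Q3" | "- Q2 = Q2" | "- Q3 = Q1"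
definition zero_q4 :: q4 where "0 = Q0"
definition minus_q4 :: "q4 \<Rightarrow> q4 \<Rightarrow> q4" where "x - y = x + - (y::q4)"
instance
proof
  fix a b c :: q4
  show "a + b + c = a + (b + c)" by (cases a; cases b; cases c) simp_all
  show "a + b = b + a" by (cases a; cases b) simp_all
  show "0 + a = a" by (simp add: zero_q4_def)
  show "- a + a = 0" by (cases a) (simp_all add: zero_q4_def)
  show "a - b = a + - b" by (simp add: minus_q4_def)
qed
end

instantiation t3 :: ab_group_add
begin
fun plus_t3 :: "t3 \<Rightarrow> t3 \<Rightarrow> t3" where
  "T0 + y = y" | "T1 + T0 = T1" | "T1 + T1 = T2" | "T1 + T2 = T0"
| "T2 + T0 = T2" | "T2 + T1 = T0" | "T2 + T2 = T1"
fun uminus_t3 :: "t3 \<Rightarrow> t3" where "- T0 = T0" | "- T1 = T2" | "- T2 = T1"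
definition zero_t3 :: t3 where "0 = T0"
definition minus_t3 :: "t3 \<Rightarrow> t3 \<Rightarrow> t3" where "x - y = x + - (y::t3)"
instance
proof
  fix a b c :: t3
  show "a + b + c = a + (b + c)" by (cases a; cases b; cases c) simp_all
  show "a + b = b + a" by (cases a; cases b) simp_all
  show "0 + a = a" by (simp add: zero_t3_def)
  show "- a + a = 0" by (cases a) (simp_all add: zero_t3_def)
  show "a - b = a + - b" by (simp add: minus_t3_def)
qed
end

fun xor4 :: "q4 \<Rightarrow> q4 \<Rightarrow> q4" where
  "xor4 Q0 y = y" | "xor4 Q1 Q0 = Q1" | "xor4 Q1 Q1 = Q0" | "xor4 Q1 Q2 = Q3" | "xor4 Q1 Q3 = Q2"
| "xor4 Q2 Q0 = Q2" | "xor4 Q2 Q1 = Q3" | "xor4 Q2 Q2 = Q0" | "xor4 Q2 Q3 = Q1"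
| "xor4 Q3 Q0 = Q3" | "xor4 Q3 Q1 = Q2" | "xor4 Q3 Q2 = Q1" | "xor4 Q3 Q3 = Q0"

fun rot :: "t3 \<Rightarrow> q4 \<Rightarrow> q4" where
  "rot T0 y = y" | "rot T1 Q0 = Q0" | "rot T1 Q1 = Q2" | "rot T1 Q2 = Q3" | "rot T1 Q3 = Q1"
| "rot T2 Q0 = Q0" | "rot T2 Q1 = Q3" | "rot T2 Q2 = Q1" | "rot T2 Q3 = Q2"

text \<open>\<open>AA v s\<close> is the affine map that sends \<open>x\<close> to
  \<open>rot s x\<close> plus \<open>v\<close> over the field of four elements; these maps form the
  alternating group of degree four.\<close>

fun mulA :: "a4 \<Rightarrow> a4 \<Rightarrow> a4" where
  "mulA (AA v s) (AA w t) = AA (xor4 v (rot s w)) (s + t)"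

fun tn :: "t3 \<Rightarrow> nat" where "tn T0 = 0" | "tn T1 = 1" | "tn T2 = 2"

lemma tn_add: "tn (s + t) = (tn s + tn t) mod 3" by (cases s; cases t) simp_all

lemma card_a4: "card (UNIV :: a4 set) = 12" "finite (UNIV :: a4 set)"
proof -
  have b: "bij_betw (\<lambda>(v, s). AA v s) UNIV UNIV"
    by (auto simp: bij_betw_def inj_on_def image_iff) (metis a4.exhaust)
  have cq: "card {Q0, Q1, Q2, Q3} = 4" and ct: "card {T0, T1, T2} = 3" and fq: "finite {Q0, Q1, Q2, Q3}" "finite {T0, T1, T2}"
    by simp_all
  have "(UNIV :: (q4 \<times> t3) set) = {Q0, Q1, Q2, Q3} \<times> {T0, T1, T2}"
    by (simp only: UNIV_q4[symmetric] UNIV_t3[symmetric] UNIV_Times_UNIV)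
  then have "card (UNIV :: (q4 \<times> t3) set) = 4 * 3" "finite (UNIV :: (q4 \<times> t3) set)"
    by (metis (no_types) card_cartesian_product cq ct, metis (no_types) finite_cartesian_product fq)
  then show "card (UNIV :: a4 set) = 12" "finite (UNIV :: a4 set)"
    using bij_betw_same_card[OF b] bij_betw_finite[OF b] by simp_all
qed

text \<open>The index of a subgroup of order 3 in its normaliser divides 4 and is congruent to 1
  modulo 3, so it is 1 unless the subgroup is normal. Then \<open>self_normalizing_kernel\<close>
  applies with \<open>q = 3\<close>; the kernel is a Sylow 2-subgroup whose three nontrivial
  elements are permuted cyclically by \<open>g\<close>.\<close>

lemma (in group) A4_model:
  assumes f: "finite (carrier G)" and o: "order G = 12" and no: "\<nexists>g. npsyl 3 g"
  shows "\<exists>f. bij_betw f UNIV (carrier G) \<and> (\<forall>x y. f (mulA x y) = f x \<otimes> f y)"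
proof -
  have p3: "prime (3::nat)" by simp
  obtain g where g: "g \<in> carrier G" "ord g = 3" using ex_ord_prime[OF f p3] o by auto
  have o': "order G = 4 * 3" using o by simp
  obtain k where k: "card (pnorm g) = k * 3" "[k = 4] (mod 3)" "k dvd 4"
    using card_pnorm[OF f o' p3 g] by auto
  have "k \<le> 4" "k > 0" using k(3) by (auto intro: dvd_imp_le Nat.gr0I)
  then have "k \<in> {1,2,3,4}" unfolding insert_iff empty_iff by presburger
  then have k14: "k = 1 \<or> k = 4" using k(2) by (auto simp: cong_def)
  have "k \<noteq> 4"
  proof
    assume "k = 4"
    then have "pnorm g = carrier G"
      using k(1) o f by (intro card_subset_eq) (auto simp: order_def pnorm_def)
    then show False using npsyl_if_pnorm[OF g] no by auto
  qed
  then have k1: "k = 1" using k14 by simp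
  have "pows g \<subseteq> pnorm g"
  proof
    fix x assume "x \<in> pows g"
    then obtain i :: nat where x: "x = g [^] i" by (auto simp: pows_def)
    have "cj x g = g [^] (1::nat)" using g x cj_eq_iff_commute[of x g] nat_pow_Suc2[of g i] by simp
    then show "x \<in> pnorm g" using x g unfolding pnorm_def by blast
  qed
  then have N: "pnorm g = pows g"
    using card_pows[OF g] k1 k(1) by (intro card_subset_eq[symmetric]) (auto intro: finite_subset[OF _ f] simp: pnorm_def)
  define U where "U = {cj y (g [^] i) | y i. y \<in> carrier G \<and> i \<in> {1..<3::nat}}"
  have o4: "order G = (3 + 1) * 3" using o by simp
  note K = self_normalizing_kernel[OF f o4 p3 g N, folded U_def]
  obtain S where S: "subgroup S G" "card S = 2 ^ 2"
    using sylow_thm[of 2 G 2 3] o f is_group by auto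
  have SG: "S \<subseteq> carrier G" using S subgroup.subset by auto
  interpret S: group "G\<lparr>carrier := S\<rparr>" using subgroup_imp_group S by auto
  have S4: "x [^] (4::nat) = \<one>" if "x \<in> S" for x
    using S.pow_order_eq_1[of x] that S by (simp add: order_def nat_pow_def)
  have "S \<subseteq> carrier G - U"
  proof
    fix x assume x: "x \<in> S"
    \<comment> \<open>Such an \<open>x\<close> would have trivial third and fourth powers.\<close>
    have "x \<notin> U"
    proof
      assume xU: "x \<in> U"
      have xc: "x \<in> carrier G" using x SG by auto
      have "x = x [^] (3::nat) \<otimes> x" using K(3)[OF xU] xc by simp
      also have "\<dots> = x [^] (4::nat)" using xc nat_pow_Suc[of x 3] by simp
      finally show False using S4[OF x] K(2) xU by simp
    qed
    then show "x \<in> carrier G - U" using x SG by auto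
  qed
  then have KS: "S = carrier G - U"
    using K(1) S(2) f by (intro card_seteq) auto
  have Sm: "x \<otimes> y \<in> S" if "x \<in> S" "y \<in> S" for x y
    by (rule subgroup.m_closed[OF S(1) that])
  have S1: "\<one> \<in> S" using S(1) subgroup.one_closed by auto
  have "S \<noteq> {\<one>}" using S(2) by auto
  then obtain a where a: "a \<in> S" "a \<noteq> \<one>" using S1 by auto
  have ac: "a \<in> carrier G" using a SG by auto
  define b where "b = cj g a"
  define c where "c = cj g b"
  have Sc: "cj x y \<in> S" if "x \<in> carrier G" "y \<in> S" for x y using K(6) KS that by auto
  have bc: "b \<in> S" "c \<in> S" using Sc a g by (auto simp: b_def c_def)
  then have bcc: "b \<in> carrier G" "c \<in> carrier G" using SG by auto
  have n1: "cj g x \<noteq> \<one>" if "x \<in> carrier G" "x \<noteq> \<one>" for x using cj_inj[of g x \<one>] g that by auto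
  have bc1: "b \<noteq> \<one>" "c \<noteq> \<one>" using n1 a ac bcc by (auto simp: b_def c_def)
  have ca: "cj g c = a" using ac g pow_ord_eq_1[of g] funpow_cj[of g a 3]
    by (simp add: b_def c_def numeral_3_eq_3)
  have ab: "a \<noteq> b" "b \<noteq> c" using K(5)[of a] K(5)[of b] a bc bc1 KS b_def c_def by auto
  have "a \<noteq> c" using ca K(5)[of c] bc bc1 KS by auto
  then have "card {\<one>, a, b, c} = 4" using ab a bc1 by auto
  then have Seq: "S = {\<one>, a, b, c}" using S(2) a bc S1 f SG
    by (intro card_subset_eq[symmetric]) (auto intro: finite_subset)
  \<comment> \<open>A nontrivial square of \<open>a\<close> would be conjugate to \<open>a\<close>
    under a power of \<open>g\<close>; the same conjugation sends the square to the fourth power,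
    which is trivial.\<close>
  have aa: "a \<otimes> a = \<one>"
  proof (rule ccontr)
    assume ne: "a \<otimes> a \<noteq> \<one>"
    have "a \<otimes> a \<in> S" using Sm a by simp
    then obtain i :: nat where i: "a \<otimes> a = cj (g [^] i) a" using K(4)[of a "a \<otimes> a"] a ne KS by auto
    have "\<one> = (a \<otimes> a) \<otimes> (a \<otimes> a)" using S4[OF a(1)] ac by (simp add: numeral_eq_Suc m_assoc)
    also have "\<dots> = cj (g [^] i) (a \<otimes> a)" using i cj_mult[of "g [^] i" a a] g ac by simp
    finally have "cj (g [^] i) (a \<otimes> a) = cj (g [^] i) \<one>" unfolding cj_one(2)[OF nat_pow_closed[OF g(1)]] by (rule sym)
    then show False using cj_inj[of "g [^] i" "a \<otimes> a" \<one>] g ac ne by simp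
  qed
  have bb: "b \<otimes> b = \<one>" using aa ac g by (simp add: b_def flip: cj_mult)
  have cc: "c \<otimes> c = \<one>" using bb bcc g by (simp add: c_def flip: cj_mult)
  have third: "x \<otimes> y = z" if "{x, y, z} = {a, b, c}" "x \<noteq> y" for x y z
  proof -
    have mem: "x \<in> S" "y \<in> S" "z \<in> S" "x \<in> {a,b,c}" "y \<in> {a,b,c}" using that Seq by auto
    then have xc: "x \<in> carrier G" "y \<in> carrier G" "x \<noteq> \<one>" "y \<noteq> \<one>" using SG a bc1 by auto
    have "x \<otimes> x = \<one>" using mem aa bb cc by auto
    then have "x \<otimes> y \<noteq> \<one>" using xc that(2) by (metis inv_equality inv_inv)
    moreover have "x \<otimes> y \<noteq> x" "x \<otimes> y \<noteq> y" using xc by auto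
    moreover have "x \<otimes> y \<in> {\<one>, x, y, z}" using Sm[OF mem(1,2)] Seq that(1) by auto
    ultimately show ?thesis by auto
  qed
  have prods: "a \<otimes> b = c" "b \<otimes> a = c" "a \<otimes> c = b" "c \<otimes> a = b" "b \<otimes> c = a" "c \<otimes> b = a"
    using ab \<open>a \<noteq> c\<close> by (intro third; auto)+
  define \<phi> where "\<phi> = case_q4 \<one> a b c"
  have \<phi>c [simp]: "\<phi> v \<in> carrier G" for v using ac bcc by (cases v) (auto simp: \<phi>_def)
  have \<phi>m: "\<phi> (xor4 v w) = \<phi> v \<otimes> \<phi> w" for v w
    using ac bcc by (cases v; cases w) (simp_all add: \<phi>_def prods aa bb cc)
  have \<phi>r: "\<phi> (rot s v) = cj (g [^] tn s) (\<phi> v)" for s v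
  proof -
    have "\<phi> (rot T1 v) = cj g (\<phi> v)" for v
      using g ca by (cases v) (simp_all add: \<phi>_def b_def c_def)
    moreover have "rot T2 v = rot T1 (rot T1 v)" by (cases v) simp_all
    moreover have "g [^] (2::nat) = g \<otimes> g" using g by (simp add: numeral_2_eq_2)
    ultimately show ?thesis using g by (cases s) (simp_all add: cj_comp)
  qed
  define F where "F x = (case x of AA v s \<Rightarrow> \<phi> v \<otimes> g [^] tn s)" for x
  have gt: "g [^] tn (s + t) = g [^] tn s \<otimes> g [^] tn t" for s t
    using pow_mod_ord[OF g(1), of "tn s + tn t"] g by (simp add: tn_add nat_pow_mult)
  have Fm: "F (mulA x y) = F x \<otimes> F y" for x y
  proof (cases x; cases y)
    fix v s w t assume xy: "x = AA v s" "y = AA w t"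
    have "F (mulA x y) = \<phi> v \<otimes> cj (g [^] tn s) (\<phi> w) \<otimes> (g [^] tn s \<otimes> g [^] tn t)"
      using xy by (simp add: F_def \<phi>m \<phi>r gt)
    also have "\<dots> = F x \<otimes> F y" using xy g m_assoc[of "inv (g [^] tn s)" "g [^] tn s" "g [^] tn t"]
      by (simp add: F_def cj_def m_assoc)
    finally show ?thesis .
  qed
  have inj: "inj F"
  proof (rule injI)
    fix x y assume eq: "F x = F y"
    obtain v s w t where xy: "x = AA v s" "y = AA w t" by (metis a4.exhaust)
    have "\<phi> v \<otimes> g [^] tn s = \<phi> w \<otimes> g [^] tn t" using eq xy by (simp add: F_def)
    then have "\<phi> w \<otimes> (\<phi> v \<otimes> g [^] tn s) = g [^] tn t"
    proof -
      have "\<phi> w \<otimes> \<phi> w = \<one>" using \<phi>m[of w w] by (cases w) (simp_all add: \<phi>_def)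
      then have "\<phi> w \<otimes> (\<phi> w \<otimes> g [^] tn t) = g [^] tn t" using g by (simp flip: m_assoc)
      then show ?thesis using \<open>\<phi> v \<otimes> g [^] tn s = \<phi> w \<otimes> g [^] tn t\<close> by simp
    qed
    then have "\<phi> (xor4 w v) = g [^] tn t \<otimes> inv (g [^] tn s)"
      using g by (simp add: \<phi>m inv_solve_right m_assoc)
    also have "inv (g [^] tn s) = g [^] tn (- s)"
      using gt[of s "- s"] g by (intro inv_equality) (simp_all add: zero_t3_def gt[symmetric] add.commute)
    finally have ph: "\<phi> (xor4 w v) = g [^] tn (t - s)" using gt[of t "- s"] by simp
    have "\<phi> (xor4 w v) \<in> S" using Seq by (cases "xor4 w v") (auto simp: \<phi>_def)
    then have nU: "\<phi> (xor4 w v) \<notin> U" using KS by auto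
    have "t - s = T0"
    proof (rule ccontr)
      assume "t - s \<noteq> T0"
      then have "tn (t - s) \<in> {1..<3}" by (cases "t - s") auto
      moreover have "\<phi> (xor4 w v) = cj \<one> (g [^] tn (t - s))" using ph g by simp
      ultimately show False using nU unfolding U_def by blast
    qed
    then have st: "s = t" by (simp flip: zero_t3_def)
    then have "\<phi> (xor4 w v) = \<one>" using ph by (simp add: zero_t3_def)
    then have "xor4 w v = Q0" using a bc1 by (cases "xor4 w v") (auto simp: \<phi>_def)
    then have "v = w" by (cases v; cases w) simp_all
    with st show "x = y" using xy by simp
  qed
  have "F ` UNIV \<subseteq> carrier G" using g by (auto simp: F_def split: a4.split)
  then have "F ` UNIV = carrier G"
    using inj f o by (intro card_subset_eq) (auto simp: card_image card_a4 order_def)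
  then show ?thesis using inj Fm by (auto simp: bij_betw_def)
qed

section \<open>Crossed homomorphisms on a group with a normal Sylow subgroup\<close>

context group begin

lemma npsylD: assumes "npsyl q g" shows "g \<in> carrier G" "ord g = q" "\<And>b. b \<in> carrier G \<Longrightarrow> \<exists>k::nat. cj b g = g [^] k"
  using assms by (auto simp: npsyl_def)

lemma int_pow_eq_iff: "\<lbrakk>g \<in> carrier G; ord g = q\<rbrakk> \<Longrightarrow> g [^] (i::int) = g [^] j \<longleftrightarrow> [i = j] (mod int q)"
  using int_pow_eq[of g i j] by (metis cong_iff_dvd_diff dvd_diff_commute)

end

locale psyl = group G for G (structure) +
  fixes q n :: nat and g
  assumes fin: "finite (carrier G)" and prime_q: "prime q" and cop: "coprime n q"
    and ordG: "order G = n * q" and ps: "npsyl q g"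
begin

lemma gc [simp]: "g \<in> carrier G" and og: "ord g = q" using npsylD[OF ps] by auto

lemma q0: "q > 0" using prime_q prime_gt_0_nat by auto

lemma pow_iff: "g [^] (i::int) = g [^] (j::int) \<longleftrightarrow> [i = j] (mod int q)"
  using int_pow_eq_iff og by simp

definition chi where "chi b = int (SOME k::nat. cj b g = g [^] k)"

lemma cj_g: "b \<in> carrier G \<Longrightarrow> cj b g = g [^] chi b"
  using someI_ex[OF npsylD(3)[OF ps, of b]] by (simp add: chi_def int_pow_int)

lemma int_pow_comm_cj:
  assumes b: "b \<in> carrier G" shows "b \<otimes> g [^] (i::int) = g [^] (chi b * i) \<otimes> b"
proof -
  have "cj b \<in> hom G G" using b by (auto simp: hom_def cj_mult)
  then interpret h: group_hom G G "cj b" by unfold_locales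
  have "cj b (g [^] i) = g [^] (chi b * i)"
    using h.hom_int_pow[of g i] b cj_g[of b] by (simp add: int_pow_pow)
  then show ?thesis using b by (simp add: cj_def inv_solve_right')
qed

lemma chi_mult:
  assumes "a \<in> carrier G" "b \<in> carrier G" shows "[chi (a \<otimes> b) = chi a * chi b] (mod int q)"
proof -
  have "g [^] chi (a \<otimes> b) \<otimes> (a \<otimes> b) = a \<otimes> (b \<otimes> g)"
    using int_pow_comm_cj[of "a \<otimes> b" 1] assms by (simp add: m_assoc)
  also have "\<dots> = a \<otimes> g [^] (chi b) \<otimes> b" using int_pow_comm_cj[of b 1] assms by (simp add: m_assoc)
  also have "\<dots> = g [^] (chi a * chi b) \<otimes> (a \<otimes> b)" using int_pow_comm_cj[of a "chi b"] assms by (simp add: m_assoc)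
  finally show ?thesis using assms pow_iff by simp
qed

lemma chi_uniq:
  assumes "b \<in> carrier G" "b \<otimes> g = g [^] (k::int) \<otimes> b" shows "[chi b = k] (mod int q)"
  using int_pow_comm_cj[OF assms(1), of 1] assms pow_iff by (simp add: cong_sym_eq)

lemma chi_pow: "[chi (g [^] (i::int)) = 1] (mod int q)"
  using int_pow_mult[OF gc, of i 1] int_pow_mult[OF gc, of 1 i]
  by (intro chi_uniq) (simp_all add: add.commute)

lemma chi_one: "[chi \<one> = 1] (mod int q)" using chi_pow[of 0] by simp

lemma pow_chi: "b \<in> carrier G \<Longrightarrow> [chi (b [^] (k::nat)) = chi b ^ k] (mod int q)"
proof (induction k)
  case (Suc k)
  have "[chi (b [^] k \<otimes> b) = chi (b [^] k) * chi b] (mod int q)" using chi_mult Suc by simp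
  also have "[chi (b [^] k) * chi b = chi b ^ k * chi b] (mod int q)" using Suc by (intro cong_scalar_right) simp
  finally show ?case by (simp add: mult.commute)
qed (simp add: chi_one)

text \<open>The section \<open>rp\<close> of the quotient map and its offset \<open>e0\<close> carry
  the factor set of the extension; summed over the transversal \<open>RR\<close>, the offset turns
  into a crossed homomorphism.\<close>

definition Cs where "Cs b = (\<lambda>i::int. g [^] i \<otimes> b) ` UNIV"
definition rp where "rp b = (SOME x. x \<in> Cs b)"
definition e0 where "e0 b = (SOME i::int. b = g [^] i \<otimes> rp b)"

lemma Cs_pow: "b \<in> carrier G \<Longrightarrow> Cs (g [^] (i::int) \<otimes> b) = Cs b"
proof -
  assume b: "b \<in> carrier G"
  have "g [^] j \<otimes> b = g [^] (j - i) \<otimes> (g [^] i \<otimes> b)" for j :: int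
    using b by (simp flip: m_assoc int_pow_mult)
  moreover have "g [^] j \<otimes> (g [^] i \<otimes> b) = g [^] (j + i) \<otimes> b" for j :: int
    using b by (simp flip: m_assoc int_pow_mult)
  ultimately show ?thesis unfolding Cs_def by blast
qed

lemma rp_in: "rp b \<in> Cs b" unfolding rp_def by (rule someI_ex) (auto simp: Cs_def)

lemma rp_closed [simp]: "b \<in> carrier G \<Longrightarrow> rp b \<in> carrier G"
  using rp_in[of b] by (auto simp: Cs_def)

lemma rp_pow: "b \<in> carrier G \<Longrightarrow> rp (g [^] (i::int) \<otimes> b) = rp b"
  by (simp add: rp_def Cs_pow)

lemma e0: "b \<in> carrier G \<Longrightarrow> b = g [^] e0 b \<otimes> rp b"
proof -
  assume b: "b \<in> carrier G"
  obtain i where i: "rp b = g [^] (i::int) \<otimes> b" using rp_in[of b] by (auto simp: Cs_def)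
  then have "b = g [^] (-i) \<otimes> rp b" using b by (simp flip: m_assoc int_pow_mult)
  then show ?thesis unfolding e0_def by (rule someI)
qed

lemma rp_rp: "b \<in> carrier G \<Longrightarrow> rp (rp b) = rp b"
  using e0[of b] rp_pow[of "rp b" "e0 b"] by simp

lemma e0_pow: "b \<in> carrier G \<Longrightarrow> [e0 (g [^] (i::int) \<otimes> b) = i + e0 b] (mod int q)"
proof -
  assume b: "b \<in> carrier G"
  have "g [^] e0 (g [^] i \<otimes> b) \<otimes> rp b = g [^] i \<otimes> b" using e0[of "g [^] i \<otimes> b"] b by (simp add: rp_pow)
  also have "\<dots> = g [^] i \<otimes> (g [^] e0 b \<otimes> rp b)" using e0[OF b] by simp
  also have "\<dots> = g [^] (i + e0 b) \<otimes> rp b" using b by (simp add: int_pow_mult m_assoc)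
  finally show ?thesis using b pow_iff by simp
qed

definition RR where "RR = rp ` carrier G"

lemma RR_sub: "RR \<subseteq> carrier G" by (auto simp: RR_def)
lemma RR_rp: "k \<in> RR \<Longrightarrow> rp k = k" by (auto simp: RR_def rp_rp)
lemma fin_RR: "finite RR" using fin by (simp add: RR_def)

lemma e0_RR: "k \<in> RR \<Longrightarrow> [e0 k = 0] (mod int q)"
proof -
  assume k: "k \<in> RR"
  then have kc: "k \<in> carrier G" using RR_sub by auto
  have "g [^] (0::int) \<otimes> k = g [^] e0 k \<otimes> k" using e0[OF kc] RR_rp[OF k] kc by simp
  then have "g [^] (0::int) = g [^] e0 k" using kc by (metis gc int_pow_closed right_cancel)
  then show ?thesis using pow_iff cong_sym by blast
qed

lemma card_RR: "card RR = n"
proof -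
  have "bij_betw (\<lambda>(i, k). g [^] int i \<otimes> k) ({..<q} \<times> RR) (carrier G)"
    unfolding bij_betw_def
  proof
    show "inj_on (\<lambda>(i, k). g [^] int i \<otimes> k) ({..<q} \<times> RR)"
    proof (rule inj_onI, clarify)
      fix i k j l assume a: "i < q" "k \<in> RR" "j < q" "l \<in> RR" "g [^] int i \<otimes> k = g [^] int j \<otimes> l"
      have c: "k \<in> carrier G" "l \<in> carrier G" using a RR_sub by auto
      have kl: "k = l" using rp_pow[of k "int i"] rp_pow[of l "int j"] a c RR_rp by metis
      then have "g [^] int i = g [^] int j" using a c by simp
      then have "i = j" using a pow_iff by (simp add: cong_def)
      then show "i = j \<and> k = l" using kl by simp
    qed
    show "(\<lambda>(i, k). g [^] int i \<otimes> k) ` ({..<q} \<times> RR) = carrier G"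
    proof
      show "carrier G \<subseteq> (\<lambda>(i, k). g [^] int i \<otimes> k) ` ({..<q} \<times> RR)"
      proof
        fix b assume b: "b \<in> carrier G"
        have "g [^] e0 b = g [^] int (nat (e0 b mod int q))" using q0 pow_iff by simp
        then have "b = g [^] int (nat (e0 b mod int q)) \<otimes> rp b" using e0[OF b] by simp
        moreover have "nat (e0 b mod int q) < q" using q0 by (simp add: nat_less_iff)
        ultimately show "b \<in> (\<lambda>(i, k). g [^] int i \<otimes> k) ` ({..<q} \<times> RR)"
          using b by (intro image_eqI[of _ _ "(nat (e0 b mod int q), rp b)"]) (auto simp: RR_def)
      qed
    qed (use RR_sub in auto)
  qed
  from bij_betw_same_card[OF this] have "q * card RR = n * q"
    using ordG by (simp add: card_cartesian_product order_def)
  then show ?thesis using q0 by simp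
qed

lemma bij_RR: "b \<in> carrier G \<Longrightarrow> bij_betw (\<lambda>k. rp (b \<otimes> k)) RR RR"
proof -
  assume b: "b \<in> carrier G"
  have "inj_on (\<lambda>k. rp (b \<otimes> k)) RR"
  proof (rule inj_onI)
    fix k l assume kl: "k \<in> RR" "l \<in> RR" "rp (b \<otimes> k) = rp (b \<otimes> l)"
    have c: "k \<in> carrier G" "l \<in> carrier G" using kl RR_sub by auto
    define d where "d = e0 (b \<otimes> k) - e0 (b \<otimes> l)"
    have "g [^] d \<otimes> (b \<otimes> l) = g [^] d \<otimes> (g [^] e0 (b \<otimes> l) \<otimes> rp (b \<otimes> l))"
      using e0[of "b \<otimes> l"] b c by simp
    also have "\<dots> = (g [^] d \<otimes> g [^] e0 (b \<otimes> l)) \<otimes> rp (b \<otimes> l)"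
      using b c by (simp only: m_assoc gc int_pow_closed rp_closed m_closed)
    also have "g [^] d \<otimes> g [^] e0 (b \<otimes> l) = g [^] e0 (b \<otimes> k)"
      by (simp add: d_def flip: int_pow_mult)
    also have "g [^] e0 (b \<otimes> k) \<otimes> rp (b \<otimes> l) = b \<otimes> k" using e0[of "b \<otimes> k"] kl(3) b c by simp
    finally have e: "b \<otimes> k = g [^] d \<otimes> (b \<otimes> l)" by (rule sym)
    have "k = inv b \<otimes> (b \<otimes> k)" using b c by (simp flip: m_assoc)
    also have "\<dots> = inv b \<otimes> (g [^] d \<otimes> (b \<otimes> l))" by (simp only: e)
    also have "\<dots> = (inv b \<otimes> g [^] d) \<otimes> (b \<otimes> l)" using b c by (simp only: m_assoc gc int_pow_closed inv_closed m_closed)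
    also have "\<dots> = (g [^] (chi (inv b) * d) \<otimes> inv b) \<otimes> (b \<otimes> l)"
      using b by (simp only: int_pow_comm_cj inv_closed)
    also have "\<dots> = g [^] (chi (inv b) * d) \<otimes> (inv b \<otimes> (b \<otimes> l))"
      using b c by (simp only: m_assoc gc int_pow_closed inv_closed m_closed)
    also have "inv b \<otimes> (b \<otimes> l) = l" using b c by (simp flip: m_assoc)
    finally have "rp k = rp l" using c by (simp add: rp_pow)
    then show "k = l" using kl RR_rp by simp
  qed
  moreover have "(\<lambda>k. rp (b \<otimes> k)) ` RR \<subseteq> RR" using b RR_sub by (auto simp: RR_def)
  ultimately show ?thesis using fin_RR by (simp add: bij_betw_def endo_inj_surj)
qed

text \<open>The sum of \<open>e0 (b \<otimes> k)\<close> over the transversal obeys the crossed rule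
  because left multiplication permutes the cosets; dividing by \<open>n\<close>, which is invertible
  modulo \<open>q\<close>, normalises the value on powers of \<open>g\<close>. This is
  Schur-Zassenhaus for a normal subgroup of prime order: the zeros of \<open>e\<close> form a
  complement.\<close>

lemma crossed_hom:
  "\<exists>e. (\<forall>a \<in> carrier G. \<forall>b \<in> carrier G. [e (a \<otimes> b) = e a + chi a * e b] (mod int q)) \<and>
       (\<forall>i::int. [e (g [^] i) = i] (mod int q))"
proof -
  obtain m where m: "[int n * m = 1] (mod int q)"
    using cong_solve_coprime_int[of "int n" "int q"] cop by auto
  define s where "s b = (\<Sum>k\<in>RR. e0 (b \<otimes> k))" for b
  have s1: "[s (a \<otimes> b) = s a + chi a * s b] (mod int q)" if ab: "a \<in> carrier G" "b \<in> carrier G" for a b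
  proof -
    have 1: "[e0 (a \<otimes> b \<otimes> k) = chi a * e0 (b \<otimes> k) + e0 (a \<otimes> rp (b \<otimes> k))] (mod int q)" if k: "k \<in> RR" for k
    proof -
      have kc: "k \<in> carrier G" using k RR_sub by auto
      have "a \<otimes> b \<otimes> k = a \<otimes> (g [^] e0 (b \<otimes> k) \<otimes> rp (b \<otimes> k))"
        using e0[of "b \<otimes> k"] ab kc by (simp add: m_assoc)
      also have "\<dots> = g [^] (chi a * e0 (b \<otimes> k)) \<otimes> (a \<otimes> rp (b \<otimes> k))"
        using int_pow_comm_cj[of a "e0 (b \<otimes> k)"] ab kc by (simp flip: m_assoc)
      finally show ?thesis using e0_pow[of "a \<otimes> rp (b \<otimes> k)" "chi a * e0 (b \<otimes> k)"] ab kc by simp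
    qed
    have "[s (a \<otimes> b) = (\<Sum>k\<in>RR. chi a * e0 (b \<otimes> k) + e0 (a \<otimes> rp (b \<otimes> k)))] (mod int q)"
      unfolding s_def by (rule cong_sum) (rule 1)
    also have "(\<Sum>k\<in>RR. chi a * e0 (b \<otimes> k) + e0 (a \<otimes> rp (b \<otimes> k))) = chi a * s b + (\<Sum>k\<in>RR. e0 (a \<otimes> rp (b \<otimes> k)))"
      by (simp add: s_def sum.distrib sum_distrib_left)
    also have "(\<Sum>k\<in>RR. e0 (a \<otimes> rp (b \<otimes> k))) = s a"
      unfolding s_def using sum.reindex_bij_betw[OF bij_RR[OF ab(2)], of "\<lambda>k. e0 (a \<otimes> k)"] .
    finally show ?thesis by (simp add: add.commute)
  qed
  have s2: "[s (g [^] i) = int n * i] (mod int q)" for i :: int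
  proof -
    have "[s (g [^] i) = (\<Sum>k\<in>RR. i)] (mod int q)" unfolding s_def
    proof (rule cong_sum)
      fix k assume k: "k \<in> RR"
      then have "[e0 (g [^] i \<otimes> k) = i + e0 k] (mod int q)" using e0_pow RR_sub by auto
      also have "[i + e0 k = i + 0] (mod int q)" using e0_RR[OF k] by (intro cong_add) auto
      finally show "[e0 (g [^] i \<otimes> k) = i] (mod int q)" by simp
    qed
    then show ?thesis using card_RR by simp
  qed
  define e where "e b = m * s b" for b
  have "[e (a \<otimes> b) = e a + chi a * e b] (mod int q)" if "a \<in> carrier G" "b \<in> carrier G" for a b
    using cong_scalar_left[OF s1[OF that], of m] by (simp add: e_def algebra_simps)
  moreover have "[e (g [^] i) = i] (mod int q)" for i :: int
  proof -
    have "[e (g [^] i) = m * (int n * i)] (mod int q)" unfolding e_def using cong_scalar_left[OF s2[of i], of m] .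
    also have "m * (int n * i) = (int n * m) * i" by (simp add: mult_ac)
    also have "[(int n * m) * i = 1 * i] (mod int q)" using m by (rule cong_scalar_right)
    finally show ?thesis by simp
  qed
  ultimately show ?thesis by blast
qed

definition ee where "ee = (SOME e. (\<forall>a \<in> carrier G. \<forall>b \<in> carrier G. [e (a \<otimes> b) = e a + chi a * e b] (mod int q)) \<and>
       (\<forall>i::int. [e (g [^] i) = i] (mod int q)))"

lemma ee_mult: "a \<in> carrier G \<Longrightarrow> b \<in> carrier G \<Longrightarrow> [ee (a \<otimes> b) = ee a + chi a * ee b] (mod int q)"
  and ee_pow: "[ee (g [^] (i::int)) = i] (mod int q)"
  using someI_ex[OF crossed_hom, folded ee_def] by auto

text \<open>In the quotient by \<open>pows g\<close>, of order \<open>n\<close>, the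
  \<open>n\<close>-th power of \<open>b\<close> is trivial; as \<open>n\<close> is invertible modulo
  \<open>q\<close>, \<open>b\<close> is itself a power of that \<open>n\<close>-th power. In this
  form every homomorphism can be seen to respect the normal subgroup.\<close>

lemma pow_q_eq_one_iff:
  assumes b: "b \<in> carrier G" shows "b [^] q = \<one> \<longleftrightarrow> (\<exists>i::int. b = g [^] i)"
proof
  assume "\<exists>i::int. b = g [^] i"
  then obtain i :: int where i: "b = g [^] i" by auto
  then have "b [^] q = g [^] (i * int q)" by (simp add: int_pow_pow flip: int_pow_int)
  also have "\<dots> = g [^] (0::int)" using pow_iff[of "i * int q" 0] by (simp add: cong_def)
  finally show "b [^] q = \<one>" by simp
next
  assume bq: "b [^] q = \<one>"
  define P where "P = pows g"
  have sP: "subgroup P G" using subgroup_pows[OF gc fin] by (simp add: P_def)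
  have PP: "x \<in> P \<Longrightarrow> \<exists>i::int. x = g [^] i" for x by (auto simp: P_def pows_def intro: int_pow_int[symmetric])
  have "P \<lhd> G"
    unfolding normal_inv_iff
  proof (intro conjI sP ballI)
    fix x h assume x: "x \<in> carrier G" and "h \<in> P"
    then obtain k :: nat where h: "h = g [^] k" by (auto simp: P_def pows_def)
    obtain l :: nat where "cj x g = g [^] l" using npsylD(3)[OF ps x] by auto
    then have "cj x h = g [^] (l * k)" using h x by (simp add: cj_pow nat_pow_pow)
    then show "x \<otimes> h \<otimes> inv x \<in> P" by (auto simp: cj_def P_def pows_def)
  qed
  then interpret N: normal P G .
  interpret F: group "G Mod P" by (rule N.factorgroup_is_group)
  have "card (rcosets P) * card P = n * q" using lagrange[OF sP] ordG by simp
  then have oF: "order (G Mod P) = n"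
    using q0 card_pows[OF gc og q0] by (simp add: order_def FactGroup_def P_def)
  have bF: "P #> b \<in> carrier (G Mod P)" using b by (auto simp: carrier_FactGroup)
  have "P #> (b [^] n) = P"
    using F.pow_order_eq_1[OF bF] oF N.FactGroup_pow[OF b, of n] by simp
  then have bn: "b [^] n \<in> P" using coset_join1[OF _ _ sP] b by blast
  obtain m where m: "[int n * m = 1] (mod int q)"
    using cong_solve_coprime_int[of "int n" "int q"] cop by auto
  have "ord b dvd q" using bq b pow_eq_id by auto
  then have "int (ord b) dvd int q" by simp
  then have "[int n * m = 1] (mod int (ord b))" using m cong_dvd_modulus by blast
  then have "b [^] (int n * m) = b [^] (1::int)" using int_pow_eq_iff[OF b refl] by blast
  then have "b = (b [^] n) [^] m" using b by (simp add: int_pow_pow[symmetric] int_pow_int)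
  moreover obtain i where "b [^] n = g [^] (i::int)" using PP[OF bn] by auto
  ultimately have "b = g [^] (i * m)" by (simp add: int_pow_pow)
  then show "\<exists>i::int. b = g [^] i" ..
qed

end

context psyl begin

text \<open>Another average: with \<open>S\<close> the sum of \<open>c\<close> over the transversal,
  the crossed rule gives \<open>n * c b + chi b * S = S\<close> modulo \<open>q\<close>. This is the
  vanishing of first cohomology in coprime order, for cocycles inflated from the quotient.\<close>

lemma coboundary:
  assumes c: "\<And>a b. a \<in> carrier G \<Longrightarrow> b \<in> carrier G \<Longrightarrow> [c (a \<otimes> b) = c a + chi a * c b] (mod int q)"
    and cg: "\<And>i::int. [c (g [^] i) = 0] (mod int q)"
  shows "\<exists>v::int. \<forall>b \<in> carrier G. [c b = v * (1 - chi b)] (mod int q)"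
proof -
  obtain m where m: "[int n * m = 1] (mod int q)"
    using cong_solve_coprime_int[of "int n" "int q"] cop by auto
  define S where "S = (\<Sum>k\<in>RR. c k)"
  have c1: "[c (g [^] i \<otimes> b) = c b] (mod int q)" if b: "b \<in> carrier G" for b and i :: int
  proof -
    have "[c (g [^] i \<otimes> b) = c (g [^] i) + chi (g [^] i) * c b] (mod int q)" using c b by simp
    also have "[c (g [^] i) + chi (g [^] i) * c b = 0 + 1 * c b] (mod int q)"
      by (intro cong_add cong_mult cg chi_pow cong_refl)
    finally show ?thesis by simp
  qed
  have "[c b = m * S * (1 - chi b)] (mod int q)" if b: "b \<in> carrier G" for b
  proof -
    have "[(\<Sum>k\<in>RR. c (b \<otimes> k)) = (\<Sum>k\<in>RR. c (rp (b \<otimes> k)))] (mod int q)"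
    proof (rule cong_sum)
      fix k assume "k \<in> RR"
      then have kc: "b \<otimes> k \<in> carrier G" using RR_sub b by auto
      show "[c (b \<otimes> k) = c (rp (b \<otimes> k))] (mod int q)"
        using c1[of "rp (b \<otimes> k)" "e0 (b \<otimes> k)"] e0[OF kc] rp_closed[OF kc] by simp
    qed
    also have "(\<Sum>k\<in>RR. c (rp (b \<otimes> k))) = S"
      unfolding S_def by (rule sum.reindex_bij_betw[OF bij_RR[OF b]])
    finally have 1: "[(\<Sum>k\<in>RR. c (b \<otimes> k)) = S] (mod int q)" .
    have "[(\<Sum>k\<in>RR. c (b \<otimes> k)) = (\<Sum>k\<in>RR. c b + chi b * c k)] (mod int q)"
      by (rule cong_sum) (use c b RR_sub in auto)
    also have "(\<Sum>k\<in>RR. c b + chi b * c k) = int n * c b + chi b * S"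
      by (simp add: S_def sum.distrib sum_distrib_left card_RR)
    finally have "[int n * c b + chi b * S = S] (mod int q)" using 1 by (metis cong_sym cong_trans)
    then have "[m * (int n * c b + chi b * S) = m * S] (mod int q)" by (rule cong_scalar_left)
    then have "[m * (int n * c b + chi b * S) - m * chi b * S = m * S - m * chi b * S] (mod int q)"
      by (intro cong_diff cong_refl)
    then have 2: "[int n * m * c b = m * S * (1 - chi b)] (mod int q)" by (simp add: algebra_simps)
    have "[int n * m * c b = 1 * c b] (mod int q)" using m by (rule cong_scalar_right)
    then show ?thesis using 2 by (metis cong_sym cong_trans mult_1)
  qed
  then show ?thesis by blast
qed

lemma bij_RR_right: "b \<in> carrier G \<Longrightarrow> bij_betw (\<lambda>k. rp (k \<otimes> b)) RR RR"
proof -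
  assume b: "b \<in> carrier G"
  have "inj_on (\<lambda>k. rp (k \<otimes> b)) RR"
  proof (rule inj_onI)
    fix k l assume kl: "k \<in> RR" "l \<in> RR" "rp (k \<otimes> b) = rp (l \<otimes> b)"
    have c: "k \<in> carrier G" "l \<in> carrier G" using kl RR_sub by auto
    define d where "d = e0 (k \<otimes> b) - e0 (l \<otimes> b)"
    have "g [^] d \<otimes> (l \<otimes> b) = g [^] d \<otimes> (g [^] e0 (l \<otimes> b) \<otimes> rp (l \<otimes> b))"
      using e0[of "l \<otimes> b"] b c by simp
    also have "\<dots> = (g [^] d \<otimes> g [^] e0 (l \<otimes> b)) \<otimes> rp (l \<otimes> b)"
      using b c by (simp only: m_assoc gc int_pow_closed rp_closed m_closed)
    also have "g [^] d \<otimes> g [^] e0 (l \<otimes> b) = g [^] e0 (k \<otimes> b)"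
      by (simp add: d_def flip: int_pow_mult)
    also have "g [^] e0 (k \<otimes> b) \<otimes> rp (l \<otimes> b) = k \<otimes> b" using e0[of "k \<otimes> b"] kl(3) b c by simp
    finally have "g [^] d \<otimes> l \<otimes> b = k \<otimes> b" using b c by (simp add: m_assoc)
    then have "g [^] d \<otimes> l = k" using b c right_cancel[of b] by simp
    then have "rp k = rp l" using c rp_pow[of l d] by simp
    then show "k = l" using kl RR_rp by simp
  qed
  moreover have "(\<lambda>k. rp (k \<otimes> b)) ` RR \<subseteq> RR" using b RR_sub by (auto simp: RR_def)
  ultimately show ?thesis using fin_RR by (simp add: bij_betw_def endo_inj_surj)
qed

lemma chi_unit: "b \<in> carrier G \<Longrightarrow> [chi b * chi (inv b) = 1] (mod int q)"
  using chi_mult[of b "inv b"] chi_one by (metis cong_sym cong_trans inv_closed r_inv)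

lemma chi_coprime: "b \<in> carrier G \<Longrightarrow> coprime (chi b) (int q)"
  using chi_unit by (metis cong_imp_coprime coprime_mult_left_iff cong_sym coprime_1_left)

end

section \<open>The lambda action and the Sylow subgroups of both groups of a brace\<close>

lemma carrier_circ [simp]: "carrier (circ_group B) = carrier B"
  and mult_circ [simp]: "x \<otimes>\<^bsub>circ_group B\<^esub> y = x \<odot>\<^bsub>B\<^esub> y"
  and one_circ: "\<one>\<^bsub>circ_group B\<^esub> = circ_one B"
  by (simp_all add: circ_group_def)

context skew_left_brace begin

sublocale C: group "circ_group B" by (rule circ_group)

lemma c_closed [simp]: "a \<in> carrier B \<Longrightarrow> b \<in> carrier B \<Longrightarrow> a \<odot> b \<in> carrier B"
  using C.m_closed by simp

lemma c_assoc: "\<lbrakk>a \<in> carrier B; b \<in> carrier B; c \<in> carrier B\<rbrakk> \<Longrightarrow> (a \<odot> b) \<odot> c = a \<odot> (b \<odot> c)"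
  using C.m_assoc by simp

text \<open>The usual lambda action, through which the circle group acts on the additive group by
  automorphisms.\<close>

definition lam where "lam a b = inv a \<otimes> (a \<odot> b)"

lemma lam_closed [simp]: "a \<in> carrier B \<Longrightarrow> b \<in> carrier B \<Longrightarrow> lam a b \<in> carrier B"
  by (simp add: lam_def)

lemma circ_lam: "a \<in> carrier B \<Longrightarrow> b \<in> carrier B \<Longrightarrow> a \<odot> b = a \<otimes> lam a b"
  by (simp add: lam_def flip: m_assoc)

lemma lam_mult: "\<lbrakk>a \<in> carrier B; b \<in> carrier B; c \<in> carrier B\<rbrakk> \<Longrightarrow> lam a (b \<otimes> c) = lam a b \<otimes> lam a c"
  by (simp add: lam_def circ_mult m_assoc)

lemma lam_one: "a \<in> carrier B \<Longrightarrow> lam a \<one> = \<one>"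
  using lam_mult[of a \<one> \<one>] by (metis l_one lam_closed one_closed r_cancel_one')

lemma circ_one_eq: "circ_one B = \<one>"
proof -
  have "\<one> \<odot> \<one> = \<one>" using circ_lam[of \<one> \<one>] lam_one by simp
  then show ?thesis using C.r_cancel_one'[of \<one> \<one>] by (simp add: one_circ)
qed

lemma c_one [simp]: "a \<in> carrier B \<Longrightarrow> a \<odot> \<one> = a" "a \<in> carrier B \<Longrightarrow> \<one> \<odot> a = a"
  using C.r_one[of a] C.l_one[of a] by (simp_all add: one_circ circ_one_eq)

lemma lam_circ: "\<lbrakk>a \<in> carrier B; b \<in> carrier B; c \<in> carrier B\<rbrakk> \<Longrightarrow> lam (a \<odot> b) c = lam a (lam b c)"
proof -
  assume a: "a \<in> carrier B" "b \<in> carrier B" "c \<in> carrier B"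
  have "(a \<odot> b) \<otimes> lam (a \<odot> b) c = a \<odot> (b \<otimes> lam b c)"
    using a circ_lam[of "a \<odot> b" c] circ_lam[of b c] by (simp add: c_assoc)
  also have "\<dots> = (a \<odot> b) \<otimes> lam a (lam b c)"
    using a circ_mult[of a b "lam b c"] by (simp add: lam_def[of a "lam b c"] m_assoc)
  finally show ?thesis using a by simp
qed

lemma lam_one_left: "c \<in> carrier B \<Longrightarrow> lam \<one> c = c"
  by (simp add: lam_def)

lemma lam_hom: "a \<in> carrier B \<Longrightarrow> group_hom B B (lam a)"
  by unfold_locales (auto simp: hom_def lam_mult)

lemma lam_pow: "\<lbrakk>a \<in> carrier B; x \<in> carrier B\<rbrakk> \<Longrightarrow> lam a (x [^] (k::nat)) = lam a x [^] k"
  "\<lbrakk>a \<in> carrier B; x \<in> carrier B\<rbrakk> \<Longrightarrow> lam a (x [^] (i::int)) = lam a x [^] i"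
  using group_hom.hom_nat_pow[OF lam_hom] group_hom.hom_int_pow[OF lam_hom] by auto

lemma c_inv: "a \<in> carrier B \<Longrightarrow> inv\<^bsub>circ_group B\<^esub> a \<in> carrier B"
  "a \<in> carrier B \<Longrightarrow> a \<odot> inv\<^bsub>circ_group B\<^esub> a = \<one>" "a \<in> carrier B \<Longrightarrow> inv\<^bsub>circ_group B\<^esub> a \<odot> a = \<one>"
  using C.inv_closed[of a] C.r_inv[of a] C.l_inv[of a] by (simp_all add: one_circ circ_one_eq)

lemma lam_inv_cancel: "\<lbrakk>a \<in> carrier B; x \<in> carrier B\<rbrakk> \<Longrightarrow> lam a (lam (inv\<^bsub>circ_group B\<^esub> a) x) = x"
  "\<lbrakk>a \<in> carrier B; x \<in> carrier B\<rbrakk> \<Longrightarrow> lam (inv\<^bsub>circ_group B\<^esub> a) (lam a x) = x"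
  using c_inv by (simp_all add: lam_one_left flip: lam_circ)

lemma lam_inj: "\<lbrakk>a \<in> carrier B; x \<in> carrier B; y \<in> carrier B\<rbrakk> \<Longrightarrow> lam a x = lam a y \<longleftrightarrow> x = y"
  by (metis lam_inv_cancel(2))

end

locale brace_half = skew_left_brace B + N: psyl B q n g for B (structure) and q n :: nat and g
begin

abbreviation tau where "tau \<equiv> N.chi"

text \<open>Automorphisms preserve the elements with trivial \<open>q\<close>-th power, and these
  are exactly the powers of \<open>g\<close>.\<close>

lemma lam_gen: "a \<in> carrier B \<Longrightarrow> \<exists>s::int. lam a g = g [^] s"
proof -
  assume a: "a \<in> carrier B"
  have "lam a g [^] q = lam a (g [^] q)" using a by (simp add: lam_pow)
  also have "g [^] q = \<one>" using N.og pow_ord_eq_1[of g] by simp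
  finally show ?thesis using N.pow_q_eq_one_iff[of "lam a g"] a by (simp add: lam_one)
qed

definition sg where "sg a = (SOME s::int. lam a g = g [^] s)"

lemma lam_g: "a \<in> carrier B \<Longrightarrow> lam a (g [^] (i::int)) = g [^] (sg a * i)"
  using someI_ex[OF lam_gen[of a], folded sg_def] by (simp add: lam_pow int_pow_pow)

lemma sg_circ: "a \<in> carrier B \<Longrightarrow> b \<in> carrier B \<Longrightarrow> [sg (a \<odot> b) = sg a * sg b] (mod int q)"
  using lam_circ[of a b "g [^] (1::int)"] by (simp only: lam_g c_closed N.gc int_pow_closed N.pow_iff mult_1_right)

lemma sg_one: "[sg \<one> = 1] (mod int q)"
  using lam_g[of \<one> 1] lam_one_left[of g] N.pow_iff[of "sg \<one>" 1] by simp

lemma sg_inv: "a \<in> carrier B \<Longrightarrow> [sg a * sg (inv\<^bsub>circ_group B\<^esub> a) = 1] (mod int q)"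
  using sg_circ[of a "inv\<^bsub>circ_group B\<^esub> a"] sg_one c_inv[of a] by (metis cong_sym cong_trans)

lemma sg_coprime: "a \<in> carrier B \<Longrightarrow> coprime (sg a) (int q)"
  using sg_inv by (metis cong_imp_coprime coprime_mult_left_iff cong_sym coprime_1_left)

text \<open>A brace of prime order is trivial: the powers of \<open>g\<close> are closed under the
  circle operation, so \<open>lam g\<close> has period \<open>q\<close> on them, and the number of
  its fixed points is a positive multiple of \<open>q\<close>.\<close>

lemma circ_pow_g: "g [^]\<^bsub>circ_group B\<^esub> (k::nat) = g [^] k" and lam_g_triv: "lam g (g [^] (i::int)) = g [^] i"
proof -
  define P where "P = range (\<lambda>i::int. g [^] i)"
  have PB: "P \<subseteq> carrier B" by (auto simp: P_def)
  have cl: "x \<odot> y \<in> P" if "x \<in> P" "y \<in> P" for x y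
    using that circ_lam[of x y] by (auto simp: P_def lam_g simp flip: int_pow_mult)
  have gP: "g \<in> P" unfolding P_def by (rule range_eqI[of _ _ 1]) simp
  have oneP: "\<one> \<in> P" unfolding P_def by (rule range_eqI[of _ _ 0]) simp
  have cP: "card P = q"
  proof -
    have "P = pows g"
    proof
      show "P \<subseteq> pows g"
      proof
        fix x assume "x \<in> P"
        then obtain i :: int where "x = g [^] i" by (auto simp: P_def)
        also have "\<dots> = g [^] int (nat (i mod int q))" using N.q0 N.pow_iff by simp
        finally show "x \<in> pows g" unfolding pows_def int_pow_int by auto
      qed
      show "pows g \<subseteq> P" unfolding P_def pows_def by (auto simp flip: int_pow_int)
    qed
    then show ?thesis using card_pows[OF N.gc N.og N.q0] by simp
  qed
  have fP: "finite P" using cP N.q0 card_ge_0_finite by auto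
  have sub: "subgroup P (circ_group B)"
    using cl oneP PB N.fin by (intro C.subgroupI_finite) (auto simp: one_circ circ_one_eq)
  interpret K: group "circ_group B\<lparr>carrier := P\<rparr>" by (rule C.subgroup_imp_group[OF sub])
  have "g [^]\<^bsub>circ_group B\<lparr>carrier := P\<rparr>\<^esub> q = \<one>"
    using K.pow_order_eq_1[of g] gP cP by (simp add: order_def one_circ circ_one_eq)
  then have gq: "g [^]\<^bsub>circ_group B\<^esub> q = \<one>" by (simp add: nat_pow_def)
  have fk: "(lam g ^^ k) y = lam (g [^]\<^bsub>circ_group B\<^esub> k) y" if "y \<in> carrier B" for k y
  proof (induction k)
    case (Suc k)
    have "g [^]\<^bsub>circ_group B\<^esub> Suc k = g \<odot> g [^]\<^bsub>circ_group B\<^esub> k"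
      using C.nat_pow_Suc2[of g k] by simp
    moreover have "g [^]\<^bsub>circ_group B\<^esub> k \<in> carrier B" using C.nat_pow_closed[of g k] by simp
    ultimately show ?case using Suc that by (simp add: lam_circ)
  qed (use that in \<open>simp add: lam_one_left one_circ circ_one_eq\<close>)
  have "[card {x \<in> P. lam g x = x} = card P] (mod q)"
  proof (rule card_fixpoints_cong[OF N.prime_q fP])
    show "lam g ` P \<subseteq> P" by (auto simp: P_def lam_g)
    show "(lam g ^^ q) x = x" if "x \<in> P" for x
      using fk[of x q] gq that PB lam_one_left by auto
  qed
  then have "q dvd card {x \<in> P. lam g x = x}" using cP by (simp add: cong_def mod_eq_0_iff_dvd)
  moreover have "card {x \<in> P. lam g x = x} > 0"
    using oneP fP lam_one[of g] by (auto simp: card_gt_0_iff)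
  ultimately have "q \<le> card {x \<in> P. lam g x = x}" by (rule dvd_imp_le)
  then have "{x \<in> P. lam g x = x} = P" using cP fP by (intro card_seteq) auto
  then have fixP: "\<And>x. x \<in> P \<Longrightarrow> lam g x = x" by auto
  then show "lam g (g [^] i) = g [^] i" for i :: int by (simp add: P_def)
  show "g [^]\<^bsub>circ_group B\<^esub> k = g [^] k" for k :: nat
  proof (induction k)
    case (Suc k)
    have "g [^] k \<in> P" unfolding P_def by (auto simp flip: int_pow_int)
    then have "g \<odot> g [^] k = g \<otimes> g [^] k" using circ_lam[of g "g [^] k"] fixP by simp
    then show ?case using Suc C.nat_pow_Suc2[of g k] nat_pow_Suc2[of g k] by simp
  qed (simp add: one_circ circ_one_eq)
qed

lemma circ_ord_g: "C.ord g = q"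
proof -
  have "C.ord g dvd k \<longleftrightarrow> q dvd k" for k
    using C.pow_eq_id[of g k] pow_eq_id[of g k] N.og by (simp add: circ_pow_g one_circ circ_one_eq)
  then show ?thesis by (meson dvd_antisym dvd_refl)
qed

text \<open>The generator \<open>g'\<close> of the circle Sylow subgroup can be exchanged for
  \<open>g\<close>, which has order \<open>q\<close> there too and hence is a power of
  \<open>g'\<close> by \<open>pow_q_eq_one_iff\<close>.\<close>

lemma circ_psyl:
  assumes "C.npsyl q g'" shows "psyl (circ_group B) q n g"
proof -
  interpret M: psyl "circ_group B" q n g'
    by unfold_locales (use N.fin N.prime_q N.cop N.ordG assms in \<open>auto simp: order_def\<close>)
  have gc: "g \<in> carrier (circ_group B)" by simp
  have "g [^]\<^bsub>circ_group B\<^esub> q = \<one>\<^bsub>circ_group B\<^esub>" using C.pow_ord_eq_1[OF gc] circ_ord_g by simp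
  then obtain i :: int where i: "g = g' [^]\<^bsub>circ_group B\<^esub> i" using M.pow_q_eq_one_iff[OF gc] by auto
  have "\<exists>k::nat. C.cj b g = g [^]\<^bsub>circ_group B\<^esub> k" if b: "b \<in> carrier (circ_group B)" for b
  proof -
    have P: "C.pows g \<subseteq> C.pows g'"
    proof
      fix x assume "x \<in> C.pows g"
      then obtain k :: nat where "x = g [^]\<^bsub>circ_group B\<^esub> k" by (auto simp: C.pows_def)
      then have "x = g' [^]\<^bsub>circ_group B\<^esub> (i * int k)" using i C.int_pow_pow[OF M.gc, of i "int k"] by (simp add: int_pow_int)
      also have "\<dots> = g' [^]\<^bsub>circ_group B\<^esub> int (nat ((i * int k) mod int q))" using N.q0 M.pow_iff by simp
      finally show "x \<in> C.pows g'" unfolding C.pows_def int_pow_int by auto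
    qed
    have fp: "finite (C.pows g')" using C.card_pows[OF M.gc M.og M.q0] M.q0 card_ge_0_finite by auto
    have PP: "C.pows g = C.pows g'"
      using C.card_pows[OF M.gc M.og M.q0] C.card_pows[OF gc circ_ord_g M.q0] by (intro card_subset_eq fp P) simp
    have "C.cj b g [^]\<^bsub>circ_group B\<^esub> q = \<one>\<^bsub>circ_group B\<^esub>"
      using C.cj_pow[OF b gc, of q] C.pow_ord_eq_1[OF gc] circ_ord_g C.cj_one(2)[OF b] by simp
    then obtain j :: int where j: "C.cj b g = g' [^]\<^bsub>circ_group B\<^esub> j"
      using M.pow_q_eq_one_iff C.cj_closed[OF b gc] by auto
    also have "\<dots> = g' [^]\<^bsub>circ_group B\<^esub> int (nat (j mod int q))" using N.q0 M.pow_iff by simp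
    finally have "C.cj b g \<in> C.pows g'" unfolding C.pows_def int_pow_int by auto
    then show ?thesis using PP by (auto simp: C.pows_def)
  qed
  then have "C.npsyl q g" using gc circ_ord_g by (auto simp: C.npsyl_def)
  then show ?thesis by unfold_locales (use N.fin N.prime_q N.cop N.ordG in \<open>auto simp: order_def\<close>)
qed

end

text \<open>The double semidirect product: \<open>\<tau>\<close> and \<open>\<sigma>\<close> give the conjugation action on the normal
  subgroup of order \<open>q\<close> in the additive and in the multiplicative group.\<close>

definition dsp :: "nat \<Rightarrow> ('a, 'm) skew_brace_scheme \<Rightarrow> ('a \<Rightarrow> int) \<Rightarrow> ('a \<Rightarrow> int) \<Rightarrow> (int \<times> 'a) skew_brace" where
  "dsp q E \<tau> \<sigma> = \<lparr>carrier = {0..<int q} \<times> carrier E,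
     monoid.mult = (\<lambda>(x, h) (y, k). ((x + \<tau> h * y) mod int q, h \<otimes>\<^bsub>E\<^esub> k)),
     one = (0, \<one>\<^bsub>E\<^esub>),
     circ = (\<lambda>(x, h) (y, k). ((x + \<sigma> h * y) mod int q, h \<odot>\<^bsub>E\<^esub> k)),
     circ_one = (0, circ_one E)\<rparr>"

lemma cong_cancel_int: "\<lbrakk>coprime a (m::int); [a * x = a * y] (mod m)\<rbrakk> \<Longrightarrow> [x = y] (mod m)"
  by (simp add: cong_mult_lcancel)

locale brace_psyl = brace_half + M: psyl "circ_group B" q n g
begin

abbreviation sig where "sig \<equiv> M.chi"

lemma circ_int_pow_g: "g [^]\<^bsub>circ_group B\<^esub> (i::int) = g [^] i"
proof -
  have "[i = int (nat (i mod int q))] (mod int q)" using N.q0 by (simp add: cong_def)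
  then have "g [^]\<^bsub>circ_group B\<^esub> i = g [^]\<^bsub>circ_group B\<^esub> int (nat (i mod int q))" "g [^] i = g [^] int (nat (i mod int q))"
    using M.pow_iff N.pow_iff by blast+
  then show ?thesis unfolding int_pow_int by (simp only: circ_pow_g)
qed

lemma circ_comm: "b \<in> carrier B \<Longrightarrow> b \<odot> g [^] (i::int) = g [^] (sig b * i) \<odot> b"
  using M.int_pow_comm_cj[of b i] by (simp add: circ_int_pow_g)

text \<open>\<open>g \<odot> b\<close> equals \<open>b \<odot> g [^] j\<close> for a suitable
  \<open>j\<close>, by normality in the circle group; the latter lies in the additive coset of
  \<open>b\<close>.\<close>

lemma lam_g_shift: "b \<in> carrier B \<Longrightarrow> \<exists>c::int. lam g b = g [^] c \<otimes> b"
proof -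
  assume b: "b \<in> carrier B"
  obtain j :: int where j: "[sig b * j = 1] (mod int q)"
    using M.chi_unit[of b] b by auto
  have "g \<odot> b = g [^] (sig b * j) \<odot> b" using N.pow_iff[of "sig b * j" 1] j by simp
  also have "\<dots> = b \<odot> g [^] j" using circ_comm[OF b, of j] by simp
  also have "\<dots> = b \<otimes> g [^] (sg b * j)" using b by (simp add: circ_lam lam_g)
  also have "\<dots> = g [^] (tau b * (sg b * j)) \<otimes> b" using N.int_pow_comm_cj b by simp
  finally have "lam g b = inv g \<otimes> (g [^] (tau b * (sg b * j)) \<otimes> b)" by (simp add: lam_def)
  also have "\<dots> = g [^] (-1 :: int) \<otimes> g [^] (tau b * (sg b * j)) \<otimes> b" using b by (simp add: m_assoc int_pow_neg)
  also have "\<dots> = g [^] (-1 + tau b * (sg b * j)) \<otimes> b" using b by (simp only: int_pow_mult N.gc)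
  finally show ?thesis ..
qed

definition cc where "cc b = (SOME c::int. lam g b = g [^] c \<otimes> b)"

lemma lam_g_cc: "b \<in> carrier B \<Longrightarrow> lam g b = g [^] cc b \<otimes> b"
  using someI_ex[OF lam_g_shift] by (simp add: cc_def)

lemma cc_uniq: "\<lbrakk>b \<in> carrier B; lam g b = g [^] (c::int) \<otimes> b\<rbrakk> \<Longrightarrow> [cc b = c] (mod int q)"
  using lam_g_cc[of b] N.pow_iff by simp

lemma lam_gk: "b \<in> carrier B \<Longrightarrow> lam (g [^] (k::nat)) b = g [^] (int k * cc b) \<otimes> b"
proof (induction k)
  case (Suc k)
  have "lam (g [^] Suc k) b = lam (g \<odot> g [^] k) b"
    using circ_pow_g[of "Suc k"] circ_pow_g[of k] C.nat_pow_Suc2[of g k] by simp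
  also have "\<dots> = lam g (g [^] (int k * cc b) \<otimes> b)" using Suc by (simp add: lam_circ)
  also have "\<dots> = g [^] (int k * cc b) \<otimes> (g [^] cc b \<otimes> b)"
    using Suc.prems by (simp add: lam_mult lam_g_triv lam_g_cc)
  also have "\<dots> = g [^] (int (Suc k) * cc b) \<otimes> b"
  proof -
    have "int (Suc k) * cc b = int k * cc b + cc b" by (simp add: algebra_simps)
    then show ?thesis using Suc.prems by (simp only: int_pow_mult N.gc m_assoc int_pow_closed)
  qed
  finally show ?case .
qed (simp add: lam_one_left)

lemma lam_gi: "b \<in> carrier B \<Longrightarrow> lam (g [^] (i::int)) b = g [^] (i * cc b) \<otimes> b"
proof -
  assume b: "b \<in> carrier B"
  define k where "k = nat (i mod int q)"
  have k: "[i = int k] (mod int q)" using N.q0 by (simp add: cong_def k_def)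
  have "g [^] i = g [^] k" using N.pow_iff[of i "int k"] k by (simp add: int_pow_int)
  moreover have "g [^] (i * cc b) = g [^] (int k * cc b)" using N.pow_iff k cong_scalar_right by blast
  ultimately show ?thesis using lam_gk[OF b, of k] by simp
qed

lemma cc_mult: "\<lbrakk>a \<in> carrier B; b \<in> carrier B\<rbrakk> \<Longrightarrow> [cc (a \<otimes> b) = cc a + tau a * cc b] (mod int q)"
proof (rule cc_uniq)
  assume a: "a \<in> carrier B" "b \<in> carrier B"
  have "lam g (a \<otimes> b) = g [^] cc a \<otimes> (a \<otimes> g [^] cc b) \<otimes> b"
    using a by (simp add: lam_mult lam_g_cc m_assoc)
  also have "\<dots> = g [^] cc a \<otimes> (g [^] (tau a * cc b) \<otimes> a) \<otimes> b" using N.int_pow_comm_cj a by simp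
  also have "\<dots> = g [^] (cc a + tau a * cc b) \<otimes> (a \<otimes> b)" using a by (simp add: int_pow_mult m_assoc)
  finally show "lam g (a \<otimes> b) = g [^] (cc a + tau a * cc b) \<otimes> (a \<otimes> b)" .
qed simp

lemma cc_g: "[cc (g [^] (i::int)) = 0] (mod int q)"
  by (rule cc_uniq) (simp_all add: lam_g_triv)

text \<open>Apply \<open>lam a\<close> to the commutation rule
  \<open>b \<otimes> g = g [^] tau b \<otimes> b\<close> and cancel the unit
  \<open>sg a\<close>.\<close>

lemma tau_lam: "\<lbrakk>a \<in> carrier B; b \<in> carrier B\<rbrakk> \<Longrightarrow> [tau (lam a b) = tau b] (mod int q)"
proof -
  assume a: "a \<in> carrier B" "b \<in> carrier B"
  have "lam a b \<otimes> g [^] sg a = lam a (b \<otimes> g [^] (1::int))" using a lam_g[of a 1] by (simp add: lam_mult)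
  also have "\<dots> = lam a (g [^] tau b \<otimes> b)" using N.int_pow_comm_cj[of b 1] a by simp
  also have "\<dots> = g [^] (sg a * tau b) \<otimes> lam a b" using a by (simp add: lam_mult lam_g)
  finally have "g [^] (tau (lam a b) * sg a) \<otimes> lam a b = g [^] (sg a * tau b) \<otimes> lam a b"
    using N.int_pow_comm_cj[of "lam a b" "sg a"] a by simp
  then have "[sg a * tau (lam a b) = sg a * tau b] (mod int q)"
    using a N.pow_iff by (simp add: mult.commute)
  then show ?thesis by (rule cong_cancel_int[OF sg_coprime[OF a(1)]])
qed

text \<open>By \<open>coboundary\<close>, \<open>cc\<close> is a multiple of \<open>1 - tau\<close>
  and therefore invariant under \<open>lam\<close>. Expanding \<open>b \<odot> g\<close> in two ways
  gives \<open>r1\<close>; letting both expressions act through \<open>lam\<close> gives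
  \<open>r2\<close>. If \<open>cc\<close> is nonzero somewhere, \<open>r2\<close> forces
  \<open>sg\<close> to agree with \<open>sig\<close> modulo \<open>q\<close>, and \<open>r1\<close>
  then forces \<open>tau\<close> to agree with \<open>1 + cc\<close>.\<close>

lemma kind_cases:
  "(\<forall>b \<in> carrier B. g \<odot> b = g \<otimes> b) \<or> (\<forall>b \<in> carrier B. g \<odot> b = b \<otimes> g)"
proof -
  obtain v where v: "\<And>b. b \<in> carrier B \<Longrightarrow> [cc b = v * (1 - tau b)] (mod int q)"
    using N.coboundary[of cc, OF cc_mult cc_g] by blast
  have r1: "[tau b * sg b = sig b * (1 + cc b)] (mod int q)" if b: "b \<in> carrier B" for b
  proof -
    have "g [^] (tau b * sg b) \<otimes> b = b \<odot> g [^] (1::int)"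
      using b lam_g[of b 1] N.int_pow_comm_cj[of b "sg b"] by (simp add: circ_lam)
    also have "\<dots> = g [^] sig b \<otimes> lam (g [^] sig b) b" using b circ_comm[of b 1] by (simp add: circ_lam)
    also have "\<dots> = g [^] (sig b * (1 + cc b)) \<otimes> b"
      using b by (simp add: lam_gi int_pow_mult m_assoc[symmetric] distrib_left)
    finally show ?thesis using b N.pow_iff by simp
  qed
  have r2: "[sg b * cc k = sig b * cc k] (mod int q)" if b: "b \<in> carrier B" and k: "k \<in> carrier B" for b k
  proof -
    have "g [^] (sg b * cc k) \<otimes> lam b k = lam b (lam g k)"
      using b k by (simp add: lam_g_cc lam_mult lam_g)
    also have "\<dots> = lam (b \<odot> g [^] (1::int)) k" using b k by (simp add: lam_circ)
    also have "\<dots> = lam (g [^] sig b) (lam b k)" using b k circ_comm[of b 1] by (simp add: lam_circ)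
    also have "\<dots> = g [^] (sig b * cc (lam b k)) \<otimes> lam b k" using b k by (simp add: lam_gi)
    finally have 1: "[sg b * cc k = sig b * cc (lam b k)] (mod int q)" using b k N.pow_iff by simp
    have "[cc (lam b k) = v * (1 - tau (lam b k))] (mod int q)" using v b k by simp
    also have "[v * (1 - tau (lam b k)) = v * (1 - tau k)] (mod int q)"
      by (intro cong_mult cong_diff cong_refl tau_lam b k)
    also have "[v * (1 - tau k) = cc k] (mod int q)" using v[OF k] by (rule cong_sym)
    finally have "[sig b * cc (lam b k) = sig b * cc k] (mod int q)" by (rule cong_scalar_left)
    with 1 show ?thesis by (rule cong_trans)
  qed
  show ?thesis
  proof (cases "\<forall>k \<in> carrier B. [cc k = 0] (mod int q)")
    case True
    have "g \<odot> b = g \<otimes> b" if b: "b \<in> carrier B" for b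
    proof -
      have "g [^] cc b = \<one>" using True b N.pow_iff[of "cc b" 0] by simp
      then show ?thesis using b by (simp add: circ_lam lam_g_cc)
    qed
    then show ?thesis by blast
  next
    case False
    then obtain k where k: "k \<in> carrier B" "\<not> [cc k = 0] (mod int q)" by auto
    then have "\<not> int q dvd cc k" by (simp add: cong_0_iff)
    then have cop: "coprime (cc k) (int q)"
      using prime_imp_coprime[of "int q" "cc k"] N.prime_q by (simp add: coprime_commute)
    have "g \<odot> b = b \<otimes> g" if b: "b \<in> carrier B" for b
    proof -
      have "[sg b = sig b] (mod int q)"
        using cong_cancel_int[OF cop] r2[OF b k(1)] by (simp add: mult.commute)
      then have h1: "[tau b * sg b = tau b * sig b] (mod int q)" by (rule cong_scalar_left)
      have "[tau b * sig b = sig b * (1 + cc b)] (mod int q)"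
        by (rule cong_trans[OF cong_sym[OF h1] r1[OF b]])
      then have h2: "[sig b * tau b = sig b * (1 + cc b)] (mod int q)" by (simp only: mult.commute[of "tau b" "sig b"])
      have "coprime (sig b) (int q)" using M.chi_coprime[of b] b by simp
      then have "[tau b = 1 + cc b] (mod int q)" using h2 by (rule cong_cancel_int)
      then have "g [^] tau b = g [^] (1 + cc b)" using N.pow_iff by simp
      then have "g \<odot> b = g [^] tau b \<otimes> b" using b by (simp add: circ_lam lam_g_cc int_pow_mult m_assoc)
      then show ?thesis using N.int_pow_comm_cj[OF b, of 1] by simp
    qed
    then show ?thesis by blast
  qed
qed

end

locale brace_kindA = brace_psyl +
  assumes kindA: "b \<in> carrier B \<Longrightarrow> g \<odot> b = g \<otimes> b"
begin

lemma lam_gi_id: "b \<in> carrier B \<Longrightarrow> lam (g [^] (i::int)) b = b"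
proof -
  assume b: "b \<in> carrier B"
  have "lam g b = g [^] (0::int) \<otimes> b" using kindA[OF b] b circ_lam[of g b] by simp
  then have "[cc b = 0] (mod int q)" using cc_uniq b by blast
  then have "[i * cc b = 0] (mod int q)" using cong_scalar_left[of "cc b" 0 "int q" i] by simp
  then have "g [^] (i * cc b) = \<one>" using N.pow_iff[of "i * cc b" 0] by simp
  then show ?thesis using b by (simp add: lam_gi)
qed

lemma gi_circ: "b \<in> carrier B \<Longrightarrow> g [^] (i::int) \<odot> b = g [^] i \<otimes> b"
  by (simp add: circ_lam lam_gi_id)

lemma sg_gi: "[sg (g [^] (i::int)) = 1] (mod int q)"
  using lam_g[of "g [^] i" 1] lam_gi_id[of g i] N.pow_iff[of "sg (g [^] i)" 1] by simp

text \<open>The average of \<open>sg b\<inverse> * N.ee (lam b k)\<close> over \<open>b\<close> is still a crossed homomorphism, and it is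
  equivariant under \<open>lam\<close>; so its kernel is a complement in both groups.\<close>

lemma common_complement:
  "\<exists>H. subgroup H B \<and> subgroup H (circ_group B) \<and> (\<forall>b \<in> carrier B. \<exists>i::int. \<exists>h \<in> H. b = g [^] i \<otimes> h) \<and>
       (\<forall>i::int. g [^] i \<in> H \<longrightarrow> g [^] i = \<one>)"
proof -
  let ?iv = "\<lambda>b. inv\<^bsub>circ_group B\<^esub> b"
  obtain m where m: "[int n * m = 1] (mod int q)"
    using cong_solve_coprime_int[of "int n" "int q"] N.cop by auto
  define s where "s k = (\<Sum>b\<in>M.RR. sg (?iv b) * N.ee (lam b k))" for k
  have RB: "b \<in> M.RR \<Longrightarrow> b \<in> carrier B" for b using M.RR_sub by auto
  have s_mult: "[s (k \<otimes> l) = s k + tau k * s l] (mod int q)" if kl: "k \<in> carrier B" "l \<in> carrier B" for k l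
  proof -
    have "[s (k \<otimes> l) = (\<Sum>b\<in>M.RR. sg (?iv b) * (N.ee (lam b k) + tau k * N.ee (lam b l)))] (mod int q)"
      unfolding s_def
    proof (intro cong_sum cong_mult cong_refl)
      fix b assume b: "b \<in> M.RR"
      have "[N.ee (lam b k \<otimes> lam b l) = N.ee (lam b k) + tau (lam b k) * N.ee (lam b l)] (mod int q)"
        using N.ee_mult RB[OF b] kl by simp
      also have "[N.ee (lam b k) + tau (lam b k) * N.ee (lam b l) = N.ee (lam b k) + tau k * N.ee (lam b l)] (mod int q)"
        by (intro cong_add cong_mult cong_refl tau_lam kl RB b)
      finally show "[N.ee (lam b (k \<otimes> l)) = N.ee (lam b k) + tau k * N.ee (lam b l)] (mod int q)"
        using RB[OF b] kl by (simp add: lam_mult)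
    qed
    then show ?thesis by (simp add: s_def sum.distrib sum_distrib_left algebra_simps)
  qed
  have s_g: "[s (g [^] i) = int n * i] (mod int q)" for i :: int
  proof -
    have "[s (g [^] i) = (\<Sum>b\<in>M.RR. i)] (mod int q)"
      unfolding s_def
    proof (rule cong_sum)
      fix b assume b: "b \<in> M.RR"
      have "[sg (?iv b) * N.ee (g [^] (sg b * i)) = sg (?iv b) * (sg b * i)] (mod int q)"
        by (intro cong_scalar_left N.ee_pow)
      also have "sg (?iv b) * (sg b * i) = (sg b * sg (?iv b)) * i" by simp
      also have "[(sg b * sg (?iv b)) * i = 1 * i] (mod int q)" by (intro cong_scalar_right sg_inv RB b)
      finally show "[sg (?iv b) * N.ee (lam b (g [^] i)) = i] (mod int q)" using RB[OF b] by (simp add: lam_g)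
    qed
    then show ?thesis by (simp add: M.card_RR)
  qed
  have s_lam: "[s (lam a k) = sg a * s k] (mod int q)" if ak: "a \<in> carrier B" "k \<in> carrier B" for a k
  proof -
    have "[s (lam a k) = (\<Sum>b\<in>M.RR. sg a * (sg (?iv (M.rp (b \<odot> a))) * N.ee (lam (M.rp (b \<odot> a)) k)))] (mod int q)"
      unfolding s_def
    proof (rule cong_sum)
      fix b assume b: "b \<in> M.RR"
      define r where "r = M.rp (b \<odot> a)"
      have ba: "b \<odot> a \<in> carrier B" using RB[OF b] ak by simp
      have r: "r \<in> carrier B" using M.rp_closed[of "b \<odot> a"] ba by (simp add: r_def)
      define i where "i = M.e0 (b \<odot> a)"
      have ba_r: "b \<odot> a = g [^] i \<odot> r" using M.e0[of "b \<odot> a"] ba by (simp add: r_def i_def circ_int_pow_g)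
      \<comment> \<open>Passing to the representative changes \<open>b \<odot> a\<close> by a power
        of \<open>g\<close>, which acts trivially; this is where \<open>kindA\<close>
        enters.\<close>
      have l: "lam b (lam a k) = lam r k"
        using ak RB[OF b] r by (simp add: ba_r lam_gi_id lam_circ flip: lam_circ[of b a k])
      have c1: "[sg b * sg a = sg r] (mod int q)"
      proof -
        have "[sg b * sg a = sg (g [^] i \<odot> r)] (mod int q)" using sg_circ[of b a] RB[OF b] ak by (simp add: ba_r cong_sym_eq)
        also have "[sg (g [^] i \<odot> r) = sg (g [^] i) * sg r] (mod int q)" using sg_circ r by simp
        also have "[sg (g [^] i) * sg r = 1 * sg r] (mod int q)" by (intro cong_scalar_right sg_gi)
        finally show ?thesis by simp
      qed
      have "[sg (?iv b) = sg (?iv b) * (sg r * sg (?iv r))] (mod int q)"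
        using cong_scalar_left[OF sg_inv[OF r], of "sg (?iv b)"] by (simp add: cong_sym_eq)
      also have "[sg (?iv b) * (sg r * sg (?iv r)) = sg (?iv b) * ((sg b * sg a) * sg (?iv r))] (mod int q)"
        by (intro cong_mult cong_refl cong_sym[OF c1])
      also have "sg (?iv b) * ((sg b * sg a) * sg (?iv r)) = (sg b * sg (?iv b)) * (sg a * sg (?iv r))" by simp
      also have "[(sg b * sg (?iv b)) * (sg a * sg (?iv r)) = 1 * (sg a * sg (?iv r))] (mod int q)"
        by (intro cong_scalar_right sg_inv RB b)
      finally have "[sg (?iv b) = sg a * sg (?iv r)] (mod int q)" by simp
      then have "[sg (?iv b) * N.ee (lam r k) = sg a * sg (?iv r) * N.ee (lam r k)] (mod int q)"
        by (rule cong_scalar_right)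
      then show "[sg (?iv b) * N.ee (lam b (lam a k)) = sg a * (sg (?iv (M.rp (b \<odot> a))) * N.ee (lam (M.rp (b \<odot> a)) k))] (mod int q)"
        by (simp add: l r_def mult.assoc)
    qed
    also have "(\<Sum>b\<in>M.RR. sg a * (sg (?iv (M.rp (b \<odot> a))) * N.ee (lam (M.rp (b \<odot> a)) k))) = sg a * s k"
      unfolding s_def sum_distrib_left
      using sum.reindex_bij_betw[OF M.bij_RR_right[of a], of "\<lambda>b. sg a * (sg (?iv b) * N.ee (lam b k))"] ak by simp
    finally show ?thesis .
  qed
  define H where "H = {k \<in> carrier B. [s k = 0] (mod int q)}"
  have one_H: "\<one> \<in> H" using s_g[of 0] by (simp add: H_def)
  have mult_H: "k \<otimes> l \<in> H" if "k \<in> H" "l \<in> H" for k l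
  proof -
    have "[s (k \<otimes> l) = s k + tau k * s l] (mod int q)" using s_mult that by (simp add: H_def)
    also have "[s k + tau k * s l = 0 + tau k * 0] (mod int q)"
      using that by (intro cong_add cong_mult cong_refl) (auto simp: H_def)
    finally show ?thesis using that by (simp add: H_def)
  qed
  have lam_H: "lam a k \<in> H" if "a \<in> carrier B" "k \<in> H" for a k
  proof -
    have "[s (lam a k) = sg a * s k] (mod int q)" using s_lam that by (simp add: H_def)
    also have "[sg a * s k = sg a * 0] (mod int q)" using that by (intro cong_scalar_left) (simp add: H_def)
    finally show ?thesis using that by (simp add: H_def)
  qed
  have HB: "H \<subseteq> carrier B" by (auto simp: H_def)
  have "subgroup H B" by (rule subgroupI_finite[OF N.fin HB one_H mult_H])
  moreover have "subgroup H (circ_group B)"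
  proof (rule C.subgroupI_finite)
    fix a b assume "a \<in> H" "b \<in> H"
    then show "a \<otimes>\<^bsub>circ_group B\<^esub> b \<in> H" using mult_H lam_H HB by (auto simp: circ_lam subset_iff)
  qed (use N.fin HB one_H in \<open>auto simp: one_circ circ_one_eq\<close>)
  moreover have "\<exists>i::int. \<exists>h \<in> H. b = g [^] i \<otimes> h" if b: "b \<in> carrier B" for b
  proof -
    define i where "i = m * s b"
    define h where "h = g [^] (- i) \<otimes> b"
    have hc: "h \<in> carrier B" using b by (simp add: h_def)
    have bh: "b = g [^] i \<otimes> h" using b by (simp add: h_def m_assoc[symmetric] flip: int_pow_mult)
    have "[s h = s (g [^] (- i)) + tau (g [^] (- i)) * s b] (mod int q)" unfolding h_def using s_mult b by simp
    also have "[s (g [^] (- i)) + tau (g [^] (- i)) * s b = int n * (- i) + 1 * s b] (mod int q)"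
      by (intro cong_add cong_mult s_g N.chi_pow cong_refl)
    also have "int n * (- i) + 1 * s b = s b - (int n * m) * s b" by (simp add: i_def)
    also have "[s b - (int n * m) * s b = s b - 1 * s b] (mod int q)"
      by (intro cong_diff cong_refl cong_scalar_right m)
    finally have "h \<in> H" using hc by (simp add: H_def)
    with bh show ?thesis by blast
  qed
  moreover have "g [^] i = \<one>" if "g [^] i \<in> H" for i :: int
  proof -
    have "[int n * i = 0] (mod int q)" using that s_g[of i] by (auto simp: H_def intro: cong_trans cong_sym)
    then have "[int n * i = int n * 0] (mod int q)" by simp
    moreover have "coprime (int n) (int q)" using N.cop by simp
    ultimately have "[i = 0] (mod int q)" using cong_cancel_int by blast
    then show ?thesis using N.pow_iff[of i 0] by simp
  qed
  ultimately show ?thesis by blast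
qed

end

section \<open>Twelfth roots of unity modulo a prime\<close>

text \<open>Where no such root exists the choice is arbitrary; \<open>D4\<close> and
  \<open>D3\<close> then keep the elements that use it out of \<open>Dq\<close>.\<close>

definition rt4 :: "nat \<Rightarrow> int" where "rt4 q = (SOME i. [i * i = -1] (mod int q))"
definition rt3 :: "nat \<Rightarrow> int" where "rt3 q = (SOME w. [w * w + w + 1 = 0] (mod int q))"

fun wi :: "nat \<Rightarrow> q4 \<Rightarrow> int" where
  "wi q Q0 = 1" | "wi q Q1 = rt4 q" | "wi q Q2 = -1" | "wi q Q3 = - rt4 q"
fun ww :: "nat \<Rightarrow> t3 \<Rightarrow> int" where
  "ww q T0 = 1" | "ww q T1 = rt3 q" | "ww q T2 = rt3 q * rt3 q"

text \<open>\<open>eps q\<close> identifies the subgroup \<open>Dq q\<close> of the cyclic group \<open>q4 \<times> t3\<close> of order 12 with the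
  group of the twelfth roots of unity modulo \<open>q\<close>.\<close>

definition eps :: "nat \<Rightarrow> q4 \<times> t3 \<Rightarrow> int" where "eps q x = wi q (fst x) * ww q (snd x)"
definition D4 :: "nat \<Rightarrow> q4 set" where "D4 q = {a. q mod 4 = 1 \<or> a \<in> {Q0, Q2}}"
definition D3 :: "nat \<Rightarrow> t3 set" where "D3 q = {b. q mod 3 = 1 \<or> b = T0}"
definition Dq :: "nat \<Rightarrow> (q4 \<times> t3) set" where "Dq q = D4 q \<times> D3 q"

lemma Dq_zero [simp]: "0 \<in> Dq q"
  by (simp add: Dq_def D4_def D3_def zero_prod_def zero_q4_def zero_t3_def)

lemma Dq_add: "x \<in> Dq q \<Longrightarrow> y \<in> Dq q \<Longrightarrow> x + y \<in> Dq q"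
  by (cases x; cases y) (auto simp: Dq_def D4_def D3_def)

lemma Dq_minus: "x \<in> Dq q \<Longrightarrow> - x \<in> Dq q"
  by (cases x) (auto simp: Dq_def D4_def D3_def)

lemma eps_zero [simp]: "eps q 0 = 1"
  by (simp add: eps_def zero_prod_def zero_q4_def zero_t3_def)

lemma cong_prime_mult_zero:
  assumes "prime q" "[a * b = 0] (mod int q)" shows "[a = 0] (mod int q) \<or> [b = (0::int)] (mod int q)"
  using assms prime_dvd_mult_iff[of "int q" a b] by (simp add: cong_0_iff)

lemma fermat_int:
  assumes "prime q" "\<not> [a = 0] (mod int q)" shows "[a ^ (q - 1) = 1] (mod int q)"
proof -
  define b where "b = nat (a mod int q)"
  have "q > 0" using assms prime_gt_0_nat by blast
  then have b: "[int b = a] (mod int q)" by (simp add: b_def cong_def)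
  then have "\<not> q dvd b" using assms(2) by (metis cong_0_iff cong_sym cong_trans int_dvd_int_iff)
  then have "[b ^ (q - 1) = 1] (mod q)" using fermat_theorem assms(1) by blast
  then have "[int b ^ (q - 1) = 1] (mod int q)" using cong_int_iff[of "b ^ (q - 1)" 1 q] by simp
  then show ?thesis using cong_pow[OF b, of "q - 1"] by (metis cong_sym cong_trans)
qed

lemma rt4:
  assumes q: "prime q" "q mod 4 = 1" shows "[rt4 q * rt4 q = -1] (mod int q)"
proof -
  have q2: "q > 2" using q prime_ge_2_nat[OF q(1)] by (cases "q = 2") auto
  have "even ((q - 1) div 2)" using q(2) by presburger
  then have "[Legendre (-1) (int q) = 1] (mod int q)"
    using euler_criterion[of q "-1"] q(1) q2 by simp
  moreover have "\<not> [-1 = (1::int)] (mod int q)"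
    using q2 by (auto simp: cong_iff_dvd_diff dest: zdvd_imp_le)
  moreover have "\<not> [0 = (1::int)] (mod int q)"
    using q2 by (auto simp: cong_iff_dvd_diff dest: zdvd_imp_le)
  ultimately have "QuadRes (int q) (-1)" by (auto simp: Legendre_def split: if_splits)
  then have "\<exists>i. [i * i = -1] (mod int q)" by (auto simp: QuadRes_def power2_eq_square)
  then show ?thesis unfolding rt4_def by (rule someI_ex)
qed

text \<open>For a primitive root \<open>g\<close> and \<open>3 * k = q - 1\<close>, the power
  \<open>g ^ k\<close> is a cube root of 1 other than 1, hence a zero of the quadratic factor of
  \<open>w ^ 3 - 1\<close>.\<close>

lemma rt3:
  assumes q: "prime q" "q mod 3 = 1" shows "[rt3 q * rt3 q + rt3 q + 1 = 0] (mod int q)"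
proof -
  obtain g where g: "residue_primroot q g"
    using prime_primitive_root_exists[OF _ q(1)] prime_gt_1_nat[OF q(1)] by blast
  define k where "k = (q - 1) div 3"
  have q1: "q > 1" using q(1) prime_gt_1_nat by blast
  have k: "q - 1 = k * 3" "k > 0" using q q1 by (auto simp: k_def) presburger+
  have og: "ord q g = q - 1" using g q(1) by (simp add: residue_primroot_def totient_prime)
  define w where "w = int (g ^ k)"
  have "\<not> [g ^ k = 1] (mod q)" using ord_divides[of g k q] og k by (auto dest: dvd_imp_le)
  then have w1: "\<not> [w - 1 = 0] (mod int q)"
    unfolding w_def by (metis cong_diff_iff_cong_0 cong_int_iff int_ops(2))
  have "[g ^ (q - 1) = 1] (mod q)" using ord_divides[of g "q - 1" q] og by simp
  then have "[w ^ 3 = 1] (mod int q)" unfolding w_def k(1)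
    by (metis cong_int_iff int_ops(2) of_nat_power power_mult)
  then have "[(w - 1) * (w * w + w + 1) = 0] (mod int q)"
    by (simp add: cong_iff_dvd_diff algebra_simps power3_eq_cube)
  then have "\<exists>w. [w * w + w + 1 = 0] (mod int q)" using cong_prime_mult_zero[OF q(1)] w1 by blast
  then show ?thesis unfolding rt3_def by (rule someI_ex)
qed

lemma rt3_cube: assumes "prime q" "q mod 3 = 1" shows "[rt3 q * (rt3 q * rt3 q) = 1] (mod int q)"
proof -
  have "[(rt3 q - 1) * (rt3 q * rt3 q + rt3 q + 1) = (rt3 q - 1) * 0] (mod int q)"
    by (intro cong_scalar_left rt3 assms)
  then show ?thesis by (simp add: cong_iff_dvd_diff algebra_simps)
qed

lemma wi_add:
  assumes q: "prime q" and a: "a \<in> D4 q" "b \<in> D4 q" shows "[wi q (a + b) = wi q a * wi q b] (mod int q)"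
proof -
  have "[rt4 q * rt4 q = -1] (mod int q)" if "q mod 4 = 1" using rt4 q that by blast
  moreover from this have "[- (rt4 q * rt4 q) = 1] (mod int q)" if "q mod 4 = 1" using that
    by (metis add.inverse_inverse cong_minus_minus_iff)
  ultimately show ?thesis using a
    by (cases a; cases b) (auto simp: D4_def cong_sym_eq)
qed

lemma ww_add:
  assumes q: "prime q" and a: "a \<in> D3 q" "b \<in> D3 q" shows "[ww q (a + b) = ww q a * ww q b] (mod int q)"
proof -
  have c: "[rt3 q * (rt3 q * rt3 q) = 1] (mod int q)" if "q mod 3 = 1" using rt3_cube q that by blast
  moreover have "[(rt3 q * rt3 q) * (rt3 q * rt3 q) = rt3 q] (mod int q)" if "q mod 3 = 1"
    using cong_scalar_left[OF c[OF that], of "rt3 q"] by (simp add: mult_ac)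
  ultimately show ?thesis using a
    by (cases a; cases b) (auto simp: D3_def cong_sym_eq mult_ac)
qed

lemma eps_add:
  assumes q: "prime q" and x: "x \<in> Dq q" "y \<in> Dq q" shows "[eps q (x + y) = eps q x * eps q y] (mod int q)"
proof -
  have "[wi q (fst x + fst y) * ww q (snd x + snd y) = (wi q (fst x) * wi q (fst y)) * (ww q (snd x) * ww q (snd y))] (mod int q)"
    using x by (intro cong_mult wi_add ww_add q) (auto simp: Dq_def)
  then show ?thesis by (simp add: eps_def mult_ac)
qed

lemma eps_inj:
  assumes q: "prime q" "q > 2" and x: "x \<in> Dq q" "y \<in> Dq q" and eq: "[eps q x = eps q y] (mod int q)"
  shows "x = y"
proof -
  have nz: "\<not> [2 = (0::int)] (mod int q)" "\<not> [1 = (0::int)] (mod int q)"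
    using q by (auto simp: cong_0_iff dest: zdvd_imp_le)
  have ker: "z = 0" if z: "z \<in> Dq q" and e: "[eps q z = 1] (mod int q)" for z
  proof -
    obtain a b where ab: "z = (a, b)" "a \<in> D4 q" "b \<in> D3 q" using z by (auto simp: Dq_def)
    have z2: "[eps q (z + z) = 1] (mod int q)"
      using cong_trans[OF eps_add[OF q(1) z z] cong_mult[OF e e]] by simp
    have z4: "[eps q ((z + z) + (z + z)) = 1] (mod int q)"
      using cong_trans[OF eps_add[OF q(1) Dq_add[OF z z] Dq_add[OF z z]] cong_mult[OF z2 z2]] by simp
    \<comment> \<open>Multiplication by 4 kills the component of order dividing four and fixes the
      other one, so that \<open>b\<close> can be treated before \<open>a\<close>.\<close>
    have "(z + z) + (z + z) = (Q0, b)" using ab by (cases a; cases b) simp_all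
    then have b1: "[ww q b = 1] (mod int q)" using z4 by (simp add: eps_def)
    have b: "b = T0"
    proof (rule ccontr)
      assume "b \<noteq> T0"
      then have q3: "q mod 3 = 1" using ab by (auto simp: D3_def)
      have "[rt3 q = 1] (mod int q)"
      proof (cases b)
        case T2
        then have "[rt3 q * (rt3 q * rt3 q) = rt3 q * 1] (mod int q)" using b1 by (intro cong_scalar_left) simp
        then show ?thesis using rt3_cube[OF q(1) q3] by (metis cong_sym cong_trans mult.right_neutral)
      qed (use \<open>b \<noteq> T0\<close> b1 in auto)
      then have "[rt3 q * rt3 q + rt3 q + 1 = 1 * 1 + 1 + 1] (mod int q)" by (intro cong_add cong_mult cong_refl)
      then have "[0 = 1 * 1 + 1 + (1::int)] (mod int q)" by (rule cong_trans[OF cong_sym[OF rt3[OF q(1) q3]]])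
      then have "[0 = (3::int)] (mod int q)" by simp
      then have "int q dvd int 3" using cong_sym_eq[of 0 "3::int" "int q"] by (simp add: cong_0_iff)
      then have "q dvd 3" by (simp only: int_dvd_int_iff)
      then have "q = 3" using q(1) by (simp add: primes_dvd_imp_eq)
      then show False using q3 by simp
    qed
    then have a1: "[wi q a = 1] (mod int q)" using e ab by (simp add: eps_def)
    have "a = Q0"
    proof (rule ccontr)
      assume a0: "a \<noteq> Q0"
      have m1: "\<not> [- 1 = (1::int)] (mod int q)" using nz(1) by (simp add: cong_iff_dvd_diff cong_0_iff)
      show False
      proof (cases "a = Q2")
        case False
        then have q4: "q mod 4 = 1" and "a = Q1 \<or> a = Q3" using ab a0 by (cases a; auto simp: D4_def)+
        then have "[wi q a * wi q a = - 1] (mod int q)" using rt4[OF q(1) q4] by auto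
        moreover have "[wi q a * wi q a = 1 * 1] (mod int q)" using a1 by (intro cong_mult)
        ultimately show False using m1 by (metis cong_sym cong_trans mult_1)
      qed (use a1 m1 in simp)
    qed
    then show ?thesis using ab b by (simp add: zero_prod_def zero_q4_def zero_t3_def)
  qed
  have inv: "[eps q (- y) * eps q y = 1] (mod int q)"
    using eps_add[OF q(1) Dq_minus[OF x(2)] x(2)] by (simp add: cong_sym_eq)
  have "[eps q (x - y) = eps q x * eps q (- y)] (mod int q)"
    using eps_add[OF q(1) x(1) Dq_minus[OF x(2)]] by simp
  also have "[eps q x * eps q (- y) = eps q y * eps q (- y)] (mod int q)" by (intro cong_scalar_right eq)
  also have "[eps q y * eps q (- y) = 1] (mod int q)" using inv by (simp add: mult.commute)
  finally have e: "[eps q (x - y) = 1] (mod int q)" .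
  have "x - y \<in> Dq q" using Dq_add[OF x(1) Dq_minus[OF x(2)]] by simp
  then have "x - y = 0" using e by (rule ker)
  then show ?thesis by (simp only: right_minus_eq)
qed

lemma eps_surj:
  assumes q: "prime q" "q > 2" and c: "[c ^ 12 = 1] (mod int q)"
  shows "\<exists>x \<in> Dq q. [c = eps q x] (mod int q)"
proof -
  \<comment> \<open>Since \<open>c ^ 13\<close> is congruent to \<open>c\<close>, the exponents 9
    and 4 split \<open>c\<close> into a fourth root of unity and a cube root of unity.\<close>
  define y where "y = c ^ 9"
  define z where "z = c ^ 4"
  have y4: "[y ^ 4 = 1] (mod int q)" and z3: "[z ^ 3 = 1] (mod int q)"
    using cong_pow[OF c, of 3] c by (simp_all add: y_def z_def flip: power_mult)
  have "[c * c ^ 12 = c * 1] (mod int q)" using c by (rule cong_scalar_left)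
  then have czy: "[c = y * z] (mod int q)" by (simp add: y_def z_def cong_sym_eq flip: power_add power_Suc)
  have nz: "\<not> [y = 0] (mod int q)" "\<not> [z = 0] (mod int q)"
  proof -
    have "\<not> int q dvd 1" using q(2) by (auto dest: zdvd_imp_le)
    then have n: "\<not> [0 = (1::int)] (mod int q)" by (simp add: cong_sym_eq[of 0] cong_0_iff)
    show "\<not> [y = 0] (mod int q)" using cong_pow[of y 0 "int q" 4] y4 n by (metis cong_sym cong_trans zero_power zero_less_numeral)
    show "\<not> [z = 0] (mod int q)" using cong_pow[of z 0 "int q" 3] z3 n by (metis cong_sym cong_trans zero_power zero_less_numeral)
  qed
  have sub0: "[u = v] (mod int q) \<longleftrightarrow> [u - v = 0] (mod int q)" for u v :: int by (rule cong_diff_iff_cong_0[symmetric])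
  have "\<exists>a \<in> D4 q. [y = wi q a] (mod int q)"
  proof -
    have "[(y * y - 1) * (y * y - -1) = 0] (mod int q)"
      using y4 by (simp add: cong_iff_dvd_diff algebra_simps eval_nat_numeral)
    then consider "[y * y = 1] (mod int q)" | "[y * y = -1] (mod int q)"
      using cong_prime_mult_zero[OF q(1)] sub0 by blast
    then show ?thesis
    proof cases
      case 1
      then have "[(y - 1) * (y - -1) = 0] (mod int q)" by (simp add: cong_iff_dvd_diff algebra_simps)
      then have "[y = 1] (mod int q) \<or> [y = -1] (mod int q)" using cong_prime_mult_zero[OF q(1)] sub0 by blast
      moreover have "Q0 \<in> D4 q" "Q2 \<in> D4 q" by (auto simp: D4_def)
      ultimately show ?thesis by (metis wi.simps(1,3))
    next
      case 2
      have "odd q" using q prime_odd_nat by blast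
      have q4: "q mod 4 = 1"
      proof (rule ccontr)
        assume "q mod 4 \<noteq> 1"
        then have od: "odd ((q - 1) div 2)" and e: "q - 1 = 2 * ((q - 1) div 2)" using \<open>odd q\<close> by presburger+
        have "[(y * y) ^ ((q - 1) div 2) = (- 1) ^ ((q - 1) div 2)] (mod int q)" using 2 by (rule cong_pow)
        then have "[y ^ (q - 1) = - 1] (mod int q)" using od e by (metis power2_eq_square power_mult power_minus_odd power_one)
        then have "[1 = (- 1 :: int)] (mod int q)" using fermat_int[OF q(1) nz(1)] by (metis cong_sym cong_trans)
        then have "int q dvd 2" by (simp add: cong_iff_dvd_diff)
        then show False using q(2) by (auto dest: zdvd_imp_le)
      qed
      have "[y * y - rt4 q * rt4 q = - 1 - - 1] (mod int q)" using 2 rt4[OF q(1) q4] by (intro cong_diff)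
      then have "[(y - rt4 q) * (y - - rt4 q) = 0] (mod int q)" by (simp add: algebra_simps)
      then have "[y = rt4 q] (mod int q) \<or> [y = - rt4 q] (mod int q)" using cong_prime_mult_zero[OF q(1)] sub0 by blast
      moreover have "Q1 \<in> D4 q" "Q3 \<in> D4 q" using q4 by (auto simp: D4_def)
      ultimately show ?thesis by (metis wi.simps(2,4))
    qed
  qed
  then obtain a where a: "a \<in> D4 q" "[y = wi q a] (mod int q)" by blast
  have "\<exists>b \<in> D3 q. [z = ww q b] (mod int q)"
  proof (cases "q mod 3 = 1")
    case True
    have "[(z - 1) * (z * z + z + 1) = 0] (mod int q)"
      using z3 by (simp add: cong_iff_dvd_diff algebra_simps eval_nat_numeral)
    then consider "[z = 1] (mod int q)" | "[z * z + z + 1 = 0] (mod int q)"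
      using cong_prime_mult_zero[OF q(1)] sub0 by blast
    then show ?thesis
    proof cases
      case 2
      let ?w = "rt3 q"
      have "(z - ?w) * (z - ?w * ?w) = (z * z + z + 1) - (?w * ?w + ?w + 1) * z + (?w * (?w * ?w) - 1)"
        by (simp add: algebra_simps)
      also have "[\<dots> = 0 - 0 * z + (1 - 1)] (mod int q)"
        by (intro cong_add cong_diff cong_mult 2 rt3 rt3_cube q True cong_refl)
      finally have "[(z - ?w) * (z - ?w * ?w) = 0] (mod int q)" by simp
      then have "[z = ?w] (mod int q) \<or> [z = ?w * ?w] (mod int q)" using cong_prime_mult_zero[OF q(1)] sub0 by blast
      moreover have "T1 \<in> D3 q" "T2 \<in> D3 q" using True by (auto simp: D3_def)
      ultimately show ?thesis by (metis ww.simps(2,3))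
    qed (intro bexI[of _ T0]; simp add: D3_def)
  next
    case False
    \<comment> \<open>The case \<open>q = 3\<close> belongs to the reduction from size twelve to
      size four; cubing is the identity modulo 3. For any other \<open>q\<close> not congruent to 1
      modulo 3, \<open>q - 1\<close> is prime to 3.\<close>
    have "[z = 1] (mod int q)"
    proof (cases "q = 3")
      case True
      have "[z * z ^ 2 = z * 1] (mod int q)" using fermat_int[OF q(1) nz(2)] True by (intro cong_scalar_left) simp
      then have "[z ^ 3 = z] (mod int q)" by (simp add: eval_nat_numeral)
      then show ?thesis using z3 by (metis cong_sym cong_trans)
    next
      case q3: False
      have "\<not> 3 dvd q" using q3 q(1) by (metis prime_nat_iff one_eq_numeral_iff semiring_norm(84))
      define k where "k = (q - 1) div 3"
      have "q - 1 = 3 * k + 1" using \<open>\<not> 3 dvd q\<close> False unfolding k_def by presburger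
      then have "z ^ (q - 1) = (z ^ 3) ^ k * z" by (simp add: power_mult)
      moreover have "[(z ^ 3) ^ k * z = 1 ^ k * z] (mod int q)" using z3 by (intro cong_mult cong_pow cong_refl)
      ultimately have "[z ^ (q - 1) = z] (mod int q)" by simp
      then show ?thesis using fermat_int[OF q(1) nz(2)] by (metis cong_sym cong_trans)
    qed
    then show ?thesis by (intro bexI[of _ T0]) (simp_all add: D3_def)
  qed
  then obtain b where b: "b \<in> D3 q" "[z = ww q b] (mod int q)" by blast
  have "[c = wi q a * ww q b] (mod int q)" using czy a(2) b(2) by (meson cong_mult cong_trans)
  then show ?thesis using a b by (intro bexI[of _ "(a, b)"]) (auto simp: eps_def Dq_def)
qed

section \<open>Double semidirect products\<close>

no_notation module.smult (infixl \<open>\<odot>\<index>\<close> 70)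

section \<open>Isomorphisms, opposites and models\<close>

definition sbi :: "('a, 'm) skew_brace_scheme \<Rightarrow> ('b, 'n) skew_brace_scheme \<Rightarrow> bool" where
  "sbi A B \<longleftrightarrow> skew_brace_iso A B \<noteq> {}"

lemma sbi_iff: "f \<in> skew_brace_iso A B \<longleftrightarrow> bij_betw f (carrier A) (carrier B) \<and>
    (\<forall>x \<in> carrier A. \<forall>y \<in> carrier A. f (x \<otimes>\<^bsub>A\<^esub> y) = f x \<otimes>\<^bsub>B\<^esub> f y \<and> f (x \<odot>\<^bsub>A\<^esub> y) = f x \<odot>\<^bsub>B\<^esub> f y)"
  by (auto simp: skew_brace_iso_def hom_def bij_betw_def)

lemma sbiI: "\<lbrakk>bij_betw f (carrier A) (carrier B);
    \<And>x y. x \<in> carrier A \<Longrightarrow> y \<in> carrier A \<Longrightarrow> f (x \<otimes>\<^bsub>A\<^esub> y) = f x \<otimes>\<^bsub>B\<^esub> f y;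
    \<And>x y. x \<in> carrier A \<Longrightarrow> y \<in> carrier A \<Longrightarrow> f (x \<odot>\<^bsub>A\<^esub> y) = f x \<odot>\<^bsub>B\<^esub> f y\<rbrakk> \<Longrightarrow> f \<in> skew_brace_iso A B"
  by (simp add: sbi_iff)

lemma iso_comp: "f \<in> skew_brace_iso A B \<Longrightarrow> g \<in> skew_brace_iso B C \<Longrightarrow> g \<circ> f \<in> skew_brace_iso A C"
  unfolding sbi_iff by (auto intro: bij_betw_trans simp: bij_betw_apply)

lemma iso_inv:
  fixes A :: "('a, 'm) skew_brace_scheme" and B :: "('b, 'n) skew_brace_scheme"
  assumes f: "f \<in> skew_brace_iso A B"
    and cl: "\<And>x y. x \<in> carrier A \<Longrightarrow> y \<in> carrier A \<Longrightarrow> x \<otimes>\<^bsub>A\<^esub> y \<in> carrier A \<and> x \<odot>\<^bsub>A\<^esub> y \<in> carrier A"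
  shows "inv_into (carrier A) f \<in> skew_brace_iso B A"
proof (rule sbiI)
  let ?g = "inv_into (carrier A) f"
  have b: "bij_betw f (carrier A) (carrier B)" using f by (simp add: sbi_iff)
  show "bij_betw ?g (carrier B) (carrier A)" by (rule bij_betw_inv_into[OF b])
  fix x y assume xy: "x \<in> carrier B" "y \<in> carrier B"
  have g: "?g x \<in> carrier A" "?g y \<in> carrier A" "f (?g x) = x" "f (?g y) = y"
    using xy b bij_betw_inv_into_right[OF b] bij_betw_apply[OF bij_betw_inv_into[OF b]] by auto
  have "f (?g x \<otimes>\<^bsub>A\<^esub> ?g y) = x \<otimes>\<^bsub>B\<^esub> y" "f (?g x \<odot>\<^bsub>A\<^esub> ?g y) = x \<odot>\<^bsub>B\<^esub> y"
    using f g by (auto simp: sbi_iff)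
  then show "?g (x \<otimes>\<^bsub>B\<^esub> y) = ?g x \<otimes>\<^bsub>A\<^esub> ?g y" "?g (x \<odot>\<^bsub>B\<^esub> y) = ?g x \<odot>\<^bsub>A\<^esub> ?g y"
    using bij_betw_inv_into_left[OF b] cl g by metis+
qed

lemma sbi_trans: "sbi A B \<Longrightarrow> sbi B C \<Longrightarrow> sbi A C"
  unfolding sbi_def using iso_comp by blast

lemma sbi_sym: "skew_left_brace A \<Longrightarrow> sbi A B \<Longrightarrow> sbi B A"
proof -
  assume "skew_left_brace A" "sbi A B"
  then interpret skew_left_brace A by simp
  show ?thesis using \<open>sbi A B\<close> iso_inv[of _ A B] by (fastforce simp: sbi_def)
qed

text \<open>Only the addition is reversed. The result is a plain \<open>skew_brace\<close> record,
  so \<open>opp (opp B)\<close> is compared with \<open>B\<close> by isomorphism instead of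
  equality.\<close>

definition opp :: "('a, 'm) skew_brace_scheme \<Rightarrow> 'a skew_brace" where
  "opp B = \<lparr>carrier = carrier B, monoid.mult = (\<lambda>x y. y \<otimes>\<^bsub>B\<^esub> x), one = \<one>\<^bsub>B\<^esub>, circ = circ B, circ_one = circ_one B\<rparr>"

lemma opp_simps [simp]: "carrier (opp B) = carrier B" "x \<otimes>\<^bsub>opp B\<^esub> y = y \<otimes>\<^bsub>B\<^esub> x" "\<one>\<^bsub>opp B\<^esub> = \<one>\<^bsub>B\<^esub>"
  "x \<odot>\<^bsub>opp B\<^esub> y = x \<odot>\<^bsub>B\<^esub> y" "circ_one (opp B) = circ_one B" "circ_group (opp B) = circ_group B"
  by (simp_all add: opp_def circ_group_def)

lemma opp_opp_iso: "sbi (opp (opp B)) B" "sbi B (opp (opp B))"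
proof -
  have "(\<lambda>x. x) \<in> skew_brace_iso (opp (opp B)) B" "(\<lambda>x. x) \<in> skew_brace_iso B (opp (opp B))"
    by (auto simp: sbi_iff bij_betw_def)
  then show "sbi (opp (opp B)) B" "sbi B (opp (opp B))" by (auto simp: sbi_def)
qed

lemma iso_opp_iff: "f \<in> skew_brace_iso (opp A) (opp B) \<longleftrightarrow> f \<in> skew_brace_iso A B"
  by (auto simp: sbi_iff)

lemma opp_group: assumes "group B" shows "group (opp B)" "\<And>x. x \<in> carrier B \<Longrightarrow> inv\<^bsub>opp B\<^esub> x = inv\<^bsub>B\<^esub> x"
proof -
  interpret group B by fact
  show g: "group (opp B)"
  proof (rule groupI)
    fix x assume "x \<in> carrier (opp B)"
    then show "\<exists>y\<in>carrier (opp B). y \<otimes>\<^bsub>opp B\<^esub> x = \<one>\<^bsub>opp B\<^esub>"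
      by (intro bexI[of _ "inv\<^bsub>B\<^esub> x"]) auto
  qed (auto simp: m_assoc)
  show "inv\<^bsub>opp B\<^esub> x = inv\<^bsub>B\<^esub> x" if "x \<in> carrier B" for x
    using that by (intro group.inv_equality[OF g]) auto
qed

lemma opp_brace: assumes "skew_left_brace B" shows "skew_left_brace (opp B)"
proof -
  interpret skew_left_brace B by fact
  show ?thesis
  proof (intro skew_left_brace.intro skew_left_brace_axioms.intro)
    show "group (opp B)" by (rule opp_group) unfold_locales
    fix a b c assume "a \<in> carrier (opp B)" "b \<in> carrier (opp B)" "c \<in> carrier (opp B)"
    then show "a \<odot>\<^bsub>opp B\<^esub> (b \<otimes>\<^bsub>opp B\<^esub> c) = (a \<odot>\<^bsub>opp B\<^esub> b) \<otimes>\<^bsub>opp B\<^esub> inv\<^bsub>opp B\<^esub> a \<otimes>\<^bsub>opp B\<^esub> (a \<odot>\<^bsub>opp B\<^esub> c)"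
      using circ_mult[of a c b] opp_group(2)[OF is_group, of a] by (simp add: m_assoc)
  qed (simp add: circ_group)
qed

lemma opp_pow: "group B \<Longrightarrow> x \<in> carrier B \<Longrightarrow> x [^]\<^bsub>opp B\<^esub> (k::nat) = x [^]\<^bsub>B\<^esub> k"
proof (induction k)
  case (Suc k)
  interpret group B by fact
  interpret o: group "opp B" by (rule opp_group) fact
  show ?case using Suc o.nat_pow_Suc[of x k] nat_pow_Suc2[of x k] by simp
qed (simp add: nat_pow_def)

text \<open>A decoration records how a complement acts on a normal cyclic subgroup of order \<open>q\<close>: \<open>t\<close> in the
  additive and \<open>s\<close> in the multiplicative group.\<close>

definition dec :: "nat \<Rightarrow> ('a, 'm) skew_brace_scheme \<Rightarrow> ('a \<Rightarrow> q4 \<times> t3) \<Rightarrow> ('a \<Rightarrow> q4 \<times> t3) \<Rightarrow> bool" where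
  "dec q E t s \<longleftrightarrow> (\<forall>a \<in> carrier E. t a \<in> Dq q \<and> s a \<in> Dq q) \<and>
     (\<forall>a \<in> carrier E. \<forall>b \<in> carrier E. t (a \<otimes>\<^bsub>E\<^esub> b) = t a + t b \<and> t (a \<odot>\<^bsub>E\<^esub> b) = t a + t b \<and> s (a \<odot>\<^bsub>E\<^esub> b) = s a + s b)"

definition dsq where "dsq q E t s = dsp q E (\<lambda>h. eps q (t h)) (\<lambda>h. eps q (s h))"

text \<open>The flag \<open>kp\<close> tells which alternative of \<open>kind_cases\<close> the
  brace belongs to.\<close>

definition mdl where "mdl q kp E t s = (if kp then opp (dsq q E t s) else dsq q E t s)"

lemma dsq_simps [simp]:
  "carrier (dsq q E t s) = {0..<int q} \<times> carrier E"
  "(x, h) \<otimes>\<^bsub>dsq q E t s\<^esub> (y, k) = ((x + eps q (t h) * y) mod int q, h \<otimes>\<^bsub>E\<^esub> k)"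
  "(x, h) \<odot>\<^bsub>dsq q E t s\<^esub> (y, k) = ((x + eps q (s h) * y) mod int q, h \<odot>\<^bsub>E\<^esub> k)"
  "\<one>\<^bsub>dsq q E t s\<^esub> = (0, \<one>\<^bsub>E\<^esub>)" "circ_one (dsq q E t s) = (0, circ_one E)"
  by (simp_all add: dsq_def dsp_def)

text \<open>Carries results about plain monoid records, such as \<open>semidirect_group\<close>,
  over to brace records.\<close>

lemma group_truncate:
  assumes "group \<lparr>carrier = carrier S, monoid.mult = monoid.mult S, one = one S\<rparr>" (is "group ?T")
  shows "group S"
proof -
  interpret g: group ?T by fact
  show ?thesis
  proof (rule groupI)
    show "x \<otimes>\<^bsub>S\<^esub> y \<in> carrier S" if "x \<in> carrier S" "y \<in> carrier S" for x y
      using g.m_closed[of x y] that by simp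
    show "x \<otimes>\<^bsub>S\<^esub> y \<otimes>\<^bsub>S\<^esub> z = x \<otimes>\<^bsub>S\<^esub> (y \<otimes>\<^bsub>S\<^esub> z)" if "x \<in> carrier S" "y \<in> carrier S" "z \<in> carrier S" for x y z
      using g.m_assoc[of x y z] that by simp
    show "\<one>\<^bsub>S\<^esub> \<in> carrier S" using g.one_closed by simp
    show "\<one>\<^bsub>S\<^esub> \<otimes>\<^bsub>S\<^esub> x = x" if "x \<in> carrier S" for x using g.l_one[of x] that by simp
    show "\<exists>y\<in>carrier S. y \<otimes>\<^bsub>S\<^esub> x = \<one>\<^bsub>S\<^esub>" if "x \<in> carrier S" for x using g.l_inv_ex[of x] that by auto
  qed
qed

lemma semidirect_group:
  assumes "group H" and q: "(q::nat) > 0"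
    and m: "\<And>h k. h \<in> carrier H \<Longrightarrow> k \<in> carrier H \<Longrightarrow> [\<chi> (h \<otimes>\<^bsub>H\<^esub> k) = \<chi> h * \<chi> k] (mod int q)"
    and o: "[\<chi> \<one>\<^bsub>H\<^esub> = (1::int)] (mod int q)"
  shows "group \<lparr>carrier = {0..<int q} \<times> carrier H,
     monoid.mult = (\<lambda>(x, h) (y, k). ((x + \<chi> h * y) mod int q, h \<otimes>\<^bsub>H\<^esub> k)), one = (0, \<one>\<^bsub>H\<^esub>)\<rparr>"
    (is "group ?S")
proof (rule groupI)
  interpret group H by fact
  show "\<one>\<^bsub>?S\<^esub> \<in> carrier ?S" using q by simp
  show "x \<otimes>\<^bsub>?S\<^esub> y \<in> carrier ?S" if "x \<in> carrier ?S" "y \<in> carrier ?S" for x y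
    using that q by (auto split: prod.splits)
  show "x \<otimes>\<^bsub>?S\<^esub> y \<otimes>\<^bsub>?S\<^esub> z = x \<otimes>\<^bsub>?S\<^esub> (y \<otimes>\<^bsub>?S\<^esub> z)"
    if "x \<in> carrier ?S" "y \<in> carrier ?S" "z \<in> carrier ?S" for x y z
  proof -
    obtain a h b k c l where *: "x = (a, h)" "y = (b, k)" "z = (c, l)" by (metis surj_pair)
    have mem: "h \<in> carrier H" "k \<in> carrier H" "l \<in> carrier H" using that * by auto
    have "[(a + \<chi> h * b) mod int q + \<chi> (h \<otimes>\<^bsub>H\<^esub> k) * c = (a + \<chi> h * b) + (\<chi> h * \<chi> k) * c] (mod int q)"
      by (intro cong_add cong_mult m mem cong_refl) (simp add: cong_def)
    also have "(a + \<chi> h * b) + (\<chi> h * \<chi> k) * c = a + \<chi> h * (b + \<chi> k * c)" by (simp add: algebra_simps)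
    also have "[a + \<chi> h * (b + \<chi> k * c) = a + \<chi> h * ((b + \<chi> k * c) mod int q)] (mod int q)"
      by (intro cong_add cong_mult cong_refl) (simp add: cong_def)
    finally show ?thesis using mem * by (simp add: cong_def m_assoc)
  qed
  show "\<one>\<^bsub>?S\<^esub> \<otimes>\<^bsub>?S\<^esub> x = x" if "x \<in> carrier ?S" for x
  proof -
    obtain a h where *: "x = (a, h)" by (metis surj_pair)
    have "[\<chi> \<one>\<^bsub>H\<^esub> * a = 1 * a] (mod int q)" using o by (rule cong_scalar_right)
    then show ?thesis using that * by (auto simp: cong_def)
  qed
  show "\<exists>y\<in>carrier ?S. y \<otimes>\<^bsub>?S\<^esub> x = \<one>\<^bsub>?S\<^esub>" if "x \<in> carrier ?S" for x
  proof -
    obtain a h where *: "x = (a, h)" by (metis surj_pair)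
    define y where "y = ((- (\<chi> (inv\<^bsub>H\<^esub> h) * a)) mod int q, inv\<^bsub>H\<^esub> h)"
    have "y \<in> carrier ?S" using that * q by (simp add: y_def)
    moreover have "y \<otimes>\<^bsub>?S\<^esub> x = \<one>\<^bsub>?S\<^esub>" using that * by (simp add: y_def mod_simps)
    ultimately show ?thesis by blast
  qed
qed

text \<open>The brace axiom comes down to the coefficient of \<open>x\<close>. As \<open>t\<close>
  is a homomorphism for both operations, the inverse of \<open>a\<close> contributes
  \<open>- eps q (t h) * eps q (t k) * eps q (- t h)\<close>, which is congruent to
  \<open>- eps q (t k)\<close> and cancels against the last factor.\<close>

lemma dsq_brace:
  assumes E: "skew_left_brace E" and q: "prime q" and d: "dec q E t s"
  shows "skew_left_brace (dsq q E t s)"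
proof -
  interpret E: skew_left_brace E by fact
  have q0: "q > 0" using q prime_gt_0_nat by blast
  have t1: "t \<one>\<^bsub>E\<^esub> = 0" "s \<one>\<^bsub>E\<^esub> = 0"
  proof -
    have "t (\<one>\<^bsub>E\<^esub> \<otimes>\<^bsub>E\<^esub> \<one>\<^bsub>E\<^esub>) = t \<one>\<^bsub>E\<^esub> + t \<one>\<^bsub>E\<^esub>" "s (\<one>\<^bsub>E\<^esub> \<odot>\<^bsub>E\<^esub> \<one>\<^bsub>E\<^esub>) = s \<one>\<^bsub>E\<^esub> + s \<one>\<^bsub>E\<^esub>"
      using d E.one_closed unfolding dec_def by blast+
    then show "t \<one>\<^bsub>E\<^esub> = 0" "s \<one>\<^bsub>E\<^esub> = 0" by simp_all
  qed
  have tD: "t h \<in> Dq q" "s h \<in> Dq q" if "h \<in> carrier E" for h using d that unfolding dec_def by blast+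
  have hm: "t (h \<otimes>\<^bsub>E\<^esub> k) = t h + t k" "t (h \<odot>\<^bsub>E\<^esub> k) = t h + t k" "s (h \<odot>\<^bsub>E\<^esub> k) = s h + s k"
    if "h \<in> carrier E" "k \<in> carrier E" for h k using d that unfolding dec_def by blast+
  have G: "group (dsq q E t s)"
  proof -
    have "group \<lparr>carrier = {0..<int q} \<times> carrier E,
     monoid.mult = (\<lambda>(x, h) (y, k). ((x + eps q (t h) * y) mod int q, h \<otimes>\<^bsub>E\<^esub> k)), one = (0, \<one>\<^bsub>E\<^esub>)\<rparr>" (is "group ?S")
    proof (rule semidirect_group)
      show "group E" by (rule E.is_group)
      show "q > 0" by (rule q0)
      show "[eps q (t (h \<otimes>\<^bsub>E\<^esub> k)) = eps q (t h) * eps q (t k)] (mod int q)" if "h \<in> carrier E" "k \<in> carrier E" for h k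
        unfolding hm(1)[OF that] by (rule eps_add[OF q tD(1)[OF that(1)] tD(1)[OF that(2)]])
      show "[eps q (t \<one>\<^bsub>E\<^esub>) = 1] (mod int q)" unfolding t1 eps_zero by (rule cong_refl)
    qed
    note g = this
    show ?thesis by (rule group_truncate) (use g in \<open>simp add: dsq_def dsp_def\<close>)
  qed
  have C: "group (circ_group (dsq q E t s))"
  proof -
    have "group \<lparr>carrier = {0..<int q} \<times> carrier (circ_group E),
     monoid.mult = (\<lambda>(x, h) (y, k). ((x + eps q (s h) * y) mod int q, h \<otimes>\<^bsub>circ_group E\<^esub> k)), one = (0, \<one>\<^bsub>circ_group E\<^esub>)\<rparr>"
    proof (rule semidirect_group)
      show "group (circ_group E)" by (rule E.C.is_group)
      show "q > 0" by (rule q0)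
      show "[eps q (s (h \<otimes>\<^bsub>circ_group E\<^esub> k)) = eps q (s h) * eps q (s k)] (mod int q)"
        if "h \<in> carrier (circ_group E)" "k \<in> carrier (circ_group E)" for h k
        using that unfolding carrier_circ mult_circ hm(3)[OF that[unfolded carrier_circ]]
        by (intro eps_add[OF q] tD(2))
      show "[eps q (s \<one>\<^bsub>circ_group E\<^esub>) = 1] (mod int q)"
        unfolding one_circ E.circ_one_eq t1 eps_zero by (rule cong_refl)
    qed
    then show ?thesis by (simp add: dsq_def dsp_def circ_group_def)
  qed
  interpret G: group "dsq q E t s" by fact
  show ?thesis
  proof (intro skew_left_brace.intro skew_left_brace_axioms.intro G C)
    fix a b c assume abc: "a \<in> carrier (dsq q E t s)" "b \<in> carrier (dsq q E t s)" "c \<in> carrier (dsq q E t s)"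
    obtain x h y k z l where *: "a = (x, h)" "b = (y, k)" "c = (z, l)" by (metis surj_pair)
    have mem: "h \<in> carrier E" "k \<in> carrier E" "l \<in> carrier E" using abc * by auto
    let ?S = "dsq q E t s"
    have D: "t h \<in> Dq q" "s h \<in> Dq q" "t k \<in> Dq q" "s k \<in> Dq q" "- t h \<in> Dq q"
      using tD mem Dq_minus by simp_all
    have th: "t (inv\<^bsub>E\<^esub> h) = - t h"
    proof -
      have "t (inv\<^bsub>E\<^esub> h \<otimes>\<^bsub>E\<^esub> h) = t (inv\<^bsub>E\<^esub> h) + t h"
        using d mem E.inv_closed[OF mem(1)] unfolding dec_def by blast
      then have "t (inv\<^bsub>E\<^esub> h) + t h = 0" using mem t1 by simp
      then show ?thesis by (simp add: eq_neg_iff_add_eq_0)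
    qed
    have inva: "inv\<^bsub>?S\<^esub> a = ((- (eps q (- t h) * x)) mod int q, inv\<^bsub>E\<^esub> h)"
      using * abc mem q0 by (intro G.inv_equality) (simp_all add: mod_simps th)
    have th1: "[eps q (- t h) * eps q (t h) = 1] (mod int q)"
      using eps_add[OF q D(5) D(1)] by (simp add: cong_sym_eq)
    have thk: "[eps q (t (h \<odot>\<^bsub>E\<^esub> k)) = eps q (t h) * eps q (t k)] (mod int q)"
      using eps_add[OF q D(1,3)] by (simp only: hm mem)
    have thki: "[eps q (t ((h \<odot>\<^bsub>E\<^esub> k) \<otimes>\<^bsub>E\<^esub> inv\<^bsub>E\<^esub> h)) = eps q (t k)] (mod int q)"
      using mem th by (simp add: hm)
    have "[(x + eps q (s h) * y + eps q (t (h \<odot>\<^bsub>E\<^esub> k)) * (- (eps q (- t h) * x))) + eps q (t ((h \<odot>\<^bsub>E\<^esub> k) \<otimes>\<^bsub>E\<^esub> inv\<^bsub>E\<^esub> h)) * (x + eps q (s h) * z)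
       = (x + eps q (s h) * y + (eps q (t h) * eps q (t k)) * (- (eps q (- t h) * x))) + eps q (t k) * (x + eps q (s h) * z)] (mod int q)"
      by (intro cong_add cong_mult thk thki cong_refl)
    also have "x + eps q (s h) * y + (eps q (t h) * eps q (t k)) * (- (eps q (- t h) * x)) + eps q (t k) * (x + eps q (s h) * z)
      = x + eps q (s h) * y - (eps q (- t h) * eps q (t h)) * (eps q (t k) * x) + eps q (t k) * (x + eps q (s h) * z)"
      by (simp add: algebra_simps)
    also have "[x + eps q (s h) * y - (eps q (- t h) * eps q (t h)) * (eps q (t k) * x) + eps q (t k) * (x + eps q (s h) * z)
      = x + eps q (s h) * y - 1 * (eps q (t k) * x) + eps q (t k) * (x + eps q (s h) * z)] (mod int q)"
      by (intro cong_add cong_diff cong_mult th1 cong_refl)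
    also have "x + eps q (s h) * y - 1 * (eps q (t k) * x) + eps q (t k) * (x + eps q (s h) * z)
      = x + eps q (s h) * (y + eps q (t k) * z)" by (simp add: algebra_simps)
    finally have fin: "[(x + eps q (s h) * y + eps q (t (h \<odot>\<^bsub>E\<^esub> k)) * (- (eps q (- t h) * x))) + eps q (t ((h \<odot>\<^bsub>E\<^esub> k) \<otimes>\<^bsub>E\<^esub> inv\<^bsub>E\<^esub> h)) * (x + eps q (s h) * z)
      = x + eps q (s h) * (y + eps q (t k) * z)] (mod int q)" .
    have md: "[w mod int q = w] (mod int q)" for w by (simp add: cong_def)
    have L: "[x + eps q (s h) * ((y + eps q (t k) * z) mod int q) = x + eps q (s h) * (y + eps q (t k) * z)] (mod int q)"
      by (intro cong_add cong_mult cong_refl md)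
    have R: "[((x + eps q (s h) * y) mod int q + eps q (t (h \<odot>\<^bsub>E\<^esub> k)) * ((- (eps q (- t h) * x)) mod int q)) mod int q + eps q (t ((h \<odot>\<^bsub>E\<^esub> k) \<otimes>\<^bsub>E\<^esub> inv\<^bsub>E\<^esub> h)) * ((x + eps q (s h) * z) mod int q)
      = (x + eps q (s h) * y + eps q (t (h \<odot>\<^bsub>E\<^esub> k)) * (- (eps q (- t h) * x))) + eps q (t ((h \<odot>\<^bsub>E\<^esub> k) \<otimes>\<^bsub>E\<^esub> inv\<^bsub>E\<^esub> h)) * (x + eps q (s h) * z)] (mod int q)"
      by (rule cong_add[OF cong_trans[OF md cong_add[OF md cong_mult[OF cong_refl md]]] cong_mult[OF cong_refl md]])
    show "a \<odot>\<^bsub>?S\<^esub> (b \<otimes>\<^bsub>?S\<^esub> c) = (a \<odot>\<^bsub>?S\<^esub> b) \<otimes>\<^bsub>?S\<^esub> inv\<^bsub>?S\<^esub> a \<otimes>\<^bsub>?S\<^esub> (a \<odot>\<^bsub>?S\<^esub> c)"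
      using cong_trans[OF L cong_sym[OF cong_trans[OF R fin]]] mem unfolding inva unfolding * by (simp add: E.circ_mult cong_def del: mod_add_left_eq mod_add_right_eq mod_mult_left_eq mod_mult_right_eq)
  qed
qed

lemma mdl_brace:
  assumes "skew_left_brace E" "prime q" "dec q E t s" shows "skew_left_brace (mdl q kp E t s)"
  using dsq_brace[OF assms] opp_brace[OF dsq_brace[OF assms]] by (simp add: mdl_def)

lemma card_mdl: "carrier (mdl q kp E t s) = {0..<int q} \<times> carrier E" "card (carrier (mdl q kp E t s)) = q * card (carrier E)"
  by (simp_all add: mdl_def card_cartesian_product)

section \<open>Splitting a brace over its Sylow subgroup\<close>

lemma (in group) sub_pow: "x [^]\<^bsub>G\<lparr>carrier := H\<rparr>\<^esub> (k::nat) = x [^] k" by (simp add: nat_pow_def)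

lemma sub_brace:
  assumes B: "skew_left_brace B" and H: "subgroup H B" "subgroup H (circ_group B)"
  shows "skew_left_brace (B\<lparr>carrier := H\<rparr>)"
proof -
  interpret skew_left_brace B by fact
  have "circ_group (B\<lparr>carrier := H\<rparr>) = (circ_group B)\<lparr>carrier := H\<rparr>" by (simp add: circ_group_def)
  then have "group (circ_group (B\<lparr>carrier := H\<rparr>))" using C.subgroup_imp_group[OF H(2)] by simp
  moreover have "inv\<^bsub>B\<lparr>carrier := H\<rparr>\<^esub> a = inv\<^bsub>B\<^esub> a" if "a \<in> H" for a using m_inv_consistent[OF H(1) that] .
  ultimately show ?thesis
    using subgroup_imp_group[OF H(1)] circ_mult subgroup.mem_carrier[OF H(1)]
    by (intro skew_left_brace.intro skew_left_brace_axioms.intro) auto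
qed

context psyl begin

lemma chi_twelfth:
  assumes n: "n dvd 12" and H: "subgroup H G" "card H = n" and h: "h \<in> H"
  shows "[chi h ^ 12 = 1] (mod int q)"
proof -
  interpret K: group "G\<lparr>carrier := H\<rparr>" using subgroup_imp_group[OF H(1)] .
  have hc: "h \<in> carrier G" using h H subgroup.mem_carrier by auto
  have "h [^] n = \<one>" using K.pow_order_eq_1[of h] h H by (simp add: order_def nat_pow_def)
  moreover obtain k where "12 = n * k" using n unfolding dvd_def by blast
  ultimately have "h [^] (12::nat) = \<one>" using hc by (metis nat_pow_one nat_pow_pow)
  then show ?thesis using pow_chi[OF hc, of 12] chi_one by (metis cong_sym cong_trans)
qed

end

context brace_kindA begin

text \<open>On a complement of order dividing 12 the characters \<open>tau\<close> and
  \<open>sig\<close> take twelfth roots of unity as values, so \<open>eps_surj\<close> and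
  \<open>eps_inj\<close> pull them back to homomorphisms into \<open>Dq q\<close>. The last conjunct
  detects when \<open>g\<close> is additively central; \<open>brace_is_model\<close> needs it to
  justify setting the flag.\<close>

theorem splitting:
  assumes n: "n dvd 12" and q2: "q > 2"
  shows "\<exists>H t s. skew_left_brace (B\<lparr>carrier := H\<rparr>) \<and> finite H \<and> card H = n \<and> dec q (B\<lparr>carrier := H\<rparr>) t s \<and>
    sbi (dsq q (B\<lparr>carrier := H\<rparr>) t s) B \<and> ((\<forall>h \<in> H. t h = 0) \<longrightarrow> (\<forall>b \<in> carrier B. g \<otimes> b = b \<otimes> g))"
proof -
  obtain H where H: "subgroup H B" "subgroup H (circ_group B)"
    and ex: "\<And>b. b \<in> carrier B \<Longrightarrow> \<exists>i::int. \<exists>h \<in> H. b = g [^] i \<otimes> h"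
    and tr: "\<And>i::int. g [^] i \<in> H \<Longrightarrow> g [^] i = \<one>"
    using common_complement by blast
  have HB: "H \<subseteq> carrier B" using H subgroup.subset by auto
  have Hc: "h \<in> H \<Longrightarrow> h \<in> carrier B" for h using HB by auto
  define F where "F = (\<lambda>(x::int, h). g [^] x \<otimes> h)"
  have uniq: "[x = y] (mod int q) \<and> h = k" if "g [^] (x::int) \<otimes> h = g [^] (y::int) \<otimes> k" "h \<in> H" "k \<in> H" for x y h k
  proof -
    have "g [^] (x - y) = k \<otimes> inv h"
    proof -
      have "g [^] (x - y) = g [^] (- y) \<otimes> g [^] x" by (simp flip: int_pow_mult)
      then have "g [^] (x - y) \<otimes> h = g [^] (- y) \<otimes> (g [^] x \<otimes> h)" using that Hc by (simp add: m_assoc)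
      also have "\<dots> = g [^] (- y) \<otimes> (g [^] y \<otimes> k)" using that by simp
      also have "\<dots> = k" using that Hc by (simp add: m_assoc[symmetric] flip: int_pow_mult)
      finally show ?thesis using that Hc by (simp add: inv_solve_right)
    qed
    then have "g [^] (x - y) \<in> H" using H(1) that by (simp add: subgroup.m_closed subgroup.m_inv_closed)
    then have 1: "g [^] (x - y) = \<one>" using tr by blast
    then have "[x - y = 0] (mod int q)" using N.pow_iff[of "x - y" 0] by simp
    then have 2: "[x = y] (mod int q)" by (simp add: cong_diff_iff_cong_0)
    then have "g [^] x = g [^] y" using N.pow_iff by simp
    then have "h = k" using that Hc by simp
    with 2 show ?thesis by simp
  qed
  have bijF: "bij_betw F ({0..<int q} \<times> H) (carrier B)"
    unfolding bij_betw_def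
  proof
    show "inj_on F ({0..<int q} \<times> H)"
      using uniq by (fastforce simp: inj_on_def F_def cong_def)
    show "F ` ({0..<int q} \<times> H) = carrier B"
    proof
      show "F ` ({0..<int q} \<times> H) \<subseteq> carrier B" using Hc by (auto simp: F_def)
      show "carrier B \<subseteq> F ` ({0..<int q} \<times> H)"
      proof
        fix b assume "b \<in> carrier B"
        then obtain i :: int and h where ih: "h \<in> H" "b = g [^] i \<otimes> h" using ex by blast
        have "g [^] i = g [^] (i mod int q)" using N.pow_iff by simp
        then have "b = F (i mod int q, h)" using ih by (simp add: F_def)
        then show "b \<in> F ` ({0..<int q} \<times> H)" using ih N.q0 by (intro image_eqI) auto
      qed
    qed
  qed
  have fH: "finite H" using N.fin HB finite_subset by auto
  have "q * card H = n * q"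
    using bij_betw_same_card[OF bijF] N.ordG by (simp add: card_cartesian_product order_def)
  then have cH: "card H = n" using N.q0 by simp
  let ?H = "B\<lparr>carrier := H\<rparr>"
  define t where "t h = (SOME x. x \<in> Dq q \<and> [tau h = eps q x] (mod int q))" for h
  define s where "s h = (SOME x. x \<in> Dq q \<and> [sig h = eps q x] (mod int q))" for h
  have t: "t h \<in> Dq q \<and> [tau h = eps q (t h)] (mod int q)" if "h \<in> H" for h
    unfolding t_def by (rule someI_ex) (use eps_surj[OF N.prime_q q2 N.chi_twelfth[OF n H(1) cH that]] in blast)
  have s: "s h \<in> Dq q \<and> [sig h = eps q (s h)] (mod int q)" if "h \<in> H" for h
    unfolding s_def by (rule someI_ex) (use eps_surj[OF N.prime_q q2 M.chi_twelfth[OF n H(2) cH that]] in blast)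
  have hom_aux: "u = v + w" if "u \<in> Dq q" "v \<in> Dq q" "w \<in> Dq q"
    "[x = eps q u] (mod int q)" "[y = eps q v] (mod int q)" "[z = eps q w] (mod int q)" "[x = y * z] (mod int q)" for u v w x y z
  proof (rule eps_inj[OF N.prime_q q2 that(1) Dq_add[OF that(2,3)]])
    have "[eps q u = y * z] (mod int q)" using that(4,7) by (rule cong_trans[OF cong_sym])
    also have "[y * z = eps q v * eps q w] (mod int q)" using that(5,6) by (rule cong_mult)
    also have "[eps q v * eps q w = eps q (v + w)] (mod int q)" using eps_add[OF N.prime_q that(2,3)] by (rule cong_sym)
    finally show "[eps q u = eps q (v + w)] (mod int q)" .
  qed
  have Hm: "h \<otimes> k \<in> H" "h \<odot> k \<in> H" if "h \<in> H" "k \<in> H" for h k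
    using subgroup.m_closed[OF H(1) that] subgroup.m_closed[OF H(2) that] by auto
  \<comment> \<open>The additive character is multiplicative on the circle group as well, because it
    is invariant under \<open>lam\<close>.\<close>
  have tau_c: "[tau (h \<odot> k) = tau h * tau k] (mod int q)" if "h \<in> H" "k \<in> H" for h k
  proof -
    have "[tau (h \<otimes> lam h k) = tau h * tau (lam h k)] (mod int q)" using N.chi_mult that Hc by simp
    also have "[tau h * tau (lam h k) = tau h * tau k] (mod int q)" using tau_lam that Hc by (intro cong_scalar_left) simp
    finally show ?thesis using that Hc by (simp add: circ_lam)
  qed
  have d: "dec q ?H t s"
    unfolding dec_def
  proof (intro conjI ballI)
    fix a assume "a \<in> carrier ?H" then show "t a \<in> Dq q" "s a \<in> Dq q" using t s by auto
  next
    fix a b assume "a \<in> carrier ?H" "b \<in> carrier ?H"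
    then have ab: "a \<in> H" "b \<in> H" by auto
    note ms = t[OF ab(1)] t[OF ab(2)] s[OF ab(1)] s[OF ab(2)] t[OF Hm(1)[OF ab]] t[OF Hm(2)[OF ab]] s[OF Hm(2)[OF ab]]
    have c: "[tau (a \<otimes> b) = tau a * tau b] (mod int q)" "[sig (a \<odot> b) = sig a * sig b] (mod int q)"
      using N.chi_mult[of a b] M.chi_mult[of a b] ab Hc by auto
    have "t (a \<otimes> b) = t a + t b" using ms c(1) by (intro hom_aux[of _ _ _ "tau (a \<otimes> b)" "tau a" "tau b"]) auto
    then show "t (a \<otimes>\<^bsub>?H\<^esub> b) = t a + t b" by simp
    have "t (a \<odot> b) = t a + t b" using ms tau_c[OF ab] by (intro hom_aux[of _ _ _ "tau (a \<odot> b)" "tau a" "tau b"]) auto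
    then show "t (a \<odot>\<^bsub>?H\<^esub> b) = t a + t b" by simp
    have "s (a \<odot> b) = s a + s b" using ms c(2) by (intro hom_aux[of _ _ _ "sig (a \<odot> b)" "sig a" "sig b"]) auto
    then show "s (a \<odot>\<^bsub>?H\<^esub> b) = s a + s b" by simp
  qed
  have "F \<in> skew_brace_iso (dsq q ?H t s) B"
  proof (rule sbiI)
    show "bij_betw F (carrier (dsq q ?H t s)) (carrier B)" using bijF by simp
    fix a b assume ab: "a \<in> carrier (dsq q ?H t s)" "b \<in> carrier (dsq q ?H t s)"
    obtain x h y k where *: "a = (x, h)" "b = (y, k)" by (metis surj_pair)
    have mem: "h \<in> H" "k \<in> H" using ab * by auto
    then have memc: "h \<in> carrier B" "k \<in> carrier B" using Hc by auto
    have "F a \<otimes> F b = g [^] x \<otimes> (h \<otimes> g [^] y) \<otimes> k" using * memc by (simp add: F_def m_assoc)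
    also have "\<dots> = g [^] (x + tau h * y) \<otimes> (h \<otimes> k)"
      using memc N.int_pow_comm_cj[of h y] by (simp add: int_pow_mult m_assoc)
    also have "g [^] (x + tau h * y) = g [^] ((x + eps q (t h) * y) mod int q)"
    proof -
      have "[x + tau h * y = x + eps q (t h) * y] (mod int q)" using t[OF mem(1)] by (intro cong_add cong_mult) auto
      then show ?thesis using N.pow_iff by (simp add: cong_def)
    qed
    finally show "F (a \<otimes>\<^bsub>dsq q ?H t s\<^esub> b) = F a \<otimes> F b" using * by (simp add: F_def)
    have "F a \<odot> F b = g [^] x \<odot> h \<odot> (g [^] y \<odot> k)" using * memc by (simp add: F_def gi_circ)
    also have "\<dots> = g [^] x \<odot> (h \<odot> g [^] y) \<odot> k" using memc by (simp add: c_assoc)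
    also have "\<dots> = g [^] x \<odot> (g [^] (sig h * y) \<odot> (h \<odot> k))" using memc circ_comm[of h y] by (simp add: c_assoc)
    also have "\<dots> = g [^] (x + sig h * y) \<otimes> (h \<odot> k)" using memc by (simp add: gi_circ int_pow_mult m_assoc)
    also have "g [^] (x + sig h * y) = g [^] ((x + eps q (s h) * y) mod int q)"
    proof -
      have "[x + sig h * y = x + eps q (s h) * y] (mod int q)" using s[OF mem(1)] by (intro cong_add cong_mult) auto
      then show ?thesis using N.pow_iff by (simp add: cong_def)
    qed
    finally show "F (a \<odot>\<^bsub>dsq q ?H t s\<^esub> b) = F a \<odot> F b" using * by (simp add: F_def)
  qed
  then have sb: "sbi (dsq q ?H t s) B" by (auto simp: sbi_def)
  have "g \<otimes> b = b \<otimes> g" if t0: "\<forall>h \<in> H. t h = 0" and b: "b \<in> carrier B" for b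
  proof -
    obtain i :: int and h where ih: "h \<in> H" "b = g [^] i \<otimes> h" using ex[OF b] by blast
    have "g [^] tau h = g [^] (1::int)" using t[OF ih(1)] t0 ih N.pow_iff by (metis eps_zero)
    then have "h \<otimes> g = g \<otimes> h" using N.int_pow_comm_cj[of h 1] ih Hc by simp
    moreover have "g \<otimes> g [^] i = g [^] i \<otimes> g"
      using int_pow_mult[OF N.gc, of i 1] int_pow_mult[OF N.gc, of 1 i] by (simp add: add.commute)
    ultimately have "g \<otimes> (g [^] i \<otimes> h) = g [^] i \<otimes> (h \<otimes> g)"
      using ih Hc m_assoc[of g "g [^] i" h] m_assoc[of "g [^] i" g h] by simp
    then show ?thesis using ih Hc by (simp add: m_assoc)
  qed
  then show ?thesis using sub_brace[OF skew_left_brace_axioms H] fH cH d sb by blast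
qed

end

definition diso where
  "diso E t s E' t' s' \<longleftrightarrow> (\<exists>f \<in> skew_brace_iso E E'. \<forall>h \<in> carrier E. t' (f h) = t h \<and> s' (f h) = s h)"

lemma opp_psyl:
  assumes "psyl B q n g" shows "psyl (opp B) q n g"
proof -
  interpret psyl B q n g by fact
  interpret o: group "opp B" by (rule opp_group(1)[OF is_group])
  have "o.ord g dvd k \<longleftrightarrow> q dvd k" for k
    using o.pow_eq_id[of g k] pow_eq_id[of g k] og opp_pow[OF is_group gc, of k] by simp
  then have "o.ord g = q" by (meson dvd_antisym dvd_refl)
  moreover have "\<exists>k::nat. o.cj b g = g [^]\<^bsub>opp B\<^esub> k" if b: "b \<in> carrier (opp B)" for b
  proof -
    obtain k :: nat where "cj (inv\<^bsub>B\<^esub> b) g = g [^]\<^bsub>B\<^esub> k" using npsylD(3)[OF ps, of "inv\<^bsub>B\<^esub> b"] b by auto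
    then have "o.cj b g = g [^]\<^bsub>B\<^esub> k" using b by (simp add: o.cj_def cj_def opp_group(2)[OF is_group] m_assoc)
    then show ?thesis using opp_pow[OF is_group gc, of k] by (intro exI[of _ k]) simp
  qed
  ultimately have "o.npsyl q g" by (simp add: o.npsyl_def)
  then show ?thesis by unfold_locales (use fin prime_q cop ordG in \<open>auto simp: order_def\<close>)
qed

text \<open>The condition on \<open>kp\<close> selects one description: if \<open>t\<close>
  vanishes, \<open>g\<close> is additively central, both alternatives of \<open>kind_cases\<close>
  say the same, and the flag stays off.\<close>

theorem brace_is_model:
  fixes B :: "'a skew_brace"
  assumes B: "skew_left_brace B" "finite (carrier B)" "card (carrier B) = n * q"
    and q: "prime q" "q > 2" "coprime n q" and n: "n dvd 12"
    and N: "\<exists>g. group.npsyl B q g" and M: "\<exists>g. group.npsyl (circ_group B) q g"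
  shows "\<exists>kp (E :: 'a skew_brace) t s. skew_left_brace E \<and> finite (carrier E) \<and> card (carrier E) = n \<and>
    dec q E t s \<and> sbi (mdl q kp E t s) B \<and> (kp \<longrightarrow> (\<exists>h \<in> carrier E. t h \<noteq> 0))"
proof -
  interpret skew_left_brace B by fact
  obtain g where g: "npsyl q g" using N by auto
  obtain g' where g': "C.npsyl q g'" using M by auto
  interpret N: psyl B q n g by unfold_locales (use B q g in \<open>auto simp: order_def\<close>)
  interpret brace_half B q n g by unfold_locales
  interpret M: psyl "circ_group B" q n g using circ_psyl[OF g'] .
  interpret brace_psyl B q n g by unfold_locales
  show ?thesis
  proof (cases "\<forall>b \<in> carrier B. g \<odot>\<^bsub>B\<^esub> b = g \<otimes>\<^bsub>B\<^esub> b")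
    case True
    interpret brace_kindA B q n g by unfold_locales (use True in auto)
    from splitting[OF n q(2)] obtain H t s where H: "skew_left_brace (B\<lparr>carrier := H\<rparr>)" "finite H" "card H = n" "dec q (B\<lparr>carrier := H\<rparr>) t s"
      "sbi (dsq q (B\<lparr>carrier := H\<rparr>) t s) B" by blast
    then show ?thesis
      by (intro exI[of _ False] exI[of _ "B\<lparr>carrier := H\<rparr>"] exI[of _ t] exI[of _ s]) (simp add: mdl_def)
  next
    case False
    then have kb: "\<forall>b \<in> carrier B. g \<odot>\<^bsub>B\<^esub> b = b \<otimes>\<^bsub>B\<^esub> g" using kind_cases by blast
    interpret ob: skew_left_brace "opp B" by (rule opp_brace[OF B(1)])
    interpret oN: psyl "opp B" q n g by (rule opp_psyl[OF N.psyl_axioms])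
    interpret oM: psyl "circ_group (opp B)" q n g using M.psyl_axioms by simp
    interpret o: brace_kindA "opp B" q n g by unfold_locales (use kb in auto)
    from o.splitting[OF n q(2)] obtain H t s where H: "skew_left_brace ((opp B)\<lparr>carrier := H\<rparr>)" "finite H" "card H = n"
      "dec q ((opp B)\<lparr>carrier := H\<rparr>) t s" "sbi (dsq q ((opp B)\<lparr>carrier := H\<rparr>) t s) (opp B)"
      "(\<forall>h \<in> H. t h = 0) \<longrightarrow> (\<forall>b \<in> carrier (opp B). g \<otimes>\<^bsub>opp B\<^esub> b = b \<otimes>\<^bsub>opp B\<^esub> g)" by blast
    have "\<exists>h \<in> H. t h \<noteq> 0" using H(6) False kb by auto
    moreover have "sbi (opp (dsq q ((opp B)\<lparr>carrier := H\<rparr>) t s)) B"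
    proof -
      have "sbi (opp (dsq q ((opp B)\<lparr>carrier := H\<rparr>) t s)) (opp (opp B))"
        using H(5) iso_opp_iff by (auto simp: sbi_def)
      then show ?thesis using opp_opp_iso(1) sbi_trans by blast
    qed
    ultimately show ?thesis using H(1-4)
      by (intro exI[of _ True] exI[of _ "(opp B)\<lparr>carrier := H\<rparr>"] exI[of _ t] exI[of _ s]) (simp add: mdl_def)
  qed
qed

section \<open>Isomorphisms between models\<close>

lemma mod_mult_add_int:
  fixes m :: int
  shows "(a * (b mod m) + c) mod m = (a * b + c) mod m" "(c + a * (b mod m)) mod m = (c + a * b) mod m"
  by (metis mod_add_left_eq mod_mult_right_eq, metis mod_add_right_eq mod_mult_right_eq)

lemma dec_zero:
  assumes "skew_left_brace E" "dec q E t s" shows "t \<one>\<^bsub>E\<^esub> = 0" "s \<one>\<^bsub>E\<^esub> = 0"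
proof -
  interpret E: skew_left_brace E by fact
  have "t (\<one>\<^bsub>E\<^esub> \<otimes>\<^bsub>E\<^esub> \<one>\<^bsub>E\<^esub>) = t \<one>\<^bsub>E\<^esub> + t \<one>\<^bsub>E\<^esub>" "s (\<one>\<^bsub>E\<^esub> \<odot>\<^bsub>E\<^esub> \<one>\<^bsub>E\<^esub>) = s \<one>\<^bsub>E\<^esub> + s \<one>\<^bsub>E\<^esub>"
    using assms(2) E.one_closed unfolding dec_def by blast+
  then show "t \<one>\<^bsub>E\<^esub> = 0" "s \<one>\<^bsub>E\<^esub> = 0" by simp_all
qed

lemma decD:
  assumes "dec q E t s" "h \<in> carrier E"
  shows "t h \<in> Dq q" "s h \<in> Dq q" "k \<in> carrier E \<Longrightarrow> t (h \<otimes>\<^bsub>E\<^esub> k) = t h + t k"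
    "k \<in> carrier E \<Longrightarrow> t (h \<odot>\<^bsub>E\<^esub> k) = t h + t k" "k \<in> carrier E \<Longrightarrow> s (h \<odot>\<^bsub>E\<^esub> k) = s h + s k"
  using assms unfolding dec_def by blast+

lemma dsq_pow_one:
  assumes E: "skew_left_brace E" and q: "prime q" and d: "dec q E t s" and x: "x \<in> {0..<int q}"
  shows "(x, \<one>\<^bsub>E\<^esub>) [^]\<^bsub>dsq q E t s\<^esub> (k::nat) = ((int k * x) mod int q, \<one>\<^bsub>E\<^esub>)"
proof -
  interpret E: skew_left_brace E by fact
  interpret S: skew_left_brace "dsq q E t s" by (rule dsq_brace[OF E q d])
  show ?thesis
  proof (induction k)
    case (Suc k)
    have "(x, \<one>\<^bsub>E\<^esub>) [^]\<^bsub>dsq q E t s\<^esub> Suc k = ((int k * x) mod int q, \<one>\<^bsub>E\<^esub>) \<otimes>\<^bsub>dsq q E t s\<^esub> (x, \<one>\<^bsub>E\<^esub>)"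
      by (simp only: S.nat_pow_Suc Suc)
    then show ?case using dec_zero[OF E d] by (simp add: mod_simps algebra_simps)
  qed simp
qed

text \<open>Having trivial \<open>q\<close>-th power singles out the normal factor, so an
  isomorphism of models must respect it.\<close>

lemma dsq_pow_q:
  assumes E: "skew_left_brace E" "finite (carrier E)" "card (carrier E) = n" and q: "prime q" "coprime n q"
    and d: "dec q E t s" and b: "b \<in> carrier (dsq q E t s)"
  shows "b [^]\<^bsub>dsq q E t s\<^esub> q = \<one>\<^bsub>dsq q E t s\<^esub> \<longleftrightarrow> snd b = \<one>\<^bsub>E\<^esub>"
proof -
  interpret E: skew_left_brace E by fact
  interpret S: skew_left_brace "dsq q E t s" by (rule dsq_brace[OF E(1) q(1) d])
  obtain x h where xh: "b = (x, h)" "x \<in> {0..<int q}" "h \<in> carrier E" using b by auto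
  have snd_pow: "snd (b [^]\<^bsub>dsq q E t s\<^esub> k) = h [^]\<^bsub>E\<^esub> k" for k :: nat
  proof (induction k)
    case (Suc k)
    have "snd (c \<otimes>\<^bsub>dsq q E t s\<^esub> b) = snd c \<otimes>\<^bsub>E\<^esub> h" for c using xh by (cases c) simp
    then show ?case using Suc by simp
  qed simp
  show ?thesis
  proof
    assume "b [^]\<^bsub>dsq q E t s\<^esub> q = \<one>\<^bsub>dsq q E t s\<^esub>"
    then have 1: "h [^]\<^bsub>E\<^esub> q = \<one>\<^bsub>E\<^esub>" using snd_pow[of q] by simp
    have 2: "h [^]\<^bsub>E\<^esub> n = \<one>\<^bsub>E\<^esub>" using E.pow_order_eq_1[OF xh(3)] E(3) by (simp add: order_def)
    have "E.ord h dvd q" "E.ord h dvd n" using 1 2 E.pow_eq_id[OF xh(3)] by auto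
    then have "E.ord h = 1" using q(2) by (metis coprime_common_divisor_nat)
    then show "snd b = \<one>\<^bsub>E\<^esub>" using E.ord_eq_1[OF xh(3)] xh by simp
  next
    assume "snd b = \<one>\<^bsub>E\<^esub>"
    then show "b [^]\<^bsub>dsq q E t s\<^esub> q = \<one>\<^bsub>dsq q E t s\<^esub>"
      using dsq_pow_one[OF E(1) q(1) d xh(2), of q] xh by simp
  qed
qed

lemma mdl_pow_q:
  assumes E: "skew_left_brace E" "finite (carrier E)" "card (carrier E) = n" and q: "prime q" "coprime n q"
    and d: "dec q E t s" and b: "b \<in> carrier (mdl q kp E t s)"
  shows "b [^]\<^bsub>mdl q kp E t s\<^esub> q = \<one>\<^bsub>mdl q kp E t s\<^esub> \<longleftrightarrow> snd b = \<one>\<^bsub>E\<^esub>"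
proof -
  have g: "group (dsq q E t s)" using dsq_brace[OF E(1) q(1) d] skew_left_brace.axioms(1) by blast
  have bc: "b \<in> carrier (dsq q E t s)" using b by (simp add: mdl_def split: if_splits)
  show ?thesis using dsq_pow_q[OF E q d bc] opp_pow[OF g bc, of q] by (simp add: mdl_def)
qed

lemma iso_one:
  assumes A: "skew_left_brace A" and B: "skew_left_brace B" and f: "f \<in> skew_brace_iso A B"
  shows "f \<one>\<^bsub>A\<^esub> = \<one>\<^bsub>B\<^esub>" "x \<in> carrier A \<Longrightarrow> f (x [^]\<^bsub>A\<^esub> (k::nat)) = f x [^]\<^bsub>B\<^esub> k"
proof -
  interpret A: skew_left_brace A by fact
  interpret B: skew_left_brace B by fact
  interpret h: group_hom A B f
    by unfold_locales (use f in \<open>simp add: skew_brace_iso_def\<close>)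
  show "f \<one>\<^bsub>A\<^esub> = \<one>\<^bsub>B\<^esub>" by simp
  show "x \<in> carrier A \<Longrightarrow> f (x [^]\<^bsub>A\<^esub> (k::nat)) = f x [^]\<^bsub>B\<^esub> k" by (rule h.hom_nat_pow)
qed

text \<open>This makes the flag an isomorphism invariant: the left side speaks only of the
  operations and the normal factor. In the opposite, \<open>(1, \<one>)\<close> and
  \<open>(0, h)\<close> with \<open>t h\<close> nonzero violate the equation, by
  \<open>eps_inj\<close>.\<close>

lemma mdl_kindA_iff:
  assumes F: "skew_left_brace F" and d: "dec q F r w" and kq: "kq \<longrightarrow> (\<exists>h \<in> carrier F. r h \<noteq> 0)"
    and q: "prime q" "q > 2"
  shows "(\<forall>x \<in> {0..<int q} \<times> {\<one>\<^bsub>F\<^esub>}. \<forall>b \<in> carrier (mdl q kq F r w). x \<odot>\<^bsub>mdl q kq F r w\<^esub> b = x \<otimes>\<^bsub>mdl q kq F r w\<^esub> b) \<longleftrightarrow> \<not> kq"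
  proof -
    interpret F: skew_left_brace F by fact
    have q1: "int q > 1" using q(2) by simp
    show ?thesis
    proof (cases kq)
      case False
      then show ?thesis using dec_zero[OF F d] by (auto simp: mdl_def)
    next
      case True
      then obtain h where h: "h \<in> carrier F" "r h \<noteq> 0" using kq by auto
      have "eps q (r h) mod int q \<noteq> 1"
      proof
        assume "eps q (r h) mod int q = 1"
        then have "[eps q (r h) = eps q 0] (mod int q)" using q1 by (simp add: cong_def)
        then show False using eps_inj[OF q decD(1)[OF d h(1)] Dq_zero] h by blast
      qed
      then have "(1, \<one>\<^bsub>F\<^esub>) \<odot>\<^bsub>mdl q kq F r w\<^esub> (0, h) \<noteq> (1, \<one>\<^bsub>F\<^esub>) \<otimes>\<^bsub>mdl q kq F r w\<^esub> (0, h)"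
        using True h q1 by (simp add: mdl_def)
      moreover have "(1, \<one>\<^bsub>F\<^esub>) \<in> {0..<int q} \<times> {\<one>\<^bsub>F\<^esub>}" "(0, h) \<in> carrier (mdl q kq F r w)"
        using h q1 by (auto simp: card_mdl)
      ultimately show ?thesis using True by blast
    qed
  qed

text \<open>An isomorphism acts on the normal factor as multiplication by a unit \<open>u\<close>
  and induces \<open>\<psi>\<close> on the quotient; comparing the actions on
  \<open>(1, \<one>)\<close> recovers \<open>t\<close> and \<open>s\<close>. The explicit form of
  \<open>f\<close> on the normal factor is recorded because models are iterated: the decorations for
  \<open>p\<close> are evaluated on the factor of order 3.\<close>

theorem model_iso:
  assumes E: "skew_left_brace E" "finite (carrier E)" "card (carrier E) = n" "dec q E t s"
    and E': "skew_left_brace E'" "finite (carrier E')" "card (carrier E') = n" "dec q E' t' s'"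
    and q: "prime q" "q > 2" "coprime n q"
    and k: "kp \<longrightarrow> (\<exists>h \<in> carrier E. t h \<noteq> 0)" "kp' \<longrightarrow> (\<exists>h \<in> carrier E'. t' h \<noteq> 0)"
    and f: "f \<in> skew_brace_iso (mdl q kp E t s) (mdl q kp' E' t' s')"
  shows "kp = kp'" "\<exists>u \<psi>. coprime u (int q) \<and> \<psi> \<in> skew_brace_iso E E' \<and>
    (\<forall>h \<in> carrier E. t' (\<psi> h) = t h \<and> s' (\<psi> h) = s h) \<and>
    (\<forall>x \<in> {0..<int q}. f (x, \<one>\<^bsub>E\<^esub>) = ((u * x) mod int q, \<one>\<^bsub>E'\<^esub>)) \<and>
    (\<forall>x \<in> {0..<int q}. \<forall>h \<in> carrier E. snd (f (x, h)) = \<psi> h)"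
proof -
  interpret E: skew_left_brace E by fact
  interpret E': skew_left_brace E' by fact
  note b1 = mdl_brace[OF E(1) q(1) E(4)] and b2 = mdl_brace[OF E'(1) q(1) E'(4)]
  have q1: "int q > 1" using q(2) by simp
  let ?P = "{0..<int q} \<times> {\<one>\<^bsub>E\<^esub>}" and ?P' = "{0..<int q} \<times> {\<one>\<^bsub>E'\<^esub>}"
  have bij: "bij_betw f ({0..<int q} \<times> carrier E) ({0..<int q} \<times> carrier E')"
    using f by (simp add: sbi_iff card_mdl)
  have fP: "f b \<in> ?P' \<longleftrightarrow> b \<in> ?P" if b: "b \<in> {0..<int q} \<times> carrier E" for b
  proof -
    have bc: "b \<in> carrier (mdl q kp E t s)" "f b \<in> carrier (mdl q kp' E' t' s')"
      using b bij_betw_apply[OF bij b] by (simp_all add: card_mdl)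
    have "f b [^]\<^bsub>mdl q kp' E' t' s'\<^esub> q = \<one>\<^bsub>mdl q kp' E' t' s'\<^esub> \<longleftrightarrow> b [^]\<^bsub>mdl q kp E t s\<^esub> q = \<one>\<^bsub>mdl q kp E t s\<^esub>"
    proof -
      interpret b1: skew_left_brace "mdl q kp E t s" by (rule b1)
      have "f (b [^]\<^bsub>mdl q kp E t s\<^esub> q) = f \<one>\<^bsub>mdl q kp E t s\<^esub> \<longleftrightarrow> b [^]\<^bsub>mdl q kp E t s\<^esub> q = \<one>\<^bsub>mdl q kp E t s\<^esub>"
        using f bc(1) by (intro inj_on_eq_iff[of f "carrier (mdl q kp E t s)"]) (auto simp: sbi_iff bij_betw_def)
      then show ?thesis using iso_one[OF b1 b2 f] bc(1) by simp
    qed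
    then have "snd (f b) = \<one>\<^bsub>E'\<^esub> \<longleftrightarrow> snd b = \<one>\<^bsub>E\<^esub>"
      using mdl_pow_q[OF E(1-3) q(1,3) E(4) bc(1)] mdl_pow_q[OF E'(1-3) q(1,3) E'(4) bc(2)] by simp
    then show ?thesis using b bij_betw_apply[OF bij b] by (auto simp: mem_Times_iff)
  qed
  have "(\<forall>x \<in> ?P. \<forall>b \<in> carrier (mdl q kp E t s). x \<odot>\<^bsub>mdl q kp E t s\<^esub> b = x \<otimes>\<^bsub>mdl q kp E t s\<^esub> b) \<longleftrightarrow>
        (\<forall>x \<in> ?P'. \<forall>b \<in> carrier (mdl q kp' E' t' s'). x \<odot>\<^bsub>mdl q kp' E' t' s'\<^esub> b = x \<otimes>\<^bsub>mdl q kp' E' t' s'\<^esub> b)" (is "?L \<longleftrightarrow> ?R")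
  proof -
    interpret b1: skew_left_brace "mdl q kp E t s" by (rule b1)
    let ?C = "{0..<int q} \<times> carrier E"
    have imP: "f ` ?P = ?P'"
    proof
      show "f ` ?P \<subseteq> ?P'"
      proof
        fix y assume "y \<in> f ` ?P"
        then obtain b where b: "b \<in> ?P" "y = f b" by blast
        then have bC: "b \<in> ?C" using E.one_closed by auto
        show "y \<in> ?P'" using fP[OF bC] b(1) unfolding b(2) by (rule iffD2)
      qed
      show "?P' \<subseteq> f ` ?P"
      proof
        fix y assume y: "y \<in> ?P'"
        then have "y \<in> f ` ?C" using bij E'.one_closed by (auto simp: bij_betw_def)
        then obtain b where b: "b \<in> ?C" "y = f b" by blast
        have "b \<in> ?P" using fP[OF b(1)] y unfolding b(2) by (rule iffD1)
        with b(2) show "y \<in> f ` ?P" by (rule image_eqI)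
      qed
    qed
    have imC: "f ` carrier (mdl q kp E t s) = carrier (mdl q kp' E' t' s')" using bij by (simp add: bij_betw_def card_mdl)
    have PC: "x \<in> ?P \<Longrightarrow> x \<in> carrier (mdl q kp E t s)" for x using E.one_closed by (auto simp: card_mdl)
    have "?R \<longleftrightarrow> (\<forall>x \<in> ?P. \<forall>b \<in> carrier (mdl q kp E t s). f x \<odot>\<^bsub>mdl q kp' E' t' s'\<^esub> f b = f x \<otimes>\<^bsub>mdl q kp' E' t' s'\<^esub> f b)"
      unfolding imP[symmetric] imC[symmetric] by blast
    also have "\<dots> \<longleftrightarrow> (\<forall>x \<in> ?P. \<forall>b \<in> carrier (mdl q kp E t s). f (x \<odot>\<^bsub>mdl q kp E t s\<^esub> b) = f (x \<otimes>\<^bsub>mdl q kp E t s\<^esub> b))"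
      using f PC by (intro ball_cong refl) (simp add: sbi_iff)
    also have "\<dots> \<longleftrightarrow> ?L"
    proof (intro ball_cong refl)
      fix x b assume "x \<in> ?P" "b \<in> carrier (mdl q kp E t s)"
      then have "x \<odot>\<^bsub>mdl q kp E t s\<^esub> b \<in> carrier (mdl q kp E t s)" "x \<otimes>\<^bsub>mdl q kp E t s\<^esub> b \<in> carrier (mdl q kp E t s)"
        using PC by auto
      moreover have "inj_on f (carrier (mdl q kp E t s))" using f by (simp add: sbi_iff bij_betw_def)
      ultimately show "f (x \<odot>\<^bsub>mdl q kp E t s\<^esub> b) = f (x \<otimes>\<^bsub>mdl q kp E t s\<^esub> b) \<longleftrightarrow> x \<odot>\<^bsub>mdl q kp E t s\<^esub> b = x \<otimes>\<^bsub>mdl q kp E t s\<^esub> b"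
        by (simp add: inj_on_eq_iff)
    qed
    finally show ?thesis ..
  qed
  then show kk: "kp = kp'" using mdl_kindA_iff[OF E(1,4) k(1) q(1,2)] mdl_kindA_iff[OF E'(1,4) k(2) q(1,2)] by simp
  let ?S = "dsq q E t s" and ?S' = "dsq q E' t' s'"
  have f: "f \<in> skew_brace_iso ?S ?S'" using f kk by (simp add: mdl_def iso_opp_iff split: if_splits)
  note s1 = dsq_brace[OF E(1) q(1) E(4)] and s2 = dsq_brace[OF E'(1) q(1) E'(4)]
  have fm: "f (x \<otimes>\<^bsub>?S\<^esub> y) = f x \<otimes>\<^bsub>?S'\<^esub> f y" "f (x \<odot>\<^bsub>?S\<^esub> y) = f x \<odot>\<^bsub>?S'\<^esub> f y"
    if "x \<in> carrier ?S" "y \<in> carrier ?S" for x y using f that by (auto simp: sbi_iff)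
  define u where "u = fst (f (1, \<one>\<^bsub>E\<^esub>))"
  have f1: "f (1, \<one>\<^bsub>E\<^esub>) = (u, \<one>\<^bsub>E'\<^esub>)" and u: "u \<in> {0..<int q}"
    using fP[of "(1, \<one>\<^bsub>E\<^esub>)"] q1 by (auto simp: u_def mem_Times_iff prod_eq_iff)
  have fx: "f (x, \<one>\<^bsub>E\<^esub>) = ((u * x) mod int q, \<one>\<^bsub>E'\<^esub>)" if x: "x \<in> {0..<int q}" for x
  proof -
    have 1: "(x, \<one>\<^bsub>E\<^esub>) = (1, \<one>\<^bsub>E\<^esub>) [^]\<^bsub>?S\<^esub> nat x"
      using dsq_pow_one[OF E(1) q(1) E(4), of 1 "nat x"] x q1 by simp
    have "f (x, \<one>\<^bsub>E\<^esub>) = f (1, \<one>\<^bsub>E\<^esub>) [^]\<^bsub>?S'\<^esub> nat x"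
      unfolding 1 by (rule iso_one(2)[OF s1 s2 f]) (use q1 in simp)
    also have "\<dots> = ((int (nat x) * u) mod int q, \<one>\<^bsub>E'\<^esub>)"
      unfolding f1 by (rule dsq_pow_one[OF E'(1) q(1) E'(4) u])
    finally show ?thesis using x by (simp add: mult.commute)
  qed
  have "\<not> int q dvd u"
  proof
    assume "int q dvd u"
    then have "u = 0" using u by (auto dest: zdvd_imp_le)
    then have e: "f (1, \<one>\<^bsub>E\<^esub>) = f (0, \<one>\<^bsub>E\<^esub>)" using fx[of 0] f1 q1 by simp
    have "(1 :: int, \<one>\<^bsub>E\<^esub>) = (0, \<one>\<^bsub>E\<^esub>)"
      by (rule inj_onD[OF bij_betw_imp_inj_on[OF bij] e]) (use q1 in auto)
    then show False by simp
  qed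
  then have cu: "coprime u (int q)" using prime_imp_coprime[of "int q" u] q(1) by (simp add: coprime_commute)
  define \<psi> where "\<psi> h = snd (f (0, h))" for h
  define c where "c h = fst (f (0, h))" for h
  have f0: "f (0, h) = (c h, \<psi> h)" for h by (simp add: c_def \<psi>_def)
  have cl: "c h \<in> {0..<int q}" "\<psi> h \<in> carrier E'" if "h \<in> carrier E" for h
    using bij_betw_apply[OF bij, of "(0, h)"] that q1 by (auto simp: f0)
  have fxh: "f (x, h) = ((u * x + c h) mod int q, \<psi> h)" if x: "x \<in> {0..<int q}" and h: "h \<in> carrier E" for x h
  proof -
    have "(x, h) = (x, \<one>\<^bsub>E\<^esub>) \<otimes>\<^bsub>?S\<^esub> (0, h)" using x h by simp
    then have "f (x, h) = f (x, \<one>\<^bsub>E\<^esub>) \<otimes>\<^bsub>?S'\<^esub> f (0, h)" using fm(1)[of "(x, \<one>\<^bsub>E\<^esub>)" "(0, h)"] x h q1 by simp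
    then show ?thesis using fx[OF x] cl[OF h] dec_zero[OF E'(1,4)] by (simp add: f0 mod_simps)
  qed
  have \<psi>m: "\<psi> (h \<otimes>\<^bsub>E\<^esub> k) = \<psi> h \<otimes>\<^bsub>E'\<^esub> \<psi> k" "\<psi> (h \<odot>\<^bsub>E\<^esub> k) = \<psi> h \<odot>\<^bsub>E'\<^esub> \<psi> k"
    if hk: "h \<in> carrier E" "k \<in> carrier E" for h k
  proof -
    have "(0, h \<otimes>\<^bsub>E\<^esub> k) = (0, h) \<otimes>\<^bsub>?S\<^esub> (0, k)" "(0, h \<odot>\<^bsub>E\<^esub> k) = (0, h) \<odot>\<^bsub>?S\<^esub> (0, k)" by simp_all
    then have "f (0, h \<otimes>\<^bsub>E\<^esub> k) = f (0, h) \<otimes>\<^bsub>?S'\<^esub> f (0, k)" "f (0, h \<odot>\<^bsub>E\<^esub> k) = f (0, h) \<odot>\<^bsub>?S'\<^esub> f (0, k)"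
      using fm[of "(0, h)" "(0, k)"] hk q1 by simp_all
    then show "\<psi> (h \<otimes>\<^bsub>E\<^esub> k) = \<psi> h \<otimes>\<^bsub>E'\<^esub> \<psi> k" "\<psi> (h \<odot>\<^bsub>E\<^esub> k) = \<psi> h \<odot>\<^bsub>E'\<^esub> \<psi> k"
      by (simp_all add: f0)
  qed
  have "\<psi> ` carrier E = carrier E'"
  proof
    show "\<psi> ` carrier E \<subseteq> carrier E'" using cl by auto
    show "carrier E' \<subseteq> \<psi> ` carrier E"
    proof
      fix h' assume "h' \<in> carrier E'"
      then have "(0, h') \<in> f ` ({0..<int q} \<times> carrier E)" using bij q1 by (auto simp: bij_betw_def)
      then obtain x h where "x \<in> {0..<int q}" "h \<in> carrier E" "(0, h') = f (x, h)" by auto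
      then show "h' \<in> \<psi> ` carrier E" using fxh by auto
    qed
  qed
  moreover from this have "inj_on \<psi> (carrier E)" using E(2,3) E'(2,3) by (intro eq_card_imp_inj_on) auto
  ultimately have \<psi>i: "\<psi> \<in> skew_brace_iso E E'" using \<psi>m by (intro sbiI) (auto simp: bij_betw_def)
  have ts: "t' (\<psi> h) = t h \<and> s' (\<psi> h) = s h" if h: "h \<in> carrier E" for h
  proof
    have one: "(1, \<one>\<^bsub>E\<^esub>) \<in> carrier ?S" "(0, h) \<in> carrier ?S" using q1 h by auto
    \<comment> \<open>Moving \<open>(1, \<one>)\<close> past \<open>h\<close> exposes the action of
      \<open>h\<close> in the first component; the offset \<open>c h\<close> occurs on both sides
      and cancels.\<close>
    have e1: "f (eps q (t h) mod int q, h) = f (0, h) \<otimes>\<^bsub>?S'\<^esub> f (1, \<one>\<^bsub>E\<^esub>)" "f (eps q (s h) mod int q, h) = f (0, h) \<odot>\<^bsub>?S'\<^esub> f (1, \<one>\<^bsub>E\<^esub>)"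
      using fm[OF one(2,1)] h by simp_all
    have m: "eps q (t h) mod int q \<in> {0..<int q}" "eps q (s h) mod int q \<in> {0..<int q}" using q1 by auto
    have "[u * eps q (t h) + c h = c h + eps q (t' (\<psi> h)) * u] (mod int q)"
      using e1(1) fxh[OF m(1) h] cl[OF h] by (simp add: f0 f1 mod_mult_add_int cong_def)
    then have "[u * eps q (t h) + c h - c h = c h + eps q (t' (\<psi> h)) * u - c h] (mod int q)" by (intro cong_diff cong_refl)
    then have "[u * eps q (t h) = u * eps q (t' (\<psi> h))] (mod int q)" by (simp add: mult.commute)
    then have "[eps q (t h) = eps q (t' (\<psi> h))] (mod int q)" by (rule cong_cancel_int[OF cu])
    then show "t' (\<psi> h) = t h"
      using eps_inj[OF q(1,2) decD(1)[OF E(4) h] decD(1)[OF E'(4) cl(2)[OF h]]] by simp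
    have "[u * eps q (s h) + c h = c h + eps q (s' (\<psi> h)) * u] (mod int q)"
      using e1(2) fxh[OF m(2) h] cl[OF h] by (simp add: f0 f1 mod_mult_add_int cong_def)
    then have "[u * eps q (s h) + c h - c h = c h + eps q (s' (\<psi> h)) * u - c h] (mod int q)" by (intro cong_diff cong_refl)
    then have "[u * eps q (s h) = u * eps q (s' (\<psi> h))] (mod int q)" by (simp add: mult.commute)
    then have "[eps q (s h) = eps q (s' (\<psi> h))] (mod int q)" by (rule cong_cancel_int[OF cu])
    then show "s' (\<psi> h) = s h"
      using eps_inj[OF q(1,2) decD(2)[OF E(4) h] decD(2)[OF E'(4) cl(2)[OF h]]] by simp
  qed
  show "\<exists>u \<psi>. coprime u (int q) \<and> \<psi> \<in> skew_brace_iso E E' \<and>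
    (\<forall>h \<in> carrier E. t' (\<psi> h) = t h \<and> s' (\<psi> h) = s h) \<and>
    (\<forall>x \<in> {0..<int q}. f (x, \<one>\<^bsub>E\<^esub>) = ((u * x) mod int q, \<one>\<^bsub>E'\<^esub>)) \<and>
    (\<forall>x \<in> {0..<int q}. \<forall>h \<in> carrier E. snd (f (x, h)) = \<psi> h)"
    using cu \<psi>i ts fx fxh by (intro exI[of _ u] exI[of _ \<psi>]) simp
qed

text \<open>Automorphisms of a cyclic group commute with each other, so any unit \<open>u\<close>
  may be chosen; for \<open>q = 3\<close> the units 1 and 2 later identify
  \<open>(\<alpha>, \<beta>)\<close> with its negative.\<close>

theorem model_isoI:
  assumes E: "skew_left_brace E" and q: "prime q" and d: "dec q E t s"
    and \<psi>: "\<psi> \<in> skew_brace_iso E E'" and ts: "\<forall>h \<in> carrier E. t' (\<psi> h) = t h \<and> s' (\<psi> h) = s h"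
    and u: "coprime u (int q)"
  shows "(\<lambda>(x, h). ((u * x) mod int q, \<psi> h)) \<in> skew_brace_iso (mdl q kp E t s) (mdl q kp E' t' s')"
proof -
  let ?f = "\<lambda>(x, h). ((u * x) mod int q, \<psi> h)"
  have q0: "int q > 0" using q prime_gt_0_nat by simp
  have "bij_betw (\<lambda>x. (u * x) mod int q) {0..<int q} {0..<int q}"
  proof -
    have "inj_on (\<lambda>x. (u * x) mod int q) {0..<int q}"
    proof (rule inj_onI)
      fix x y assume xy: "x \<in> {0..<int q}" "y \<in> {0..<int q}" "(u * x) mod int q = (u * y) mod int q"
      have "[u * x = u * y] (mod int q)" unfolding cong_def by (rule xy(3))
      then have "[x = y] (mod int q)" by (rule cong_cancel_int[OF u])
      then have "x mod int q = y mod int q" unfolding cong_def .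
      then show "x = y" using xy(1,2) by simp
    qed
    moreover have "(\<lambda>x. (u * x) mod int q) ` {0..<int q} \<subseteq> {0..<int q}" using q0 by auto
    ultimately show ?thesis by (simp add: bij_betw_def endo_inj_surj)
  qed
  moreover have "bij_betw \<psi> (carrier E) (carrier E')" using \<psi> by (simp add: sbi_iff)
  ultimately have b: "bij_betw ?f ({0..<int q} \<times> carrier E) ({0..<int q} \<times> carrier E')"
    using bij_betw_map_prod[of "\<lambda>x. (u * x) mod int q" "{0..<int q}" "{0..<int q}" \<psi> "carrier E" "carrier E'"]
    by (simp add: map_prod_def)
  have "?f \<in> skew_brace_iso (dsq q E t s) (dsq q E' t' s')"
  proof (rule sbiI)
    fix a b assume ab: "a \<in> carrier (dsq q E t s)" "b \<in> carrier (dsq q E t s)"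
    obtain x h y k where *: "a = (x, h)" "b = (y, k)" by (metis surj_pair)
    have mem: "h \<in> carrier E" "k \<in> carrier E" using ab * by auto
    have "(u * ((x + c * y) mod int q)) mod int q = ((u * x) mod int q + c * ((u * y) mod int q)) mod int q" for c
      unfolding mod_mult_right_eq mod_add_left_eq mod_mult_add_int by (simp add: algebra_simps)
    then show "?f (a \<otimes>\<^bsub>dsq q E t s\<^esub> b) = ?f a \<otimes>\<^bsub>dsq q E' t' s'\<^esub> ?f b"
      "?f (a \<odot>\<^bsub>dsq q E t s\<^esub> b) = ?f a \<odot>\<^bsub>dsq q E' t' s'\<^esub> ?f b"
      using mem ts \<psi> unfolding * sbi_iff by simp_all
  qed (use b in simp)
  then show ?thesis by (simp add: mdl_def iso_opp_iff)
qed

section \<open>Executable structures and the exhaustive search\<close>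

instantiation q4 :: enum
begin
definition "enum_q4 = [Q0, Q1, Q2, Q3]"
definition "enum_all_q4 P \<longleftrightarrow> P Q0 \<and> P Q1 \<and> P Q2 \<and> P Q3"
definition "enum_ex_q4 P \<longleftrightarrow> P Q0 \<or> P Q1 \<or> P Q2 \<or> P Q3"
instance by standard (auto simp: enum_q4_def enum_all_q4_def enum_ex_q4_def UNIV_q4)
end

instantiation t3 :: enum
begin
definition "enum_t3 = [T0, T1, T2]"
definition "enum_all_t3 P \<longleftrightarrow> P T0 \<and> P T1 \<and> P T2"
definition "enum_ex_t3 P \<longleftrightarrow> P T0 \<or> P T1 \<or> P T2"
instance by standard (auto simp: enum_t3_def enum_all_t3_def enum_ex_t3_def UNIV_t3)
end

text \<open>The list starts with the identity and two generators of \<open>mulA\<close>, since the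
  search branches in this order. The tables \<open>hl4\<close> and \<open>hl3\<close> are written in
  it.\<close>

definition els :: "a4 list" where
  "els = [AA Q0 T0, AA Q1 T0, AA Q0 T1, AA Q2 T0, AA Q3 T0, AA Q1 T1, AA Q2 T1, AA Q3 T1, AA Q0 T2, AA Q1 T2, AA Q2 T2, AA Q3 T2]"

lemma UNIV_a4: "UNIV = set els"
proof -
  have "x \<in> set els" for x by (cases x; rename_tac v s; case_tac v; case_tac s) (simp_all add: els_def)
  then show ?thesis by auto
qed

lemma distinct_els: "distinct els" by (simp add: els_def)

instantiation a4 :: enum
begin
definition "enum_a4 = els"
definition "enum_all_a4 P \<longleftrightarrow> list_all P els"
definition "enum_ex_a4 P \<longleftrightarrow> list_ex P els"
instance
  by standard (simp_all add: enum_a4_def enum_all_a4_def enum_ex_a4_def list_all_iff list_ex_iff UNIV_a4[symmetric] distinct_els)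
end

definition cbr :: "('a \<Rightarrow> 'a \<Rightarrow> 'a) \<Rightarrow> 'a \<Rightarrow> ('a \<Rightarrow> 'a \<Rightarrow> 'a) \<Rightarrow> 'a skew_brace" where
  "cbr m e c = \<lparr>carrier = UNIV, monoid.mult = m, one = e, circ = c, circ_one = e\<rparr>"

lemma cbr_simps [simp]: "carrier (cbr m e c) = UNIV" "x \<otimes>\<^bsub>cbr m e c\<^esub> y = m x y" "\<one>\<^bsub>cbr m e c\<^esub> = e"
  "x \<odot>\<^bsub>cbr m e c\<^esub> y = c x y" "circ_one (cbr m e c) = e"
  by (simp_all add: cbr_def)

text \<open>Executable axioms: inverses enter as any \<open>x'\<close> with
  \<open>m x' x = e\<close>, in place of the description operator behind \<open>inv\<close>.\<close>

definition is_cbr :: "('a \<Rightarrow> 'a \<Rightarrow> 'a) \<Rightarrow> 'a \<Rightarrow> ('a \<Rightarrow> 'a \<Rightarrow> 'a) \<Rightarrow> bool" where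
  "is_cbr m e c \<longleftrightarrow> (\<forall>x y z. m (m x y) z = m x (m y z)) \<and> (\<forall>x. m e x = x) \<and> (\<forall>x. \<exists>y. m y x = e) \<and>
     (\<forall>x y z. c (c x y) z = c x (c y z)) \<and> (\<forall>x. c e x = x) \<and> (\<forall>x. \<exists>y. c y x = e) \<and>
     (\<forall>x x'. m x' x = e \<longrightarrow> (\<forall>y z. c x (m y z) = m (m (c x y) x') (c x z)))"

lemma cbr_brace: assumes "is_cbr m e c" shows "skew_left_brace (cbr m e c)"
proof -
  have g: "group (cbr m e c)" by (rule groupI) (use assms in \<open>auto simp: is_cbr_def\<close>)
  have h: "group (circ_group (cbr m e c))" by (rule groupI) (use assms in \<open>auto simp: is_cbr_def one_circ\<close>)
  interpret g: group "cbr m e c" by fact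
  show ?thesis
  proof (intro skew_left_brace.intro skew_left_brace_axioms.intro g h)
    fix a b d
    have "m (inv\<^bsub>cbr m e c\<^esub> a) a = e" using g.l_inv[of a] by simp
    then show "a \<odot>\<^bsub>cbr m e c\<^esub> (b \<otimes>\<^bsub>cbr m e c\<^esub> d) = a \<odot>\<^bsub>cbr m e c\<^esub> b \<otimes>\<^bsub>cbr m e c\<^esub> inv\<^bsub>cbr m e c\<^esub> a \<otimes>\<^bsub>cbr m e c\<^esub> (a \<odot>\<^bsub>cbr m e c\<^esub> d)"
      using assms by (simp add: is_cbr_def)
  qed
qed

fun greedy :: "('a \<Rightarrow> 'a \<Rightarrow> bool) \<Rightarrow> 'a list \<Rightarrow> 'a list" where
  "greedy R [] = []"
| "greedy R (x # xs) = x # greedy R (filter (\<lambda>y. \<not> R x y) xs)"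

lemma greedy_sub: "set (greedy R xs) \<subseteq> set xs"
  by (induction R xs rule: greedy.induct) auto

lemma greedy_cover: "(\<And>x. R x x) \<Longrightarrow> y \<in> set xs \<Longrightarrow> \<exists>x \<in> set (greedy R xs). R x y"
  by (induction R xs rule: greedy.induct) auto

text \<open>What counts is the relation from the element listed first to the other one; as the order
  is unknown, both directions appear.\<close>

lemma greedy_irred: "\<lbrakk>x \<in> set (greedy R xs); y \<in> set (greedy R xs); R x y; R y x\<rbrakk> \<Longrightarrow> x = y"
proof (induction R xs rule: greedy.induct)
  case (2 R z xs)
  have n: "w \<in> set (greedy R (filter (\<lambda>y. \<not> R z y) xs)) \<Longrightarrow> \<not> R z w" for w
    using greedy_sub[of R "filter (\<lambda>y. \<not> R z y) xs"] by auto
  consider "x = z" | "y = z" | "x \<noteq> z" "y \<noteq> z" by blast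
  then show ?case
  proof cases
    case 1
    with 2(3,4) n[of y] show ?thesis by auto
  next
    case 2
    with \<open>x \<in> set (greedy R (z # xs))\<close> \<open>R y x\<close> n[of x] show ?thesis by auto
  next
    case 3
    have "x \<in> set (greedy R (filter (\<lambda>y. \<not> R z y) xs))" "y \<in> set (greedy R (filter (\<lambda>y. \<not> R z y) xs))"
      using 2(2,3) 3 by simp_all
    then show ?thesis using 2(1,4,5) by blast
  qed
qed simp

text \<open>\<open>L\<close> is the partial map found so far and \<open>W\<close> the pending
  values. The key \<open>kf k v b\<close> may depend on the value \<open>v\<close>, because for
  lambda maps the product \<open>a \<odot> b\<close> involves the automorphism attached to
  \<open>a\<close>. Exhausted fuel returns the current map, which weakens pruning but loses no
  solution.\<close>

fun proc :: "('k \<Rightarrow> 'v \<Rightarrow> 'k \<Rightarrow> 'k) \<Rightarrow> ('v \<Rightarrow> 'v \<Rightarrow> 'v) \<Rightarrow> nat \<Rightarrow> ('k \<times> 'v) list \<Rightarrow> ('k \<times> 'v) list \<Rightarrow> ('k \<times> 'v) list option" where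
  "proc kf vf n L [] = Some L"
| "proc kf vf 0 L W = Some L"
| "proc kf vf (Suc n) L ((k, v) # W) = (case map_of L k of
     Some v' \<Rightarrow> (if v = v' then proc kf vf n L W else None)
   | None \<Rightarrow> proc kf vf n ((k, v) # L)
       (map (\<lambda>(b, vb). (kf k v b, vf v vb)) ((k, v) # L) @ map (\<lambda>(a, va). (kf a va k, vf va v)) L @ W))"

fun srch :: "('k \<Rightarrow> 'v \<Rightarrow> 'k \<Rightarrow> 'k) \<Rightarrow> ('v \<Rightarrow> 'v \<Rightarrow> 'v) \<Rightarrow> 'v list \<Rightarrow> nat \<Rightarrow> 'k list \<Rightarrow> ('k \<times> 'v) list \<Rightarrow> ('k \<times> 'v) list list" where
  "srch kf vf vs n [] L = [L]"
| "srch kf vf vs n (k # ks) L = (case map_of L k of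
     Some _ \<Rightarrow> srch kf vf vs n ks L
   | None \<Rightarrow> concat (map (\<lambda>v. case proc kf vf n L [(k, v)] of None \<Rightarrow> [] | Some L' \<Rightarrow> srch kf vf vs n ks L') vs))"

text \<open>The search enumerates the maps \<open>f\<close> with \<open>f (kf a (f a) b) = vf (f a) (f b)\<close>, propagating this
  equation eagerly; it never discards a partial map that extends to a solution.\<close>

lemma proc_complete:
  "\<lbrakk>\<forall>a b. f (kf a (f a) b) = vf (f a) (f b); \<forall>(k, v) \<in> set L. f k = v; \<forall>(k, v) \<in> set W. f k = v\<rbrakk> \<Longrightarrow>
    \<exists>L'. proc kf vf n L W = Some L' \<and> (\<forall>(k, v) \<in> set L'. f k = v) \<and> fst ` set L \<subseteq> fst ` set L' \<and>
      (n > 0 \<longrightarrow> W \<noteq> [] \<longrightarrow> fst (hd W) \<in> fst ` set L')"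
proof (induction kf vf n L W rule: proc.induct)
  case (3 kf vf n L k v W)
  note f = 3(3) and L = 3(4) and W = 3(5)
  have fk: "f k = v" using W by simp
  have W': "\<forall>(k, v) \<in> set W. f k = v" using W by simp
  show ?case
  proof (cases "map_of L k")
    case None
    have L1: "\<forall>(k, v) \<in> set ((k, v) # L). f k = v" using L fk by simp
    have A1: "f (kf k v b) = vf v vb" if "(b, vb) \<in> set ((k, v) # L)" for b vb
    proof -
      have "f b = vb" using bspec[OF L1 that] by simp
      then show ?thesis using f fk by metis
    qed
    have A2: "f (kf a va k) = vf va v" if "(a, va) \<in> set L" for a va
    proof -
      have "f a = va" using bspec[OF L that] by simp
      then show ?thesis using f fk by metis
    qed
    have "\<forall>(k, v) \<in> set (map (\<lambda>(b, vb). (kf k v b, vf v vb)) ((k, v) # L) @ map (\<lambda>(a, va). (kf a va k, vf va v)) L @ W). f k = v"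
      unfolding set_append set_map ball_Un using A1 A2 W' by (intro conjI ballI) auto
    then obtain L' where "proc kf vf n ((k, v) # L) (map (\<lambda>(b, vb). (kf k v b, vf v vb)) ((k, v) # L) @ map (\<lambda>(a, va). (kf a va k, vf va v)) L @ W) = Some L'"
      "\<forall>(k, v) \<in> set L'. f k = v" "fst ` set ((k, v) # L) \<subseteq> fst ` set L'"
      using 3(1)[OF None f L1] by blast
    then show ?thesis using None by simp
  next
    case (Some v')
    then have kL: "(k, v') \<in> set L" by (rule map_of_SomeD)
    then have "f k = v'" using bspec[OF L kL] by simp
    then have v': "v = v'" using fk by simp
    obtain L' where "proc kf vf n L W = Some L'" "\<forall>(k, v) \<in> set L'. f k = v" "fst ` set L \<subseteq> fst ` set L'"
      using 3(2)[OF Some v' f L W'] by blast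
    moreover have "k \<in> fst ` set L" using kL by force
    ultimately show ?thesis using Some v' by auto
  qed
qed auto

text \<open>With positive fuel the first pending entry is always recorded; therefore every key of
  \<open>ks\<close> is defined in the end.\<close>

lemma srch_complete:
  assumes f: "\<forall>a b. f (kf a (f a) b) = vf (f a) (f b)" and vs: "\<And>a. f a \<in> set vs"
  shows "\<forall>(k, v) \<in> set L. f k = v \<Longrightarrow>
    \<exists>L' \<in> set (srch kf vf vs (Suc n) ks L). (\<forall>(k, v) \<in> set L'. f k = v) \<and> fst ` set L \<union> set ks \<subseteq> fst ` set L'"
proof (induction ks arbitrary: L)
  case (Cons k ks)
  show ?case
  proof (cases "map_of L k")
    case None
    have W: "\<forall>(k, v) \<in> set [(k, f k)]. f k = v" by simp
    obtain L1 where L1: "proc kf vf (Suc n) L [(k, f k)] = Some L1" "\<forall>(k, v) \<in> set L1. f k = v"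
      "fst ` set L \<subseteq> fst ` set L1" "k \<in> fst ` set L1"
      using proc_complete[where n = "Suc n" and f = f and kf = kf and vf = vf, OF f Cons.prems W] by (elim exE conjE) simp
    from Cons.IH[OF L1(2)] obtain L' where L': "L' \<in> set (srch kf vf vs (Suc n) ks L1)" "\<forall>(k, v) \<in> set L'. f k = v"
      "fst ` set L1 \<union> set ks \<subseteq> fst ` set L'" by blast
    have "L' \<in> set (case proc kf vf (Suc n) L [(k, f k)] of None \<Rightarrow> [] | Some L' \<Rightarrow> srch kf vf vs (Suc n) ks L')"
      using L'(1) L1(1) by simp
    then have "L' \<in> set (srch kf vf vs (Suc n) (k # ks) L)"
      unfolding srch.simps None option.case set_concat set_map using vs[of k] by blast
    moreover have "fst ` set L \<union> set (k # ks) \<subseteq> fst ` set L'"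
      using L1(3,4) L'(3) unfolding list.set by blast
    ultimately show ?thesis using L'(2) by blast
  next
    case (Some v)
    then have "k \<in> fst ` set L" by (force dest: map_of_SomeD)
    moreover obtain L' where L': "L' \<in> set (srch kf vf vs (Suc n) ks L)" "\<forall>(k, v) \<in> set L'. f k = v"
      "fst ` set L \<union> set ks \<subseteq> fst ` set L'" using Cons.IH[OF Cons.prems] by blast
    ultimately have "fst ` set L \<union> set (k # ks) \<subseteq> fst ` set L'" unfolding list.set by blast
    moreover have "L' \<in> set (srch kf vf vs (Suc n) (k # ks) L)" unfolding srch.simps Some option.case by (rule L'(1))
    ultimately show ?thesis using L'(2) by blast
  qed
qed auto

section \<open>Braces of size four\<close>

text \<open>The four names stand for the possible pairs of additive and circle group, in this order:
  cyclic and cyclic, Klein and Klein, cyclic and Klein, Klein and cyclic.\<close>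

datatype fi = F0 | F1 | F2 | F3

definition fis where "fis = [F0, F1, F2, F3]"

definition odd4 :: "q4 \<Rightarrow> bool" where "odd4 x \<longleftrightarrow> x = Q1 \<or> x = Q3"

fun fadd :: "fi \<Rightarrow> q4 \<Rightarrow> q4 \<Rightarrow> q4" where
  "fadd F0 x y = x + y" | "fadd F1 x y = xor4 x y" | "fadd F2 x y = x + y" | "fadd F3 x y = xor4 x y"

fun flam :: "fi \<Rightarrow> q4 \<Rightarrow> q4 \<Rightarrow> q4" where
  "flam F0 x y = y" | "flam F1 x y = y"
| "flam F2 x y = (if odd4 x then - y else y)" | "flam F3 x y = (if odd4 x then - y else y)"

definition fcirc where "fcirc i x y = fadd i x (flam i x y)"
definition fbr where "fbr i = cbr (fadd i) Q0 (fcirc i)"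

lemma fbr_brace: "skew_left_brace (fbr i)"
proof -
  have "is_cbr (fadd i) Q0 (fcirc i)" unfolding is_cbr_def by (cases i; simp only:; code_simp)
  then show ?thesis by (simp add: fbr_def cbr_brace)
qed

text \<open>Functions on \<open>q4\<close> are kept as lists of values, over which
  \<open>code_simp\<close> can enumerate.\<close>

fun fn4 :: "'b list \<Rightarrow> q4 \<Rightarrow> 'b" where
  "fn4 [a, b, c, d] x = (case x of Q0 \<Rightarrow> a | Q1 \<Rightarrow> b | Q2 \<Rightarrow> c | Q3 \<Rightarrow> d)"

definition L4 :: "(q4 \<Rightarrow> 'b) \<Rightarrow> 'b list" where "L4 f = [f Q0, f Q1, f Q2, f Q3]"

lemma fn4_L4 [simp]: "fn4 (L4 f) = f" by (rule ext; case_tac x) (simp_all add: L4_def)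

definition lists4 :: "'b list \<Rightarrow> 'b list list" where
  "lists4 vs = [[a, b, c, d]. a \<leftarrow> vs, b \<leftarrow> vs, c \<leftarrow> vs, d \<leftarrow> vs]"

lemma L4_in: "(\<And>x. f x \<in> set vs) \<Longrightarrow> L4 f \<in> set (lists4 vs)"
  by (auto simp: L4_def lists4_def image_iff)

lemma lists4_L4: "l \<in> set (lists4 vs) \<Longrightarrow> L4 (fn4 l) = l \<and> (\<forall>x. fn4 l x \<in> set vs)"
  by (auto simp: L4_def lists4_def split: q4.split)

definition q4s where "q4s = [Q0, Q1, Q2, Q3]"

lemma set_q4s: "x \<in> set q4s" by (cases x) (simp_all add: q4s_def)

definition auts4 :: "(q4 \<Rightarrow> q4 \<Rightarrow> q4) \<Rightarrow> q4 list list" where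
  "auts4 m = filter (\<lambda>l. distinct l \<and> (\<forall>x y. fn4 l (m x y) = m (fn4 l x) (fn4 l y))) (lists4 q4s)"

lemma L4_auts4:
  assumes "inj f" "\<And>x y. f (m x y) = m (f x) (f y)" shows "L4 f \<in> set (auts4 m)"
proof -
  have "L4 f \<in> set (lists4 q4s)" by (rule L4_in) (rule set_q4s)
  moreover have "distinct (L4 f)" using assms(1) by (auto simp: L4_def inj_eq)
  ultimately show ?thesis using assms(2) by (simp add: auts4_def)
qed

text \<open>\<open>l0\<close> to \<open>l3\<close> form an arbitrary assignment of automorphisms to
  the four elements; the premise is the rule that makes it a lambda map, and \<open>\<psi>\<close>
  is the relabelling that brings it to standard form.\<close>

definition chk4 :: "(q4 \<Rightarrow> q4 \<Rightarrow> q4) \<Rightarrow> q4 list list \<Rightarrow> fi \<Rightarrow> fi \<Rightarrow> bool" where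
  "chk4 m au i j \<longleftrightarrow> list_all (\<lambda>l0. list_all (\<lambda>l1. list_all (\<lambda>l2. list_all (\<lambda>l3.
     (\<forall>a b c. fn4 (fn4 [l0, l1, l2, l3] (m a (fn4 (fn4 [l0, l1, l2, l3] a) b))) c
         = fn4 (fn4 [l0, l1, l2, l3] a) (fn4 (fn4 [l0, l1, l2, l3] b) c)) \<longrightarrow>
     list_ex (\<lambda>\<psi>. (\<forall>x y. fn4 \<psi> (fn4 (fn4 [l0, l1, l2, l3] x) y) = flam i (fn4 \<psi> x) (fn4 \<psi> y)) \<or>
                  (\<forall>x y. fn4 \<psi> (fn4 (fn4 [l0, l1, l2, l3] x) y) = flam j (fn4 \<psi> x) (fn4 \<psi> y))) au) au) au) au) au"

lemma auts4_add: "auts4 (+) = [[Q0, Q1, Q2, Q3], [Q0, Q3, Q2, Q1]]" by code_simp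
lemma auts4_xor: "auts4 xor4 = [[Q0, Q1, Q2, Q3], [Q0, Q1, Q3, Q2], [Q0, Q2, Q1, Q3], [Q0, Q2, Q3, Q1],
    [Q0, Q3, Q1, Q2], [Q0, Q3, Q2, Q1]]" by code_simp

lemma chk4_add: "chk4 (+) (auts4 (+)) F0 F2" unfolding auts4_add by code_simp
lemma chk4_xor: "chk4 xor4 (auts4 xor4) F1 F3" unfolding auts4_xor by code_simp

definition isos4 :: "fi \<Rightarrow> fi \<Rightarrow> q4 list list" where
  "isos4 i j = filter (\<lambda>l. distinct l \<and> (\<forall>x y. fn4 l (fadd i x y) = fadd j (fn4 l x) (fn4 l y)) \<and>
     (\<forall>x y. fn4 l (fcirc i x y) = fcirc j (fn4 l x) (fn4 l y))) (lists4 q4s)"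

lemma isos4_ne: "list_all (\<lambda>i. list_all (\<lambda>j. i = j \<or> isos4 i j = []) fis) fis" by code_simp

text \<open>The elements of \<open>D4 q\<close>, the argument being the truth value of
  \<open>q mod 4 = 1\<close>.\<close>

fun dv :: "bool \<Rightarrow> q4 list" where "dv True = q4s" | "dv False = [Q0, Q2]"

definition hom4 :: "(q4 \<Rightarrow> q4 \<Rightarrow> q4) \<Rightarrow> q4 list \<Rightarrow> q4 list list" where
  "hom4 m vs = filter (\<lambda>l. \<forall>x y. fn4 l (m x y) = fn4 l x + fn4 l y) (lists4 vs)"

definition bhom4 :: "fi \<Rightarrow> q4 list \<Rightarrow> q4 list list" where
  "bhom4 i vs = filter (\<lambda>l. \<forall>x y. fn4 l (fadd i x y) = fn4 l x + fn4 l y) (hom4 (fcirc i) vs)"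

type_synonym quad = "q4 list \<times> q4 list \<times> q4 list \<times> q4 list"

text \<open>\<open>a\<close> and \<open>b\<close> are the additive and circle decorations for the
  prime 3, where signs are the only units, whence \<open>dv False\<close>; \<open>c\<close> and
  \<open>d\<close> are the components in \<open>q4\<close> of the decorations for
  \<open>p\<close>.\<close>

definition quads :: "fi \<Rightarrow> bool \<Rightarrow> quad list" where
  "quads i df = [(a, b, c, d). a \<leftarrow> bhom4 i (dv False), b \<leftarrow> hom4 (fcirc i) (dv False), c \<leftarrow> bhom4 i (dv df), d \<leftarrow> hom4 (fcirc i) (dv df)]"

definition rel4 :: "q4 list list \<Rightarrow> quad \<Rightarrow> quad \<Rightarrow> bool" where
  "rel4 au x y \<longleftrightarrow> (case x of (a, b, c, d) \<Rightarrow> case y of (a', b', c', d') \<Rightarrow>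
     list_ex (\<lambda>\<psi>. (\<forall>x. fn4 a' (fn4 \<psi> x) = fn4 a x) \<and> (\<forall>x. fn4 b' (fn4 \<psi> x) = fn4 b x) \<and>
       (\<forall>x. fn4 c' (fn4 \<psi> x) = fn4 c x) \<and> (\<forall>x. fn4 d' (fn4 \<psi> x) = fn4 d x)) au)"

definition qreps :: "fi \<Rightarrow> bool \<Rightarrow> quad list" where
  "qreps i df = greedy (rel4 (isos4 i i)) (quads i df)"

definition z4 :: "q4 list" where "z4 = [Q0, Q0, Q0, Q0]"

text \<open>Orbits of \<open>(\<alpha>, \<beta>)\<close> under negation, the automorphism of the
  group of order 3. A value is nonzero only where the complement centralises that group:
  \<open>\<beta>\<close> needs \<open>b = z4\<close>, and \<open>\<alpha>\<close>, a homomorphism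
  for both operations, needs \<open>a = z4\<close> as well. The five pairs represent the zero vector
  and the four lines of the plane modulo 3.\<close>

definition abs3 :: "bool \<Rightarrow> q4 list \<Rightarrow> q4 list \<Rightarrow> (t3 \<times> t3) list" where
  "abs3 tf a b = (if tf \<and> b = z4 then (if a = z4 then [(T0, T0), (T0, T1), (T1, T0), (T1, T1), (T1, T2)] else [(T0, T0), (T0, T1)])
     else [(T0, T0)])"

type_synonym ocode = "bool \<times> bool \<times> fi \<times> quad \<times> (t3 \<times> t3)"

text \<open>A flag may be \<open>True\<close> only where the corresponding additive decoration is
  nonzero, in accordance with \<open>brace_is_model\<close>.\<close>

definition ocodes :: "bool \<Rightarrow> bool \<Rightarrow> ocode list" where
  "ocodes df tf = concat (map (\<lambda>i. concat (map (\<lambda>(a, b, c, d).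
     concat (map (\<lambda>(\<alpha>, \<beta>).
       [(kp, k3, i, (a, b, c, d), (\<alpha>, \<beta>)). kp \<leftarrow> (if c = z4 \<and> \<alpha> = T0 then [False] else [False, True]),
                                     k3 \<leftarrow> (if a = z4 then [False] else [False, True])])
       (abs3 tf a b))) (qreps i df))) fis)"

section \<open>Braces of size twelve involving the alternating group\<close>

datatype aut = AF q4 t3 bool

fun frob :: "bool \<Rightarrow> q4 \<Rightarrow> q4" where
  "frob False x = x" | "frob True Q0 = Q0" | "frob True Q1 = Q1" | "frob True Q2 = Q3" | "frob True Q3 = Q2"

fun neg3 :: "bool \<Rightarrow> t3 \<Rightarrow> t3" where "neg3 False x = x" | "neg3 True x = - x"

text \<open>With \<open>q4\<close> read as the field of four elements, \<open>AF w k b\<close> is conjugation by the semiaffine map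
  sending \<open>v\<close> to \<open>rot k (frob b v) + w\<close>.\<close>

fun ap :: "aut \<Rightarrow> a4 \<Rightarrow> a4" where
  "ap (AF w k b) (AA v s) = AA (xor4 w (xor4 (rot k (frob b v)) (rot (neg3 b s) w))) (neg3 b s)"

fun xorb :: "bool \<Rightarrow> bool \<Rightarrow> bool" where
  "xorb False y = y" | "xorb True True = False" | "xorb True False = True"

fun cmp :: "aut \<Rightarrow> aut \<Rightarrow> aut" where
  "cmp (AF w k b) (AF w' k' b') = AF (xor4 w (rot k (frob b w'))) (k + neg3 b k') (xorb b b')"

definition auts :: "aut list" where
  "auts = [AF w k b. w \<leftarrow> [Q0, Q1, Q2, Q3], k \<leftarrow> [T0, T1, T2], b \<leftarrow> [False, True]]"

lemma set_auts: "c \<in> set auts"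
  by (cases c; rename_tac w k b; case_tac w; case_tac k; case_tac b) (simp_all add: auts_def)

definition idA where "idA = AA Q0 T0"

lemma ap_cmp: "list_all (\<lambda>f. list_all (\<lambda>g. \<forall>y. ap f (ap g y) = ap (cmp f g) y) auts) auts"
  by code_simp

lemma ap_inj: "list_all (\<lambda>f. list_all (\<lambda>g. (\<forall>y. ap f y = ap g y) \<longrightarrow> f = g) auts) auts"
  by code_simp

lemma ap_hom: "list_all (\<lambda>f. distinct (map (ap f) els) \<and> (\<forall>x y. ap f (mulA x y) = mulA (ap f x) (ap f y))) auts"
  by code_simp

text \<open>The result is that injective endomorphisms of \<open>mulA\<close> are among the 24 maps
  \<open>ap c\<close>. Twelve entries create at most 144 pending products, so the fuel lets every
  propagation run to its end.\<close>

lemma endo_search: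
  "list_all (\<lambda>L. \<not> distinct (map (map_of L) els) \<or> list_ex (\<lambda>c. list_all (\<lambda>(k, v). ap c k = v) L) auts)
     (srch (\<lambda>k v b. mulA k b) mulA els (Suc 299) els [])"
  by code_simp

text \<open>Eight braces with addition \<open>mulA\<close>, and \<open>Gx\<close> with circle
  operation \<open>mulA\<close> over an abelian addition. In the family \<open>Gr g i\<close> the
  lambda map of \<open>AA v t\<close> conjugates by an affine map whose translation part is that of
  the inverse element if \<open>g\<close> holds, and whose rotation is \<open>mul3 i t\<close>. Thus
  \<open>Gr False T0\<close> is the trivial brace, and in \<open>Gr True T2\<close> the circle
  operation is the reversed product.\<close>

datatype gi = Gr bool t3 | Hd | He | Gx

fun mul3 :: "t3 \<Rightarrow> t3 \<Rightarrow> t3" where "mul3 T0 y = T0" | "mul3 T1 y = y" | "mul3 T2 y = - y"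

text \<open>The values form the cyclic group of order four generated by
  \<open>AF Q2 T0 True\<close>, each being taken at three elements.\<close>

fun he :: "a4 \<Rightarrow> aut" where
  "he (AA Q0 T0) = AF Q0 T0 False"
| "he (AA Q1 T0) = AF Q1 T0 False"
| "he (AA Q2 T0) = AF Q3 T0 True"
| "he (AA Q3 T0) = AF Q2 T0 True"
| "he (AA Q0 T1) = AF Q1 T0 False"
| "he (AA Q1 T1) = AF Q3 T0 True"
| "he (AA Q2 T1) = AF Q0 T0 False"
| "he (AA Q3 T1) = AF Q2 T0 True"
| "he (AA Q0 T2) = AF Q3 T0 True"
| "he (AA Q1 T2) = AF Q0 T0 False"
| "he (AA Q2 T2) = AF Q1 T0 False"
| "he (AA Q3 T2) = AF Q2 T0 True"

fun Lam :: "gi \<Rightarrow> a4 \<Rightarrow> aut" where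
  "Lam (Gr g i) (AA v t) = AF (if g then rot (- t) v else Q0) (mul3 i t) False"
| "Lam Hd (AA v t) = AF Q0 (- t) (v = Q2 \<or> v = Q3)"
| "Lam He x = he x"
| "Lam Gx (AA v t) = AF Q0 T0 False"

fun mulX :: "a4 \<Rightarrow> a4 \<Rightarrow> a4" where "mulX (AA v s) (AA w t) = AA (xor4 v w) (s + t)"

fun eadd :: "gi \<Rightarrow> a4 \<Rightarrow> a4 \<Rightarrow> a4" where "eadd Gx x y = mulX x y" | "eadd _ x y = mulA x y"

fun ecirc :: "gi \<Rightarrow> a4 \<Rightarrow> a4 \<Rightarrow> a4" where "ecirc Gx x y = mulA x y" | "ecirc j x y = mulA x (ap (Lam j x) y)"

definition gis where "gis = [Gr False T0, Gr False T1, Gr False T2, Gr True T0, Gr True T1, Gr True T2, Hd, He, Gx]"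
definition gis8 where "gis8 = [Gr False T0, Gr False T1, Gr False T2, Gr True T0, Gr True T1, Gr True T2, Hd, He]"

definition ebr where "ebr j = cbr (eadd j) idA (ecirc j)"

text \<open>The axioms of \<open>is_cbr\<close> at the type \<open>a4\<close>, where the quantifiers
  are executable.\<close>

definition is_sb :: "gi \<Rightarrow> bool" where
  "is_sb j \<longleftrightarrow> (\<forall>x y z. eadd j (eadd j x y) z = eadd j x (eadd j y z)) \<and> (\<forall>x. eadd j idA x = x) \<and> (\<forall>x. \<exists>y. eadd j y x = idA) \<and>
     (\<forall>x y z. ecirc j (ecirc j x y) z = ecirc j x (ecirc j y z)) \<and> (\<forall>x. ecirc j idA x = x) \<and> (\<forall>x. \<exists>y. ecirc j y x = idA) \<and>
     (\<forall>x x'. eadd j x' x = idA \<longrightarrow> (\<forall>y z. ecirc j x (eadd j y z) = eadd j (eadd j (ecirc j x y) x') (ecirc j x z)))"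

lemma is_sb: "list_all is_sb gis" by code_simp

text \<open>An unknown lambda map assigns automorphisms to elements subject to the homomorphism rule
  on the circle group; every solution is conjugate by some \<open>c\<close> to one of eight. The
  initial entry says that the neutral element acts trivially.\<close>

lemma lam_search:
  "list_all (\<lambda>L. list_ex (\<lambda>j. list_ex (\<lambda>c. list_all (\<lambda>(k, v). cmp (Lam j (ap c k)) c = cmp c v) L) auts) gis8)
     (srch (\<lambda>a f b. mulA a (ap f b)) cmp auts (Suc 199) els [(AA Q0 T0, AF Q0 T0 False)])"
  by code_simp

text \<open>Candidates of the form \<open>ap c\<close> suffice, because an isomorphism between two
  of the nine braces preserves \<open>mulA\<close>; see \<open>iso_ap\<close>.\<close>

definition auE :: "gi \<Rightarrow> gi \<Rightarrow> aut list" where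
  "auE i j = filter (\<lambda>c. (\<forall>x y. ap c (eadd i x y) = eadd j (ap c x) (ap c y)) \<and> (\<forall>x y. ap c (ecirc i x y) = ecirc j (ap c x) (ap c y))) auts"

lemma auE_ne: "list_all (\<lambda>i. list_all (\<lambda>j. i = j \<or> auE i j = []) gis) gis" by code_simp

text \<open>Homomorphisms from the circle group to the cyclic group of order four. The value
  \<open>Q1\<close> occurs only for \<open>Hd\<close> and \<open>He\<close>, whose circle groups
  have a cyclic quotient of order four.\<close>

fun hl4 :: "gi \<Rightarrow> q4 list list" where
  "hl4 (Gr False T2) = [[Q0, Q0, Q0, Q0, Q0, Q0, Q0, Q0, Q0, Q0, Q0, Q0],
     [Q0, Q0, Q0, Q2, Q2, Q0, Q2, Q2, Q0, Q0, Q2, Q2],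
     [Q0, Q2, Q0, Q0, Q2, Q2, Q0, Q2, Q0, Q2, Q0, Q2],
     [Q0, Q2, Q0, Q2, Q0, Q2, Q2, Q0, Q0, Q2, Q2, Q0]]"
| "hl4 (Gr True T0) = [[Q0, Q0, Q0, Q0, Q0, Q0, Q0, Q0, Q0, Q0, Q0, Q0],
     [Q0, Q0, Q0, Q2, Q2, Q2, Q0, Q2, Q0, Q2, Q2, Q0],
     [Q0, Q2, Q0, Q0, Q2, Q2, Q2, Q0, Q0, Q0, Q2, Q2],
     [Q0, Q2, Q0, Q2, Q0, Q0, Q2, Q2, Q0, Q2, Q0, Q2]]"
| "hl4 Hd = [[Q0, Q0, Q0, Q0, Q0, Q0, Q0, Q0, Q0, Q0, Q0, Q0],
     [Q0, Q0, Q0, Q2, Q2, Q0, Q2, Q2, Q0, Q0, Q2, Q2],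
     [Q0, Q2, Q0, Q1, Q3, Q2, Q1, Q3, Q0, Q2, Q1, Q3],
     [Q0, Q2, Q0, Q3, Q1, Q2, Q3, Q1, Q0, Q2, Q3, Q1]]"
| "hl4 He = [[Q0, Q0, Q0, Q0, Q0, Q0, Q0, Q0, Q0, Q0, Q0, Q0],
     [Q0, Q0, Q0, Q2, Q2, Q2, Q0, Q2, Q2, Q0, Q0, Q2],
     [Q0, Q2, Q2, Q1, Q3, Q1, Q0, Q3, Q1, Q0, Q2, Q3],
     [Q0, Q2, Q2, Q3, Q1, Q3, Q0, Q1, Q3, Q0, Q2, Q1]]"
| "hl4 _ = [[Q0, Q0, Q0, Q0, Q0, Q0, Q0, Q0, Q0, Q0, Q0, Q0]]"

fun hl3 :: "gi \<Rightarrow> t3 list list" where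
  "hl3 Hd = [[T0, T0, T0, T0, T0, T0, T0, T0, T0, T0, T0, T0]]"
| "hl3 He = [[T0, T0, T0, T0, T0, T0, T0, T0, T0, T0, T0, T0]]"
| "hl3 _ = [[T0, T0, T0, T0, T0, T0, T0, T0, T0, T0, T0, T0],
     [T0, T0, T1, T0, T0, T1, T1, T1, T2, T2, T2, T2],
     [T0, T0, T2, T0, T0, T2, T2, T2, T1, T1, T1, T1]]"

definition toL :: "(a4 \<times> 'b) list \<Rightarrow> 'b list" where "toL L = map (\<lambda>k. the (map_of L k)) els"

definition t3s where "t3s = [T0, T1, T2]"

lemma hl4_search: "list_all (\<lambda>j. list_all (\<lambda>L. toL L \<in> set (hl4 j)) (srch (\<lambda>k v b. ecirc j k b) (+) q4s (Suc 299) els [(AA Q0 T0, Q0)])) gis"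
  by code_simp

lemma hl3_search: "list_all (\<lambda>j. list_all (\<lambda>L. toL L \<in> set (hl3 j)) (srch (\<lambda>k v b. ecirc j k b) (+) t3s (Suc 299) els [(AA Q0 T0, T0)])) gis"
  by code_simp

definition fnE :: "'b list \<Rightarrow> a4 \<Rightarrow> 'b" where "fnE l k = the (map_of (zip els l) k)"

definition ishom :: "(a4 \<Rightarrow> a4 \<Rightarrow> a4) \<Rightarrow> 'b :: plus list \<Rightarrow> bool" where
  "ishom m l \<longleftrightarrow> (\<forall>x y. fnE l (m x y) = fnE l x + fnE l y)"

lemma hl_hom: "list_all (\<lambda>j. list_all (ishom (ecirc j)) (hl4 j) \<and> list_all (ishom (ecirc j)) (hl3 j)) gis" by code_simp

definition z12 where "z12 = replicate 12 Q0"
definition y12 where "y12 = replicate 12 T0"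

type_synonym edec = "(q4 list \<times> t3 list) \<times> (q4 list \<times> t3 list)"

definition sel4 :: "bool \<Rightarrow> q4 list list \<Rightarrow> q4 list list" where
  "sel4 df = filter (list_all (\<lambda>x. x \<in> set (dv df)))"
definition sel3 :: "bool \<Rightarrow> t3 list list \<Rightarrow> t3 list list" where
  "sel3 tf = filter (list_all (\<lambda>x. tf \<or> x = T0))"

text \<open>The pair \<open>(t4, u3)\<close> is filtered once more because an additive decoration
  has to respect both operations, while \<open>(s4, s3)\<close> concerns the circle group
  alone.\<close>

definition edecs :: "gi \<Rightarrow> bool \<Rightarrow> bool \<Rightarrow> edec list" where
  "edecs j df tf = [((t4, u3), (s4, s3)). t4 \<leftarrow> filter (ishom (eadd j)) (sel4 df (hl4 j)), u3 \<leftarrow> filter (ishom (eadd j)) (sel3 tf (hl3 j)),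
      s4 \<leftarrow> sel4 df (hl4 j), s3 \<leftarrow> sel3 tf (hl3 j)]"

definition relE :: "aut list \<Rightarrow> edec \<Rightarrow> edec \<Rightarrow> bool" where
  "relE au x y \<longleftrightarrow> (case x of ((a, b), (c, d)) \<Rightarrow> case y of ((a', b'), (c', d')) \<Rightarrow>
     list_ex (\<lambda>\<psi>. (\<forall>x. fnE a' (ap \<psi> x) = fnE a x) \<and> (\<forall>x. fnE b' (ap \<psi> x) = fnE b x) \<and>
       (\<forall>x. fnE c' (ap \<psi> x) = fnE c x) \<and> (\<forall>x. fnE d' (ap \<psi> x) = fnE d x)) au)"

definition ereps :: "gi \<Rightarrow> bool \<Rightarrow> bool \<Rightarrow> edec list" where
  "ereps j df tf = greedy (relE (auE j j)) (edecs j df tf)"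

type_synonym ecode = "bool \<times> gi \<times> edec"

definition ecodes :: "bool \<Rightarrow> bool \<Rightarrow> ecode list" where
  "ecodes df tf = concat (map (\<lambda>j. concat (map (\<lambda>((t4, u3), s). [(kp, j, ((t4, u3), s)). kp \<leftarrow> (if t4 = z12 \<and> u3 = y12 then [False] else [False, True])])
      (ereps j df tf))) gis)"

section \<open>Classification in sizes four and twelve from the searches\<close>

lemma srch_total:
  assumes f: "\<forall>a b. f (kf a (f a) b) = vf (f a) (f b)" and vs: "\<And>a. f a \<in> set vs"
    and ks: "\<And>k. k \<in> set ks" and L: "\<forall>(k, v) \<in> set L. f k = v"
  shows "\<exists>L' \<in> set (srch kf vf vs (Suc n) ks L). \<forall>k. map_of L' k = Some (f k)"
proof -
  obtain L' where L': "L' \<in> set (srch kf vf vs (Suc n) ks L)" "\<forall>(k, v) \<in> set L'. f k = v" "set ks \<subseteq> fst ` set L'"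
    using srch_complete[of f kf vf vs L n ks, OF f vs L] by blast
  have "map_of L' k = Some (f k)" for k
  proof (cases "map_of L' k")
    case None
    then have "k \<notin> fst ` set L'" by (simp add: map_of_eq_None_iff)
    then show ?thesis using L'(3) ks[of k] by blast
  next
    case (Some v)
    then show ?thesis using bspec[OF L'(2) map_of_SomeD[OF Some]] by simp
  qed
  then show ?thesis using L'(1) by blast
qed

lemma in_els: "x \<in> set els" using UNIV_a4 by blast

lemma ap_unique:
  assumes inj: "inj f" and hom: "\<And>x y. f (mulA x y) = mulA (f x) (f y)"
  shows "\<exists>c. f = ap c"
proof -
  have "\<exists>L \<in> set (srch (\<lambda>k v b. mulA k b) mulA els (Suc 299) els []). \<forall>k. map_of L k = Some (f k)"
    by (rule srch_total) (use hom in_els in auto)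
  then obtain L where L: "L \<in> set (srch (\<lambda>k v b. mulA k b) mulA els (Suc 299) els [])" "\<And>k. map_of L k = Some (f k)"
    by blast
  have "map (map_of L) els = map (\<lambda>k. Some (f k)) els" by (simp add: L(2))
  moreover have "distinct (map (\<lambda>k. Some (f k)) els)"
    using distinct_els inj by (auto simp: distinct_map inj_on_def)
  ultimately have "distinct (map (map_of L) els)" by (simp only:)
  moreover have "\<not> distinct (map (map_of L) els) \<or> list_ex (\<lambda>c. list_all (\<lambda>(k, v). ap c k = v) L) auts"
    using endo_search L(1) unfolding list_all_iff by blast
  ultimately obtain c where c: "list_all (\<lambda>(k, v). ap c k = v) L" unfolding list_ex_iff by blast
  have "f k = ap c k" for k using c map_of_SomeD[OF L(2)[of k]] unfolding list_all_iff by fastforce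
  then show ?thesis by blast
qed

lemma ap_props: "ap f (ap g y) = ap (cmp f g) y" "(\<forall>y. ap f y = ap g y) \<Longrightarrow> f = g" "inj (ap f)" "ap f (mulA x y) = mulA (ap f x) (ap f y)"
proof -
  show "ap f (ap g y) = ap (cmp f g) y" using ap_cmp set_auts unfolding list_all_iff by blast
  show "(\<forall>y. ap f y = ap g y) \<Longrightarrow> f = g" using ap_inj set_auts unfolding list_all_iff by blast
  have d: "distinct (map (ap f) els) \<and> (\<forall>x y. ap f (mulA x y) = mulA (ap f x) (ap f y))"
    using ap_hom set_auts unfolding list_all_iff by blast
  then show "inj (ap f)" using UNIV_a4 by (simp add: distinct_map)
  show "ap f (mulA x y) = mulA (ap f x) (ap f y)" using d by blast
qed

lemma bij_ap: "bij (ap c)"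
  using ap_props(3) card_a4(2) by (simp add: bij_def finite_UNIV_inj_surj)

lemma in_gis: "j \<in> set gis \<longleftrightarrow> True"
proof (cases j)
  case (Gr g i)
  then show ?thesis by (cases g; cases i) (simp_all add: gis_def)
qed (simp_all add: gis_def)

lemma ebr_brace: "skew_left_brace (ebr j)"
proof -
  have "is_sb j" using is_sb in_gis unfolding list_all_iff by blast
  then have "is_cbr (eadd j) idA (ecirc j)" unfolding is_sb_def is_cbr_def by blast
  then show ?thesis by (simp add: ebr_def cbr_brace)
qed

lemma ebr_simps [simp]: "carrier (ebr j) = UNIV" "x \<otimes>\<^bsub>ebr j\<^esub> y = eadd j x y" "x \<odot>\<^bsub>ebr j\<^esub> y = ecirc j x y" "\<one>\<^bsub>ebr j\<^esub> = idA"
  by (simp_all add: ebr_def)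

lemma fbr_simps [simp]: "carrier (fbr j) = UNIV" "x \<otimes>\<^bsub>fbr j\<^esub> y = fadd j x y" "x \<odot>\<^bsub>fbr j\<^esub> y = fcirc j x y" "\<one>\<^bsub>fbr j\<^esub> = Q0"
  by (simp_all add: fbr_def)

context skew_left_brace begin

text \<open>Moves the lambda maps to the concrete type that models the additive group; the resulting
  \<open>L\<close> is what the exhaustive checks range over.\<close>

lemma transport_lam:
  assumes b: "bij_betw f UNIV (carrier B)" and m: "\<And>x y. f (m x y) = f x \<otimes> f y"
  shows "\<exists>L. (\<forall>a. inj (L a)) \<and> (\<forall>a x y. L a (m x y) = m (L a x) (L a y)) \<and>
    (\<forall>a b c. L (m a (L a b)) c = L a (L b c)) \<and> (\<forall>a b. f (m a (L a b)) = f a \<odot> f b)"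
proof -
  define L where "L a b = inv_into UNIV f (lam (f a) (f b))" for a b
  have fc [simp]: "f x \<in> carrier B" for x using b by (auto simp: bij_betw_def)
  have fi: "f x = f y \<longleftrightarrow> x = y" for x y using b by (auto simp: bij_betw_def inj_eq)
  have fL: "f (L a x) = lam (f a) (f x)" for a x
    unfolding L_def by (rule f_inv_into_f) (use b in \<open>simp add: bij_betw_def\<close>)
  have 1: "f (m a (L a c)) = f a \<odot> f c" for a c by (simp add: m fL circ_lam)
  show ?thesis
  proof (intro exI[of _ L] conjI allI)
    show "inj (L a)" for a
    proof (rule injI)
      fix x y assume "L a x = L a y"
      then have "lam (f a) (f x) = lam (f a) (f y)" by (simp flip: fL)
      then show "x = y" using lam_inj[of "f a" "f x" "f y"] fi by simp
    qed
    show "L a (m x y) = m (L a x) (L a y)" for a x y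
      unfolding fi[symmetric] by (simp add: fL m lam_mult)
    show "L (m a (L a c)) d = L a (L c d)" for a c d
      unfolding fi[symmetric] by (simp add: fL 1 lam_circ)
    show "f (m a (L a c)) = f a \<odot> f c" for a c by (rule 1)
  qed
qed

end

lemma (in group) order4:
  assumes f: "finite (carrier G)" and o: "order G = 4"
  shows "\<exists>f. bij_betw f UNIV (carrier G) \<and> ((\<forall>x y. f (x + y) = f x \<otimes> f y) \<or> (\<forall>x y. f (xor4 x y) = f x \<otimes> f y))"
proof -
  have cU: "card (UNIV :: q4 set) = 4" by (simp add: UNIV_q4)
  have bij: "bij_betw f UNIV (carrier G)" if "inj f" "\<And>x. f x \<in> carrier G" for f :: "q4 \<Rightarrow> 'a"
  proof -
    have "f ` UNIV = carrier G" using that cU o f by (intro card_subset_eq) (auto simp: card_image order_def)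
    then show ?thesis using that by (simp add: bij_betw_def)
  qed
  show ?thesis
  proof (cases "\<exists>g \<in> carrier G. ord g = 4")
    case True
    then obtain g where g: "g \<in> carrier G" "ord g = 4" by auto
    define qn :: "q4 \<Rightarrow> nat" where "qn = case_q4 0 1 2 3"
    have qa: "qn (x + y) = (qn x + qn y) mod 4" for x y by (cases x; cases y) (simp_all add: qn_def)
    have qi: "qn x = qn y \<longleftrightarrow> x = y" for x y by (cases x; cases y) (simp_all add: qn_def)
    have ql: "qn x < 4" for x by (cases x) (simp_all add: qn_def)
    have "inj (\<lambda>x. g [^] qn x)"
    proof (rule injI)
      fix x y assume e: "g [^] qn x = g [^] qn y"
      have "qn x = qn y" by (rule inj_onD[OF inj_pows[OF g] e]) (simp_all add: ql)
      then show "x = y" using qi by blast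
    qed
    moreover have "g [^] qn (x + y) = g [^] qn x \<otimes> g [^] qn y" for x y
      using pow_mod_ord[OF g(1), of "qn x + qn y"] g by (simp add: qa nat_pow_mult)
    ultimately show ?thesis using bij[of "\<lambda>x. g [^] qn x"] g by auto
  next
    case False
    have sq: "x \<otimes> x = \<one>" if x: "x \<in> carrier G" for x
    proof -
      have d: "ord x dvd 4" using ord_dvd_group_order[OF x] o by simp
      then have "ord x \<le> 4" by (rule dvd_imp_le) simp
      moreover have "ord x \<noteq> 3" using d by auto
      moreover have "ord x \<noteq> 4" using False x by blast
      moreover have "ord x \<noteq> 0" using ord_ge_1[OF f x] by simp
      ultimately have "ord x = 1 \<or> ord x = 2" by linarith
      then have "ord x dvd 2" by auto
      then have "x [^] (2::nat) = \<one>" using pow_eq_id x by blast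
      then show ?thesis using x by (simp add: numeral_2_eq_2)
    qed
    have comm: "x \<otimes> y = y \<otimes> x" if "x \<in> carrier G" "y \<in> carrier G" for x y
    proof -
      have i: "inv z = z" if "z \<in> carrier G" for z using sq[OF that] that by (intro inv_equality)
      show ?thesis using i[of "x \<otimes> y"] i[of x] i[of y] that inv_mult_group[of x y] by simp
    qed
    have "\<exists>a \<in> carrier G. a \<noteq> \<one>"
    proof (rule ccontr)
      assume "\<not> ?thesis"
      then have "carrier G \<subseteq> {\<one>}" by auto
      then have "card (carrier G) \<le> card {\<one>}" by (intro card_mono) auto
      then show False using o by (simp add: order_def)
    qed
    then obtain a where a: "a \<in> carrier G" "a \<noteq> \<one>" by auto
    have "\<exists>b \<in> carrier G. b \<notin> {\<one>, a}"
    proof (rule ccontr)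
      assume "\<not> ?thesis"
      then have "carrier G \<subseteq> {\<one>, a}" by auto
      then have "card (carrier G) \<le> card {\<one>, a}" by (intro card_mono) auto
      then show False using o a by (simp add: order_def)
    qed
    then obtain b where b: "b \<in> carrier G" "b \<noteq> \<one>" "b \<noteq> a" by auto
    define f where "f = case_q4 \<one> a b (a \<otimes> b)"
    have ab: "a \<otimes> b \<noteq> \<one>" "a \<otimes> b \<noteq> a" "a \<otimes> b \<noteq> b"
      using a b sq[of a] l_cancel_one'[of a b] r_cancel_one'[of b a] by (metis inv_equality inv_inv, auto)
    have l: "x \<otimes> (x \<otimes> y) = y" if "x \<in> carrier G" "y \<in> carrier G" for x y
      using that sq[of x] by (simp flip: m_assoc)
    have lc: "x \<otimes> (y \<otimes> z) = y \<otimes> (x \<otimes> z)" if "x \<in> carrier G" "y \<in> carrier G" "z \<in> carrier G" for x y z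
      using that comm[of x y] by (simp flip: m_assoc)
    have "inj f"
    proof (rule injI)
      fix x y assume "f x = f y" then show "x = y"
        using a b ab by (cases x; cases y) (auto simp: f_def)
    qed
    moreover have "f x \<in> carrier G" for x using a b by (cases x) (auto simp: f_def)
    moreover have "f (xor4 x y) = f x \<otimes> f y" for x y
      using a b sq[of a] sq[of b] l[of a b] l[of b a] comm[of a b] comm[of "a \<otimes> b" a] comm[of "a \<otimes> b" b] sq[of "a \<otimes> b"]
      by (cases x; cases y) (simp_all add: f_def)
    ultimately show ?thesis using bij[of f] by auto
  qed
qed

lemma in_fis: "i \<in> set fis" by (cases i) (simp_all add: fis_def)

theorem order4_brace:
  assumes F: "skew_left_brace F" "finite (carrier F)" "card (carrier F) = 4"
  shows "\<exists>i. sbi (fbr i) F"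
proof -
  interpret F: skew_left_brace F by fact
  obtain f where b: "bij_betw f UNIV (carrier F)"
    and m: "(\<forall>x y. f (x + y) = f x \<otimes>\<^bsub>F\<^esub> f y) \<or> (\<forall>x y. f (xor4 x y) = f x \<otimes>\<^bsub>F\<^esub> f y)"
    using F.order4 F by (auto simp: order_def)
  have key: "\<exists>i. sbi (fbr i) F" if m: "\<And>x y. f (m x y) = f x \<otimes>\<^bsub>F\<^esub> f y" and c: "chk4 m (auts4 m) i j"
    and ij: "\<And>x y. fadd i x y = m x y" "\<And>x y. fadd j x y = m x y" for m i j
  proof -
    obtain L where L': "(\<forall>a. inj (L a)) \<and> (\<forall>a x y. L a (m x y) = m (L a x) (L a y)) \<and>
    (\<forall>a b c. L (m a (L a b)) c = L a (L b c)) \<and> (\<forall>a b. f (m a (L a b)) = f a \<odot>\<^bsub>F\<^esub> f b)"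
      by (rule exE[OF F.transport_lam[where f = f and m = m, OF b m]])
    note L = L'[THEN conjunct1, rule_format] L'[THEN conjunct2, THEN conjunct1, rule_format]
      L'[THEN conjunct2, THEN conjunct2, THEN conjunct1, rule_format] L'[THEN conjunct2, THEN conjunct2, THEN conjunct2, rule_format]
    define l where "l x = L4 (L x)" for x
    have la: "l x \<in> set (auts4 m)" for x unfolding l_def by (rule L4_auts4[where f = "L x" and m = m, OF L(1)[of x] L(2)[of x]])
    have ll: "fn4 (fn4 [l Q0, l Q1, l Q2, l Q3] a) b = L a b" for a b by (cases a) (simp_all add: l_def)
    have "list_ex (\<lambda>\<psi>. (\<forall>x y. fn4 \<psi> (L x y) = flam i (fn4 \<psi> x) (fn4 \<psi> y)) \<or>
                  (\<forall>x y. fn4 \<psi> (L x y) = flam j (fn4 \<psi> x) (fn4 \<psi> y))) (auts4 m)"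
    proof -
      have "(\<forall>a b c. fn4 (fn4 [l Q0, l Q1, l Q2, l Q3] (m a (fn4 (fn4 [l Q0, l Q1, l Q2, l Q3] a) b))) c
         = fn4 (fn4 [l Q0, l Q1, l Q2, l Q3] a) (fn4 (fn4 [l Q0, l Q1, l Q2, l Q3] b) c)) \<longrightarrow>
        list_ex (\<lambda>\<psi>. (\<forall>x y. fn4 \<psi> (fn4 (fn4 [l Q0, l Q1, l Q2, l Q3] x) y) = flam i (fn4 \<psi> x) (fn4 \<psi> y)) \<or>
                  (\<forall>x y. fn4 \<psi> (fn4 (fn4 [l Q0, l Q1, l Q2, l Q3] x) y) = flam j (fn4 \<psi> x) (fn4 \<psi> y))) (auts4 m)"
        by (rule c[unfolded chk4_def list_all_iff, THEN bspec, OF la[of Q0], THEN bspec, OF la[of Q1],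
              THEN bspec, OF la[of Q2], THEN bspec, OF la[of Q3]])
      then show ?thesis unfolding ll using L(3) by simp
    qed
    then obtain \<psi> k where \<psi>: "\<psi> \<in> set (auts4 m)" and k: "\<And>x y. fadd k x y = m x y"
      "\<And>x y. fn4 \<psi> (L x y) = flam k (fn4 \<psi> x) (fn4 \<psi> y)"
      using ij unfolding list_ex_iff by blast
    have \<psi>h: "fn4 \<psi> (m x y) = m (fn4 \<psi> x) (fn4 \<psi> y)" for x y using \<psi> by (simp add: auts4_def)
    have "distinct (L4 (fn4 \<psi>))" using \<psi> lists4_L4[of \<psi> q4s] by (simp add: auts4_def)
    then have inj: "inj (fn4 \<psi>)" by (intro injI; rename_tac x y; case_tac x; case_tac y) (simp_all add: L4_def)
    then have \<psi>b: "bij (fn4 \<psi>)" by (simp add: bij_def finite_UNIV_inj_surj)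
    \<comment> \<open>Changing the labelling \<open>f\<close> by \<open>\<psi>\<close> turns the
      lambda maps \<open>L\<close> into \<open>flam k\<close>.\<close>
    define g where "g = f \<circ> inv_into UNIV (fn4 \<psi>)"
    have gf: "g (fn4 \<psi> x) = f x" for x using inj by (simp add: g_def)
    have "g \<in> skew_brace_iso (fbr k) F"
    proof (rule sbiI)
      show "bij_betw g (carrier (fbr k)) (carrier F)"
        unfolding g_def using bij_betw_trans[OF bij_imp_bij_inv[OF \<psi>b] b] by simp
      fix x y
      obtain x' y' where *: "x = fn4 \<psi> x'" "y = fn4 \<psi> y'" using \<psi>b by (metis bij_pointE)
      have "g (fadd k x y) = g (fn4 \<psi> (m x' y'))" by (simp add: * k \<psi>h)
      also have "\<dots> = g x \<otimes>\<^bsub>F\<^esub> g y" by (simp add: * gf m)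
      finally show "g (x \<otimes>\<^bsub>fbr k\<^esub> y) = g x \<otimes>\<^bsub>F\<^esub> g y" by simp
      have "g (fcirc k x y) = g (fn4 \<psi> (m x' (L x' y')))" by (simp add: * fcirc_def k \<psi>h)
      also have "\<dots> = g x \<odot>\<^bsub>F\<^esub> g y" by (simp add: * gf L(4))
      finally show "g (x \<odot>\<^bsub>fbr k\<^esub> y) = g x \<odot>\<^bsub>F\<^esub> g y" by simp
    qed
    then show ?thesis by (auto simp: sbi_def)
  qed
  from m show ?thesis
  proof
    assume "\<forall>x y. f (x + y) = f x \<otimes>\<^bsub>F\<^esub> f y"
    then show ?thesis using key[of "(+)" F0 F2] chk4_add by simp
  next
    assume "\<forall>x y. f (xor4 x y) = f x \<otimes>\<^bsub>F\<^esub> f y"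
    then show ?thesis using key[of xor4 F1 F3] chk4_xor by simp
  qed
qed

lemma ecirc8: "j \<noteq> Gx \<Longrightarrow> ecirc j x y = mulA x (ap (Lam j x) y)" "j \<noteq> Gx \<Longrightarrow> eadd j x y = mulA x y"
  by (cases j; simp)+

theorem A4_add_brace:
  assumes E: "skew_left_brace E" and b: "bij_betw f UNIV (carrier E)" and m: "\<And>x y. f (mulA x y) = f x \<otimes>\<^bsub>E\<^esub> f y"
  shows "\<exists>j. sbi (ebr j) E"
proof -
  interpret E: skew_left_brace E by fact
  obtain L where L': "(\<forall>a. inj (L a)) \<and> (\<forall>a x y. L a (mulA x y) = mulA (L a x) (L a y)) \<and>
    (\<forall>a b c. L (mulA a (L a b)) c = L a (L b c)) \<and> (\<forall>a b. f (mulA a (L a b)) = f a \<odot>\<^bsub>E\<^esub> f b)"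
      by (rule exE[OF E.transport_lam[where f = f and m = mulA, OF b m]])
    note L = L'[THEN conjunct1, rule_format] L'[THEN conjunct2, THEN conjunct1, rule_format]
      L'[THEN conjunct2, THEN conjunct2, THEN conjunct1, rule_format] L'[THEN conjunct2, THEN conjunct2, THEN conjunct2, rule_format]
  have "\<forall>a. \<exists>c. L a = ap c" using ap_unique[where f = "L a" for a, OF L(1) L(2)] by blast
  then obtain \<Lambda> where \<Lambda>: "\<And>a. L a = ap (\<Lambda> a)" by metis
  have \<Lambda>m: "\<Lambda> (mulA a (ap (\<Lambda> a) b)) = cmp (\<Lambda> a) (\<Lambda> b)" for a b
    by (rule ap_props(2)) (use L(3)[of a b] in \<open>simp add: \<Lambda> flip: ap_props(1)\<close>)
  have \<Lambda>0: "\<Lambda> (AA Q0 T0) = AF Q0 T0 False"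
  proof (rule ap_props(2), rule allI)
    fix y
    have "f (AA Q0 T0) = \<one>\<^bsub>E\<^esub>"
    proof -
      have "f (AA Q0 T0) \<in> carrier E" using b by (auto simp: bij_betw_def)
      moreover have "f (AA Q0 T0) \<otimes>\<^bsub>E\<^esub> f (AA Q0 T0) = f (AA Q0 T0)" using m[of "AA Q0 T0" "AA Q0 T0"] by simp
      ultimately show ?thesis using E.r_cancel_one' by simp
    qed
    moreover have "f y \<in> carrier E" using b by (auto simp: bij_betw_def)
    ultimately have "f (mulA (AA Q0 T0) (L (AA Q0 T0) y)) = f y" using L(4)[of "AA Q0 T0" y] by simp
    then have "mulA (AA Q0 T0) (L (AA Q0 T0) y) = y" using b by (auto simp: bij_betw_def inj_eq)
    then have "ap (\<Lambda> (AA Q0 T0)) y = y" using \<Lambda> by (cases "L (AA Q0 T0) y") simp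
    moreover have "ap (AF Q0 T0 False) y = y" by (cases y; rename_tac v s; case_tac v; case_tac s) simp_all
    ultimately show "ap (\<Lambda> (AA Q0 T0)) y = ap (AF Q0 T0 False) y" by simp
  qed
  have "\<exists>L' \<in> set (srch (\<lambda>a f b. mulA a (ap f b)) cmp auts (Suc 199) els [(AA Q0 T0, AF Q0 T0 False)]).
    \<forall>k. map_of L' k = Some (\<Lambda> k)"
    by (rule srch_total) (use \<Lambda>m \<Lambda>0 set_auts in_els in auto)
  then obtain L' where L': "L' \<in> set (srch (\<lambda>a f b. mulA a (ap f b)) cmp auts (Suc 199) els [(AA Q0 T0, AF Q0 T0 False)])"
    "\<And>k. map_of L' k = Some (\<Lambda> k)" by blast
  obtain j c where j: "j \<in> set gis8" and c: "list_all (\<lambda>(k, v). cmp (Lam j (ap c k)) c = cmp c v) L'"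
    using lam_search L'(1) unfolding list_all_iff[of _ "srch _ _ _ _ _ _"] list_ex_iff by blast
  have cL: "cmp (Lam j (ap c k)) c = cmp c (\<Lambda> k)" for k
    using c map_of_SomeD[OF L'(2)[of k]] unfolding list_all_iff by fastforce
  have jX: "j \<noteq> Gx" using j by (auto simp: gis8_def)
  define g where "g = f \<circ> inv_into UNIV (ap c)"
  have gf: "g (ap c x) = f x" for x using ap_props(3) by (simp add: g_def)
  have "g \<in> skew_brace_iso (ebr j) E"
  proof (rule sbiI)
    show "bij_betw g (carrier (ebr j)) (carrier E)"
      unfolding g_def using bij_betw_trans[OF bij_imp_bij_inv[OF bij_ap] b] by simp
    fix x y
    obtain x' y' where *: "x = ap c x'" "y = ap c y'" using bij_ap by (metis bij_pointE)
    show "g (x \<otimes>\<^bsub>ebr j\<^esub> y) = g x \<otimes>\<^bsub>E\<^esub> g y"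
      by (simp add: * ecirc8[OF jX] gf m flip: ap_props(4))
    have "ecirc j x y = mulA (ap c x') (ap (cmp (Lam j (ap c x')) c) y')" by (simp add: * ecirc8[OF jX] ap_props(1))
    also have "\<dots> = ap c (mulA x' (ap (\<Lambda> x') y'))" by (simp add: cL ap_props(4) flip: ap_props(1))
    finally have "g (ecirc j x y) = f (mulA x' (L x' y'))" by (simp add: gf \<Lambda>)
    then show "g (x \<odot>\<^bsub>ebr j\<^esub> y) = g x \<odot>\<^bsub>E\<^esub> g y" by (simp add: L(4) * gf)
  qed
  then show ?thesis by (auto simp: sbi_def)
qed

text \<open>Consequently every homomorphism from this group to a group of exponent two is trivial,
  in particular every character into the units modulo 3.\<close>

lemma A4_two_squares: "\<forall>x. \<exists>y z. x = mulA (mulA y y) (mulA z z)" by code_simp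

lemma A4_order3_conj: "\<forall>u s. s = T0 \<or> list_ex (\<lambda>c. ap c (AA Q0 T1) = AA u s) auts" by code_simp

text \<open>The general table of an operation on \<open>q4\<close> with neutral element
  \<open>Q0\<close> and automorphism \<open>rot T1\<close>: the products of \<open>Q1\<close> with
  \<open>Q1\<close>, \<open>Q2\<close>, \<open>Q3\<close> are free, and rotation gives the
  others.\<close>

fun tab4 :: "q4 \<Rightarrow> q4 \<Rightarrow> q4 \<Rightarrow> q4 \<Rightarrow> q4 \<Rightarrow> q4" where
  "tab4 x y z Q0 w = w" | "tab4 x y z Q1 Q0 = Q1" | "tab4 x y z Q2 Q0 = Q2" | "tab4 x y z Q3 Q0 = Q3"
| "tab4 x y z Q1 Q1 = x" | "tab4 x y z Q1 Q2 = y" | "tab4 x y z Q1 Q3 = z"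
| "tab4 x y z Q2 Q2 = rot T1 x" | "tab4 x y z Q2 Q3 = rot T1 y" | "tab4 x y z Q2 Q1 = rot T1 z"
| "tab4 x y z Q3 Q3 = rot T2 x" | "tab4 x y z Q3 Q1 = rot T2 y" | "tab4 x y z Q3 Q2 = rot T2 z"

lemma tab4_group: "\<forall>x y z. (\<forall>a b c. tab4 x y z a b = tab4 x y z a c \<longrightarrow> b = c) \<and>
    (\<forall>a b c. tab4 x y z (tab4 x y z a b) c = tab4 x y z a (tab4 x y z b c)) \<longrightarrow> x = Q0 \<and> y = Q3 \<and> z = Q2"
  by code_simp

text \<open>A group operation on \<open>q4\<close> with neutral element \<open>Q0\<close> admitting the automorphism \<open>rot T1\<close> of order
  three is determined.\<close>

lemma op4_eq_xor4:
  assumes id: "\<And>a. m Q0 a = a" "\<And>a. m a Q0 = a" and canc: "\<And>a b c. m a b = m a c \<Longrightarrow> b = c"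
    and assoc: "\<And>a b c. m (m a b) c = m a (m b c)" and r: "\<And>a b. rot T1 (m a b) = m (rot T1 a) (rot T1 b)"
  shows "m a b = xor4 a b"
proof -
  have rr: "rot T2 x = rot T1 (rot T1 x)" for x by (cases x) simp_all
  have t: "m a b = tab4 (m Q1 Q1) (m Q1 Q2) (m Q1 Q3) a b" for a b
    by (cases a; cases b) (simp_all add: id rr r)
  have "m Q1 Q1 = Q0 \<and> m Q1 Q2 = Q3 \<and> m Q1 Q3 = Q2"
    using tab4_group[rule_format, of "m Q1 Q1" "m Q1 Q2" "m Q1 Q3"] canc assoc unfolding t[symmetric] by blast
  then show ?thesis unfolding t[of a b] by (cases a; cases b) simp_all
qed

text \<open>Characters of the circle group modulo 3 are trivial, so \<open>g\<close> is additively
  central and fixed by every \<open>lam a\<close>. The crossed homomorphism \<open>ee\<close> then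
  becomes a homomorphism to the residues modulo 3 on both groups, whose kernel is the Klein subgroup
  of the circle group. There \<open>lam g\<close> acts as a rotation, which forces the addition of
  the kernel to be \<open>xor4\<close>; the additive group is its direct product with the powers of
  \<open>g\<close>.\<close>

theorem A4_circ_brace:
  assumes E: "skew_left_brace E" "finite (carrier E)" "card (carrier E) = 12" and g: "group.npsyl E 3 g"
    and b: "bij_betw f UNIV (carrier E)" and m: "\<And>x y. f (mulA x y) = f x \<odot>\<^bsub>E\<^esub> f y"
  shows "sbi (ebr Gx) E"
proof -
  interpret E: skew_left_brace E by fact
  have cop: "coprime (4::nat) 3" using coprime_Suc_left_nat[of 3] by simp
  interpret N: psyl E 3 4 g by unfold_locales (use E g cop in \<open>auto simp: order_def\<close>)
  interpret H: brace_half E 3 4 g by unfold_locales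
  have fc [simp]: "f x \<in> carrier E" for x using b by (auto simp: bij_betw_def)
  have fi: "f x = f y \<longleftrightarrow> x = y" for x y using b by (auto simp: bij_betw_def inj_eq)
  have fs: "\<exists>x. a = f x" if "a \<in> carrier E" for a using b that by (auto simp: bij_betw_def)
  have trivial: "[h a = 1] (mod int 3)" if hm: "\<And>a b. a \<in> carrier E \<Longrightarrow> b \<in> carrier E \<Longrightarrow> [h (a \<odot>\<^bsub>E\<^esub> b) = h a * h b] (mod int 3)"
    and hu: "\<And>a. a \<in> carrier E \<Longrightarrow> coprime (h a) (int 3)" and a: "a \<in> carrier E" for h :: "_ \<Rightarrow> int" and a
  proof -
    have sq: "[h (c \<odot>\<^bsub>E\<^esub> c) = 1] (mod int 3)" if c: "c \<in> carrier E" for c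
    proof -
      have "\<not> 3 dvd h c"
      proof
        assume "3 dvd h c"
        then have "is_unit (3::int)" using coprime_common_divisor[OF hu[OF c], of 3] by simp
        then show False by simp
      qed
      then have "h c mod 3 = 1 \<or> h c mod 3 = 2" by presburger
      then have "(h c * h c) mod 3 = 1" using mod_mult_eq[of "h c" 3 "h c"] by auto
      then have 1: "[h c * h c = 1] (mod int 3)" by (simp add: cong_def)
      show ?thesis by (rule cong_trans[OF hm[OF c c] 1])
    qed
    obtain x where x: "a = f x" using fs[OF a] by blast
    obtain y z where "x = mulA (mulA y y) (mulA z z)" using A4_two_squares by blast
    then have ax: "a = (f y \<odot>\<^bsub>E\<^esub> f y) \<odot>\<^bsub>E\<^esub> (f z \<odot>\<^bsub>E\<^esub> f z)" by (simp add: x m)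
    have "[h a = h (f y \<odot>\<^bsub>E\<^esub> f y) * h (f z \<odot>\<^bsub>E\<^esub> f z)] (mod int 3)" unfolding ax by (rule hm) simp_all
    also have "[h (f y \<odot>\<^bsub>E\<^esub> f y) * h (f z \<odot>\<^bsub>E\<^esub> f z) = 1 * 1] (mod int 3)" by (intro cong_mult sq fc)
    finally show ?thesis by simp
  qed
  have sg1: "[H.sg a = 1] (mod int 3)" if "a \<in> carrier E" for a
    by (rule trivial[of H.sg, OF H.sg_circ H.sg_coprime that])
  have lg: "E.lam a g = g" if "a \<in> carrier E" for a
    using H.lam_g[OF that, of 1] sg1[OF that] N.pow_iff[of "H.sg a" 1] by simp
  have tau_lam: "[N.chi (E.lam a c) = N.chi c] (mod int 3)" if ac: "a \<in> carrier E" "c \<in> carrier E" for a c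
  proof -
    have "E.lam a c \<otimes>\<^bsub>E\<^esub> g = E.lam a (c \<otimes>\<^bsub>E\<^esub> g)" using ac lg by (simp add: E.lam_mult)
    also have "\<dots> = E.lam a (g [^]\<^bsub>E\<^esub> N.chi c \<otimes>\<^bsub>E\<^esub> c)" using N.int_pow_comm_cj[of c 1] ac by simp
    also have "\<dots> = g [^]\<^bsub>E\<^esub> N.chi c \<otimes>\<^bsub>E\<^esub> E.lam a c" using ac lg by (simp add: E.lam_mult E.lam_pow)
    finally show ?thesis using ac by (intro N.chi_uniq) simp_all
  qed
  have tau1: "[N.chi a = 1] (mod int 3)" if "a \<in> carrier E" for a
  proof (rule trivial[of N.chi, OF _ N.chi_coprime that])
    fix a c assume ac: "a \<in> carrier E" "c \<in> carrier E"
    have "[N.chi (a \<otimes>\<^bsub>E\<^esub> E.lam a c) = N.chi a * N.chi (E.lam a c)] (mod int 3)" using ac by (intro N.chi_mult) simp_all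
    also have "[N.chi a * N.chi (E.lam a c) = N.chi a * N.chi c] (mod int 3)" by (intro cong_scalar_left tau_lam ac)
    finally show "[N.chi (a \<odot>\<^bsub>E\<^esub> c) = N.chi a * N.chi c] (mod int 3)" using ac by (simp add: E.circ_lam)
  qed
  have central: "a \<otimes>\<^bsub>E\<^esub> g = g \<otimes>\<^bsub>E\<^esub> a" if a: "a \<in> carrier E" for a
    using N.int_pow_comm_cj[OF a, of 1] tau1[OF a] N.pow_iff[of "N.chi a" 1] by simp
  define e where "e = N.ee"
  have em: "[e (a \<otimes>\<^bsub>E\<^esub> c) = e a + e c] (mod int 3)" if "a \<in> carrier E" "c \<in> carrier E" for a c
  proof -
    have "[e (a \<otimes>\<^bsub>E\<^esub> c) = e a + N.chi a * e c] (mod int 3)" unfolding e_def by (rule N.ee_mult[OF that])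
    also have "[e a + N.chi a * e c = e a + 1 * e c] (mod int 3)" by (intro cong_add cong_mult cong_refl tau1 that)
    finally show ?thesis by simp
  qed
  have eg: "[e (g [^]\<^bsub>E\<^esub> (i::int)) = i] (mod int 3)" for i unfolding e_def by (rule N.ee_pow)
  have el: "[e (E.lam a c) = e c] (mod int 3)" if a: "a \<in> carrier E" and c: "c \<in> carrier E" for a c
  proof -
    \<comment> \<open>The failure of invariance under \<open>lam a\<close> is a crossed homomorphism
      vanishing on \<open>g\<close>, hence a multiple of \<open>1 - chi\<close>, which is zero
      here.\<close>
    define D where "D x = e (E.lam a x) - e x" for x
    have "\<exists>v::int. \<forall>x \<in> carrier E. [D x = v * (1 - N.chi x)] (mod int 3)"
    proof (rule N.coboundary)
      fix x y assume xy: "x \<in> carrier E" "y \<in> carrier E"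
      have "[D (x \<otimes>\<^bsub>E\<^esub> y) = (e (E.lam a x) + e (E.lam a y)) - (e x + e y)] (mod int 3)"
        unfolding D_def E.lam_mult[OF a xy] by (intro cong_diff em) (use xy a in simp_all)
      also have "(e (E.lam a x) + e (E.lam a y)) - (e x + e y) = D x + 1 * D y" by (simp add: D_def)
      also have "[D x + 1 * D y = D x + N.chi x * D y] (mod int 3)"
        by (intro cong_add cong_mult cong_refl cong_sym[OF tau1] xy)
      finally show "[D (x \<otimes>\<^bsub>E\<^esub> y) = D x + N.chi x * D y] (mod int 3)" .
    next
      show "[D (g [^]\<^bsub>E\<^esub> i) = 0] (mod int 3)" for i :: int
        using lg[OF a] a by (simp add: D_def E.lam_pow)
    qed
    then obtain v where v: "[D c = v * (1 - N.chi c)] (mod int 3)" using c by blast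
    also have "[v * (1 - N.chi c) = v * (1 - 1)] (mod int 3)" by (intro cong_mult cong_diff cong_refl tau1 c)
    finally show ?thesis by (simp add: D_def cong_diff_iff_cong_0)
  qed
  have ec: "[e (a \<odot>\<^bsub>E\<^esub> c) = e a + e c] (mod int 3)" if "a \<in> carrier E" "c \<in> carrier E" for a c
  proof -
    have "[e (a \<otimes>\<^bsub>E\<^esub> E.lam a c) = e a + e (E.lam a c)] (mod int 3)" using that by (intro em) simp_all
    also have "[e a + e (E.lam a c) = e a + e c] (mod int 3)" by (intro cong_add cong_refl el that)
    finally show ?thesis using that by (simp add: E.circ_lam)
  qed
  have f1: "f idA = \<one>\<^bsub>E\<^esub>"
  proof -
    have "f idA \<odot>\<^bsub>E\<^esub> f idA = f idA" using m[of idA idA] by (simp add: idA_def)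
    then show ?thesis using E.C.r_cancel_one'[of "f idA" "f idA"] by (simp add: one_circ E.circ_one_eq)
  qed
  have e1: "[e \<one>\<^bsub>E\<^esub> = 0] (mod int 3)" using eg[of 0] by simp
  \<comment> \<open>These elements have trivial circle square, and 2 is invertible modulo 3.\<close>
  have eV: "[e (f (AA v T0)) = 0] (mod int 3)" for v
  proof -
    have "mulA (AA v T0) (AA v T0) = idA" by (cases v) (simp_all add: idA_def)
    then have "f (AA v T0) \<odot>\<^bsub>E\<^esub> f (AA v T0) = \<one>\<^bsub>E\<^esub>" using m[of "AA v T0" "AA v T0"] f1 by simp
    then have "[e \<one>\<^bsub>E\<^esub> = e (f (AA v T0)) + e (f (AA v T0))] (mod 3)"
      using ec[of "f (AA v T0)" "f (AA v T0)"] by simp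
    then have "[e (f (AA v T0)) + e (f (AA v T0)) = 0] (mod 3)" using cong_trans[OF cong_sym] e1 by simp
    then show ?thesis unfolding cong_def by presburger
  qed
  obtain u s where us: "g = f (AA u s)" using fs[OF N.gc] by (metis a4.exhaust)
  have "s \<noteq> T0"
  proof
    assume "s = T0"
    then have "[e g = 0] (mod int 3)" using eV us by simp
    moreover have "[e g = 1] (mod int 3)" using eg[of 1] by simp
    ultimately show False unfolding cong_def by simp
  qed
  \<comment> \<open>The preimage of \<open>g\<close> lies outside the Klein part, so an automorphism
    of \<open>mulA\<close> takes \<open>AA Q0 T1\<close> to it; after relabelling, \<open>g\<close>
    is the standard rotation.\<close>
  then obtain c where c: "ap c (AA Q0 T1) = AA u s" using A4_order3_conj unfolding list_ex_iff by blast
  define h where "h x = f (ap c x)" for x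
  have hg: "h (AA Q0 T1) = g" by (simp add: h_def c us)
  have hm: "h (mulA x y) = h x \<odot>\<^bsub>E\<^esub> h y" for x y by (simp add: h_def ap_props(4) m)
  have hb: "bij_betw h UNIV (carrier E)"
    using bij_betw_trans[OF bij_ap b] by (simp add: h_def[abs_def] comp_def)
  have hc [simp]: "h x \<in> carrier E" for x by (simp add: h_def)
  have hi: "h x = h y \<longleftrightarrow> x = y" for x y using ap_props(3) by (auto simp: h_def fi inj_eq)
  have apV: "\<exists>v'. ap c (AA v T0) = AA v' T0" for v by (cases c; rename_tac w k b; case_tac b) simp_all
  have h1: "h (AA Q0 T0) = \<one>\<^bsub>E\<^esub>"
  proof -
    have "h (AA Q0 T0) \<odot>\<^bsub>E\<^esub> h (AA Q0 T0) = h (AA Q0 T0)" using hm[of "AA Q0 T0" "AA Q0 T0"] by simp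
    then show ?thesis using E.C.r_cancel_one'[of "h (AA Q0 T0)" "h (AA Q0 T0)"] by (simp add: one_circ E.circ_one_eq)
  qed
  have hV: "[e (h (AA v T0)) = 0] (mod int 3)" for v using eV apV[of v] by (auto simp: h_def)
  have circ_g: "a \<odot>\<^bsub>E\<^esub> g = a \<otimes>\<^bsub>E\<^esub> g" if "a \<in> carrier E" for a using lg[OF that] that by (simp add: E.circ_lam)
  have hA: "h (AA v s) = h (AA v T0) \<otimes>\<^bsub>E\<^esub> g [^]\<^bsub>E\<^esub> tn s" for v s
  proof (cases s)
    case T0 then show ?thesis by simp
  next
    case T1
    have "h (AA v T1) = h (AA v T0) \<odot>\<^bsub>E\<^esub> g" using hm[of "AA v T0" "AA Q0 T1"] by (simp add: hg) (cases v; simp)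
    then show ?thesis using T1 by (simp add: circ_g)
  next
    case T2
    have "h (AA v T2) = (h (AA v T0) \<odot>\<^bsub>E\<^esub> g) \<odot>\<^bsub>E\<^esub> g"
      using hm[of "mulA (AA v T0) (AA Q0 T1)" "AA Q0 T1"] hm[of "AA v T0" "AA Q0 T1"] by (simp add: hg) (cases v; simp)
    then show ?thesis using T2 by (simp add: circ_g E.m_assoc numeral_2_eq_2)
  qed
  have ker: "\<exists>v. a = h (AA v T0)" if a: "a \<in> carrier E" and ea: "[e a = 0] (mod int 3)" for a
  proof -
    have "a \<in> range h" using hb a by (simp add: bij_betw_def)
    then obtain x where "a = h x" by blast
    then obtain v s where vs: "a = h (AA v s)" by (cases x) blast
    have "[e a = e (h (AA v T0)) + e (g [^]\<^bsub>E\<^esub> int (tn s))] (mod int 3)"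
      unfolding vs hA[of v s] int_pow_int[symmetric] by (rule em) simp_all
    also have "[e (h (AA v T0)) + e (g [^]\<^bsub>E\<^esub> int (tn s)) = 0 + int (tn s)] (mod int 3)"
      by (intro cong_add hV eg)
    finally have "[e a = 0 + int (tn s)] (mod int 3)" .
    then have "[0 = int (tn s)] (mod 3)" using cong_trans[OF cong_sym[OF ea]] by simp
    then have "s = T0" by (cases s) (simp_all add: cong_def)
    then show ?thesis using vs by blast
  qed
  define \<phi> where "\<phi> v = h (AA v T0)" for v
  have \<phi>c [simp]: "\<phi> v \<in> carrier E" for v by (simp add: \<phi>_def)
  have \<phi>i: "\<phi> v = \<phi> w \<longleftrightarrow> v = w" for v w by (simp add: \<phi>_def hi)
  have "\<exists>w. \<phi> v \<otimes>\<^bsub>E\<^esub> \<phi> w' = \<phi> w" for v w'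
  proof -
    have "[e (\<phi> v \<otimes>\<^bsub>E\<^esub> \<phi> w') = e (\<phi> v) + e (\<phi> w')] (mod int 3)" by (rule em) simp_all
    also have "[e (\<phi> v) + e (\<phi> w') = 0 + 0] (mod int 3)" unfolding \<phi>_def by (intro cong_add hV)
    finally show ?thesis using ker[of "\<phi> v \<otimes>\<^bsub>E\<^esub> \<phi> w'"] by (simp add: \<phi>_def)
  qed
  then obtain mm where mm: "\<And>v w. \<phi> v \<otimes>\<^bsub>E\<^esub> \<phi> w = \<phi> (mm v w)" by metis
  have lr: "E.lam g (\<phi> v) = \<phi> (rot T1 v)" for v
  proof -
    have "g \<otimes>\<^bsub>E\<^esub> E.lam g (\<phi> v) = h (AA Q0 T1) \<odot>\<^bsub>E\<^esub> h (AA v T0)" by (simp add: hg E.circ_lam \<phi>_def)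
    also have "\<dots> = h (AA (rot T1 v) T1)" by (simp flip: hm)
    also have "\<dots> = g \<otimes>\<^bsub>E\<^esub> \<phi> (rot T1 v)" using hA[of "rot T1 v" T1] central[of "\<phi> (rot T1 v)"] by (simp add: \<phi>_def)
    finally show ?thesis by simp
  qed
  have \<phi>0: "\<phi> Q0 = \<one>\<^bsub>E\<^esub>" by (simp add: \<phi>_def h1)
  have mx: "mm v w = xor4 v w" for v w
  proof (rule op4_eq_xor4)
    show "mm Q0 a = a" "mm a Q0 = a" for a unfolding \<phi>i[symmetric] mm[symmetric] by (simp_all add: \<phi>0)
    show "b = c" if "mm a b = mm a c" for a b c
    proof -
      have "\<phi> a \<otimes>\<^bsub>E\<^esub> \<phi> b = \<phi> a \<otimes>\<^bsub>E\<^esub> \<phi> c" using that by (simp add: mm)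
      then show ?thesis by (simp add: \<phi>i)
    qed
    show "mm (mm a b) c = mm a (mm b c)" for a b c
      unfolding \<phi>i[symmetric] mm[symmetric] by (simp add: E.m_assoc)
    show "rot T1 (mm a b) = mm (rot T1 a) (rot T1 b)" for a b
      unfolding \<phi>i[symmetric] mm[symmetric] lr[symmetric] by (simp add: E.lam_mult)
  qed
  have pc: "g [^]\<^bsub>E\<^esub> (k::nat) \<otimes>\<^bsub>E\<^esub> a = a \<otimes>\<^bsub>E\<^esub> g [^]\<^bsub>E\<^esub> k" if "a \<in> carrier E" for k a
  proof (induction k)
    case (Suc k)
    have gk: "g [^]\<^bsub>E\<^esub> k \<in> carrier E" by simp
    have "(g [^]\<^bsub>E\<^esub> k \<otimes>\<^bsub>E\<^esub> g) \<otimes>\<^bsub>E\<^esub> a = g [^]\<^bsub>E\<^esub> k \<otimes>\<^bsub>E\<^esub> (g \<otimes>\<^bsub>E\<^esub> a)" by (rule E.m_assoc[OF gk N.gc that])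
    also have "g \<otimes>\<^bsub>E\<^esub> a = a \<otimes>\<^bsub>E\<^esub> g" by (rule central[OF that, symmetric])
    also have "g [^]\<^bsub>E\<^esub> k \<otimes>\<^bsub>E\<^esub> (a \<otimes>\<^bsub>E\<^esub> g) = (g [^]\<^bsub>E\<^esub> k \<otimes>\<^bsub>E\<^esub> a) \<otimes>\<^bsub>E\<^esub> g" by (rule E.m_assoc[OF gk that N.gc, symmetric])
    also have "\<dots> = a \<otimes>\<^bsub>E\<^esub> (g [^]\<^bsub>E\<^esub> k \<otimes>\<^bsub>E\<^esub> g)" unfolding Suc by (rule E.m_assoc[OF that gk N.gc])
    finally show ?case by simp
  qed (use that in simp)
  have "h \<in> skew_brace_iso (ebr Gx) E"
  proof (rule sbiI)
    show "bij_betw h (carrier (ebr Gx)) (carrier E)" using hb by simp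
    fix x y
    obtain v s w t where xy: "x = AA v s" "y = AA w t" by (metis a4.exhaust)
    have gt: "g [^]\<^bsub>E\<^esub> tn (s + t) = g [^]\<^bsub>E\<^esub> tn s \<otimes>\<^bsub>E\<^esub> g [^]\<^bsub>E\<^esub> tn t"
      using E.pow_mod_ord[OF N.gc, of "tn s + tn t"] N.og by (simp add: tn_add E.nat_pow_mult)
    have "h x \<otimes>\<^bsub>E\<^esub> h y = \<phi> v \<otimes>\<^bsub>E\<^esub> (g [^]\<^bsub>E\<^esub> tn s \<otimes>\<^bsub>E\<^esub> \<phi> w) \<otimes>\<^bsub>E\<^esub> g [^]\<^bsub>E\<^esub> tn t"
      unfolding xy hA[of v s] hA[of w t] by (simp add: \<phi>_def E.m_assoc)
    also have "\<phi> v \<otimes>\<^bsub>E\<^esub> (g [^]\<^bsub>E\<^esub> tn s \<otimes>\<^bsub>E\<^esub> \<phi> w) \<otimes>\<^bsub>E\<^esub> g [^]\<^bsub>E\<^esub> tn t = (\<phi> v \<otimes>\<^bsub>E\<^esub> \<phi> w) \<otimes>\<^bsub>E\<^esub> (g [^]\<^bsub>E\<^esub> tn s \<otimes>\<^bsub>E\<^esub> g [^]\<^bsub>E\<^esub> tn t)"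
      unfolding pc[OF \<phi>c, of "tn s" w] by (simp add: E.m_assoc)
    also have "\<dots> = \<phi> (xor4 v w) \<otimes>\<^bsub>E\<^esub> g [^]\<^bsub>E\<^esub> tn (s + t)" unfolding mm mx gt by (rule refl)
    also have "\<dots> = h (mulX x y)" using hA[of "xor4 v w" "s + t"] by (simp add: xy \<phi>_def)
    finally show "h (x \<otimes>\<^bsub>ebr Gx\<^esub> y) = h x \<otimes>\<^bsub>E\<^esub> h y" by simp
    show "h (x \<odot>\<^bsub>ebr Gx\<^esub> y) = h x \<odot>\<^bsub>E\<^esub> h y" by (simp add: hm)
  qed
  then show ?thesis by (auto simp: sbi_def)
qed

theorem exotic_brace:
  assumes E: "skew_left_brace E" "finite (carrier E)" "card (carrier E) = 12"
    and no: "\<not> ((\<exists>g. group.npsyl E 3 g) \<and> (\<exists>g. group.npsyl (circ_group E) 3 g))"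
  shows "\<exists>j. sbi (ebr j) E"
proof -
  interpret E: skew_left_brace E by fact
  show ?thesis
  proof (cases "\<exists>g. E.npsyl 3 g")
    case False
    then obtain f where "bij_betw f UNIV (carrier E)" "\<forall>x y. f (mulA x y) = f x \<otimes>\<^bsub>E\<^esub> f y"
      using E.A4_model E by (auto simp: order_def)
    then show ?thesis using A4_add_brace[OF E(1)] by blast
  next
    case True
    then obtain g where g: "E.npsyl 3 g" by blast
    from True no have "\<nexists>g. E.C.npsyl 3 g" by blast
    then obtain f where "bij_betw f UNIV (carrier E)" "\<forall>x y. f (mulA x y) = f x \<odot>\<^bsub>E\<^esub> f y"
      using E.C.A4_model E by (auto simp: order_def)
    then have "sbi (ebr Gx) E" using A4_circ_brace[OF E g] by blast
    then show ?thesis by blast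
  qed
qed

section \<open>Decorated braces built from size four\<close>

text \<open>At the prime 3 the second component is constant, because \<open>D3 3 = {T0}\<close>; a
  decoration reduces to a list of signs.\<close>

definition E4 :: "q4 list \<Rightarrow> q4 \<Rightarrow> q4 \<times> t3" where "E4 a h = (fn4 a h, T0)"

text \<open>The multiple of \<open>\<alpha>\<close> by a residue \<open>x\<close> in 0, 1,
  2.\<close>

definition sm :: "t3 \<Rightarrow> int \<Rightarrow> t3" where "sm \<alpha> x = (if x = 0 then T0 else if x = 1 then \<alpha> else \<alpha> + \<alpha>)"

fun TT :: "q4 list \<Rightarrow> t3 \<Rightarrow> int \<times> q4 \<Rightarrow> q4 \<times> t3" where "TT c \<alpha> (x, h) = (fn4 c h, sm \<alpha> x)"

definition M3 where "M3 i k3 a b = mdl 3 k3 (fbr i) (E4 a) (E4 b)"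

fun OM where "OM p (kp, k3, i, (a, b, c, d), (\<alpha>, \<beta>)) = mdl p kp (M3 i k3 a b) (TT c \<alpha>) (TT d \<beta>)"

text \<open>All codes satisfying the homomorphism rules, before orbit representatives are chosen
  through \<open>qreps\<close> and \<open>abs3\<close>.\<close>

definition wf3 :: "bool \<Rightarrow> bool \<Rightarrow> fi \<Rightarrow> quad \<Rightarrow> t3 \<times> t3 \<Rightarrow> bool" where
  "wf3 df tf i q ab \<longleftrightarrow> (case q of (a, b, c, d) \<Rightarrow> case ab of (\<alpha>, \<beta>) \<Rightarrow> q \<in> set (quads i df) \<and>
     (b \<noteq> z4 \<longrightarrow> \<alpha> = T0 \<and> \<beta> = T0) \<and> (a \<noteq> z4 \<longrightarrow> \<alpha> = T0) \<and> (\<not> tf \<longrightarrow> \<alpha> = T0 \<and> \<beta> = T0))"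

lemma in_quads: "(a, b, c, d) \<in> set (quads i df) \<longleftrightarrow> a \<in> set (bhom4 i (dv False)) \<and> b \<in> set (hom4 (fcirc i) (dv False)) \<and>
    c \<in> set (bhom4 i (dv df)) \<and> d \<in> set (hom4 (fcirc i) (dv df))"
  by (auto simp: quads_def)

lemma in_hom4: "l \<in> set (hom4 m vs) \<longleftrightarrow> l \<in> set (lists4 vs) \<and> (\<forall>x y. fn4 l (m x y) = fn4 l x + fn4 l y)"
  by (auto simp: hom4_def)

lemma in_bhom4: "l \<in> set (bhom4 i vs) \<longleftrightarrow> l \<in> set (hom4 (fcirc i) vs) \<and> (\<forall>x y. fn4 l (fadd i x y) = fn4 l x + fn4 l y)"
  by (auto simp: bhom4_def)

lemma in_dv: "x \<in> set (dv df) \<longleftrightarrow> df \<or> x \<in> {Q0, Q2}"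
  by (cases df; cases x) (simp_all add: q4s_def)

lemma z4_iff: "l \<in> set (lists4 vs) \<Longrightarrow> l = z4 \<longleftrightarrow> (\<forall>h. fn4 l h = Q0)"
  using lists4_L4[of l vs] by (auto simp: z4_def L4_def split: q4.split)

lemma prime3: "prime (3::nat)" "(3::nat) > 2" by simp_all

lemma D4_3: "D4 3 = {Q0, Q2}" and D3_3: "D3 3 = {T0}" by (auto simp: D4_def D3_def)

lemma eps3: "eps 3 (Q0, T0) = 1" "eps 3 (Q2, T0) = -1" by (simp_all add: eps_def)

lemma M3_carrier: "carrier (M3 i k3 a b) = {0..<3} \<times> UNIV" by (simp add: M3_def card_mdl)

lemma M3_circ: "(x, h) \<odot>\<^bsub>M3 i k3 a b\<^esub> (y, k) = ((x + eps 3 (E4 b h) * y) mod 3, fcirc i h k)"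
  by (simp add: M3_def mdl_def)

lemma M3_mult: "(x, h) \<otimes>\<^bsub>M3 i k3 a b\<^esub> (y, k) =
    (if k3 then ((y + eps 3 (E4 a k) * x) mod 3, fadd i k h) else ((x + eps 3 (E4 a h) * y) mod 3, fadd i h k))"
  by (simp add: M3_def mdl_def)

lemma dec_E4:
  assumes "a \<in> set (bhom4 i (dv False))" "b \<in> set (hom4 (fcirc i) (dv False))"
  shows "dec 3 (fbr i) (E4 a) (E4 b)"
proof -
  have "fn4 a h \<in> {Q0, Q2}" "fn4 b h \<in> {Q0, Q2}" for h
    using assms lists4_L4[of a "dv False"] lists4_L4[of b "dv False"] in_dv[of _ False] by (auto simp: in_bhom4 in_hom4)
  moreover have "T0 + T0 = T0" by simp
  ultimately show ?thesis using assms unfolding dec_def by (simp add: E4_def Dq_def D4_3 D3_3 in_bhom4 in_hom4)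
qed

lemma sm_add: "x \<in> {0..<3} \<Longrightarrow> y \<in> {0..<3} \<Longrightarrow> sm \<alpha> ((x + y) mod 3) = sm \<alpha> x + sm \<alpha> y"
proof -
  assume "x \<in> {0..<3}" "y \<in> {0..<3}"
  then have "x = 0 \<or> x = 1 \<or> x = 2" "y = 0 \<or> y = 1 \<or> y = 2" by auto
  then show ?thesis by (elim disjE; cases \<alpha>) (simp_all add: sm_def)
qed

lemma sm_T0: "sm T0 x = T0" by (simp add: sm_def)

lemma M3_brace: "a \<in> set (bhom4 i (dv False)) \<Longrightarrow> b \<in> set (hom4 (fcirc i) (dv False)) \<Longrightarrow> skew_left_brace (M3 i k3 a b)"
  unfolding M3_def by (rule mdl_brace[OF fbr_brace prime3(1) dec_E4])

lemma dec_TT: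
  assumes w: "wf3 (p mod 4 = 1) (p mod 3 = 1) i (a, b, c, d) (\<alpha>, \<beta>)"
  shows "dec p (M3 i k3 a b) (TT c \<alpha>) (TT d \<beta>)"
proof -
  let ?df = "p mod 4 = 1" and ?tf = "p mod 3 = 1"
  have q: "a \<in> set (bhom4 i (dv False))" "b \<in> set (hom4 (fcirc i) (dv False))" "c \<in> set (bhom4 i (dv ?df))" "d \<in> set (hom4 (fcirc i) (dv ?df))"
    and z: "b \<noteq> z4 \<longrightarrow> \<alpha> = T0 \<and> \<beta> = T0" "a \<noteq> z4 \<longrightarrow> \<alpha> = T0" "\<not> ?tf \<longrightarrow> \<alpha> = T0 \<and> \<beta> = T0"
    using w by (auto simp: wf3_def in_quads)
  have v: "fn4 c h \<in> D4 p" "fn4 d h \<in> D4 p" for h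
    using q(3,4) lists4_L4[of c "dv ?df"] lists4_L4[of d "dv ?df"] in_dv[of _ ?df] by (auto simp: in_bhom4 in_hom4 D4_def)
  have z0: "fn4 z4 h = Q0" for h by (cases h) (simp_all add: z4_def)
  have e: "l \<noteq> z4 \<longrightarrow> \<gamma> = T0 \<Longrightarrow> x \<in> {0..<3} \<Longrightarrow> y \<in> {0..<3} \<Longrightarrow> sm \<gamma> ((x + eps 3 (E4 l h) * y) mod 3) = sm \<gamma> x + sm \<gamma> y" for l \<gamma> x y h
    by (cases "l = z4") (simp_all add: E4_def z0 eps3 sm_add sm_T0)
  have s: "sm \<gamma> x \<in> D3 p" if "\<not> ?tf \<longrightarrow> \<gamma> = T0" for \<gamma> x using that by (auto simp: D3_def sm_T0)
  have comm: "x + y = y + (x::t3)" for x y by (rule add.commute)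
  show ?thesis
    unfolding dec_def M3_carrier
  proof (intro conjI ballI)
    fix u assume "u \<in> {0..<3::int} \<times> (UNIV :: q4 set)"
    then show "TT c \<alpha> u \<in> Dq p" "TT d \<beta> u \<in> Dq p" using v s z(3) by (cases u; simp add: Dq_def)+
  next
    fix u w assume "u \<in> {0..<3::int} \<times> (UNIV :: q4 set)" "w \<in> {0..<3::int} \<times> (UNIV :: q4 set)"
    then obtain x h y k where *: "u = (x, h)" "w = (y, k)" "x \<in> {0..<3}" "y \<in> {0..<3}" by (metis mem_Times_iff prod.collapse)
    show "TT c \<alpha> (u \<otimes>\<^bsub>M3 i k3 a b\<^esub> w) = TT c \<alpha> u + TT c \<alpha> w"
      using q(3) e[OF z(2) *(3,4), of h] e[OF z(2) *(4,3), of k] unfolding *(1,2) M3_mult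
      by (simp add: in_bhom4 add.commute)
    show "TT c \<alpha> (u \<odot>\<^bsub>M3 i k3 a b\<^esub> w) = TT c \<alpha> u + TT c \<alpha> w"
      using q(3) e[OF _ *(3,4), of b \<alpha> h] z(1) unfolding *(1,2) M3_circ by (simp add: in_bhom4 in_hom4)
    show "TT d \<beta> (u \<odot>\<^bsub>M3 i k3 a b\<^esub> w) = TT d \<beta> u + TT d \<beta> w"
      using q(4) e[OF _ *(3,4), of b \<beta> h] z(1) unfolding *(1,2) M3_circ by (simp add: in_hom4)
  qed
qed

lemma fcirc_sq: "fcirc i (fcirc i h h) (fcirc i h h) = Q0"
  by (cases i; cases h) (simp_all add: fcirc_def odd4_def)

lemma fcirc_0: "fcirc i h Q0 = h" "fcirc i Q0 h = h"
  by (cases i; cases h; simp add: fcirc_def odd4_def)+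

text \<open>The circle group is a semidirect product of groups of orders 3 and 4, so a homomorphism
  has trivial \<open>q4\<close> component on the first factor and trivial \<open>t3\<close>
  component on the second. If some \<open>h\<close> inverts the first factor,
  \<open>\<alpha>\<close> equals its own negative and vanishes.\<close>

lemma M3_hom_form:
  assumes r: "\<And>u w. u \<in> {0..<3} \<times> UNIV \<Longrightarrow> w \<in> {0..<3} \<times> UNIV \<Longrightarrow> r (u \<odot>\<^bsub>M3 i k3 a b\<^esub> w) = r u + r w"
    and b: "b \<in> set (hom4 (fcirc i) (dv False))"
  defines "c \<equiv> L4 (\<lambda>h. fst (r (0, h)))" and "\<alpha> \<equiv> snd (r (1, Q0))"
  shows "\<And>u. u \<in> {0..<3} \<times> UNIV \<Longrightarrow> r u = TT c \<alpha> u" "\<And>h k. fn4 c (fcirc i h k) = fn4 c h + fn4 c k"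
    "b \<noteq> z4 \<Longrightarrow> \<alpha> = T0"
proof -
  have bl: "b \<in> set (lists4 (dv False))" and b0: "fn4 b Q0 = Q0" and bv: "fn4 b h = Q0 \<or> fn4 b h = Q2" for h
  proof -
    show "b \<in> set (lists4 (dv False))" using b by (simp add: in_hom4)
    have "fn4 b (fcirc i Q0 Q0) = fn4 b Q0 + fn4 b Q0" using b unfolding in_hom4 by blast
    then show "fn4 b Q0 = Q0" by (cases "fn4 b Q0") (simp_all add: fcirc_0)
    show "fn4 b h = Q0 \<or> fn4 b h = Q2" using lists4_L4[OF \<open>b \<in> set (lists4 (dv False))\<close>] in_dv[of "fn4 b h" False] by auto
  qed
  define v where "v = r (1, Q0)"
  have r1: "r ((x + eps 3 (E4 b h) * y) mod 3, fcirc i h k) = r (x, h) + r (y, k)" if "x \<in> {0..<3}" "y \<in> {0..<3}" for x h y k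
    using r[of "(x, h)" "(y, k)"] that by (simp add: M3_circ)
  have r00: "r (0, Q0) = 0" using r1[of 0 0 Q0 Q0] by (simp add: fcirc_0)
  have r2: "r (2, Q0) = v + v" using r1[of 1 1 Q0 Q0] by (simp add: fcirc_0 E4_def b0 eps3 v_def)
  have "r (0, Q0) = v + v + v" using r1[of 2 1 Q0 Q0] by (simp add: fcirc_0 E4_def b0 eps3 v_def r2[unfolded v_def])
  then have vvv: "v + v + v = 0" using r00 by simp
  have fv: "fst v = Q0"
  proof -
    have "fst v + fst v + fst v = 0" using arg_cong[OF vvv, of fst] by (simp only: fst_add fst_zero)
    then show ?thesis by (cases "fst v") (simp_all add: zero_q4_def)
  qed
  have s0: "snd (r (0, h)) = T0" for h
  proof -
    have d: "r (0, fcirc i k l) = r (0, k) + r (0, l)" for k l using r1[of 0 0 k l] by simp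
    have "r (0, fcirc i (fcirc i h h) (fcirc i h h)) = (r (0, h) + r (0, h)) + (r (0, h) + r (0, h))" by (simp only: d)
    then have "(r (0, h) + r (0, h)) + (r (0, h) + r (0, h)) = 0" by (simp only: fcirc_sq r00)
    from arg_cong[OF this, of snd] have "(snd (r (0, h)) + snd (r (0, h))) + (snd (r (0, h)) + snd (r (0, h))) = 0"
      by (simp only: snd_add snd_zero)
    then show ?thesis by (cases "snd (r (0, h))") (simp_all add: zero_t3_def)
  qed
  have rx: "r (x, h) = r (x, Q0) + r (0, h)" if "x \<in> {0..<3}" for x h
    using r1[OF that, of 0 Q0 h] that by (simp add: fcirc_0)
  have v': "v = (Q0, \<alpha>)" using fv by (simp add: \<alpha>_def v_def prod_eq_iff)
  show "r u = TT c \<alpha> u" if uu: "u \<in> {0..<3} \<times> UNIV" for u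
  proof -
    obtain x h where u: "u = (x, h)" "x \<in> {0..<3}" using uu by auto
    have "r (x, Q0) = (Q0, sm \<alpha> x)"
    proof -
      have "x = 0 \<or> x = 1 \<or> x = 2" using u(2) by auto
      then show ?thesis using r00 r2 v' by (auto simp: sm_def v_def zero_prod_def zero_q4_def zero_t3_def)
    qed
    moreover have "r (0, h) = (fn4 c h, T0)" using s0[of h] by (simp add: c_def prod_eq_iff)
    moreover have "y + T0 = y" for y by (cases y) simp_all
    ultimately show ?thesis using rx[OF u(2), of h] u(1) by simp
  qed
  show "fn4 c (fcirc i h k) = fn4 c h + fn4 c k" for h k
    using r1[of 0 0 h k] by (simp add: c_def)
  show "\<alpha> = T0" if bz: "b \<noteq> z4"
  proof -
    obtain h where "fn4 b h \<noteq> Q0" using bz z4_iff[OF bl] by auto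
    then have "fn4 b h = Q2" using bv by blast
    then have "r (2, h) = r (0, h) + v" using r1[of 0 1 h Q0] by (simp add: E4_def eps3 fcirc_0 v_def)
    then have "v = 0" using rx[of 2 h] by (simp add: r2 add.commute)
    then show ?thesis by (simp add: \<alpha>_def v_def zero_prod_def zero_t3_def)
  qed
qed

text \<open>\<open>brace_is_model\<close> is used one level down, with \<open>q = 3\<close> and
  \<open>n = 4\<close>. The decoration for \<open>p\<close> is then pulled back to
  \<open>M3\<close>, where \<open>M3_hom_form\<close> puts it into standard shape.\<close>

lemma ordinary_model:
  fixes E :: "'a skew_brace"
  assumes E: "skew_left_brace E" "finite (carrier E)" "card (carrier E) = 12" and d: "dec p E t s"
    and N: "\<exists>g. group.npsyl E 3 g" "\<exists>g. group.npsyl (circ_group E) 3 g"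
  shows "\<exists>k3 i a b c d \<alpha> \<beta>. wf3 (p mod 4 = 1) (p mod 3 = 1) i (a, b, c, d) (\<alpha>, \<beta>) \<and> (k3 \<longrightarrow> a \<noteq> z4) \<and>
    diso (M3 i k3 a b) (TT c \<alpha>) (TT d \<beta>) E t s"
proof -
  have cop: "coprime (4::nat) 3" using coprime_Suc_left_nat[of 3] by simp
  have "\<exists>kp (F :: 'a skew_brace) t s. skew_left_brace F \<and> finite (carrier F) \<and> card (carrier F) = 4 \<and> dec 3 F t s \<and>
    sbi (mdl 3 kp F t s) E \<and> (kp \<longrightarrow> (\<exists>h \<in> carrier F. t h \<noteq> 0))"
    by (rule brace_is_model[OF E(1,2)]) (use E(3) cop N in simp_all)
  then obtain k3 and F :: "'a skew_brace" and t3 s3 where F: "skew_left_brace F" "finite (carrier F)" "card (carrier F) = 4"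
    and dF: "dec 3 F t3 s3" and iF: "sbi (mdl 3 k3 F t3 s3) E" and k3: "k3 \<longrightarrow> (\<exists>h \<in> carrier F. t3 h \<noteq> 0)"
    by (elim exE conjE)
  obtain i where "sbi (fbr i) F" using order4_brace[OF F] by blast
  then obtain \<phi> where \<phi>: "\<phi> \<in> skew_brace_iso (fbr i) F" by (auto simp: sbi_def)
  have \<phi>c: "\<phi> h \<in> carrier F" for h using \<phi> by (auto simp: sbi_iff bij_betw_def)
  have \<phi>m: "\<phi> (fadd i h k) = \<phi> h \<otimes>\<^bsub>F\<^esub> \<phi> k" "\<phi> (fcirc i h k) = \<phi> h \<odot>\<^bsub>F\<^esub> \<phi> k" for h k
    using \<phi> by (auto simp: sbi_iff)
  define a where "a = L4 (\<lambda>h. fst (t3 (\<phi> h)))"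
  define b where "b = L4 (\<lambda>h. fst (s3 (\<phi> h)))"
  have D: "t3 (\<phi> h) \<in> Dq 3" "s3 (\<phi> h) \<in> Dq 3" for h using decD[OF dF \<phi>c] by auto
  have aE: "E4 a h = t3 (\<phi> h)" "E4 b h = s3 (\<phi> h)" for h
    using D[of h] by (auto simp: E4_def a_def b_def prod_eq_iff Dq_def D3_3)
  have fD: "fst (t3 (\<phi> h)) \<in> set (dv False)" "fst (s3 (\<phi> h)) \<in> set (dv False)" for h
    using D[of h] by (auto simp: in_dv Dq_def D4_3)
  have a: "a \<in> set (bhom4 i (dv False))"
    unfolding in_bhom4 in_hom4 a_def using decD(3,4)[OF dF \<phi>c \<phi>c] by (simp add: L4_in[OF fD(1)] \<phi>m del: dv.simps)
  have b: "b \<in> set (hom4 (fcirc i) (dv False))"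
    unfolding in_hom4 b_def using decD(5)[OF dF \<phi>c \<phi>c] by (simp add: L4_in[OF fD(2)] \<phi>m del: dv.simps)
  have az: "a \<noteq> z4" if k3
  proof -
    obtain h where h: "h \<in> carrier F" "t3 h \<noteq> 0" using k3 \<open>k3\<close> by auto
    have "h \<in> range \<phi>" using \<phi> h by (simp add: sbi_iff bij_betw_def)
    then obtain x where x: "h = \<phi> x" by blast
    have "E4 a x \<noteq> 0" using h x aE by simp
    then have "fn4 a x \<noteq> Q0" by (auto simp: E4_def zero_prod_def zero_q4_def zero_t3_def)
    then show ?thesis by (cases x) (auto simp: z4_def)
  qed
  have "(\<lambda>(x, h). ((1 * x) mod int 3, \<phi> h)) \<in> skew_brace_iso (mdl 3 k3 (fbr i) (E4 a) (E4 b)) (mdl 3 k3 F t3 s3)"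
    by (rule model_isoI[OF fbr_brace prime3(1) dec_E4[OF a b] \<phi>]) (simp_all add: aE)
  moreover obtain f0 where "f0 \<in> skew_brace_iso (mdl 3 k3 F t3 s3) E" using iF by (auto simp: sbi_def)
  ultimately obtain f where f: "f \<in> skew_brace_iso (M3 i k3 a b) E" unfolding M3_def using iso_comp by blast
  have fc: "u \<in> {0..<3} \<times> UNIV \<Longrightarrow> f u \<in> carrier E" for u
    using f by (auto simp: sbi_iff M3_carrier bij_betw_def)
  have fm: "f (u \<otimes>\<^bsub>M3 i k3 a b\<^esub> w) = f u \<otimes>\<^bsub>E\<^esub> f w" "f (u \<odot>\<^bsub>M3 i k3 a b\<^esub> w) = f u \<odot>\<^bsub>E\<^esub> f w"
    if "u \<in> {0..<3} \<times> UNIV" "w \<in> {0..<3} \<times> UNIV" for u w using f that by (auto simp: sbi_iff M3_carrier)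
  have rt: "t (f (u \<odot>\<^bsub>M3 i k3 a b\<^esub> w)) = t (f u) + t (f w)" "s (f (u \<odot>\<^bsub>M3 i k3 a b\<^esub> w)) = s (f u) + s (f w)"
    "t (f (u \<otimes>\<^bsub>M3 i k3 a b\<^esub> w)) = t (f u) + t (f w)"
    if "u \<in> {0..<3} \<times> UNIV" "w \<in> {0..<3} \<times> UNIV" for u w
    using fm[OF that] decD(3-5)[OF d fc[OF that(1)] fc[OF that(2)]] by simp_all
  define c where "c = L4 (\<lambda>h. fst (t (f (0, h))))"
  define \<alpha> where "\<alpha> = snd (t (f (1, Q0)))"
  define dd where "dd = L4 (\<lambda>h. fst (s (f (0, h))))"
  define \<beta> where "\<beta> = snd (s (f (1, Q0)))"
  note T = M3_hom_form[of "\<lambda>u. t (f u)", OF rt(1) b, folded c_def \<alpha>_def]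
  note S = M3_hom_form[of "\<lambda>u. s (f u)", OF rt(2) b, folded dd_def \<beta>_def]
  have DD: "t (f u) \<in> Dq p" "s (f u) \<in> Dq p" if "u \<in> {0..<3} \<times> UNIV" for u using decD(1,2)[OF d fc[OF that]] by auto
  have cv: "c \<in> set (lists4 (dv (p mod 4 = 1)))" "dd \<in> set (lists4 (dv (p mod 4 = 1)))"
  proof -
    have "fst (t (f (0, h))) \<in> set (dv (p mod 4 = 1))" "fst (s (f (0, h))) \<in> set (dv (p mod 4 = 1))" for h
      using DD[of "(0, h)"] unfolding in_dv by (auto simp: Dq_def D4_def mem_Times_iff)
    then show "c \<in> set (lists4 (dv (p mod 4 = 1)))" "dd \<in> set (lists4 (dv (p mod 4 = 1)))"
      unfolding c_def dd_def by (intro L4_in; blast)+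
  qed
  have tf: "\<not> p mod 3 = 1 \<longrightarrow> \<alpha> = T0 \<and> \<beta> = T0"
    using DD[of "(1, Q0)"] by (auto simp: \<alpha>_def \<beta>_def Dq_def D3_def)
  have c_add: "fn4 c (fadd i h k) = fn4 c h + fn4 c k" for h k
  proof (cases k3)
    case False
    then show ?thesis using rt(3)[of "(0, h)" "(0, k)"] by (simp add: M3_mult c_def)
  next
    case True
    then show ?thesis using rt(3)[of "(0, k)" "(0, h)"] by (simp add: M3_mult c_def add.commute)
  qed
  \<comment> \<open>The inversion argument in the additive group: moving \<open>(1, Q0)\<close> past
    such an \<open>h\<close> turns 1 into 2, so
    \<open>\<alpha> + \<alpha> = \<alpha>\<close>.\<close>
  have a_z: "\<alpha> = T0" if az: "a \<noteq> z4"
  proof -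
    have al: "a \<in> set (lists4 (dv False))" using a by (simp add: in_bhom4 in_hom4)
    obtain h where h: "fn4 a h \<noteq> Q0" using az z4_iff[OF al] by auto
    then have h2: "fn4 a h = Q2" using lists4_L4[OF al] in_dv[of "fn4 a h" False] by auto
    have f0: "fadd i h Q0 = h" "fadd i Q0 h = h" for h by (cases i; cases h; simp)+
    have "t (f (2, h)) = t (f (0, h)) + t (f (1, Q0))"
    proof (cases k3)
      case False
      then show ?thesis using rt(3)[of "(0, h)" "(1, Q0)"] h2 by (simp add: M3_mult E4_def eps3 f0)
    next
      case True
      then show ?thesis using rt(3)[of "(1, Q0)" "(0, h)"] h2 by (simp add: M3_mult E4_def eps3 f0 add.commute)
    qed
    then have "sm \<alpha> 2 = sm \<alpha> 0 + sm \<alpha> 1" using T(1)[of "(2, h)"] T(1)[of "(0, h)"] T(1)[of "(1, Q0)"] by simp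
    then show ?thesis by (cases \<alpha>) (simp_all add: sm_def)
  qed
  have "wf3 (p mod 4 = 1) (p mod 3 = 1) i (a, b, c, dd) (\<alpha>, \<beta>)"
    using a b cv T(2,3) S(2,3) c_add a_z tf by (auto simp: wf3_def in_quads in_bhom4 in_hom4)
  moreover have "diso (M3 i k3 a b) (TT c \<alpha>) (TT dd \<beta>) E t s"
    unfolding diso_def using f T(1) S(1) by (intro bexI[of _ f]) (simp_all add: M3_carrier)
  ultimately show ?thesis using az by blast
qed

lemma isos4_iff: "l \<in> set (isos4 i j) \<longleftrightarrow> l \<in> set (lists4 q4s) \<and> fn4 l \<in> skew_brace_iso (fbr i) (fbr j)"
proof (cases "l \<in> set (lists4 q4s)")
  case True
  then have l: "L4 (fn4 l) = l" using lists4_L4 by blast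
  have "distinct l \<longleftrightarrow> bij (fn4 l)"
  proof
    assume "distinct l"
    then have "distinct (L4 (fn4 l))" by (simp add: l)
    then have "inj (fn4 l)" unfolding inj_def L4_def by (intro allI impI) (case_tac x; case_tac y; simp)
    moreover have "finite (UNIV :: q4 set)" by (simp add: UNIV_q4)
    ultimately show "bij (fn4 l)" by (simp add: bij_def finite_UNIV_inj_surj)
  next
    assume "bij (fn4 l)"
    then have "distinct (L4 (fn4 l))" unfolding L4_def by (auto simp: bij_def inj_eq)
    then show "distinct l" by (simp add: l)
  qed
  then show ?thesis using True by (auto simp: isos4_def sbi_iff)
qed (simp add: isos4_def)

lemma iso_L4: "\<psi> \<in> skew_brace_iso (fbr i) (fbr j) \<Longrightarrow> L4 \<psi> \<in> set (isos4 i j)"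
  by (simp add: isos4_iff L4_in set_q4s)

lemma iso_fbr_eq: "\<psi> \<in> skew_brace_iso (fbr i) (fbr j) \<Longrightarrow> i = j"
  using isos4_ne in_fis iso_L4[of \<psi> i j] unfolding list_all_iff by (metis empty_iff empty_set)

lemma rel4_iff: "rel4 (isos4 i i) (a, b, c, d) (a', b', c', d') \<longleftrightarrow>
    (\<exists>\<psi> \<in> skew_brace_iso (fbr i) (fbr i). fn4 a' \<circ> \<psi> = fn4 a \<and> fn4 b' \<circ> \<psi> = fn4 b \<and> fn4 c' \<circ> \<psi> = fn4 c \<and> fn4 d' \<circ> \<psi> = fn4 d)"
    (is "?L \<longleftrightarrow> ?R")
proof
  assume ?L
  then obtain l where "l \<in> set (isos4 i i)" "\<forall>x. fn4 a' (fn4 l x) = fn4 a x" "\<forall>x. fn4 b' (fn4 l x) = fn4 b x"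
    "\<forall>x. fn4 c' (fn4 l x) = fn4 c x" "\<forall>x. fn4 d' (fn4 l x) = fn4 d x" by (auto simp: rel4_def list_ex_iff)
  then show ?R by (intro bexI[of _ "fn4 l"]) (auto simp: isos4_iff fun_eq_iff)
next
  assume ?R
  then obtain \<psi> where \<psi>: "\<psi> \<in> skew_brace_iso (fbr i) (fbr i)" "fn4 a' \<circ> \<psi> = fn4 a" "fn4 b' \<circ> \<psi> = fn4 b" "fn4 c' \<circ> \<psi> = fn4 c" "fn4 d' \<circ> \<psi> = fn4 d"
    by blast
  show ?L unfolding rel4_def prod.case list_ex_iff
    by (intro bexI[of _ "L4 \<psi>"] iso_L4 \<psi>(1)) (use \<psi>(2-5) in \<open>simp add: fun_eq_iff\<close>)
qed

lemma id_iso: "id \<in> skew_brace_iso A A" by (auto simp: sbi_iff bij_betw_def)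

lemma rel4_refl: "rel4 (isos4 i i) x x"
  by (cases x) (auto simp: rel4_iff intro!: bexI[OF _ id_iso])

lemma zero_comp:
  assumes "l \<in> set (lists4 vs)" "l' \<in> set (lists4 vs)" "bij \<psi>" "fn4 l' \<circ> \<psi> = fn4 l"
  shows "l = z4 \<longleftrightarrow> l' = z4"
proof -
  have "(\<forall>h. fn4 l h = Q0) \<longleftrightarrow> (\<forall>h. fn4 l' h = Q0)"
    unfolding assms(4)[symmetric] comp_def using assms(3) by (metis bij_pointE)
  then show ?thesis using z4_iff[OF assms(1)] z4_iff[OF assms(2)] by simp
qed

lemma in_concat_map: "x \<in> set (concat (map f xs)) \<longleftrightarrow> (\<exists>y \<in> set xs. x \<in> set (f y))"
  by simp

lemma in_ocodes: "(kp, k3, i, (a, b, c, d), \<alpha>, \<beta>) \<in> set (ocodes df tf) \<longleftrightarrow> (a, b, c, d) \<in> set (qreps i df) \<and>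
    (\<alpha>, \<beta>) \<in> set (abs3 tf a b) \<and> (kp \<longrightarrow> c \<noteq> z4 \<or> \<alpha> \<noteq> T0) \<and> (k3 \<longrightarrow> a \<noteq> z4)"
  (is "?L \<longleftrightarrow> ?R")
proof
  assume ?L
  then show ?R by (auto simp: ocodes_def in_fis split: if_splits)
next
  assume R: ?R
  show ?L unfolding ocodes_def in_concat_map
    apply (rule bexI[OF _ in_fis[of i]])
    apply (rule bexI[of _ "(a, b, c, d)"])
    unfolding prod.case in_concat_map
     apply (rule bexI[of _ "(\<alpha>, \<beta>)"])
    unfolding prod.case
    using R by (cases kp; cases k3; auto)+
qed

lemma abs3_rep:
  assumes "b \<noteq> z4 \<longrightarrow> \<alpha> = T0 \<and> \<beta> = T0" "a \<noteq> z4 \<longrightarrow> \<alpha> = T0" "\<not> tf \<longrightarrow> \<alpha> = T0 \<and> \<beta> = T0"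
  shows "\<exists>u \<in> {1, 2}. (sm \<alpha> u, sm \<beta> u) \<in> set (abs3 tf a b)"
  using assms by (cases "b = z4"; cases "a = z4"; cases tf; cases \<alpha>; cases \<beta>) (auto simp: abs3_def sm_def)

lemma abs3_wf: "(\<alpha>, \<beta>) \<in> set (abs3 tf a b) \<Longrightarrow> (b \<noteq> z4 \<longrightarrow> \<alpha> = T0 \<and> \<beta> = T0) \<and> (a \<noteq> z4 \<longrightarrow> \<alpha> = T0) \<and> (\<not> tf \<longrightarrow> \<alpha> = T0 \<and> \<beta> = T0)"
  by (auto simp: abs3_def split: if_splits)

lemma abs3_irred:
  assumes "(\<alpha>, \<beta>) \<in> set (abs3 tf a b)" "(\<alpha>', \<beta>') \<in> set (abs3 tf a b)" "u = 1 \<or> u = 2" "sm \<alpha>' u = \<alpha>" "sm \<beta>' u = \<beta>"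
  shows "\<alpha> = \<alpha>' \<and> \<beta> = \<beta>'"
  using assms by (auto simp: abs3_def sm_def split: if_splits)

lemma qreps_quads: "q \<in> set (qreps i df) \<Longrightarrow> q \<in> set (quads i df)"
  using greedy_sub[of "rel4 (isos4 i i)" "quads i df"] unfolding qreps_def by (auto simp only: subset_iff)

lemma ocodes_wf: "(kp, k3, i, (a, b, c, d), \<alpha>, \<beta>) \<in> set (ocodes df tf) \<Longrightarrow> wf3 df tf i (a, b, c, d) (\<alpha>, \<beta>)"
  using abs3_wf[of \<alpha> \<beta> tf a b] qreps_quads[of "(a, b, c, d)" i df] unfolding in_ocodes wf3_def prod.case by blast

lemma quads_lists4:
  assumes "(a, b, c, d) \<in> set (quads i df)"
  shows "a \<in> set (lists4 (dv False))" "b \<in> set (lists4 (dv False))" "c \<in> set (lists4 (dv df))" "d \<in> set (lists4 (dv df))"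
  using assms by (simp_all add: in_quads in_bhom4 in_hom4)

lemma sm_mult: "x \<in> {0..<3} \<Longrightarrow> u = 1 \<or> u = 2 \<Longrightarrow> sm \<alpha> ((u * x) mod 3) = sm (sm \<alpha> u) x"
proof -
  assume "x \<in> {0..<3}" "u = 1 \<or> u = 2"
  moreover from this have "x = 0 \<or> x = 1 \<or> x = 2" by auto
  ultimately show ?thesis by (elim disjE; cases \<alpha>) (simp_all add: sm_def)
qed

context
  fixes p :: nat
  assumes p: "prime p" "p \<ge> 7"
begin

lemma p_cop: "coprime 12 p" "p > 2" "coprime (4::nat) 3"
proof -
  have "\<not> p dvd 12"
  proof
    assume "p dvd 12"
    then have "p dvd 2 * (2 * 3)" by simp
    then have "p dvd 2 \<or> p dvd 3" using p(1) by (meson prime_dvd_mult_nat)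
    then show False using p(2) by (auto dest: dvd_imp_le)
  qed
  from prime_imp_coprime[OF p(1) this] show "coprime 12 p" by (simp only: coprime_commute)
  show "p > 2" using p(2) by simp
  show "coprime (4::nat) 3" using coprime_Suc_left_nat[of 3] by simp
qed

lemma OM_brace:
  assumes "wf3 (p mod 4 = 1) (p mod 3 = 1) i (a, b, c, d) (\<alpha>, \<beta>)"
  shows "skew_left_brace (OM p (kp, k3, i, (a, b, c, d), \<alpha>, \<beta>))"
  using mdl_brace[OF M3_brace p(1) dec_TT[OF assms]] assms by (simp add: wf3_def in_quads)

lemma ordinary_code:
  assumes w: "wf3 (p mod 4 = 1) (p mod 3 = 1) i (a, b, c, d) (\<alpha>, \<beta>)" and k: "k3 \<longrightarrow> a \<noteq> z4" "kp \<longrightarrow> c \<noteq> z4 \<or> \<alpha> \<noteq> T0"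
  shows "\<exists>x \<in> set (ocodes (p mod 4 = 1) (p mod 3 = 1)). sbi (OM p x) (OM p (kp, k3, i, (a, b, c, d), \<alpha>, \<beta>))"
proof -
  have q: "(a, b, c, d) \<in> set (quads i (p mod 4 = 1))" and z: "b \<noteq> z4 \<longrightarrow> \<alpha> = T0 \<and> \<beta> = T0" "a \<noteq> z4 \<longrightarrow> \<alpha> = T0" "\<not> (p mod 3 = 1) \<longrightarrow> \<alpha> = T0 \<and> \<beta> = T0"
    using w by (auto simp: wf3_def)
  obtain q' where q': "q' \<in> set (qreps i (p mod 4 = 1))" "rel4 (isos4 i i) q' (a, b, c, d)"
    using greedy_cover[of "rel4 (isos4 i i)", OF rel4_refl q] unfolding qreps_def by blast
  obtain a' b' c' d' where q'e: "q' = (a', b', c', d')" by (cases q')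
  note q'' = qreps_quads[OF q'(1), unfolded q'e]
  obtain \<psi> where \<psi>: "\<psi> \<in> skew_brace_iso (fbr i) (fbr i)" "fn4 a \<circ> \<psi> = fn4 a'" "fn4 b \<circ> \<psi> = fn4 b'" "fn4 c \<circ> \<psi> = fn4 c'" "fn4 d \<circ> \<psi> = fn4 d'"
    using q'(2) unfolding q'e rel4_iff by blast
  have bij: "bij \<psi>" using \<psi>(1) by (simp add: sbi_iff)
  note ql = quads_lists4[OF q] and ql' = quads_lists4[OF q'']
  have za: "a' = z4 \<longleftrightarrow> a = z4" "b' = z4 \<longleftrightarrow> b = z4" "c' = z4 \<longleftrightarrow> c = z4"
    using zero_comp[OF ql'(1) ql(1) bij \<psi>(2)] zero_comp[OF ql'(2) ql(2) bij \<psi>(3)] zero_comp[OF ql'(3) ql(3) bij \<psi>(4)] by simp_all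
  obtain u :: int where u: "u = 1 \<or> u = 2" "(sm \<alpha> u, sm \<beta> u) \<in> set (abs3 (p mod 3 = 1) a' b')"
  proof -
    \<comment> \<open>\<open>abs3\<close> only sees whether the lists \<open>a\<close> and
      \<open>b\<close> vanish, and \<open>\<psi>\<close> preserves this.\<close>
    have e: "abs3 (p mod 3 = 1) a' b' = abs3 (p mod 3 = 1) a b" by (simp add: abs3_def za)
    obtain u :: int where u: "u \<in> {1, 2}" "(sm \<alpha> u, sm \<beta> u) \<in> set (abs3 (p mod 3 = 1) a b)" using abs3_rep[OF z] by blast
    from u(1) have "u = 1 \<or> u = 2" by simp
    from that[OF this] u(2) e show ?thesis by simp
  qed
  have cu: "coprime u (int 3)" using u(1) coprime_add_one_right[of "2::int"] by auto
  have a0: "sm \<alpha> u = T0 \<Longrightarrow> \<alpha> = T0" using u(1) by (cases \<alpha>) (auto simp: sm_def)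
  let ?x = "(kp, k3, i, (a', b', c', d'), sm \<alpha> u, sm \<beta> u)"
  have x: "?x \<in> set (ocodes (p mod 4 = 1) (p mod 3 = 1))" unfolding in_ocodes using q'(1) u(2) k za a0 by (auto simp: q'e)
  define f where "f = (\<lambda>(x, h). ((u * x) mod int 3, \<psi> h))"
  have fn: "fn4 a (\<psi> h) = fn4 a' h" "fn4 b (\<psi> h) = fn4 b' h" "fn4 c (\<psi> h) = fn4 c' h" "fn4 d (\<psi> h) = fn4 d' h" for h
    using \<psi>(2-5) by (simp_all add: fun_eq_iff)
  have 1: "f \<in> skew_brace_iso (M3 i k3 a' b') (M3 i k3 a b)"
    unfolding M3_def f_def
    by (rule model_isoI[OF fbr_brace prime3(1) dec_E4 \<psi>(1) _ cu]) (use q'' fn in \<open>simp_all add: in_quads E4_def\<close>)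
  have "TT c \<alpha> (f v) = TT c' (sm \<alpha> u) v \<and> TT d \<beta> (f v) = TT d' (sm \<beta> u) v" if v: "v \<in> {0..<3} \<times> (UNIV :: q4 set)" for v
  proof -
    obtain y h where "v = (y, h)" "y \<in> {0..<3}" using v by auto
    then show ?thesis using sm_mult[OF _ u(1), of y] fn by (simp add: f_def)
  qed
  then have 2: "\<forall>v \<in> carrier (M3 i k3 a' b'). TT c \<alpha> (f v) = TT c' (sm \<alpha> u) v \<and> TT d \<beta> (f v) = TT d' (sm \<beta> u) v"
    by (simp add: M3_carrier)
  have "sbi (OM p ?x) (OM p (kp, k3, i, (a, b, c, d), \<alpha>, \<beta>))"
    unfolding OM.simps sbi_def
    using model_isoI[OF M3_brace p(1) dec_TT[OF ocodes_wf[OF x]] 1 2 coprime_1_left] q'' unfolding in_quads by blast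
  then show ?thesis using x by blast
qed

text \<open>\<open>model_iso\<close> is applied twice, for \<open>p\<close> and then for 3. The
  second use yields \<open>\<psi>\<close> on the brace of size four together with the multiplier
  \<open>u\<close>, of which only the residue modulo 3 matters.\<close>

lemma OM_iso_rel:
  assumes x: "(kp, k3, i, (a, b, c, d), \<alpha>, \<beta>) \<in> set (ocodes (p mod 4 = 1) (p mod 3 = 1))" and y: "(kp', k3', i', (a', b', c', d'), \<alpha>', \<beta>') \<in> set (ocodes (p mod 4 = 1) (p mod 3 = 1))"
    and f: "sbi (OM p (kp, k3, i, (a, b, c, d), \<alpha>, \<beta>)) (OM p (kp', k3', i', (a', b', c', d'), \<alpha>', \<beta>'))"
  shows "kp = kp' \<and> k3 = k3' \<and> i = i' \<and> rel4 (isos4 i i) (a, b, c, d) (a', b', c', d') \<and> (\<exists>u. (u = 1 \<or> u = 2) \<and> sm \<alpha>' u = \<alpha> \<and> sm \<beta>' u = \<beta>)"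
proof -
  note wx = ocodes_wf[OF x] and wy = ocodes_wf[OF y]
  have qx: "a \<in> set (bhom4 i (dv False))" "b \<in> set (hom4 (fcirc i) (dv False))" "(a, b, c, d) \<in> set (quads i (p mod 4 = 1))"
    and qy: "a' \<in> set (bhom4 i' (dv False))" "b' \<in> set (hom4 (fcirc i') (dv False))" "(a', b', c', d') \<in> set (quads i' (p mod 4 = 1))"
    using wx wy by (simp_all add: wf3_def in_quads)
  have c12: "finite (carrier (M3 i k3 a b))" "card (carrier (M3 i k3 a b)) = 12" for i k3 a b
    by (simp_all add: M3_carrier UNIV_q4 card_cartesian_product)
  have kT: "kp \<longrightarrow> (\<exists>h \<in> carrier (M3 i k3 a b). TT c \<alpha> h \<noteq> 0)"
    if cl: "c \<in> set (lists4 (dv (p mod 4 = 1)))" and ck: "kp \<longrightarrow> c \<noteq> z4 \<or> \<alpha> \<noteq> T0" for kp i k3 a b c \<alpha>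
  proof
    assume kp
    then consider h where "fn4 c h \<noteq> Q0" | "\<alpha> \<noteq> T0" using ck z4_iff[OF cl] by blast
    then show "\<exists>h \<in> carrier (M3 i k3 a b). TT c \<alpha> h \<noteq> 0"
    proof cases
      case 1
      then show ?thesis by (intro bexI[of _ "(0, h)"]) (simp_all add: M3_carrier zero_prod_def zero_q4_def)
    next
      case 2
      then show ?thesis by (intro bexI[of _ "(1, Q0)"]) (simp_all add: M3_carrier zero_prod_def zero_t3_def sm_def)
    qed
  qed
  obtain f0 where f0: "f0 \<in> skew_brace_iso (mdl p kp (M3 i k3 a b) (TT c \<alpha>) (TT d \<beta>)) (mdl p kp' (M3 i' k3' a' b') (TT c' \<alpha>') (TT d' \<beta>'))"
    using f by (auto simp: sbi_def)
  note kx = kT[OF quads_lists4(3)[OF qx(3)], of kp \<alpha> i k3 a b] and ky = kT[OF quads_lists4(3)[OF qy(3)], of kp' \<alpha>' i' k3' a' b']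
  have kx': "kp \<longrightarrow> (\<exists>h \<in> carrier (M3 i k3 a b). TT c \<alpha> h \<noteq> 0)" and ky': "kp' \<longrightarrow> (\<exists>h \<in> carrier (M3 i' k3' a' b'). TT c' \<alpha>' h \<noteq> 0)"
    using kx ky x y unfolding in_ocodes by blast+
  note MI = model_iso[OF M3_brace[OF qx(1,2)] c12 dec_TT[OF wx] M3_brace[OF qy(1,2)] c12 dec_TT[OF wy] p(1) p_cop(2,1) kx' ky' f0]
  obtain \<phi> where \<phi>: "\<phi> \<in> skew_brace_iso (M3 i k3 a b) (M3 i' k3' a' b')"
    "\<forall>h \<in> carrier (M3 i k3 a b). TT c' \<alpha>' (\<phi> h) = TT c \<alpha> h \<and> TT d' \<beta>' (\<phi> h) = TT d \<beta> h" using MI(2) by blast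
  have u4: "finite (carrier (fbr i))" "card (carrier (fbr i)) = 4" for i by (simp_all add: UNIV_q4)
  have kE: "k3 \<longrightarrow> (\<exists>h \<in> carrier (fbr i). E4 a h \<noteq> 0)" if "a \<in> set (lists4 (dv False))" "k3 \<longrightarrow> a \<noteq> z4" for k3 i a
    using that z4_iff[OF that(1)] by (auto simp: E4_def zero_prod_def zero_q4_def)
  have kx3: "k3 \<longrightarrow> (\<exists>h \<in> carrier (fbr i). E4 a h \<noteq> 0)" and ky3: "k3' \<longrightarrow> (\<exists>h \<in> carrier (fbr i'). E4 a' h \<noteq> 0)"
    using kE[OF quads_lists4(1)[OF qx(3)], of k3 i] kE[OF quads_lists4(1)[OF qy(3)], of k3' i'] x y unfolding in_ocodes by blast+
  note NI = model_iso[OF fbr_brace u4 dec_E4[OF qx(1,2)] fbr_brace u4 dec_E4[OF qy(1,2)] prime3 p_cop(3) kx3 ky3 \<phi>(1)[unfolded M3_def]]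
  obtain u \<psi> where u: "coprime u (int 3)" and \<psi>: "\<psi> \<in> skew_brace_iso (fbr i) (fbr i')" "\<And>h. E4 a' (\<psi> h) = E4 a h \<and> E4 b' (\<psi> h) = E4 b h"
    "\<And>x. x \<in> {0..<3} \<Longrightarrow> \<phi> (x, Q0) = ((u * x) mod 3, Q0)" "\<And>x h. x \<in> {0..<3} \<Longrightarrow> snd (\<phi> (x, h)) = \<psi> h"
    using NI(2) by auto
  have ii: "i = i'" by (rule iso_fbr_eq[OF \<psi>(1)])
  have TT': "TT c \<alpha> v = (fn4 c (snd v), sm \<alpha> (fst v))" for c \<alpha> v by (cases v) simp
  have cd: "fn4 c' (\<psi> h) = fn4 c h" "fn4 d' (\<psi> h) = fn4 d h" for h
    using bspec[OF \<phi>(2), of "(0, h)"] \<psi>(4)[of 0 h] by (simp_all add: M3_carrier TT')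
  have rel: "rel4 (isos4 i i) (a, b, c, d) (a', b', c', d')"
    unfolding rel4_iff by (rule bexI[of _ \<psi>]) (use \<psi>(1,2) cd ii in \<open>auto simp: fun_eq_iff E4_def\<close>)
  have "\<not> 3 dvd u"
  proof
    assume "3 dvd u"
    then have "is_unit (3::int)" using coprime_common_divisor[OF u, of 3] by simp
    then show False by simp
  qed
  then have "u mod 3 = 1 \<or> u mod 3 = 2" by presburger
  moreover have "sm \<alpha>' (u mod 3) = \<alpha>" "sm \<beta>' (u mod 3) = \<beta>"
    using bspec[OF \<phi>(2), of "(1, Q0)"] \<psi>(3)[of 1] by (simp_all add: M3_carrier sm_def)
  ultimately show ?thesis using MI(1) NI(1) ii rel by blast
qed

text \<open>The isomorphism and its inverse supply the two directions that
  \<open>greedy_irred\<close> asks for; \<open>abs3_irred\<close> separates the remaining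
  pairs.\<close>

lemma OM_irred:
  assumes x: "x \<in> set (ocodes (p mod 4 = 1) (p mod 3 = 1))" and y: "y \<in> set (ocodes (p mod 4 = 1) (p mod 3 = 1))" and xy: "sbi (OM p x) (OM p y)"
  shows "x = y"
proof -
  obtain kp k3 i a b c d \<alpha> \<beta> where xe: "x = (kp, k3, i, (a, b, c, d), \<alpha>, \<beta>)" by (cases x) auto
  obtain kp' k3' i' a' b' c' d' \<alpha>' \<beta>' where ye: "y = (kp', k3', i', (a', b', c', d'), \<alpha>', \<beta>')" by (cases y) auto
  note x = x[unfolded xe] and y = y[unfolded ye] and xy = xy[unfolded xe ye]
  have yx: "sbi (OM p (kp', k3', i', (a', b', c', d'), \<alpha>', \<beta>')) (OM p (kp, k3, i, (a, b, c, d), \<alpha>, \<beta>))"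
    by (rule sbi_sym[OF OM_brace[OF ocodes_wf[OF x]] xy])
  note A = OM_iso_rel[OF x y xy] and B = OM_iso_rel[OF y x yx]
  have i: "i' = i" using A by simp
  have "(a, b, c, d) = (a', b', c', d')"
    using greedy_irred[of "(a, b, c, d)" "rel4 (isos4 i i)" "quads i (p mod 4 = 1)" "(a', b', c', d')"] A B x y
    unfolding in_ocodes qreps_def i by blast
  then have q: "a = a'" "b = b'" "c = c'" "d = d'" by simp_all
  have "\<alpha> = \<alpha>' \<and> \<beta> = \<beta>'" using abs3_irred[of \<alpha> \<beta> "(p mod 3 = 1)" a b \<alpha>' \<beta>'] A x y unfolding in_ocodes q by blast
  then show ?thesis using A q by (simp add: xe ye)
qed

end

section \<open>Decorated braces built on the alternating group\<close>

definition FE :: "q4 list \<Rightarrow> t3 list \<Rightarrow> a4 \<Rightarrow> q4 \<times> t3" where "FE a b x = (fnE a x, fnE b x)"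

fun XM where "XM p (kp, j, (t4, u3), (s4, s3)) = mdl p kp (ebr j) (FE t4 u3) (FE s4 s3)"

lemma fnE_map [simp]: "fnE (map f els) = f"
  by (rule ext) (simp add: fnE_def map_of_zip_map in_els)

lemma hl_map: "list_all (\<lambda>j. list_all (\<lambda>l. map (fnE l) els = l) (hl4 j) \<and> list_all (\<lambda>l. map (fnE l) els = l) (hl3 j)) gis"
  by code_simp

lemma map_fnE: "l \<in> set (hl4 j) \<Longrightarrow> map (fnE l) els = l" "l' \<in> set (hl3 j) \<Longrightarrow> map (fnE l') els = l'"
  using hl_map in_gis[of j] unfolding list_all_iff by blast+

lemma hl_ishom: "l \<in> set (hl4 j) \<Longrightarrow> ishom (ecirc j) l" "l' \<in> set (hl3 j) \<Longrightarrow> ishom (ecirc j) l'"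
  using hl_hom in_gis[of j] unfolding list_all_iff by blast+

lemma z12_map: "z12 = map (\<lambda>x. Q0) els" "y12 = map (\<lambda>x. T0) els"
  by (simp_all add: z12_def y12_def els_def numeral_eq_Suc)

lemma fnE_zero: "l \<in> set (hl4 j) \<Longrightarrow> l = z12 \<longleftrightarrow> (\<forall>x. fnE l x = Q0)" "l' \<in> set (hl3 j) \<Longrightarrow> l' = y12 \<longleftrightarrow> (\<forall>x. fnE l' x = T0)"
proof -
  assume l: "l \<in> set (hl4 j)"
  show "l = z12 \<longleftrightarrow> (\<forall>x. fnE l x = Q0)"
  proof
    assume "\<forall>x. fnE l x = Q0"
    then have "map (fnE l) els = z12" by (simp add: z12_map)
    then show "l = z12" using map_fnE(1)[OF l] by simp
  qed (simp add: z12_map)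
next
  assume l: "l' \<in> set (hl3 j)"
  show "l' = y12 \<longleftrightarrow> (\<forall>x. fnE l' x = T0)"
  proof
    assume "\<forall>x. fnE l' x = T0"
    then have "map (fnE l') els = y12" by (simp add: z12_map)
    then show "l' = y12" using map_fnE(2)[OF l] by simp
  qed (simp add: z12_map)
qed

lemma in_edecs: "((t4, u3), (s4, s3)) \<in> set (edecs j df tf) \<longleftrightarrow>
    t4 \<in> set (sel4 df (hl4 j)) \<and> u3 \<in> set (sel3 tf (hl3 j)) \<and> s4 \<in> set (sel4 df (hl4 j)) \<and> s3 \<in> set (sel3 tf (hl3 j)) \<and>
    ishom (eadd j) t4 \<and> ishom (eadd j) u3"
  by (auto simp: edecs_def)

lemma sel4_iff: "l \<in> set (sel4 df (hl4 j)) \<longleftrightarrow> l \<in> set (hl4 j) \<and> (\<forall>x. fnE l x \<in> set (dv df))"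
proof (cases "l \<in> set (hl4 j)")
  case True
  have "list_all (\<lambda>x. x \<in> set (dv df)) (map (fnE l) els) \<longleftrightarrow> (\<forall>x. fnE l x \<in> set (dv df))"
    using in_els by (auto simp: list_all_iff simp del: dv.simps)
  then show ?thesis using True unfolding map_fnE(1)[OF True] by (simp add: sel4_def)
qed (simp add: sel4_def)

lemma sel3_iff: "l \<in> set (sel3 tf (hl3 j)) \<longleftrightarrow> l \<in> set (hl3 j) \<and> (\<forall>x. tf \<or> fnE l x = T0)"
proof (cases "l \<in> set (hl3 j)")
  case True
  have "list_all (\<lambda>x. tf \<or> x = T0) (map (fnE l) els) \<longleftrightarrow> (\<forall>x. tf \<or> fnE l x = T0)"
    using in_els by (auto simp: list_all_iff)
  then show ?thesis using True unfolding map_fnE(2)[OF True] by (simp add: sel3_def)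
qed (simp add: sel3_def)

lemma dec_FE:
  assumes "((t4, u3), (s4, s3)) \<in> set (edecs j (p mod 4 = 1) (p mod 3 = 1))"
  shows "dec p (ebr j) (FE t4 u3) (FE s4 s3)"
proof -
  have l: "t4 \<in> set (hl4 j)" "u3 \<in> set (hl3 j)" "s4 \<in> set (hl4 j)" "s3 \<in> set (hl3 j)"
    and v: "\<And>x. fnE t4 x \<in> set (dv (p mod 4 = 1))" "\<And>x. fnE s4 x \<in> set (dv (p mod 4 = 1))"
      "\<And>x. p mod 3 = 1 \<or> fnE u3 x = T0" "\<And>x. p mod 3 = 1 \<or> fnE s3 x = T0"
    and a: "ishom (eadd j) t4" "ishom (eadd j) u3"
    using assms unfolding in_edecs sel4_iff sel3_iff by blast+
  have "FE t4 u3 x \<in> Dq p" "FE s4 s3 x \<in> Dq p" for x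
    using v[of x] unfolding in_dv FE_def Dq_def D4_def D3_def by auto
  then show ?thesis
    using a hl_ishom[of _ j] l unfolding dec_def by (simp add: FE_def ishom_def)
qed

lemma ecirc_idA: "ecirc j idA idA = idA"
  using is_sb in_gis[of j] unfolding list_all_iff is_sb_def by blast

text \<open>By completeness of the search \<open>f\<close> is one of its results, and
  \<open>hl4_search\<close> finds all of these in the table.\<close>

lemma hom_list4:
  assumes f: "\<And>x y. f (ecirc j x y) = f x + (f y :: q4)" shows "map f els \<in> set (hl4 j)"
proof -
  have "f (AA Q0 T0) = f (AA Q0 T0) + f (AA Q0 T0)" using f[of idA idA] by (simp add: ecirc_idA) (simp add: idA_def)
  then have f0: "f (AA Q0 T0) = Q0" by (cases "f (AA Q0 T0)") simp_all
  obtain L where L: "L \<in> set (srch (\<lambda>k v b. ecirc j k b) (+) q4s (Suc 299) els [(AA Q0 T0, Q0)])" "\<forall>k. map_of L k = Some (f k)"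
    using srch_total[where f = f and kf = "\<lambda>k v b. ecirc j k b" and vf = "(+)" and vs = q4s and ks = els and L = "[(AA Q0 T0, Q0)]" and n = 299]
      f f0 set_q4s in_els by auto
  have "toL L \<in> set (hl4 j)" using hl4_search L(1) in_gis[of j] unfolding list_all_iff by blast
  moreover have "toL L = map f els" using L(2) by (simp add: toL_def)
  ultimately show ?thesis by simp
qed

lemma set_t3s: "x \<in> set t3s" by (cases x) (simp_all add: t3s_def)

lemma hom_list3:
  assumes f: "\<And>x y. f (ecirc j x y) = f x + (f y :: t3)" shows "map f els \<in> set (hl3 j)"
proof -
  have "f (AA Q0 T0) = f (AA Q0 T0) + f (AA Q0 T0)" using f[of idA idA] by (simp add: ecirc_idA) (simp add: idA_def)
  then have f0: "f (AA Q0 T0) = T0" by (cases "f (AA Q0 T0)") simp_all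
  obtain L where L: "L \<in> set (srch (\<lambda>k v b. ecirc j k b) (+) t3s (Suc 299) els [(AA Q0 T0, T0)])" "\<forall>k. map_of L k = Some (f k)"
    using srch_total[where f = f and kf = "\<lambda>k v b. ecirc j k b" and vf = "(+)" and vs = t3s and ks = els and L = "[(AA Q0 T0, T0)]" and n = 299]
      f f0 set_t3s in_els by auto
  have "toL L \<in> set (hl3 j)" using hl3_search L(1) in_gis[of j] unfolding list_all_iff by blast
  moreover have "toL L = map f els" using L(2) by (simp add: toL_def)
  ultimately show ?thesis by simp
qed

lemma dec_edecs:
  assumes d: "dec p (ebr j) t s"
  shows "\<exists>t4 u3 s4 s3. ((t4, u3), (s4, s3)) \<in> set (edecs j (p mod 4 = 1) (p mod 3 = 1)) \<and> FE t4 u3 = t \<and> FE s4 s3 = s"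
proof -
  have D: "t x \<in> Dq p" "s x \<in> Dq p" "t (eadd j x y) = t x + t y" "t (ecirc j x y) = t x + t y" "s (ecirc j x y) = s x + s y" for x y
    using decD(1,2)[OF d, of x] decD(3-5)[OF d, of x y] by simp_all
  let ?t4 = "map (\<lambda>x. fst (t x)) els" and ?u3 = "map (\<lambda>x. snd (t x)) els" and ?s4 = "map (\<lambda>x. fst (s x)) els" and ?s3 = "map (\<lambda>x. snd (s x)) els"
  have "?t4 \<in> set (hl4 j)" by (rule hom_list4) (simp add: D)
  moreover have "?s4 \<in> set (hl4 j)" by (rule hom_list4) (simp add: D)
  moreover have "?u3 \<in> set (hl3 j)" by (rule hom_list3) (simp add: D)
  moreover have "?s3 \<in> set (hl3 j)" by (rule hom_list3) (simp add: D)
  moreover have "fst (t x) \<in> set (dv (p mod 4 = 1))" "fst (s x) \<in> set (dv (p mod 4 = 1))" "p mod 3 = 1 \<or> snd (t x) = T0" "p mod 3 = 1 \<or> snd (s x) = T0" for x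
    using D(1,2)[of x] unfolding in_dv by (auto simp: Dq_def D4_def D3_def mem_Times_iff)
  moreover have "ishom (eadd j) ?t4" "ishom (eadd j) ?u3" unfolding ishom_def fnE_map by (simp_all add: D)
  ultimately have "((?t4, ?u3), (?s4, ?s3)) \<in> set (edecs j (p mod 4 = 1) (p mod 3 = 1))"
    unfolding in_edecs sel4_iff sel3_iff fnE_map by blast
  moreover have "FE ?t4 ?u3 = t" "FE ?s4 ?s3 = s" by (simp_all only: FE_def[abs_def] fnE_map prod.collapse)
  ultimately show ?thesis by blast
qed

lemma auE_iff: "c \<in> set (auE i j) \<longleftrightarrow> ap c \<in> skew_brace_iso (ebr i) (ebr j)"
  using bij_ap[of c] by (auto simp: auE_def set_auts sbi_iff)

lemma eadd_comm: "(\<forall>x y. eadd j x y = eadd j y x) \<longleftrightarrow> j = Gx"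
proof
  assume c: "\<forall>x y. eadd j x y = eadd j y x"
  show "j = Gx"
  proof (rule ccontr)
    assume j: "j \<noteq> Gx"
    have "mulA (AA Q1 T0) (AA Q0 T1) = mulA (AA Q0 T1) (AA Q1 T0)"
      using c[rule_format, of "AA Q1 T0" "AA Q0 T1"] by (simp only: ecirc8(2)[OF j])
    then show False by simp
  qed
next
  have x: "xor4 v w = xor4 w v" for v w by (cases v; cases w) simp_all
  assume "j = Gx"
  then show "\<forall>x y. eadd j x y = eadd j y x" by (intro allI) (case_tac x; case_tac y; simp add: x add.commute)
qed

text \<open>Commutativity of the addition separates \<open>Gx\<close> from the others. So an
  isomorphism preserves \<open>mulA\<close>, either as the addition or as the circle operation, and
  \<open>ap_unique\<close> applies.\<close>

lemma iso_ap:
  assumes \<psi>: "\<psi> \<in> skew_brace_iso (ebr i) (ebr j)" shows "i = j \<and> (\<exists>c \<in> set (auE i j). \<psi> = ap c)"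
proof -
  have b: "bij \<psi>" and m: "\<And>x y. \<psi> (eadd i x y) = eadd j (\<psi> x) (\<psi> y)" "\<And>x y. \<psi> (ecirc i x y) = ecirc j (\<psi> x) (\<psi> y)"
    using \<psi> by (auto simp: sbi_iff)
  have sj: "\<And>y. \<exists>x. y = \<psi> x" and ij: "\<And>x y. \<psi> x = \<psi> y \<longleftrightarrow> x = y" using b by (auto simp: bij_def surj_def inj_eq)
  have "(\<forall>x y. eadd i x y = eadd i y x) \<longleftrightarrow> (\<forall>x y. eadd j x y = eadd j y x)"
  proof
    assume c: "\<forall>x y. eadd i x y = eadd i y x"
    show "\<forall>x y. eadd j x y = eadd j y x"
    proof (intro allI)
      fix x y
      obtain x' y' where "x = \<psi> x'" "y = \<psi> y'" using sj by metis
      then show "eadd j x y = eadd j y x" using c by (simp flip: m(1))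
    qed
  next
    assume c: "\<forall>x y. eadd j x y = eadd j y x"
    show "\<forall>x y. eadd i x y = eadd i y x"
    proof (intro allI)
      fix x y
      have "\<psi> (eadd i x y) = \<psi> (eadd i y x)" unfolding m(1) by (rule c[rule_format])
      then show "eadd i x y = eadd i y x" unfolding ij .
    qed
  qed
  then have G: "i = Gx \<longleftrightarrow> j = Gx" unfolding eadd_comm .
  have "\<psi> (mulA x y) = mulA (\<psi> x) (\<psi> y)" for x y
  proof (cases "i = Gx")
    case True
    then have "j = Gx" using G by simp
    then show ?thesis using m(2)[of x y] True by simp
  next
    case False
    then have jn: "j \<noteq> Gx" using G by simp
    show ?thesis using m(1)[of x y] by (simp only: ecirc8(2)[OF False] ecirc8(2)[OF jn])
  qed
  then obtain c where c: "\<psi> = ap c" using ap_unique[of \<psi>] b by (auto simp: bij_def)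
  then have ca: "c \<in> set (auE i j)" using \<psi> by (simp add: auE_iff)
  have "i = j \<or> auE i j = []" using auE_ne in_gis unfolding list_all_iff by blast
  then show ?thesis using c ca by auto
qed

lemma relE_iff: "relE (auE j j) ((a, b), (c, d)) ((a', b'), (c', d')) \<longleftrightarrow>
    (\<exists>\<psi> \<in> skew_brace_iso (ebr j) (ebr j). FE a' b' \<circ> \<psi> = FE a b \<and> FE c' d' \<circ> \<psi> = FE c d)" (is "?L \<longleftrightarrow> ?R")
proof
  assume ?L
  then obtain e where "e \<in> set (auE j j)" "\<forall>x. fnE a' (ap e x) = fnE a x" "\<forall>x. fnE b' (ap e x) = fnE b x"
    "\<forall>x. fnE c' (ap e x) = fnE c x" "\<forall>x. fnE d' (ap e x) = fnE d x" unfolding relE_def prod.case list_ex_iff by blast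
  then show ?R unfolding auE_iff by (intro bexI[of _ "ap e"]) (simp_all add: fun_eq_iff FE_def)
next
  assume ?R
  then obtain \<psi> where \<psi>: "\<psi> \<in> skew_brace_iso (ebr j) (ebr j)" "FE a' b' \<circ> \<psi> = FE a b" "FE c' d' \<circ> \<psi> = FE c d" by blast
  obtain e where e: "e \<in> set (auE j j)" "\<psi> = ap e" using iso_ap[OF \<psi>(1)] by blast
  have "\<forall>x. FE a' b' (ap e x) = FE a b x \<and> FE c' d' (ap e x) = FE c d x" using \<psi>(2,3) unfolding e(2) by (simp add: fun_eq_iff)
  then show ?L unfolding relE_def prod.case list_ex_iff by (intro bexI[OF _ e(1)]) (simp add: FE_def)
qed

lemma relE_refl: "relE (auE j j) x x"
  by (cases x rule: prod.exhaust; cases "fst x"; cases "snd x") (auto simp: relE_iff intro!: bexI[OF _ id_iso])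

lemma in_ecodes: "(kp, j, (t4, u3), s) \<in> set (ecodes df tf) \<longleftrightarrow> ((t4, u3), s) \<in> set (ereps j df tf) \<and>
    (kp \<longrightarrow> t4 \<noteq> z12 \<or> u3 \<noteq> y12)"  (is "?L \<longleftrightarrow> ?R")
proof
  assume ?L
  then show ?R by (auto simp: ecodes_def in_gis split: if_splits)
next
  assume R: ?R
  have j: "j \<in> set gis" by (simp add: in_gis)
  show ?L unfolding ecodes_def in_concat_map
    apply (rule bexI[OF _ j])
    apply (rule bexI[of _ "((t4, u3), s)"])
    unfolding prod.case
    using R by (cases kp; auto)+
qed

lemma ereps_edecs: "e \<in> set (ereps j df tf) \<Longrightarrow> e \<in> set (edecs j df tf)"
  using greedy_sub[of "relE (auE j j)" "edecs j df tf"] unfolding ereps_def by (auto simp only: subset_iff)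

lemma FE_zero:
  assumes "((t4, u3), s) \<in> set (edecs j df tf)"
  shows "(t4 \<noteq> z12 \<or> u3 \<noteq> y12) \<longleftrightarrow> (\<exists>h \<in> carrier (ebr j). FE t4 u3 h \<noteq> 0)"
proof -
  obtain s4 s3 where s: "s = (s4, s3)" by (cases s)
  have l: "t4 \<in> set (hl4 j)" "u3 \<in> set (hl3 j)" using assms unfolding s in_edecs sel4_iff sel3_iff by blast+
  show ?thesis unfolding fnE_zero(1)[OF l(1)] fnE_zero(2)[OF l(2)]
    by (auto simp: FE_def zero_prod_def zero_q4_def zero_t3_def)
qed

context
  fixes p :: nat
  assumes p: "prime p" "p \<ge> 7"
begin

lemma ecodes_edecs: "(kp, j, e) \<in> set (ecodes (p mod 4 = 1) (p mod 3 = 1)) \<Longrightarrow> e \<in> set (edecs j (p mod 4 = 1) (p mod 3 = 1))"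
  using in_ecodes[of kp j "fst (fst e)" "snd (fst e)" "snd e" "(p mod 4 = 1)" "(p mod 3 = 1)"] ereps_edecs[of e j "(p mod 4 = 1)" "(p mod 3 = 1)"] by simp

lemma XM_brace: "x \<in> set (ecodes (p mod 4 = 1) (p mod 3 = 1)) \<Longrightarrow> skew_left_brace (XM p x)"
proof -
  assume x: "x \<in> set (ecodes (p mod 4 = 1) (p mod 3 = 1))"
  obtain kp j t4 u3 s4 s3 where xe: "x = (kp, j, (t4, u3), (s4, s3))" by (cases x) auto
  show ?thesis unfolding xe XM.simps
    by (rule mdl_brace[OF ebr_brace p(1) dec_FE[OF ecodes_edecs[OF x[unfolded xe]]]])
qed

lemma exotic_code:
  assumes d: "dec p (ebr j) t s" and k: "kp \<longrightarrow> (\<exists>h \<in> carrier (ebr j). t h \<noteq> 0)"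
  shows "\<exists>x \<in> set (ecodes (p mod 4 = 1) (p mod 3 = 1)). sbi (XM p x) (mdl p kp (ebr j) t s)"
proof -
  obtain t4 u3 s4 s3 where e: "((t4, u3), (s4, s3)) \<in> set (edecs j (p mod 4 = 1) (p mod 3 = 1))" and ts: "FE t4 u3 = t" "FE s4 s3 = s"
    using dec_edecs[OF d] by blast
  obtain e' where e': "e' \<in> set (ereps j (p mod 4 = 1) (p mod 3 = 1))" "relE (auE j j) e' ((t4, u3), (s4, s3))"
    using greedy_cover[of "relE (auE j j)", OF relE_refl e] unfolding ereps_def by blast
  obtain t4' u3' s4' s3' where ee: "e' = ((t4', u3'), (s4', s3'))" by (cases e') auto
  obtain \<psi> where \<psi>: "\<psi> \<in> skew_brace_iso (ebr j) (ebr j)" "FE t4 u3 \<circ> \<psi> = FE t4' u3'" "FE s4 s3 \<circ> \<psi> = FE s4' s3'"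
    using e'(2) unfolding ee relE_iff by blast
  note E = ereps_edecs[OF e'(1)[unfolded ee]]
  have \<psi>': "\<forall>h \<in> carrier (ebr j). t (\<psi> h) = FE t4' u3' h \<and> s (\<psi> h) = FE s4' s3' h"
    using \<psi>(2,3) unfolding ts by (simp add: fun_eq_iff)
  have "kp \<longrightarrow> t4' \<noteq> z12 \<or> u3' \<noteq> y12"
    unfolding FE_zero[OF E]
  proof
    assume kp
    then obtain h where h: "t h \<noteq> 0" using k by blast
    have "h \<in> range \<psi>" using \<psi>(1) by (simp add: sbi_iff bij_def)
    then obtain g where "h = \<psi> g" by blast
    then show "\<exists>h \<in> carrier (ebr j). FE t4' u3' h \<noteq> 0" using h \<psi>' by (intro bexI[of _ g]) auto
  qed
  then have x: "(kp, j, (t4', u3'), (s4', s3')) \<in> set (ecodes (p mod 4 = 1) (p mod 3 = 1))" using e'(1) unfolding in_ecodes ee by blast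
  have "sbi (XM p (kp, j, (t4', u3'), (s4', s3'))) (mdl p kp (ebr j) t s)"
    unfolding XM.simps sbi_def using model_isoI[OF ebr_brace p(1) dec_FE[OF E] \<psi>(1) \<psi>' coprime_1_left] by blast
  then show ?thesis using x by blast
qed

lemma card_ebr: "finite (carrier (ebr j))" "card (carrier (ebr j)) = 12"
  using card_a4 by (simp_all add: UNIV_a4 els_def)

lemma XM_iso_rel:
  assumes x: "(kp, j, (t4, u3), (s4, s3)) \<in> set (ecodes (p mod 4 = 1) (p mod 3 = 1))" and y: "(kp', j', (t4', u3'), (s4', s3')) \<in> set (ecodes (p mod 4 = 1) (p mod 3 = 1))"
    and f: "sbi (XM p (kp, j, (t4, u3), (s4, s3))) (XM p (kp', j', (t4', u3'), (s4', s3')))"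
  shows "kp = kp' \<and> j = j' \<and> relE (auE j j) ((t4, u3), (s4, s3)) ((t4', u3'), (s4', s3'))"
proof -
  note ex = ecodes_edecs[OF x] and ey = ecodes_edecs[OF y]
  obtain f0 where f0: "f0 \<in> skew_brace_iso (mdl p kp (ebr j) (FE t4 u3) (FE s4 s3)) (mdl p kp' (ebr j') (FE t4' u3') (FE s4' s3'))"
    using f by (auto simp: sbi_def)
  have kx: "kp \<longrightarrow> (\<exists>h \<in> carrier (ebr j). FE t4 u3 h \<noteq> 0)" and ky: "kp' \<longrightarrow> (\<exists>h \<in> carrier (ebr j'). FE t4' u3' h \<noteq> 0)"
    using x y unfolding in_ecodes FE_zero[OF ex, symmetric] FE_zero[OF ey, symmetric] by blast+
  note MI = model_iso[OF ebr_brace card_ebr dec_FE[OF ex] ebr_brace card_ebr dec_FE[OF ey] p(1) p_cop(2,1)[OF p] kx ky f0]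
  obtain \<psi> where \<psi>: "\<psi> \<in> skew_brace_iso (ebr j) (ebr j')" "\<And>h. FE t4' u3' (\<psi> h) = FE t4 u3 h \<and> FE s4' s3' (\<psi> h) = FE s4 s3 h"
    using MI(2) by auto
  have j: "j = j'" using iso_ap[OF \<psi>(1)] by blast
  have "relE (auE j j) ((t4, u3), (s4, s3)) ((t4', u3'), (s4', s3'))"
    unfolding relE_iff by (rule bexI[of _ \<psi>]) (use \<psi> j in \<open>simp_all add: fun_eq_iff\<close>)
  then show ?thesis using MI(1) j by blast
qed

lemma XM_irred:
  assumes x: "x \<in> set (ecodes (p mod 4 = 1) (p mod 3 = 1))" and y: "y \<in> set (ecodes (p mod 4 = 1) (p mod 3 = 1))" and xy: "sbi (XM p x) (XM p y)"
  shows "x = y"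
proof -
  obtain kp j t4 u3 s4 s3 where xe: "x = (kp, j, (t4, u3), (s4, s3))" by (cases x) auto
  obtain kp' j' t4' u3' s4' s3' where ye: "y = (kp', j', (t4', u3'), (s4', s3'))" by (cases y) auto
  have yx: "sbi (XM p y) (XM p x)" by (rule sbi_sym[OF XM_brace[OF x] xy])
  note A = XM_iso_rel[OF x[unfolded xe] y[unfolded ye] xy[unfolded xe ye]]
    and B = XM_iso_rel[OF y[unfolded ye] x[unfolded xe] yx[unfolded xe ye]]
  have j: "j' = j" using A by simp
  have "((t4, u3), (s4, s3)) = ((t4', u3'), (s4', s3'))"
    using greedy_irred[of "((t4, u3), (s4, s3))" "relE (auE j j)" "edecs j (p mod 4 = 1) (p mod 3 = 1)" "((t4', u3'), (s4', s3'))"] A B x y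
    unfolding xe ye in_ecodes ereps_def j by blast
  then show ?thesis using A by (simp add: xe ye)
qed

end

text \<open>An extension of a brace of size four by a group of order three has only three elements of
  order dividing three in either group, whereas the group \<open>mulA\<close> is not of this kind.\<close>

lemma fcube:
  "fadd i (fadd i (fadd i h h) h) (fadd i (fadd i h h) h) = fadd i (fadd i h h) h \<longleftrightarrow> h = Q0"
  "fadd i (fadd i h (fadd i h h)) (fadd i h (fadd i h h)) = fadd i h (fadd i h h) \<longleftrightarrow> h = Q0"
  "fcirc i (fcirc i (fcirc i h h) h) (fcirc i (fcirc i h h) h) = fcirc i (fcirc i h h) h \<longleftrightarrow> h = Q0"
  by (cases i; cases h; simp add: fcirc_def odd4_def)+

text \<open>\<open>Z\<close> expresses that the cube of \<open>u\<close> is idempotent, hence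
  trivial, without naming a neutral element. \<open>AA Q0 T1\<close> and \<open>AA Q1 T2\<close>
  have trivial cube, but their product is an involution.\<close>

lemma mulA_no_closed:
  assumes b: "bij_betw f S UNIV" and m: "\<And>u v. u \<in> S \<Longrightarrow> v \<in> S \<Longrightarrow> m u v \<in> S \<and> f (m u v) = mulA (f u) (f v)"
    and Z: "\<And>u. u \<in> S \<Longrightarrow> m (m (m u u) u) (m (m u u) u) = m (m u u) u \<longleftrightarrow> Z u"
    and cl: "\<And>u v. u \<in> S \<Longrightarrow> v \<in> S \<Longrightarrow> Z u \<Longrightarrow> Z v \<Longrightarrow> Z (m u v)"
  shows False
proof -
  have fi: "f u = f v \<longleftrightarrow> u = v" if "u \<in> S" "v \<in> S" for u v using b that by (auto simp: bij_betw_def inj_on_eq_iff)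
  let ?c = "\<lambda>x. mulA (mulA x x) x"
  have Z': "Z u \<longleftrightarrow> mulA (?c (f u)) (?c (f u)) = ?c (f u)" if u: "u \<in> S" for u
  proof -
    have c: "m (m u u) u \<in> S" "m (m (m u u) u) (m (m u u) u) \<in> S" using m u by blast+
    have uu: "m u u \<in> S" using m u by blast
    have f: "f (m (m u u) u) = ?c (f u)" using m[OF uu u] m[OF u u] by simp
    have "Z u \<longleftrightarrow> f (m (m (m u u) u) (m (m u u) u)) = f (m (m u u) u)" unfolding fi[OF c(2,1)] Z[OF u] ..
    then show ?thesis using m[OF c(1) c(1)] f by simp
  qed
  have r: "f ` S = UNIV" using b by (simp add: bij_betw_def)
  obtain u where u: "u \<in> S" "f u = AA Q0 T1" using r by (metis UNIV_I imageE)
  obtain v where v: "v \<in> S" "f v = AA Q1 T2" using r by (metis UNIV_I imageE)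
  have "Z u" "Z v" using Z'[OF u(1)] Z'[OF v(1)] u v by simp_all
  then have "Z (m u v)" using cl u v by blast
  then show False using Z'[of "m u v"] m[OF u(1) v(1)] u v by simp
qed

lemma M3_not_ebr:
  assumes a: "a \<in> set (bhom4 i (dv False))" and b: "b \<in> set (hom4 (fcirc i) (dv False))"
    and f: "f \<in> skew_brace_iso (M3 i k3 a b) (ebr j)"
  shows False
proof -
  have bij: "bij_betw f ({0..<3} \<times> UNIV) UNIV" and fm: "\<And>u v. u \<in> {0..<3} \<times> UNIV \<Longrightarrow> v \<in> {0..<3} \<times> UNIV \<Longrightarrow>
      f (u \<otimes>\<^bsub>M3 i k3 a b\<^esub> v) = eadd j (f u) (f v) \<and> f (u \<odot>\<^bsub>M3 i k3 a b\<^esub> v) = ecirc j (f u) (f v)"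
    using f by (auto simp: sbi_iff M3_carrier)
  have z: "fn4 l Q0 = Q0" if "l \<in> set (hom4 (fcirc i) (dv False))" for l
  proof -
    have "fn4 l (fcirc i Q0 Q0) = fn4 l Q0 + fn4 l Q0" using that unfolding in_hom4 by blast
    then show ?thesis by (cases "fn4 l Q0") (simp_all add: fcirc_0)
  qed
  have a0: "eps 3 (E4 a Q0) = 1" and b0: "eps 3 (E4 b Q0) = 1" using z[of a] z[OF b] a by (simp_all add: E4_def eps3 in_bhom4)
  have f0: "fadd i Q0 Q0 = Q0" "fcirc i Q0 Q0 = Q0" by (cases i; simp add: fcirc_def)+
  have x3: "x = 0 \<or> x = 1 \<or> x = (2::int)" if "x \<in> {0..<3}" for x using that by auto
  interpret M: skew_left_brace "M3 i k3 a b" by (rule M3_brace[OF a b])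
  have cl: "u \<otimes>\<^bsub>M3 i k3 a b\<^esub> v \<in> {0..<3} \<times> UNIV" "u \<odot>\<^bsub>M3 i k3 a b\<^esub> v \<in> {0..<3} \<times> UNIV"
    if "u \<in> {0..<3} \<times> UNIV" "v \<in> {0..<3} \<times> UNIV" for u v
    using M.m_closed[of u v] M.c_closed[of u v] that by (simp_all add: M3_carrier)
  show False
  proof (cases "j = Gx")
    case False
    show False
    proof (rule mulA_no_closed[OF bij, where m = "monoid.mult (M3 i k3 a b)" and Z = "\<lambda>u. snd u = Q0"])
      show "u \<otimes>\<^bsub>M3 i k3 a b\<^esub> v \<in> {0..<3} \<times> UNIV \<and> f (u \<otimes>\<^bsub>M3 i k3 a b\<^esub> v) = mulA (f u) (f v)"
        if "u \<in> {0..<3} \<times> UNIV" "v \<in> {0..<3} \<times> UNIV" for u v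
        using cl(1)[OF that] fm[OF that] ecirc8(2)[OF False] by simp
    next
      fix u :: "int \<times> q4" assume u: "u \<in> {0..<3} \<times> UNIV"
      obtain x h where uxh: "u = (x, h)" "x \<in> {0..<3}" using u by auto
      let ?c = "(u \<otimes>\<^bsub>M3 i k3 a b\<^esub> u) \<otimes>\<^bsub>M3 i k3 a b\<^esub> u"
      show "?c \<otimes>\<^bsub>M3 i k3 a b\<^esub> ?c = ?c \<longleftrightarrow> snd u = Q0"
      proof
        assume "?c \<otimes>\<^bsub>M3 i k3 a b\<^esub> ?c = ?c"
        then have "snd (?c \<otimes>\<^bsub>M3 i k3 a b\<^esub> ?c) = snd ?c" by simp
        then show "snd u = Q0" unfolding uxh(1) M3_mult by (cases k3) (simp_all add: M3_mult fcube)
      next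
        assume "snd u = Q0"
        then show "?c \<otimes>\<^bsub>M3 i k3 a b\<^esub> ?c = ?c" using x3[OF uxh(2)] unfolding uxh(1)
          by (cases k3; elim disjE) (simp_all add: M3_mult a0 f0)
      qed
    next
      fix u v :: "int \<times> q4" assume "snd u = Q0" "snd v = Q0"
      then show "snd (u \<otimes>\<^bsub>M3 i k3 a b\<^esub> v) = Q0" by (cases u; cases v; cases k3) (simp_all add: M3_mult f0)
    qed
  next
    case True
    show False
    proof (rule mulA_no_closed[OF bij, where m = "circ (M3 i k3 a b)" and Z = "\<lambda>u. snd u = Q0"])
      show "u \<odot>\<^bsub>M3 i k3 a b\<^esub> v \<in> {0..<3} \<times> UNIV \<and> f (u \<odot>\<^bsub>M3 i k3 a b\<^esub> v) = mulA (f u) (f v)"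
        if "u \<in> {0..<3} \<times> UNIV" "v \<in> {0..<3} \<times> UNIV" for u v
        using cl(2)[OF that] fm[OF that] True by simp
    next
      fix u :: "int \<times> q4" assume u: "u \<in> {0..<3} \<times> UNIV"
      obtain x h where uxh: "u = (x, h)" "x \<in> {0..<3}" using u by auto
      let ?c = "(u \<odot>\<^bsub>M3 i k3 a b\<^esub> u) \<odot>\<^bsub>M3 i k3 a b\<^esub> u"
      show "?c \<odot>\<^bsub>M3 i k3 a b\<^esub> ?c = ?c \<longleftrightarrow> snd u = Q0"
      proof
        assume "?c \<odot>\<^bsub>M3 i k3 a b\<^esub> ?c = ?c"
        then have "snd (?c \<odot>\<^bsub>M3 i k3 a b\<^esub> ?c) = snd ?c" by simp
        then show "snd u = Q0" unfolding uxh(1) by (simp add: M3_circ fcube)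
      next
        assume "snd u = Q0"
        then show "?c \<odot>\<^bsub>M3 i k3 a b\<^esub> ?c = ?c" using x3[OF uxh(2)] unfolding uxh(1)
          by (elim disjE) (simp_all add: M3_circ b0 f0)
      qed
    next
      fix u v :: "int \<times> q4" assume "snd u = Q0" "snd v = Q0"
      then show "snd (u \<odot>\<^bsub>M3 i k3 a b\<^esub> v) = Q0" by (cases u; cases v) (simp add: M3_circ f0)
    qed
  qed
qed

section \<open>The count\<close>

text \<open>The function \<open>k\<close> recovers from an entry the index of its block, which makes
  the blocks disjoint.\<close>

lemma distinct_concat_map:
  assumes "distinct xs" "\<And>x. x \<in> set xs \<Longrightarrow> distinct (f x)" "\<And>x y. x \<in> set xs \<Longrightarrow> y \<in> set (f x) \<Longrightarrow> k y = x"
  shows "distinct (concat (map f xs))"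
  using assms
proof (induction xs)
  case (Cons x xs)
  have "set (f x) \<inter> set (concat (map f xs)) = {}"
  proof (rule ccontr)
    assume "set (f x) \<inter> set (concat (map f xs)) \<noteq> {}"
    then obtain y x' where y: "y \<in> set (f x)" "x' \<in> set xs" "y \<in> set (f x')" by auto
    have "x = x'" using Cons.prems(3)[of x y] Cons.prems(3)[of x' y] y by simp
    then show False using Cons.prems(1) y(2) by simp
  qed
  moreover have "distinct (concat (map f xs))" using Cons.prems by (intro Cons.IH) simp_all
  ultimately show ?case using Cons.prems(2)[of x] by simp
qed simp

lemma distinct_greedy: "(\<And>x. R x x) \<Longrightarrow> distinct (greedy R xs)"
proof (induction R xs rule: greedy.induct)
  case (2 R x xs)
  have "x \<notin> set (greedy R (filter (\<lambda>y. \<not> R x y) xs))"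
    using greedy_sub[of R "filter (\<lambda>y. \<not> R x y) xs"] 2(2)[of x] by auto
  then show ?case using 2 by simp
qed simp

lemma distinct_ocodes: "distinct (ocodes df tf)"
  unfolding ocodes_def
proof (rule distinct_concat_map[where k = "\<lambda>(kp, k3, i, q, ab). i"])
  show "distinct fis" by (simp add: fis_def)
next
  fix i :: fi
  let ?g = "\<lambda>(a, b, c, d). concat (map (\<lambda>(\<alpha>, \<beta>). [(kp, k3, i, (a, b, c, d), (\<alpha>, \<beta>)). kp \<leftarrow> (if c = z4 \<and> \<alpha> = T0 then [False] else [False, True]),
                                     k3 \<leftarrow> (if a = z4 then [False] else [False, True])]) (abs3 tf a b))"
  show "distinct (concat (map ?g (qreps i df)))"
  proof (rule distinct_concat_map[where k = "\<lambda>(kp, k3, i, q, ab). q"])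
    show "distinct (qreps i df)" unfolding qreps_def by (rule distinct_greedy) (rule rel4_refl)
  next
    fix q :: quad
    obtain a b c d where q: "q = (a, b, c, d)" by (cases q)
    show "distinct (?g q)" unfolding q prod.case
    proof (rule distinct_concat_map[where k = "\<lambda>(kp, k3, i, q, ab). ab"])
      show "distinct (abs3 tf a b)" by (simp add: abs3_def)
    qed (auto split: if_splits)
  qed auto
qed auto

lemma distinct_ecodes: "distinct (ecodes df tf)"
  unfolding ecodes_def
proof (rule distinct_concat_map[where k = "\<lambda>(kp, j, e). j"])
  show "distinct gis" by (simp add: gis_def)
next
  fix j :: gi
  let ?g = "\<lambda>((t4, u3), s). [(kp, j, ((t4, u3), s)). kp \<leftarrow> (if t4 = z12 \<and> u3 = y12 then [False] else [False, True])]"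
  show "distinct (concat (map ?g (ereps j df tf)))"
  proof (rule distinct_concat_map[where k = "\<lambda>(kp, j, e). e"])
    show "distinct (ereps j df tf)" unfolding ereps_def by (rule distinct_greedy) (rule relE_refl)
  next
    fix e :: edec
    obtain t4 u3 s where e: "e = ((t4, u3), s)" by (cases e) auto
    show "distinct (?g e)" unfolding e prod.case by simp
  qed (auto split: if_splits)
qed (auto split: if_splits)

lemma card_quotient_index:
  assumes S: "equiv S r" and I: "\<And>i. i \<in> I \<Longrightarrow> g i \<in> S" and cov: "\<And>B. B \<in> S \<Longrightarrow> \<exists>i \<in> I. (g i, B) \<in> r"
    and irr: "\<And>i j. i \<in> I \<Longrightarrow> j \<in> I \<Longrightarrow> (g i, g j) \<in> r \<Longrightarrow> i = j"
  shows "card (S // r) = card I"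
proof -
  have "S // r = (\<lambda>i. r `` {g i}) ` I"
  proof
    show "S // r \<subseteq> (\<lambda>i. r `` {g i}) ` I"
    proof
      fix X assume "X \<in> S // r"
      then obtain B where B: "B \<in> S" "X = r `` {B}" by (rule quotientE)
      obtain i where i: "i \<in> I" "(g i, B) \<in> r" using cov[OF B(1)] by blast
      have "X = r `` {g i}" using equiv_class_eq[OF S i(2)] B(2) by simp
      then show "X \<in> (\<lambda>i. r `` {g i}) ` I" using i(1) by blast
    qed
    show "(\<lambda>i. r `` {g i}) ` I \<subseteq> S // r" using I by (auto intro: quotientI)
  qed
  moreover have "inj_on (\<lambda>i. r `` {g i}) I"
    by (rule inj_onI) (use irr I eq_equiv_class[OF _ S] in blast)
  ultimately show ?thesis by (simp add: card_image)
qed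

context
  fixes p :: nat
  assumes p: "prime p" "p \<ge> 7"
begin

lemma card_OM:
  "finite (carrier (OM p (kp, k3, i, (a, b, c, d), \<alpha>, \<beta>)))" "card (carrier (OM p (kp, k3, i, (a, b, c, d), \<alpha>, \<beta>))) = 12 * p"
  by (simp_all add: card_mdl M3_carrier card_cartesian_product UNIV_q4)

lemma card_XM: "finite (carrier (XM p (kp, j, (t4, u3), (s4, s3))))" "card (carrier (XM p (kp, j, (t4, u3), (s4, s3)))) = 12 * p"
  using card_ebr[OF p, of j] by (simp_all add: card_mdl card_cartesian_product)

lemma brace_code:
  fixes B :: "nat skew_brace"
  assumes B: "skew_left_brace B" "finite (carrier B)" "card (carrier B) = 12 * p"
  shows "(\<exists>x \<in> set (ocodes (p mod 4 = 1) (p mod 3 = 1)). sbi (OM p x) B) \<or> (\<exists>x \<in> set (ecodes (p mod 4 = 1) (p mod 3 = 1)). sbi (XM p x) B)"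
proof -
  interpret skew_left_brace B by fact
  have N: "\<exists>g. group.npsyl B p g" by (rule npsyl_12p) (use B p in \<open>simp_all add: order_def\<close>)
  have M: "\<exists>g. group.npsyl (circ_group B) p g"
    by (rule C.npsyl_12p) (use B p in \<open>simp_all add: order_def circ_group_def\<close>)
  have n: "(12::nat) dvd 12" by simp
  have "\<exists>kp (E :: nat skew_brace) t s. skew_left_brace E \<and> finite (carrier E) \<and> card (carrier E) = 12 \<and>
    dec p E t s \<and> sbi (mdl p kp E t s) B \<and> (kp \<longrightarrow> (\<exists>h \<in> carrier E. t h \<noteq> 0))"
    by (rule brace_is_model[OF B p(1) p_cop(2,1)[OF p] n N M])
  then obtain kp and E :: "nat skew_brace" and t s where E: "skew_left_brace E" "finite (carrier E)" "card (carrier E) = 12"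
    and d: "dec p E t s" and iB: "sbi (mdl p kp E t s) B" and k: "kp \<longrightarrow> (\<exists>h \<in> carrier E. t h \<noteq> 0)" by (elim exE conjE)
  show ?thesis
  proof (cases "(\<exists>g. group.npsyl E 3 g) \<and> (\<exists>g. group.npsyl (circ_group E) 3 g)")
    case True
    have "\<exists>k3 i a b c d \<alpha> \<beta>. wf3 (p mod 4 = 1) (p mod 3 = 1) i (a, b, c, d) (\<alpha>, \<beta>) \<and> (k3 \<longrightarrow> a \<noteq> z4) \<and> diso (M3 i k3 a b) (TT c \<alpha>) (TT d \<beta>) E t s"
      by (rule ordinary_model[OF E d]) (use True in blast)+
    then obtain k3 i a b c dd \<alpha> \<beta> where w: "wf3 (p mod 4 = 1) (p mod 3 = 1) i (a, b, c, dd) (\<alpha>, \<beta>)" and k3: "k3 \<longrightarrow> a \<noteq> z4"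
      and f: "diso (M3 i k3 a b) (TT c \<alpha>) (TT dd \<beta>) E t s" by (elim exE conjE)
    obtain f where f: "f \<in> skew_brace_iso (M3 i k3 a b) E" "\<forall>h \<in> carrier (M3 i k3 a b). t (f h) = TT c \<alpha> h \<and> s (f h) = TT dd \<beta> h"
      using f unfolding diso_def by blast
    have q: "a \<in> set (bhom4 i (dv False))" "b \<in> set (hom4 (fcirc i) (dv False))" using w by (simp_all add: wf3_def in_quads)
    have "kp \<longrightarrow> c \<noteq> z4 \<or> \<alpha> \<noteq> T0"
    proof
      assume kp
      then obtain h where h: "h \<in> carrier E" "t h \<noteq> 0" using k by blast
      have "h \<in> f ` carrier (M3 i k3 a b)" using f(1) h(1) by (simp add: sbi_iff bij_betw_def)
      then obtain u where u: "u \<in> carrier (M3 i k3 a b)" "h = f u" by blast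
      then have nz: "TT c \<alpha> u \<noteq> 0" using f(2) h(2) by simp
      show "c \<noteq> z4 \<or> \<alpha> \<noteq> T0"
      proof (rule ccontr)
        assume "\<not> (c \<noteq> z4 \<or> \<alpha> \<noteq> T0)"
        then have c: "c = z4" "\<alpha> = T0" by simp_all
        obtain x g where ux: "u = (x, g)" by (cases u)
        have "fn4 z4 g = Q0" by (cases g) (simp_all add: z4_def)
        then show False using nz unfolding ux c by (simp add: sm_T0 zero_prod_def zero_q4_def zero_t3_def)
      qed
    qed
    then obtain x where x: "x \<in> set (ocodes (p mod 4 = 1) (p mod 3 = 1))" "sbi (OM p x) (OM p (kp, k3, i, (a, b, c, dd), \<alpha>, \<beta>))"
      using ordinary_code[OF p w k3] by blast
    have "sbi (OM p (kp, k3, i, (a, b, c, dd), \<alpha>, \<beta>)) (mdl p kp E t s)"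
      unfolding OM.simps sbi_def using model_isoI[OF M3_brace[OF q] p(1) dec_TT[OF w] f coprime_1_left] by blast
    then have "sbi (OM p x) B" using sbi_trans[OF x(2)] sbi_trans[OF _ iB] by blast
    then show ?thesis using x(1) by blast
  next
    case False
    obtain j where "sbi (ebr j) E" using exotic_brace[OF E False] by blast
    then obtain \<phi> where \<phi>: "\<phi> \<in> skew_brace_iso (ebr j) E" by (auto simp: sbi_def)
    have \<phi>c: "\<phi> x \<in> carrier E" for x using \<phi> by (auto simp: sbi_iff bij_betw_def)
    have \<phi>m: "\<phi> (eadd j x y) = \<phi> x \<otimes>\<^bsub>E\<^esub> \<phi> y" "\<phi> (ecirc j x y) = \<phi> x \<odot>\<^bsub>E\<^esub> \<phi> y" for x y using \<phi> by (simp_all add: sbi_iff)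
    let ?t = "\<lambda>x. t (\<phi> x)" and ?s = "\<lambda>x. s (\<phi> x)"
    have d': "dec p (ebr j) ?t ?s" unfolding dec_def using decD[OF d \<phi>c] \<phi>c by (simp add: \<phi>m)
    have "kp \<longrightarrow> (\<exists>h \<in> carrier (ebr j). ?t h \<noteq> 0)"
    proof
      assume kp
      then obtain h where h: "h \<in> carrier E" "t h \<noteq> 0" using k by blast
      have "h \<in> range \<phi>" using \<phi> h(1) by (simp add: sbi_iff bij_betw_def)
      then obtain u where "h = \<phi> u" by blast
      then show "\<exists>h \<in> carrier (ebr j). ?t h \<noteq> 0" using h(2) by (intro bexI[of _ u]) simp_all
    qed
    then obtain x where x: "x \<in> set (ecodes (p mod 4 = 1) (p mod 3 = 1))" "sbi (XM p x) (mdl p kp (ebr j) ?t ?s)"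
      using exotic_code[OF p d'] by blast
    have ts: "\<forall>h \<in> carrier (ebr j). t (\<phi> h) = ?t h \<and> s (\<phi> h) = ?s h" by simp
    have "sbi (mdl p kp (ebr j) ?t ?s) (mdl p kp E t s)"
      unfolding sbi_def using model_isoI[OF ebr_brace p(1) d' \<phi> ts coprime_1_left] by blast
    then have "sbi (XM p x) B" using sbi_trans[OF x(2)] sbi_trans[OF _ iB] by blast
    then show ?thesis using x(1) by blast
  qed
qed

lemma OM_not_XM:
  assumes x: "x \<in> set (ocodes (p mod 4 = 1) (p mod 3 = 1))" and y: "y \<in> set (ecodes (p mod 4 = 1) (p mod 3 = 1))" shows "\<not> sbi (OM p x) (XM p y)"
proof
  assume xy: "sbi (OM p x) (XM p y)"
  obtain kp k3 i a b c d \<alpha> \<beta> where xe: "x = (kp, k3, i, (a, b, c, d), \<alpha>, \<beta>)" by (cases x) auto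
  obtain kp' j t4 u3 s4 s3 where ye: "y = (kp', j, (t4, u3), (s4, s3))" by (cases y) auto
  note x = x[unfolded xe] and y = y[unfolded ye] and xy = xy[unfolded xe ye]
  note w = ocodes_wf[OF x] and e = ecodes_edecs[OF p y]
  have q: "a \<in> set (bhom4 i (dv False))" "b \<in> set (hom4 (fcirc i) (dv False))" "c \<in> set (lists4 (dv (p mod 4 = 1)))"
    using w by (simp_all add: wf3_def in_quads in_bhom4 in_hom4)
  have c12: "finite (carrier (M3 i k3 a b))" "card (carrier (M3 i k3 a b)) = 12"
    by (simp_all add: M3_carrier UNIV_q4 card_cartesian_product)
  have kx: "kp \<longrightarrow> (\<exists>h \<in> carrier (M3 i k3 a b). TT c \<alpha> h \<noteq> 0)"
  proof
    assume kp
    then have "c \<noteq> z4 \<or> \<alpha> \<noteq> T0" using x unfolding in_ocodes by blast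
    then consider h where "fn4 c h \<noteq> Q0" | "\<alpha> \<noteq> T0" using z4_iff[OF q(3)] by blast
    then show "\<exists>h \<in> carrier (M3 i k3 a b). TT c \<alpha> h \<noteq> 0"
    proof cases
      case 1
      then show ?thesis by (intro bexI[of _ "(0, h)"]) (simp_all add: M3_carrier zero_prod_def zero_q4_def)
    next
      case 2
      then show ?thesis by (intro bexI[of _ "(1, Q0)"]) (simp_all add: M3_carrier zero_prod_def zero_t3_def sm_def)
    qed
  qed
  have ky: "kp' \<longrightarrow> (\<exists>h \<in> carrier (ebr j). FE t4 u3 h \<noteq> 0)" using y unfolding in_ecodes FE_zero[OF e, symmetric] by blast
  obtain f where f: "f \<in> skew_brace_iso (mdl p kp (M3 i k3 a b) (TT c \<alpha>) (TT d \<beta>)) (mdl p kp' (ebr j) (FE t4 u3) (FE s4 s3))"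
    using xy by (auto simp: sbi_def)
  obtain \<psi> where "\<psi> \<in> skew_brace_iso (M3 i k3 a b) (ebr j)"
    using model_iso(2)[OF M3_brace[OF q(1,2)] c12 dec_TT[OF w] ebr_brace card_ebr[OF p] dec_FE[OF e] p(1) p_cop(2,1)[OF p] kx ky f] by blast
  then show False by (rule M3_not_ebr[OF q(1,2)])
qed

lemma num_skew_braces_codes: "num_skew_braces (12 * p) = length (ocodes (p mod 4 = 1) (p mod 3 = 1)) + length (ecodes (p mod 4 = 1) (p mod 3 = 1))"
proof -
  let ?n = "12 * p" and ?I = "set (ocodes (p mod 4 = 1) (p mod 3 = 1)) <+> set (ecodes (p mod 4 = 1) (p mod 3 = 1))"
  have ob: "skew_left_brace (OM p x) \<and> finite (carrier (OM p x)) \<and> card (carrier (OM p x)) = ?n" if x: "x \<in> set (ocodes (p mod 4 = 1) (p mod 3 = 1))" for x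
  proof -
    obtain kp k3 i a b c d \<alpha> \<beta> where xe: "x = (kp, k3, i, (a, b, c, d), \<alpha>, \<beta>)" by (cases x) auto
    show ?thesis using OM_brace[OF p ocodes_wf[OF x[unfolded xe]]] card_OM unfolding xe by blast
  qed
  have eb: "skew_left_brace (XM p x) \<and> finite (carrier (XM p x)) \<and> card (carrier (XM p x)) = ?n" if x: "x \<in> set (ecodes (p mod 4 = 1) (p mod 3 = 1))" for x
  proof -
    obtain kp j t4 u3 s4 s3 where xe: "x = (kp, j, (t4, u3), (s4, s3))" by (cases x) auto
    show ?thesis using XM_brace[OF p x] card_XM unfolding xe by blast
  qed
  \<comment> \<open>The models have carriers of other types. \<open>go\<close> and \<open>ge\<close>
    choose copies on the natural numbers, and questions of isomorphism are referred back to the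
    models.\<close>
  have "\<forall>x \<in> set (ocodes (p mod 4 = 1) (p mod 3 = 1)). \<exists>A. A \<in> skew_braces_of_size ?n \<and> sbi (OM p x) A"
  proof
    fix x assume "x \<in> set (ocodes (p mod 4 = 1) (p mod 3 = 1))"
    then show "\<exists>A. A \<in> skew_braces_of_size ?n \<and> sbi (OM p x) A"
      using ob[of x] finite_skew_left_brace_copy[of "OM p x" ?n] unfolding sbi_def by blast
  qed
  then obtain go where go: "\<And>x. x \<in> set (ocodes (p mod 4 = 1) (p mod 3 = 1)) \<Longrightarrow> go x \<in> skew_braces_of_size ?n \<and> sbi (OM p x) (go x)"
    unfolding bchoice_iff by blast
  have "\<forall>x \<in> set (ecodes (p mod 4 = 1) (p mod 3 = 1)). \<exists>A. A \<in> skew_braces_of_size ?n \<and> sbi (XM p x) A"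
  proof
    fix x assume "x \<in> set (ecodes (p mod 4 = 1) (p mod 3 = 1))"
    then show "\<exists>A. A \<in> skew_braces_of_size ?n \<and> sbi (XM p x) A"
      using eb[of x] finite_skew_left_brace_copy[of "XM p x" ?n] unfolding sbi_def by blast
  qed
  then obtain ge where ge: "\<And>x. x \<in> set (ecodes (p mod 4 = 1) (p mod 3 = 1)) \<Longrightarrow> ge x \<in> skew_braces_of_size ?n \<and> sbi (XM p x) (ge x)"
    unfolding bchoice_iff by blast
  have r: "(A, B) \<in> skew_brace_iso_rel ?n \<longleftrightarrow> A \<in> skew_braces_of_size ?n \<and> B \<in> skew_braces_of_size ?n \<and> sbi A B" for A B
    by (simp add: skew_brace_iso_rel_def sbi_def)
  have sl: "skew_left_brace A" if "A \<in> skew_braces_of_size ?n" for A using that by (simp add: skew_braces_of_size_def)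
  have "card (skew_braces_of_size ?n // skew_brace_iso_rel ?n) = card ?I"
  proof (rule card_quotient_index[OF equiv_skew_brace_iso_rel, where g = "case_sum go ge"])
    show "i \<in> ?I \<Longrightarrow> case_sum go ge i \<in> skew_braces_of_size ?n" for i using go ge by auto
  next
    fix B assume B: "B \<in> skew_braces_of_size ?n"
    have "(\<exists>x \<in> set (ocodes (p mod 4 = 1) (p mod 3 = 1)). sbi (OM p x) B) \<or> (\<exists>x \<in> set (ecodes (p mod 4 = 1) (p mod 3 = 1)). sbi (XM p x) B)"
      by (rule brace_code) (use B in \<open>simp_all add: skew_braces_of_size_def\<close>)
    then show "\<exists>i \<in> ?I. (case_sum go ge i, B) \<in> skew_brace_iso_rel ?n"
    proof (elim disjE bexE)
      fix x assume x: "x \<in> set (ocodes (p mod 4 = 1) (p mod 3 = 1))" "sbi (OM p x) B"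
      have "sbi (go x) (OM p x)" using sbi_sym ob[OF x(1)] go[OF x(1)] by blast
      then have "sbi (go x) B" using sbi_trans x(2) by blast
      then show ?thesis using r go[OF x(1)] B x(1) by (intro bexI[of _ "Inl x"]) auto
    next
      fix x assume x: "x \<in> set (ecodes (p mod 4 = 1) (p mod 3 = 1))" "sbi (XM p x) B"
      have "sbi (ge x) (XM p x)" using sbi_sym eb[OF x(1)] ge[OF x(1)] by blast
      then have "sbi (ge x) B" using sbi_trans x(2) by blast
      then show ?thesis using r ge[OF x(1)] B x(1) by (intro bexI[of _ "Inr x"]) auto
    qed
  next
    fix i j assume i: "i \<in> ?I" and j: "j \<in> ?I" and ij: "(case_sum go ge i, case_sum go ge j) \<in> skew_brace_iso_rel ?n"
    note ij = ij[unfolded r]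
    have oo: "x = y" if x: "x \<in> set (ocodes (p mod 4 = 1) (p mod 3 = 1))" and y: "y \<in> set (ocodes (p mod 4 = 1) (p mod 3 = 1))" and xy: "sbi (go x) (go y)" for x y
    proof -
      have "sbi (go y) (OM p y)" using sbi_sym ob[OF y] go[OF y] by blast
      then have "sbi (go x) (OM p y)" using sbi_trans xy by blast
      then have "sbi (OM p x) (OM p y)" using sbi_trans go[OF x] by blast
      then show ?thesis by (rule OM_irred[OF p x y])
    qed
    have ee: "x = y" if x: "x \<in> set (ecodes (p mod 4 = 1) (p mod 3 = 1))" and y: "y \<in> set (ecodes (p mod 4 = 1) (p mod 3 = 1))" and xy: "sbi (ge x) (ge y)" for x y
    proof -
      have "sbi (ge y) (XM p y)" using sbi_sym eb[OF y] ge[OF y] by blast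
      then have "sbi (ge x) (XM p y)" using sbi_trans xy by blast
      then have "sbi (XM p x) (XM p y)" using sbi_trans ge[OF x] by blast
      then show ?thesis by (rule XM_irred[OF p x y])
    qed
    have oe: False if x: "x \<in> set (ocodes (p mod 4 = 1) (p mod 3 = 1))" and y: "y \<in> set (ecodes (p mod 4 = 1) (p mod 3 = 1))" and xy: "sbi (go x) (ge y)" for x y
    proof -
      have "sbi (ge y) (XM p y)" using sbi_sym eb[OF y] ge[OF y] by blast
      then have "sbi (go x) (XM p y)" using sbi_trans xy by blast
      then have "sbi (OM p x) (XM p y)" using sbi_trans go[OF x] by blast
      then show ?thesis using OM_not_XM[OF x y] by blast
    qed
    show "i = j"
    proof (cases i)
      case (Inl x)
      then have x: "x \<in> set (ocodes (p mod 4 = 1) (p mod 3 = 1))" using i by auto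
      show ?thesis
      proof (cases j)
        case (Inl y)
        then show ?thesis using oo[OF x, of y] \<open>i = Inl x\<close> j ij by auto
      next
        case (Inr y)
        then show ?thesis using oe[OF x, of y] \<open>i = Inl x\<close> j ij by auto
      qed
    next
      case (Inr x)
      then have x: "x \<in> set (ecodes (p mod 4 = 1) (p mod 3 = 1))" using i by auto
      show ?thesis
      proof (cases j)
        case (Inl y)
        then have y: "y \<in> set (ocodes (p mod 4 = 1) (p mod 3 = 1))" using j by auto
        have "sbi (go y) (ge x)" using sbi_sym[OF sl, of "ge x" "go y"] ge[OF x] ij Inl \<open>i = Inr x\<close> by auto
        then show ?thesis using oe[OF y x] by blast
      next
        case (Inr y)
        then show ?thesis using ee[OF x, of y] \<open>i = Inr x\<close> j ij by auto
      qed
    qed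
  qed
  then show ?thesis
    by (simp add: num_skew_braces_def card_Plus distinct_card[OF distinct_ocodes] distinct_card[OF distinct_ecodes])
qed

end

section \<open>Evaluating the lengths of the code lists\<close>

definition owt :: "bool \<Rightarrow> quad \<Rightarrow> nat" where
  "owt tf q = (case q of (a, b, c, d) \<Rightarrow> sum_list (map (\<lambda>(\<alpha>, \<beta>). (if c = z4 \<and> \<alpha> = T0 then 1 else 2) * (if a = z4 then 1 else 2)) (abs3 tf a b)))"

text \<open>Both values of \<open>tf\<close> are counted in one run, because the costly list
  \<open>qreps i df\<close> does not depend on \<open>tf\<close>.\<close>

definition ocnt :: "quad list \<Rightarrow> nat \<times> nat" where
  "ocnt qs = (sum_list (map (owt False) qs), sum_list (map (owt True) qs))"

lemma length_concat_map: "length (concat (map f xs)) = sum_list (map (\<lambda>x. length (f x)) xs)"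
  by (simp add: length_concat comp_def)

lemma length_ocodes: "length (ocodes df tf) = sum_list (map (\<lambda>i. sum_list (map (owt tf) (qreps i df))) fis)"
proof -
  have q: "length (case q of (a, b, c, d) \<Rightarrow> concat (map (\<lambda>(\<alpha>, \<beta>).
       [(kp, k3, i, (a, b, c, d), (\<alpha>, \<beta>)). kp \<leftarrow> (if c = z4 \<and> \<alpha> = T0 then [False] else [False, True]),
                                     k3 \<leftarrow> (if a = z4 then [False] else [False, True])]) (abs3 tf a b))) = owt tf q"
    for i :: fi and q :: quad
  proof -
    obtain a b c d where q: "q = (a, b, c, d)" by (cases q)
    have e: "length (case ab of (\<alpha>, \<beta>) \<Rightarrow>
       [(kp, k3, i, (a, b, c, d), (\<alpha>, \<beta>)). kp \<leftarrow> (if c = z4 \<and> \<alpha> = T0 then [False] else [False, True]),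
                                     k3 \<leftarrow> (if a = z4 then [False] else [False, True])]) =
       (case ab of (\<alpha>, \<beta>) \<Rightarrow> (if c = z4 \<and> \<alpha> = T0 then 1 else 2) * (if a = z4 then 1 else 2))" for ab :: "t3 \<times> t3"
      by (cases ab) simp
    show ?thesis unfolding q prod.case owt_def length_concat_map e by (rule refl)
  qed
  show ?thesis unfolding ocodes_def length_concat_map q by (rule refl)
qed

lemma ocnt_F0: "ocnt (qreps F0 False) = (36, 78)" by code_simp
lemma ocnt_F1: "ocnt (qreps F1 False) = (149, 221)" by code_simp
lemma ocnt_F2: "ocnt (qreps F2 False) = (90, 153)" by code_simp
lemma ocnt_F3: "ocnt (qreps F3 False) = (36, 78)" by code_simp
lemma ocnt_T0: "ocnt (qreps F0 True) = (102, 213)" by code_simp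
text \<open>For \<open>F1\<close> and \<open>F2\<close> the counts are the same for both values of
  \<open>df\<close>: their circle group is the Klein group, whose homomorphisms into
  \<open>q4\<close> take only the values \<open>Q0\<close> and \<open>Q2\<close>.\<close>

lemma ocnt_T1: "ocnt (qreps F1 True) = (149, 221)" by code_simp
lemma ocnt_T2: "ocnt (qreps F2 True) = (90, 153)" by code_simp
lemma ocnt_T3: "ocnt (qreps F3 True) = (54, 117)" by code_simp

lemma ocodes_count: "length (ocodes False False) = 311" "length (ocodes True False) = 395"
  "length (ocodes False True) = 530" "length (ocodes True True) = 704"
  using ocnt_F0 ocnt_F1 ocnt_F2 ocnt_F3 ocnt_T0 ocnt_T1 ocnt_T2 ocnt_T3
  by (simp_all add: ocnt_def length_ocodes fis_def)

lemma ecodes_FF: "length (ecodes False False) = 13" by code_simp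
text \<open>The surplus over the previous count comes from \<open>Hd\<close> and \<open>He\<close>,
  for which \<open>hl4\<close> contains lists with values \<open>Q1\<close> and
  \<open>Q3\<close>.\<close>

lemma ecodes_TF: "length (ecodes True False) = 15" by code_simp
lemma ecodes_FT: "length (ecodes False True) = 76" by code_simp
lemma ecodes_TT: "length (ecodes True True) = 78" by code_simp

theorem mainTheorem1:
  fixes p :: nat
  assumes "prime p" and "p \<ge> 7"
  shows "(p mod 12 = 11 \<longrightarrow> num_skew_braces (12 * p) = 324) \<and>
         (p mod 12 = 5 \<longrightarrow> num_skew_braces (12 * p) = 410) \<and>
         (p mod 12 = 7 \<longrightarrow> num_skew_braces (12 * p) = 606) \<and>
         (p mod 12 = 1 \<longrightarrow> num_skew_braces (12 * p) = 782)"
proof -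
  \<comment> \<open>The residues 11, 5, 7, 1 modulo 12 correspond to the argument pairs (False,
    False), (True, False), (False, True), (True, True) of the code lists; the totals are 311 + 13,
    395 + 15, 530 + 76 and 704 + 78.\<close>
  have m: "p mod 4 = (p mod 12) mod 4" "p mod 3 = (p mod 12) mod 3" by (simp_all add: mod_mod_cancel)
  note N = num_skew_braces_codes[OF assms, unfolded m]
  show ?thesis
    using N by (intro conjI impI) (simp_all add: ocodes_count ecodes_FF ecodes_TF ecodes_FT ecodes_TT)
qed

end
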